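(* Let $\ell-d\ge0$. Then, for any $\varepsilon>0$, $t_0>0$, integer $K\ge\max(M,\ell-d)$, and all $t\ge t_0\varepsilon^\ell$, the following hold. (1) If $x\in\mathbb R^d_\varepsilon\setminus\{0\}$, then $$\mathbf v^\varepsilon(x,t)=t^{1-d/\ell}F_0\!\left(\frac{x}{t^{1/\ell}}\right)+\sum_{k=M}^{\ell-d}\varepsilon^kt^{1-(k+d)/\ell}F_k\!\left(\frac{x}{t^{1/\ell}}\right)+\varepsilon^{\ell-d}\,\Omega\!\left(\frac x\varepsilon\right)+\sum_{k=\max(M,\ell-d+1)}^K\frac{\varepsilon^k}{t^{(k+d)/\ell-1}}F_k\!\left(\frac{x}{t^{1/\ell}}\right)+\mathbf r^\varepsilon_{\mathbf v}(K;x,t),$$ where $\Omega(y)=S(y)-\hat F(y)-\sum_{k=0}^{\ell-d}\Omega_k(y)$. (2) If $x=0$, then $$\mathbf v^\varepsilon(0,t)=\sum_{k=0}^{\ell-d-1}\varepsilon^kt^{1-(d+k)/\ell}\frac{\ell H_k(0)}{\ell-d-k}+\varepsilon^{\ell-d}\bigl(H_{\ell-d}(0)\ln t-\ell H_{\ell-d}(0)\ln\varepsilon+S(0)\bigr)+\sum_{k=\ell-d+1}^K\frac{\varepsilon^k}{t^{(d+k)/\ell-1}}\frac{\ell H_k(0)}{\ell-d-k}+\mathbf r^\varepsilon_{\mathbf v}(K;0,t).$$ In both cases, $$|\mathbf r^\varepsilon_{\mathbf v}(K;x,t)|\le\frac{\varepsilon^{K+1}R_{\mathbf v}(K,t_0)}{t^{(K+d+1)/\ell-1}},$$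 and $R_{\mathbf v}(K,t_0)\ge0$ does not depend on $\varepsilon>0$, $x\in\mathbb R^d_\varepsilon$, and $t\ge t_0\varepsilon^\ell$.
   Context: Convention: a sum whose upper limit is less than its lower limit is zero. Differential operator. Let $d\in\mathbb N$ and let $\ell\in\mathbb N$ be even. Let $\mathcal A(\mathcal D)=\sum_{|\alpha|=\ell}b_\alpha\mathcal D^\alpha$ with $b_\alpha\in\mathbb C$, $\mathcal D_j=-i\,\partial/\partial y_j$, be a differential operator on $\mathbb R^d$ with symbol $\mathcal A(\xi)=\sum_{|\alpha|=\ell}b_\alpha\xi^\alpha$. It is strongly elliptic: there is $c>0$ with $\operatorname{Re}\mathcal A(\xi)\ge c|\xi|^\ell$ for all $\xi\in\mathbb R^d$. Difference operator. For $\varepsilon>0$ let $\mathbb R^d_\varepsilon=\varepsilon\mathbb Z^d$. For a function $u$ on $\mathbb R^d$ or on $\mathbb R^d_\varepsilon$ let $\delta_{\varepsilon,k\pm}u(y)=u(y\pm\varepsilon e_k)-u(y)$, where $e_k$ is the $k$th unit coordinate vector. Fix an integer $\hat\ell\ge\ell$ and coefficients $a_\nu\in\mathbb C$ (not depending on $\varepsilon$), $\nu=(\nu_1,\dots,\nu_{2d})$ a multi-index, and let $$\mathbf A_\varepsilon=\varepsilon^{-\ell}\sum_{\ell\le|\nu|\le\hat\ell}a_\nu\,\delta_{\varepsilon,1-}^{\nu_1}\delta_{\varepsilon,1+}^{\nu_2}\cdots\delta_{\varepsilon,d-}^{\nu_{2d-1}}\delta_{\varepsilon,d+}^{\nu_{2d}}.$$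 A function on $\mathbb R^d$ is called smooth if it is continuous and bounded together with all its derivatives. Assume that $\mathbf A_\varepsilon$ is an $M$th order approximation of $\mathcal A(\mathcal D)$ for a fixed $M\in\mathbb N$: for every smooth $u$ there is $C(u)>0$ such that $\sup_{y\in\mathbb R^d}|\mathbf A_\varepsilon u(y)-\mathcal A(\mathcal D)u(y)|\le C(u)\varepsilon^M$ for all $\varepsilon>0$. The symbol of $\mathbf A_\varepsilon$ is $$A(\theta)=\sum_{\ell\le|\nu|\le\hat\ell}a_\nu(e^{-i\theta_1}-1)^{\nu_1}(e^{i\theta_1}-1)^{\nu_2}\cdots(e^{-i\theta_d}-1)^{\nu_{2d-1}}(e^{i\theta_d}-1)^{\nu_{2d}}.$$ Assume $\operatorname{Re}A(\theta)>0$ for all $\theta\in R_\pi\setminus\{0\}$, where $R_\lambda=[-\lambda,\lambda]^d$. Second discrete Green function. $\mathbf v^\varepsilon(x,t)$, $x\in\mathbb R^d_\varepsilon$, $t\ge0$, is the function that is rapidly decreasing in $x$ (faster than any negative power of $|x|$), $C^1$ in $t\in[0,\infty)$, and satisfies $\partial_t\mathbf v^\varepsilon+\mathbf A_\varepsilon\mathbf v^\varepsilon=\boldsymbol\delta^\varepsilon$ for $t>0$, $\mathbf v^\varepsilon(x,0)=0$, where $\boldsymbol\delta^\varepsilon(0)=\varepsilon^{-d}$ and $\boldsymbol\delta^\varepsilon(x)=0$ for $x\ne0$. It is given by $$\mathbf v^\varepsilon(x,t)=\frac1{(2\pi)^d}\int_{R_{\pi/\varepsilon}}\frac{1-e^{-t\varepsilon^{-\ell}A(\varepsilon\eta)}}{\varepsilon^{-\ell}A(\varepsilon\eta)}e^{ix\eta}\,d\eta.$$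 The functions $H_k$. $H(y)=\frac{1}{(2\pi)^d}\int_{\mathbb R^d}e^{-\mathcal A(\xi)}e^{iy\xi}\,d\xi$. The polynomials $\mathcal P_{m+\ell}(\xi)$, $m\ge1$, are defined by the expansion, for each fixed $\xi\in\mathbb R^d$ as $s\to0+$ (any $K$), $e^{-s^{-\ell}A(s\xi)}=e^{-\mathcal A(\xi)}\bigl(1+\sum_{m=1}^Ks^m\mathcal P_{m+\ell}(\xi)+O(s^{K+1})\bigr)$ (one has $\mathcal P_{m+\ell}=0$ for $1\le m\le M-1$). Put $H_0=H$ and $H_k=\mathcal P_{k+\ell}(\mathcal D)H$ for $k\ge1$. The functions $F_k$, $\hat F$, $\Omega_k$ (for $y\neq0$; write $y=rn$, $r=|y|>0$, $n=y/|y|$): $$F_k(y)=\ell r^{\ell-d-k}\int_r^\infty\frac{H_k(\rho n)}{\rho^{\ell-d-k+1}}\,d\rho\quad(k=0,\dots,\ell-d),$$ $$F_k(y)=-\frac{\ell}{r^{d+k-\ell}}\int_0^r\rho^{d+k-\ell-1}H_k(\rho n)\,d\rho\quad(k\ge\ell-d+1).$$ Let $H_k^{(j)}(0;n)=\frac{d^j}{d\rho^j}H_k(\rho n)|_{\rho=0}$ be the $j$th directional derivative at the origin. For $k=0,\dots,\ell-d$ put $\hat H_k(\rho;n)=H_k(\rho n)-\sum_{j=0}^{\ell-d-k}\frac{H_k^{(j)}(0;n)}{j!}\rho^j$ and $$\hat F(y)=\ell\sum_{k=0}^{\ell-d}r^{\ell-d-k}\int_0^1\frac{\hat H_k(\rho;n)}{\rho^{\ell-d-k+1}}\,d\rho,$$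 $$\Omega_k(y)=\ell r^{\ell-d-k}\Bigl(\int_1^\infty\frac{H_k(\rho n)}{\rho^{\ell-d-k+1}}\,d\rho-\sum_{j=0}^{\ell-d-k-1}\frac{H_k^{(j)}(0;n)}{j!(\ell-j-d-k)}-\frac{H_k^{(\ell-d-k)}(0;n)}{(\ell-d-k)!}\ln r\Bigr).$$ The function $S$. For fixed $y\in\mathbb R^d$ write, for $\theta\in R_\pi\setminus\{0\}$, $$\frac{e^{iy\theta}}{A(\theta)}=\sum_{k=0}^{\ell-d}Q_{k-\ell}(\theta,y)+\hat Q(\theta,y),$$ where $Q_{k-\ell}(\cdot,y)$ is the homogeneous term of degree $k-\ell$ in $\theta$ (a ratio of homogeneous polynomials; $Q_{-\ell}=1/\mathcal A(\theta)$) of the expansion of the left-hand side as $\theta\to0$, and $|\hat Q(\theta,y)|\le c_1(y)|\theta|^{-d+1}$. For a unit vector $n\in S^{d-1}$ let $r_\pi(n)$ be the distance from the origin to the boundary of the cube $R_\pi$ in the direction $n$, let $d\sigma$ be the surface measure on $S^{d-1}$ (counting measure on $\{\pm1\}$ if $d=1$), and let $B_1$ be the unit ball in $\mathbb R^d$. Then $$S(y)=\frac{1}{(2\pi)^d}\Bigl(\int_{B_1}(1-e^{-\mathcal A(\xi)})Q_{-d}(\xi,y)\,d\xi-\int_{\mathbb R^d\setminus B_1}e^{-\mathcal A(\xi)}Q_{-d}(\xi,y)\,d\xi+\int_{R_\pi}\hat Q(\theta,y)\,d\theta$$ $$-\sum_{k=0}^{\ell-d-M}\int_{\mathbb R^d}e^{-\mathcal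 A(\xi)}Q_{k-\ell}(\xi,y)\mathcal P_{2\ell-d-k}(\xi)\,d\xi-\sum_{k=0}^{\ell-d-1}\frac{1}{\ell-d-k}\int_{S^{d-1}}r_\pi(n)^{d+k-\ell}Q_{k-\ell}(n,y)\,d\sigma(n)+\int_{S^{d-1}}\ln(r_\pi(n))\,Q_{-d}(n,y)\,d\sigma(n)\Bigr).$$ *)

theory Defs
  imports
    "HOL-Analysis.Analysis"
    "HOL-Library.Landau_Symbols"
    "HOL-Library.Poly_Mapping"
begin

text \<open>
  Euclidean space is \<^typ>\<open>real ^ 'd\<close>, of dimension d = CARD('d). Every definition below that contains
  the truncated difference of \<open>l\<close> and CARD('d) is meant for CARD('d) at most \<open>l\<close>.
\<close>

subsection \<open>Multi-indices, polynomials\<close>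

definition mi_abs :: "('i::finite \<Rightarrow> nat) \<Rightarrow> nat" where
  "mi_abs \<alpha> = (\<Sum>i\<in>UNIV. \<alpha> i)"

lemma finite_mi_abs_le: "finite {\<alpha>::'i::finite \<Rightarrow> nat. mi_abs \<alpha> \<le> n}"
proof (rule finite_subset)
  show "{\<alpha>::'i \<Rightarrow> nat. mi_abs \<alpha> \<le> n} \<subseteq> Pi\<^sub>E UNIV (\<lambda>_. {..n})"
  proof
    fix \<alpha> :: "'i \<Rightarrow> nat"
    assume "\<alpha> \<in> {\<alpha>. mi_abs \<alpha> \<le> n}"
    then have "\<alpha> i \<le> n" for i
      using member_le_sum[of i UNIV \<alpha>] by (simp add: mi_abs_def)
    then show "\<alpha> \<in> Pi\<^sub>E UNIV (\<lambda>_. {..n})"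
      by auto
  qed
  show "finite (Pi\<^sub>E (UNIV::'i set) (\<lambda>_. {..n}))"
    by (rule finite_PiE) auto
qed

definition monom_at :: "real ^ 'd \<Rightarrow> ('d::finite \<Rightarrow> nat) \<Rightarrow> complex" where
  "monom_at \<xi> \<alpha> = (\<Prod>k\<in>UNIV. complex_of_real (\<xi> $ k) ^ \<alpha> k)"

type_synonym 'd polyn = "('d \<Rightarrow> nat) \<Rightarrow>\<^sub>0 complex"

definition peval :: "('d::finite) polyn \<Rightarrow> real ^ 'd \<Rightarrow> complex" where
  "peval p \<xi> = (\<Sum>\<alpha>\<in>Poly_Mapping.keys p. Poly_Mapping.lookup p \<alpha> * monom_at \<xi> \<alpha>)"

definition homogeneous :: "nat \<Rightarrow> ('d::finite) polyn \<Rightarrow> bool" where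
  "homogeneous n p \<longleftrightarrow> (\<forall>\<alpha>\<in>Poly_Mapping.keys p. mi_abs \<alpha> = n)"

subsection \<open>Differential operators\<close>

text \<open>
  A fixed enumeration of the coordinates. It only serves to write down compositions over all
  coordinates; the operators composed below commute (the derivatives on smooth functions), so that
  the choice is immaterial.
\<close>

definition coords :: "('d::finite) list" where
  "coords = (SOME ks. distinct ks \<and> set ks = UNIV)"

lemma coords: "distinct (coords :: 'd::finite list)" "set (coords :: 'd list) = UNIV"
proof -
  have "\<exists>ks::'d list. distinct ks \<and> set ks = UNIV"
    using finite_distinct_list[of "UNIV :: 'd set"] by auto
  then have "distinct (coords :: 'd list) \<and> set (coords :: 'd list) = UNIV"
    unfolding coords_def by (rule someI_ex)
  then show "distinct (coords :: 'd list)" "set (coords :: 'd list) = UNIV"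
    by auto
qed

definition partial_deriv :: "'d::finite \<Rightarrow> (real ^ 'd \<Rightarrow> complex) \<Rightarrow> real ^ 'd \<Rightarrow> complex" where
  "partial_deriv k u y = vector_derivative (\<lambda>s. u (y + s *\<^sub>R axis k 1)) (at 0)"

text \<open>Continuity of all derivatives is implied by their differentiability.\<close>

definition smooth_bounded :: "(real ^ 'd::finite \<Rightarrow> complex) \<Rightarrow> bool" where
  "smooth_bounded u \<longleftrightarrow>
     (\<forall>ks. (\<forall>y. foldr partial_deriv ks u differentiable (at y)) \<and>
           bounded (range (foldr partial_deriv ks u)))"

definition D_coord :: "'d::finite \<Rightarrow> (real ^ 'd \<Rightarrow> complex) \<Rightarrow> real ^ 'd \<Rightarrow> complex" where
  "D_coord k u y = - \<i> * partial_deriv k u y"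

definition D_multi :: "('d::finite \<Rightarrow> nat) \<Rightarrow> (real ^ 'd \<Rightarrow> complex) \<Rightarrow> real ^ 'd \<Rightarrow> complex" where
  "D_multi \<alpha> u = foldr (\<lambda>k. D_coord k ^^ \<alpha> k) coords u"

definition peval_D :: "('d::finite) polyn \<Rightarrow> (real ^ 'd \<Rightarrow> complex) \<Rightarrow> real ^ 'd \<Rightarrow> complex" where
  "peval_D p u y = (\<Sum>\<alpha>\<in>Poly_Mapping.keys p. Poly_Mapping.lookup p \<alpha> * D_multi \<alpha> u y)"

definition diff_op :: "nat \<Rightarrow> (('d::finite \<Rightarrow> nat) \<Rightarrow> complex) \<Rightarrow>
    (real ^ 'd \<Rightarrow> complex) \<Rightarrow> real ^ 'd \<Rightarrow> complex" where
  "diff_op l b u y = (\<Sum>\<alpha> | mi_abs \<alpha> = l. b \<alpha> * D_multi \<alpha> u y)"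

definition diff_symbol :: "nat \<Rightarrow> (('d::finite \<Rightarrow> nat) \<Rightarrow> complex) \<Rightarrow> real ^ 'd \<Rightarrow> complex" where
  "diff_symbol l b \<xi> = (\<Sum>\<alpha> | mi_abs \<alpha> = l. b \<alpha> * monom_at \<xi> \<alpha>)"

definition strongly_elliptic :: "nat \<Rightarrow> (('d::finite \<Rightarrow> nat) \<Rightarrow> complex) \<Rightarrow> bool" where
  "strongly_elliptic l b \<longleftrightarrow> (\<exists>c>0. \<forall>\<xi>. Re (diff_symbol l b \<xi>) \<ge> c * norm \<xi> ^ l)"

subsection \<open>Difference operators\<close>

definition lattice :: "real \<Rightarrow> (real ^ 'd::finite) set" where
  "lattice \<epsilon> = {x. \<forall>k. \<exists>m::int. x $ k = \<epsilon> * of_int m}"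

definition delta_minus :: "real \<Rightarrow> 'd::finite \<Rightarrow> (real ^ 'd \<Rightarrow> complex) \<Rightarrow> real ^ 'd \<Rightarrow> complex" where
  "delta_minus \<epsilon> k u y = u (y - \<epsilon> *\<^sub>R axis k 1) - u y"

definition delta_plus :: "real \<Rightarrow> 'd::finite \<Rightarrow> (real ^ 'd \<Rightarrow> complex) \<Rightarrow> real ^ 'd \<Rightarrow> complex" where
  "delta_plus \<epsilon> k u y = u (y + \<epsilon> *\<^sub>R axis k 1) - u y"

text \<open>
  A multi-index with 2d components is a function on the sum type \<^typ>\<open>'d + 'd\<close>: the component at
  \<open>Inl k\<close> is the exponent of the backward difference in the k-th coordinate, the component at
  \<open>Inr k\<close> that of the forward difference.
\<close>

definition delta_multi :: "real \<Rightarrow> ('d::finite + 'd \<Rightarrow> nat) \<Rightarrow>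
    (real ^ 'd \<Rightarrow> complex) \<Rightarrow> real ^ 'd \<Rightarrow> complex" where
  "delta_multi \<epsilon> \<nu> u =
     foldr (\<lambda>k w. (delta_minus \<epsilon> k ^^ \<nu> (Inl k)) ((delta_plus \<epsilon> k ^^ \<nu> (Inr k)) w)) coords u"

text \<open>At a lattice point the value only depends on the restriction of \<open>u\<close> to the lattice.\<close>

definition difference_op :: "nat \<Rightarrow> nat \<Rightarrow> (('d::finite + 'd \<Rightarrow> nat) \<Rightarrow> complex) \<Rightarrow> real \<Rightarrow>
    (real ^ 'd \<Rightarrow> complex) \<Rightarrow> real ^ 'd \<Rightarrow> complex" where
  "difference_op l lhat a \<epsilon> u y =
     (\<Sum>\<nu> | l \<le> mi_abs \<nu> \<and> mi_abs \<nu> \<le> lhat. a \<nu> * delta_multi \<epsilon> \<nu> u y) / complex_of_real \<epsilon> ^ l"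

definition difference_symbol :: "nat \<Rightarrow> nat \<Rightarrow> (('d::finite + 'd \<Rightarrow> nat) \<Rightarrow> complex) \<Rightarrow>
    real ^ 'd \<Rightarrow> complex" where
  "difference_symbol l lhat a \<theta> =
     (\<Sum>\<nu> | l \<le> mi_abs \<nu> \<and> mi_abs \<nu> \<le> lhat. a \<nu> *
        (\<Prod>k\<in>UNIV. (cis (- (\<theta> $ k)) - 1) ^ \<nu> (Inl k) * (cis (\<theta> $ k) - 1) ^ \<nu> (Inr k)))"

definition approximates_of_order :: "nat \<Rightarrow> nat \<Rightarrow> nat \<Rightarrow> (('d::finite + 'd \<Rightarrow> nat) \<Rightarrow> complex) \<Rightarrow>
    (('d \<Rightarrow> nat) \<Rightarrow> complex) \<Rightarrow> bool" where
  "approximates_of_order M l lhat a b \<longleftrightarrow>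
     (\<forall>u. smooth_bounded u \<longrightarrow>
        (\<exists>C>0. \<forall>\<epsilon>>0. \<forall>y. norm (difference_op l lhat a \<epsilon> u y - diff_op l b u y) \<le> C * \<epsilon> ^ M))"

definition cube :: "real \<Rightarrow> (real ^ 'd::finite) set" where
  "cube c = cbox (\<chi> k. - c) (\<chi> k. c)"

subsection \<open>The second discrete Green function\<close>

definition rapidly_decreasing_on :: "(real ^ 'd::finite) set \<Rightarrow> (real ^ 'd \<Rightarrow> complex) \<Rightarrow> bool" where
  "rapidly_decreasing_on X u \<longleftrightarrow> (\<forall>N::nat. \<exists>C. \<forall>x\<in>X. norm x ^ N * norm (u x) \<le> C)"

definition discrete_delta :: "real \<Rightarrow> real ^ 'd::finite \<Rightarrow> complex" where
  "discrete_delta \<epsilon> x = (if x = 0 then 1 / complex_of_real \<epsilon> ^ CARD('d) else 0)"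

definition second_discrete_green :: "nat \<Rightarrow> nat \<Rightarrow> (('d::finite + 'd \<Rightarrow> nat) \<Rightarrow> complex) \<Rightarrow> real \<Rightarrow>
    (real ^ 'd \<Rightarrow> real \<Rightarrow> complex) \<Rightarrow> bool" where
  "second_discrete_green l lhat a \<epsilon> v \<longleftrightarrow>
     (\<forall>t\<ge>0. rapidly_decreasing_on (lattice \<epsilon>) (\<lambda>x. v x t)) \<and>
     (\<forall>x\<in>lattice \<epsilon>. v x 0 = 0 \<and>
        (\<exists>v'. continuous_on {0..} v' \<and>
           (\<forall>t\<ge>0. (v x has_vector_derivative v' t) (at t within {0..})) \<and>
           (\<forall>t>0. v' t + difference_op l lhat a \<epsilon> (\<lambda>z. v z t) x = discrete_delta \<epsilon> x)))"

subsection \<open>The functions \<open>H\<^sub>k\<close>\<close>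

definition H_ker :: "nat \<Rightarrow> (('d::finite \<Rightarrow> nat) \<Rightarrow> complex) \<Rightarrow> real ^ 'd \<Rightarrow> complex" where
  "H_ker l b y =
     (LINT \<xi>|lborel. exp (- diff_symbol l b \<xi>) * cis (y \<bullet> \<xi>)) / complex_of_real ((2 * pi) ^ CARD('d))"

text \<open>\<open>P j\<close> is the polynomial with index j; only the indices j > l occur.\<close>

definition exp_expansion :: "nat \<Rightarrow> nat \<Rightarrow> (('d::finite + 'd \<Rightarrow> nat) \<Rightarrow> complex) \<Rightarrow>
    (('d \<Rightarrow> nat) \<Rightarrow> complex) \<Rightarrow> (nat \<Rightarrow> 'd polyn) \<Rightarrow> bool" where
  "exp_expansion l lhat a b P \<longleftrightarrow>
     (\<forall>\<xi> K. (\<lambda>s::real. exp (- (difference_symbol l lhat a (s *\<^sub>R \<xi>) / complex_of_real s ^ l))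
               - exp (- diff_symbol l b \<xi>) *
                   (1 + (\<Sum>m=1..K. complex_of_real s ^ m * peval (P (m + l)) \<xi>)))
             \<in> O[at_right 0](\<lambda>s. complex_of_real s ^ (K + 1)))"

definition H_fun :: "nat \<Rightarrow> (('d::finite \<Rightarrow> nat) \<Rightarrow> complex) \<Rightarrow> (nat \<Rightarrow> 'd polyn) \<Rightarrow> nat \<Rightarrow>
    real ^ 'd \<Rightarrow> complex" where
  "H_fun l b P k = (if k = 0 then H_ker l b else peval_D (P (k + l)) (H_ker l b))"

definition H_dir :: "nat \<Rightarrow> (('d::finite \<Rightarrow> nat) \<Rightarrow> complex) \<Rightarrow> (nat \<Rightarrow> 'd polyn) \<Rightarrow> nat \<Rightarrow> nat \<Rightarrow>
    real ^ 'd \<Rightarrow> complex" where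
  "H_dir l b P k j n =
     ((\<lambda>f \<rho>. vector_derivative f (at \<rho>)) ^^ j) (\<lambda>\<rho>::real. H_fun l b P k (\<rho> *\<^sub>R n)) 0"

subsection \<open>The functions \<open>F\<^sub>k\<close>, \<open>\<Omega>\<^sub>k\<close> and their companions, for nonzero argument\<close>

text \<open>Here \<^term>\<open>sgn y\<close> is the unit vector in the direction of \<open>y\<close>.\<close>

definition F_fun :: "nat \<Rightarrow> (('d::finite \<Rightarrow> nat) \<Rightarrow> complex) \<Rightarrow> (nat \<Rightarrow> 'd polyn) \<Rightarrow> nat \<Rightarrow>
    real ^ 'd \<Rightarrow> complex" where
  "F_fun l b P k y =
     (if k \<le> l - CARD('d)
      then of_nat l * complex_of_real (norm y) ^ (l - CARD('d) - k) *
             (LINT \<rho>:{norm y..}|lborel.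
                H_fun l b P k (\<rho> *\<^sub>R sgn y) / complex_of_real \<rho> ^ (l - CARD('d) - k + 1))
      else - (of_nat l / complex_of_real (norm y) ^ (CARD('d) + k - l)) *
             (LINT \<rho>:{0..norm y}|lborel.
                complex_of_real \<rho> ^ (CARD('d) + k - l - 1) * H_fun l b P k (\<rho> *\<^sub>R sgn y)))"

definition H_hat :: "nat \<Rightarrow> (('d::finite \<Rightarrow> nat) \<Rightarrow> complex) \<Rightarrow> (nat \<Rightarrow> 'd polyn) \<Rightarrow> nat \<Rightarrow>
    real \<Rightarrow> real ^ 'd \<Rightarrow> complex" where
  "H_hat l b P k \<rho> n = H_fun l b P k (\<rho> *\<^sub>R n)
     - (\<Sum>j=0..l - CARD('d) - k. H_dir l b P k j n / fact j * complex_of_real \<rho> ^ j)"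

definition F_hat :: "nat \<Rightarrow> (('d::finite \<Rightarrow> nat) \<Rightarrow> complex) \<Rightarrow> (nat \<Rightarrow> 'd polyn) \<Rightarrow>
    real ^ 'd \<Rightarrow> complex" where
  "F_hat l b P y = of_nat l *
     (\<Sum>k=0..l - CARD('d). complex_of_real (norm y) ^ (l - CARD('d) - k) *
        (LINT \<rho>:{0..1}|lborel. H_hat l b P k \<rho> (sgn y) / complex_of_real \<rho> ^ (l - CARD('d) - k + 1)))"

definition Omega_k :: "nat \<Rightarrow> (('d::finite \<Rightarrow> nat) \<Rightarrow> complex) \<Rightarrow> (nat \<Rightarrow> 'd polyn) \<Rightarrow> nat \<Rightarrow>
    real ^ 'd \<Rightarrow> complex" where
  "Omega_k l b P k y = of_nat l * complex_of_real (norm y) ^ (l - CARD('d) - k) *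
     ((LINT \<rho>:{1..}|lborel.
         H_fun l b P k (\<rho> *\<^sub>R sgn y) / complex_of_real \<rho> ^ (l - CARD('d) - k + 1))
      - (\<Sum>j<l - CARD('d) - k.
           H_dir l b P k j (sgn y) / (fact j * of_nat (l - j - CARD('d) - k)))
      - H_dir l b P k (l - CARD('d) - k) (sgn y) / fact (l - CARD('d) - k)
          * complex_of_real (ln (norm y)))"

subsection \<open>The function \<open>S\<close>\<close>

text \<open>
  \<open>Q k \<theta> y\<close> is the homogeneous term of degree k - l in \<open>\<theta>\<close>. Homogeneity and the bound on the
  remainder determine \<open>Q k \<theta> y\<close> uniquely for nonzero \<open>\<theta>\<close> and k at most l - d; its value
  at \<open>\<theta> = 0\<close> is irrelevant.
\<close>

definition Q_hat :: "nat \<Rightarrow> nat \<Rightarrow> (('d::finite + 'd \<Rightarrow> nat) \<Rightarrow> complex) \<Rightarrow>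
    (nat \<Rightarrow> real ^ 'd \<Rightarrow> real ^ 'd \<Rightarrow> complex) \<Rightarrow> real ^ 'd \<Rightarrow> real ^ 'd \<Rightarrow> complex" where
  "Q_hat l lhat a Q \<theta> y =
     cis (y \<bullet> \<theta>) / difference_symbol l lhat a \<theta> - (\<Sum>k=0..l - CARD('d). Q k \<theta> y)"

definition Q_expansion :: "nat \<Rightarrow> nat \<Rightarrow> (('d::finite + 'd \<Rightarrow> nat) \<Rightarrow> complex) \<Rightarrow>
    (nat \<Rightarrow> real ^ 'd \<Rightarrow> real ^ 'd \<Rightarrow> complex) \<Rightarrow> bool" where
  "Q_expansion l lhat a Q \<longleftrightarrow> (\<forall>y.
     (\<forall>k\<le>l - CARD('d). \<exists>p q i j. homogeneous i p \<and> homogeneous j q \<and> int i - int j = int k - int l \<and>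
        (\<forall>\<theta>. \<theta> \<noteq> 0 \<longrightarrow> peval q \<theta> \<noteq> 0 \<and> Q k \<theta> y = peval p \<theta> / peval q \<theta>)) \<and>
     (\<exists>c. \<forall>\<theta>\<in>cube pi - {0}. norm (Q_hat l lhat a Q \<theta> y) \<le> c * norm \<theta> powi (1 - int CARD('d))))"

definition r_pi :: "real ^ 'd::finite \<Rightarrow> real" where
  "r_pi n = (THE s. s > 0 \<and> s *\<^sub>R n \<in> frontier (cube pi))"

text \<open>
  The surface measure on the unit sphere: the measure of a set E of directions is d times the
  Lebesgue measure of the part of the unit ball that lies in the cone over E. For d = 1 this is
  the counting measure on the two points of the sphere.
\<close>

definition surface_measure :: "(real ^ 'd::finite) measure" where
  "surface_measure = scale_measure (of_nat CARD('d))
     (distr (restrict_space lborel (cball 0 1 - {0})) (restrict_space borel (sphere 0 1)) sgn)"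

lemma emeasure_surface_measure:
  fixes E :: "(real ^ 'd::finite) set"
  assumes "E \<in> sets borel" "E \<subseteq> sphere 0 1"
  shows "emeasure surface_measure E =
    of_nat CARD('d) * emeasure lborel {x \<in> cball 0 1 - {0}. sgn x \<in> E}"
proof -
  let ?B = "cball 0 1 - {0} :: (real ^ 'd) set"
  have c: "continuous_on ?B (sgn :: real ^ 'd \<Rightarrow> _)"
    unfolding sgn_div_norm by (intro continuous_intros) auto
  have m: "(sgn :: real ^ 'd \<Rightarrow> _) \<in>
      restrict_space lborel ?B \<rightarrow>\<^sub>M restrict_space borel (sphere 0 1)"
  proof (rule measurable_restrict_space2)
    show "(sgn :: real ^ 'd \<Rightarrow> _) \<in> space (restrict_space lborel ?B) \<rightarrow> sphere 0 1"
      by (auto simp: space_restrict_space norm_sgn)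
    have "sets (restrict_space lborel ?B) = sets (restrict_space borel ?B)"
      by (rule sets_restrict_space_cong) simp
    then show "(sgn :: real ^ 'd \<Rightarrow> _) \<in> restrict_space lborel ?B \<rightarrow>\<^sub>M borel"
      using borel_measurable_continuous_on_restrict[OF c] measurable_cong_sets by blast
  qed
  have E: "E \<in> sets (restrict_space borel (sphere 0 1))"
    using assms by (auto simp: sets_restrict_space intro!: image_eqI[of _ _ E])
  have "sgn -` E \<inter> space (restrict_space lborel ?B) = {x \<in> ?B. sgn x \<in> E}"
    by (auto simp: space_restrict_space)
  moreover have "emeasure (restrict_space lborel ?B) {x \<in> ?B. sgn x \<in> E} =
      emeasure lborel {x \<in> ?B. sgn x \<in> E}"
    by (rule emeasure_restrict_space) auto
  ultimately show ?thesis
    unfolding surface_measure_def using emeasure_distr[OF m E] by simp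
qed

definition S_fun :: "nat \<Rightarrow> nat \<Rightarrow> nat \<Rightarrow> (('d::finite + 'd \<Rightarrow> nat) \<Rightarrow> complex) \<Rightarrow>
    (('d \<Rightarrow> nat) \<Rightarrow> complex) \<Rightarrow> (nat \<Rightarrow> 'd polyn) \<Rightarrow> (nat \<Rightarrow> real ^ 'd \<Rightarrow> real ^ 'd \<Rightarrow> complex) \<Rightarrow>
    real ^ 'd \<Rightarrow> complex" where
  "S_fun M l lhat a b P Q y =
     ((LINT \<xi>:ball 0 1|lborel. (1 - exp (- diff_symbol l b \<xi>)) * Q (l - CARD('d)) \<xi> y)
      - (LINT \<xi>:- ball 0 1|lborel. exp (- diff_symbol l b \<xi>) * Q (l - CARD('d)) \<xi> y)
      + (LINT \<theta>:cube pi|lborel. Q_hat l lhat a Q \<theta> y)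
      - (\<Sum>k | k + CARD('d) + M \<le> l.
           LINT \<xi>|lborel. exp (- diff_symbol l b \<xi>) * Q k \<xi> y * peval (P (2 * l - CARD('d) - k)) \<xi>)
      - (\<Sum>k<l - CARD('d). 1 / of_nat (l - CARD('d) - k) *
           (LINT n|surface_measure.
              complex_of_real (r_pi n powi (int CARD('d) + int k - int l)) * Q k n y))
      + (LINT n|surface_measure. complex_of_real (ln (r_pi n)) * Q (l - CARD('d)) n y))
     / complex_of_real ((2 * pi) ^ CARD('d))"

definition Omega :: "nat \<Rightarrow> nat \<Rightarrow> nat \<Rightarrow> (('d::finite + 'd \<Rightarrow> nat) \<Rightarrow> complex) \<Rightarrow>
    (('d \<Rightarrow> nat) \<Rightarrow> complex) \<Rightarrow> (nat \<Rightarrow> 'd polyn) \<Rightarrow> (nat \<Rightarrow> real ^ 'd \<Rightarrow> real ^ 'd \<Rightarrow> complex) \<Rightarrow>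
    real ^ 'd \<Rightarrow> complex" where
  "Omega M l lhat a b P Q y =
     S_fun M l lhat a b P Q y - F_hat l b P y - (\<Sum>k=0..l - CARD('d). Omega_k l b P k y)"

end

theory Submission
  imports Defs "HOL-Complex_Analysis.Complex_Analysis"
begin

text \<open>
  After rescaling to mesh size 1, the Green function is the Fourier integral over the cube, because the
  lattice equation is a linear differential equation with bounded generator. Put \<open>t = s\<^sup>-\<^sup>l\<close>. The time
  derivative of the Green function is the integral of \<open>exp (- t A)\<close>; inserting the expansion of
  \<open>exp (- A (s \<xi>) / s\<^sup>l)\<close>, whose remainder is controlled uniformly in \<open>\<xi>\<close> by Cauchy estimates in \<open>s\<close>, expands
  it in the functions \<open>H\<^sub>k (s y)\<close>, uniformly in \<open>y\<close>. Each term has the antiderivative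
  \<open>s\<^sup>k\<^sup>-\<^sup>l\<^sup>+\<^sup>d F\<^sub>k (s y)\<close>, so the difference of the Green function and these antiderivatives is, up to
  the required error, a constant depending on \<open>y\<close> only. The constant is found for fixed \<open>y\<close> as \<open>s\<close> tends
  to 0, where one may compare constant terms modulo negative powers of \<open>s\<close> and \<open>ln s\<close>: splitting off
  the homogeneous terms of \<open>exp (i y \<theta>) / A \<theta>\<close> produces \<open>S\<close>, and Taylor expansion of \<open>H\<^sub>k\<close> at the origin
  produces the constant terms of the antiderivatives.
\<close>

subsection \<open>Polar coordinates\<close>

text \<open>Three obstacles shape the proof. The assumed expansion of the exponential holds for each
  \<open>\<xi>\<close> separately, with constants depending on \<open>\<xi>\<close>, whereas
  integration over \<open>\<xi>\<close> needs constants of polynomial growth; as the rescaled symbol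
  is bounded by a multiple of \<open>|\<xi>| ^ l\<close> on the complex disc
  \<open>|s| |\<xi>| \<le> 1\<close>, Cauchy estimates on discs of radius proportional to
  \<open>1 / |\<xi>|\<close> supply them. Secondly, the analysis of \<open>1 / A\<close> near the
  origin is available for fixed \<open>y\<close> only, while the remainder must be uniform in
  \<open>y\<close>; so the uniform estimate is made for the derivative in \<open>s\<close> and
  integrated from \<open>s = 0\<close>, where the pointwise limit enters as a mere initial value.
  Thirdly, matching all singular coefficients of the two sides would be laborious; since the
  derivative bound already keeps the difference bounded as \<open>s\<close> tends to 0, negative
  powers and logarithm must cancel by themselves. In the original variables \<open>s\<close> is
  \<open>\<epsilon> / t powr (1 / l)\<close> and \<open>y\<close> is
  \<open>x / \<epsilon>\<close>.\<close>

lemma lborel_integrable_scaleR_iff: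
  fixes f :: "real ^ 'd::finite \<Rightarrow> 'b::{banach, second_countable_topology}"
  assumes "c > 0"
  shows "integrable lborel (\<lambda>x. f (c *\<^sub>R x)) \<longleftrightarrow> integrable lborel f"
proof -
  have *: "integrable lborel (\<lambda>x. f (c *\<^sub>R x))" if f: "integrable lborel f" and c: "c > 0"
    for f :: "real ^ 'd \<Rightarrow> 'b" and c :: real
  proof -
    have [measurable]: "f \<in> borel_measurable borel" using f by auto
    have "integrable (density (distr lborel borel (\<lambda>x. 0 + c *\<^sub>R x)) (\<lambda>_. \<bar>c\<bar>^DIM(real ^ 'd))) f"
      using f lborel_affine[of c "0::real ^ 'd"] c by simp
    then have "integrable lborel (\<lambda>x. \<bar>c\<bar>^DIM(real ^ 'd) *\<^sub>R f (c *\<^sub>R x))"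
      using c by (subst (asm) integrable_density) (auto simp: integrable_distr_eq)
    then have "integrable lborel (\<lambda>x. inverse (c ^ CARD('d)) *\<^sub>R c ^ CARD('d) *\<^sub>R f (c *\<^sub>R x))"
      using c by (rule_tac integrable_scaleR_right) simp
    then show ?thesis
      using c by simp
  qed
  show ?thesis
    using *[of f c] *[of "\<lambda>x. f (c *\<^sub>R x)" "1/c"] assms by auto
qed

lemma lborel_integral_scaleR:
  fixes f :: "real ^ 'd::finite \<Rightarrow> 'b::{banach, second_countable_topology}"
  assumes "c > 0"
  shows "(\<integral>x. f x \<partial>lborel) = c ^ CARD('d) *\<^sub>R (\<integral>x. f (c *\<^sub>R x) \<partial>lborel)"
proof (cases "integrable lborel f")
  case True
  then have [measurable]: "f \<in> borel_measurable borel" by auto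
  have "(\<integral>x. f x \<partial>lborel) = (\<integral>x. f x \<partial>density (distr lborel borel (\<lambda>x. 0 + c *\<^sub>R x)) (\<lambda>_. \<bar>c\<bar>^DIM(real ^ 'd)))"
    using lborel_affine[of c "0::real ^ 'd"] assms by simp
  also have "\<dots> = (\<integral>x. c ^ CARD('d) *\<^sub>R f x \<partial>(distr lborel borel (\<lambda>x. 0 + c *\<^sub>R x)))"
    using assms by (subst integral_density) (auto simp:)
  also have "\<dots> = (\<integral>x. c ^ CARD('d) *\<^sub>R f (c *\<^sub>R x) \<partial>lborel)"
    using assms by (subst integral_distr) (auto simp:)
  finally show ?thesis by simp
next
  case False
  with lborel_integrable_scaleR_iff[OF assms, of f] show ?thesis
    by (simp add: not_integrable_integral_eq)
qed

text \<open>Dilation by \<open>a\<close> maps the unit sector onto the sector of radius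
  \<open>a\<close>. This homogeneity is the geometric input to polar coordinates, because the
  surface measure is itself defined through unit sectors.\<close>

lemma emeasure_sector:
  fixes B :: "(real ^ 'd::finite) set"
  assumes "a > 0" and [measurable]: "B \<in> sets borel"
  shows "emeasure lborel {x. x \<noteq> 0 \<and> norm x \<le> a \<and> sgn x \<in> B} =
     ennreal (a ^ CARD('d)) * emeasure lborel {x. x \<noteq> 0 \<and> norm x \<le> 1 \<and> sgn x \<in> B}"
proof -
  have s[measurable]: "(sgn :: real ^ 'd \<Rightarrow> _) \<in> borel_measurable borel"
    by (simp add: sgn_div_norm[abs_def])
  have [measurable]: "{x. x \<noteq> 0 \<and> norm x \<le> a \<and> sgn x \<in> B} \<in> sets borel" for a
    by measurable
  have "emeasure lborel {x. x \<noteq> 0 \<and> norm x \<le> a \<and> sgn x \<in> B} = 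
    emeasure (density (distr lborel borel (\<lambda>x. 0 + a *\<^sub>R x)) (\<lambda>_. \<bar>a\<bar>^DIM(real ^ 'd))) {x. x \<noteq> 0 \<and> norm x \<le> a \<and> sgn x \<in> B}"
    using lborel_affine[of a "0::real ^ 'd"] assms by simp
  also have "\<dots> = ennreal (a ^ CARD('d)) * emeasure lborel ((\<lambda>x. 0 + a *\<^sub>R x) -` {x. x \<noteq> 0 \<and> norm x \<le> a \<and> sgn x \<in> B})"
    using assms by (subst emeasure_density_const) (auto simp: emeasure_distr)
  also have "(\<lambda>x. 0 + a *\<^sub>R x) -` {x. x \<noteq> 0 \<and> norm x \<le> a \<and> sgn x \<in> B} = {x. x \<noteq> 0 \<and> norm x \<le> 1 \<and> sgn x \<in> B}"
    using assms by (auto simp: sgn_scaleR)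
  finally show ?thesis .
qed

text \<open>The surface measure lives on the trace sigma-algebra of the sphere. Its image on all
  Borel sets has the same integrals of Borel functions and can be multiplied with the radial measure
  without restricting functions; being concentrated on the sphere becomes an almost-everywhere
  statement.\<close>

definition sphere_borel :: "(real ^ 'd::finite) measure" where
  "sphere_borel = distr surface_measure borel (\<lambda>x. x)"

lemma sets_surface_measure: "sets (surface_measure :: (real ^ 'd::finite) measure) = sets (restrict_space borel (sphere 0 1))"
  by (simp add: surface_measure_def)

lemma space_surface_measure: "space (surface_measure :: (real ^ 'd::finite) measure) = sphere 0 1"
  using sets_eq_imp_space_eq[OF sets_surface_measure] by (simp add: space_restrict_space)

lemma measurable_surface_measure:
  "f \<in> borel_measurable borel \<Longrightarrow> f \<in> borel_measurable (surface_measure :: (real ^ 'd::finite) measure)"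
  by (simp add: measurable_cong_sets[OF sets_surface_measure refl] measurable_restrict_space1)

lemma measurable_id_surface: "(\<lambda>x. x) \<in> borel_measurable (surface_measure :: (real ^ 'd::finite) measure)"
  by (rule measurable_surface_measure) simp

lemma emeasure_sphere_borel:
  fixes B :: "(real ^ 'd::finite) set"
  assumes [measurable]: "B \<in> sets borel"
  shows "emeasure sphere_borel B = of_nat CARD('d) * emeasure lborel {x. x \<noteq> 0 \<and> norm x \<le> 1 \<and> sgn x \<in> B}"
proof -
  have "emeasure sphere_borel B = emeasure surface_measure (B \<inter> sphere 0 1)"
    unfolding sphere_borel_def using measurable_id_surface
    by (subst emeasure_distr) (auto simp: space_surface_measure vimage_def Int_commute)
  also have "\<dots> = of_nat CARD('d) * emeasure lborel {x \<in> cball 0 1 - {0}. sgn x \<in> B \<inter> sphere 0 1}"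
    by (rule emeasure_surface_measure) auto
  also have "{x \<in> cball 0 1 - {0}. sgn x \<in> B \<inter> sphere 0 1} = {x. x \<noteq> 0 \<and> norm x \<le> 1 \<and> sgn x \<in> B}"
    by (auto simp: norm_sgn)
  finally show ?thesis .
qed

lemma finite_sphere_borel: "finite_measure (sphere_borel :: (real ^ 'd::finite) measure)"
proof
  have "emeasure lborel {x. x \<noteq> 0 \<and> norm x \<le> 1 \<and> sgn x \<in> (UNIV::(real ^ 'd) set)} \<le> emeasure lborel (cball 0 1 :: (real ^ 'd) set)"
    by (rule emeasure_mono) auto
  also have "\<dots> < \<infinity>"
    using emeasure_bounded_finite[of "cball 0 1 :: (real ^ 'd) set"] by simp
  finally have "emeasure (sphere_borel :: (real ^ 'd) measure) UNIV < \<infinity>"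
    by (subst emeasure_sphere_borel) (auto simp: ennreal_mult_less_top ennreal_of_nat_eq_real_of_nat)
  then show "emeasure (sphere_borel :: (real ^ 'd) measure) (space sphere_borel) \<noteq> \<infinity>"
    by (simp add: sphere_borel_def)
qed

lemma integral_sphere_borel:
  fixes f :: "real ^ 'd::finite \<Rightarrow> 'b::{banach, second_countable_topology}"
  assumes "f \<in> borel_measurable borel"
  shows "integral\<^sup>L sphere_borel f = integral\<^sup>L surface_measure f"
  unfolding sphere_borel_def
  by (subst integral_distr) (use assms measurable_id_surface in auto)

lemma AE_sphere_borel: "AE n in (sphere_borel :: (real ^ 'd::finite) measure). norm n = 1"
  unfolding sphere_borel_def
  by (subst AE_distr_iff) (auto simp: measurable_id_surface space_surface_measure)

section \<open>Lebesgue measure as a product of a radial and a spherical measure\<close>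

definition radial_measure :: "nat \<Rightarrow> real measure" where
  "radial_measure d = density lborel (\<lambda>\<rho>. indicator {0<..} \<rho> * ennreal (\<rho> ^ (d - 1)))"

text \<open>The factor \<open>d\<close> is the one in the definition of the surface measure; moved
  to the radial side, it cancels the \<open>1 / d\<close> from integrating
  \<open>\<rho> ^ (d - 1)\<close>.\<close>

lemma emeasure_radial_atMost:
  assumes "a > 0" "d > 0"
  shows "of_nat d * emeasure (radial_measure d) {..a} = ennreal (a ^ d)"
proof -
  have "emeasure (radial_measure d) {..a} = (\<integral>\<^sup>+ \<rho>. ennreal (\<rho> ^ (d - 1)) * indicator {0<..a} \<rho> \<partial>lborel)"
    unfolding radial_measure_def
    by (subst emeasure_density) (auto intro!: nn_integral_cong simp: indicator_def)
  also have "\<dots> = (\<integral>\<^sup>+ \<rho>. ennreal (\<rho> ^ (d - 1)) * indicator {0..a} \<rho> \<partial>lborel)"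
    using AE_lborel_singleton[of "0::real"]
    by (intro nn_integral_cong_AE) (auto simp: indicator_def elim!: eventually_mono)
  also have "\<dots> = ennreal (a ^ d / d - 0 ^ d / d)"
    using assms
    by (intro nn_integral_FTC_Icc) (auto intro!: derivative_eq_intros simp: has_real_derivative_iff_has_vector_derivative[symmetric])
  finally show ?thesis
    using assms by (simp add: ennreal_of_nat_eq_real_of_nat ennreal_mult'[symmetric] zero_power)
qed

lemma emeasure_radial_atMost0:
  assumes "a \<le> 0"
  shows "emeasure (radial_measure d) {..a} = 0"
  unfolding radial_measure_def using assms
  by (subst emeasure_density) (auto simp: indicator_def nn_integral_0_iff_AE)

definition polar_measure :: "(real \<times> (real ^ 'd::finite)) measure" where
  "polar_measure = distr (density lborel (indicator (-{0}))) (borel \<Otimes>\<^sub>M borel) (\<lambda>x. (norm x, sgn x))"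

lemma emeasure_polar_measure:
  assumes [measurable]: "A \<in> sets borel" "B \<in> sets borel"
  shows "emeasure (polar_measure :: (real \<times> (real ^ 'd::finite)) measure) (A \<times> B) = 
    emeasure lborel {x. x \<noteq> 0 \<and> norm x \<in> A \<and> sgn x \<in> B}"
proof -
  have "emeasure (polar_measure :: (real \<times> (real ^ 'd)) measure) (A \<times> B) = 
     emeasure (density lborel (indicator (-{0}))) {x::real ^ 'd. norm x \<in> A \<and> sgn x \<in> B}"
    unfolding polar_measure_def
    by (subst emeasure_distr) (auto simp: vimage_def)
  also have "\<dots> = emeasure lborel {x. x \<noteq> 0 \<and> norm x \<in> A \<and> sgn x \<in> B}"
    by (subst emeasure_density)
      (auto simp flip: nn_integral_indicator intro!: nn_integral_cong simp: indicator_def)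
  finally show ?thesis .
qed

lemma UN_atMost_nat: "(\<Union>i. {..real i}) = UNIV"
  using real_arch_simple by auto

text \<open>For a fixed set \<open>B\<close> of directions both sides are measures in the radial
  variable. They agree and are finite on the half-lines \<open>{..a}\<close>, by the scaling of
  sectors, and half-lines form an intersection-stable generator of the Borel sets. Rectangles then
  determine the product measure.\<close>

lemma polar_measure_eq:
  "radial_measure CARD('d) \<Otimes>\<^sub>M sphere_borel = (polar_measure :: (real \<times> (real ^ 'd::finite)) measure)"
proof (rule pair_measure_eqI)
  interpret finite_measure "sphere_borel :: (real ^ 'd) measure" by (rule finite_sphere_borel)
  show sf: "sigma_finite_measure (sphere_borel :: (real ^ 'd) measure)"
    by (rule sigma_finite_measure_axioms)
  have fin: "emeasure (radial_measure CARD('d)) {..a} \<noteq> \<infinity>" for a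
  proof (cases "a > 0")
    case True
    show ?thesis
    proof
      assume "emeasure (radial_measure CARD('d)) {..a} = \<infinity>"
      with emeasure_radial_atMost[OF True, of "CARD('d)"] show False
        by (simp add: ennreal_mult_top)
    qed
  qed (use emeasure_radial_atMost0 in auto)
  show "sigma_finite_measure (radial_measure CARD('d))"
  proof
    have "(\<Union>i. {..real i}) = space (radial_measure CARD('d))"
      using UN_atMost_nat by (auto simp: radial_measure_def)
    moreover have "range (\<lambda>i. {..real i}) \<subseteq> sets (radial_measure CARD('d))"
      by (auto simp: radial_measure_def)
    ultimately show "\<exists>A. countable A \<and> A \<subseteq> sets (radial_measure CARD('d)) \<and>
      \<Union> A = space (radial_measure CARD('d)) \<and> (\<forall>a\<in>A. emeasure (radial_measure CARD('d)) a \<noteq> \<infinity>)"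
      using fin by (intro exI[of _ "range (\<lambda>i. {..real i})"]) auto
  qed
  show "sets (radial_measure CARD('d) \<Otimes>\<^sub>M sphere_borel) = sets (polar_measure :: (real \<times> (real ^ 'd)) measure)"
    unfolding polar_measure_def sets_distr
    by (intro sets_pair_measure_cong) (auto simp: radial_measure_def sphere_borel_def)
  fix A and B :: "(real ^ 'd) set"
  assume "A \<in> sets (radial_measure CARD('d))" "B \<in> sets sphere_borel"
  then have A[measurable]: "A \<in> sets borel" and B[measurable]: "B \<in> sets borel"
    by (auto simp: radial_measure_def sphere_borel_def)
  let ?M = "distr (density lborel (indicator {x. x \<noteq> 0 \<and> sgn x \<in> B})) borel (norm :: real ^ 'd \<Rightarrow> real)"
  let ?N = "scale_measure (emeasure sphere_borel B) (radial_measure CARD('d))"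
  have M: "emeasure ?M A = emeasure lborel {x. x \<noteq> 0 \<and> norm x \<in> A \<and> sgn x \<in> B}"
    if [measurable]: "A \<in> sets borel" for A
  proof -
    have [measurable]: "(norm :: real ^ 'd \<Rightarrow> real) -` A \<in> sets borel"
      by (rule measurable_sets_borel[where M=borel]) (use that in auto)
    have "emeasure ?M A = emeasure (density lborel (indicator {x. x \<noteq> 0 \<and> sgn x \<in> B})) (norm -` A)"
      by (subst emeasure_distr) auto
    also have "\<dots> = emeasure lborel {x. x \<noteq> 0 \<and> norm x \<in> A \<and> sgn x \<in> B}"
      by (subst emeasure_density)
        (auto simp flip: nn_integral_indicator intro!: nn_integral_cong simp: indicator_def)
    finally show ?thesis .
  qed
  have B1: "emeasure sphere_borel B \<noteq> \<infinity>"
    using emeasure_finite by auto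
  have atM: "emeasure ?N {..a} = emeasure ?M {..a}" for a
  proof (cases "a > 0")
    case True
    have "emeasure ?N {..a} = emeasure sphere_borel B * emeasure (radial_measure CARD('d)) {..a}"
      by simp
    also have "\<dots> = emeasure lborel {x. x \<noteq> 0 \<and> norm x \<le> 1 \<and> sgn x \<in> B} * 
       (of_nat CARD('d) * emeasure (radial_measure CARD('d)) {..a})"
      by (simp add: emeasure_sphere_borel mult_ac)
    also have "\<dots> = emeasure lborel {x. x \<noteq> 0 \<and> norm x \<le> a \<and> sgn x \<in> B}"
      using True by (subst emeasure_radial_atMost) (auto simp: emeasure_sector[OF True B] mult.commute)
    finally show ?thesis using M[of "{..a}"] by simp
  next
    case False
    then have e0: "{x. x \<noteq> 0 \<and> norm x \<in> {..a} \<and> sgn x \<in> B} = {}"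
      by (auto simp: not_less) (meson norm_le_zero_iff order_trans)
    with False show ?thesis using M[of "{..a}", unfolded e0] emeasure_radial_atMost0[of a] by simp
  qed
  have "?N = ?M"
  proof (rule measure_eqI_generator_eq[where A="\<lambda>i. {..real i}" and E="range atMost" and \<Omega>=UNIV])
    show "Int_stable (range (atMost :: real \<Rightarrow> _))"
      by (auto simp: Int_stable_def)
    show "sets ?N = sigma_sets UNIV (range atMost)" "sets ?M = sigma_sets UNIV (range atMost)"
      by (simp_all add: radial_measure_def borel_eq_atMost)
    show "emeasure ?N X = emeasure ?M X" if "X \<in> range atMost" for X
      using that atM by auto
    show "emeasure ?N {..real i} \<noteq> \<infinity>" for i
      using fin[of i] B1 by (simp add: ennreal_mult_eq_top_iff)
  qed (use UN_atMost_nat in auto)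
  then have "emeasure ?N A = emeasure ?M A" by simp
  then show "emeasure (radial_measure CARD('d)) A * emeasure sphere_borel B = emeasure polar_measure (A \<times> B)"
    using M[of A] emeasure_polar_measure[of A B] by (simp add: mult.commute)
qed

lemma polar_pair_measurable:
  "(\<lambda>(\<rho>, n). \<rho> *\<^sub>R n) \<in> borel_measurable (borel \<Otimes>\<^sub>M (borel :: (real ^ 'd::finite) measure))"
  by measurable

lemma
  fixes f :: "real ^ 'd::finite \<Rightarrow> 'b::{banach, second_countable_topology}"
  assumes [measurable]: "f \<in> borel_measurable borel"
  shows integrable_polar_iff: "integrable lborel f \<longleftrightarrow>
      integrable (radial_measure CARD('d) \<Otimes>\<^sub>M sphere_borel) (\<lambda>(\<rho>, n). f (\<rho> *\<^sub>R n))"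
    and integral_polar: "integral\<^sup>L lborel f =
      integral\<^sup>L (radial_measure CARD('d) \<Otimes>\<^sub>M sphere_borel) (\<lambda>(\<rho>, n). f (\<rho> *\<^sub>R n))"
proof -
  have m: "(\<lambda>(\<rho>, n). f (\<rho> *\<^sub>R n)) \<in> borel_measurable (borel \<Otimes>\<^sub>M borel)"
    using measurable_comp[OF polar_pair_measurable assms] by (simp add: o_def split_beta')
  have [simp]: "norm x *\<^sub>R sgn x = x" for x :: "real ^ 'd"
    by (cases "x = 0") (auto simp: sgn_div_norm)
  have ae: "AE x in lborel. indicat_real (- {0::real ^ 'd}) x *\<^sub>R f x = f x"
    using AE_lborel_singleton[of "0::real ^ 'd"] by eventually_elim (auto simp: indicator_def)
  have mi: "(\<lambda>x. indicat_real (- {0::real ^ 'd}) x *\<^sub>R f x) \<in> borel_measurable lborel"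
    by measurable
  have "integrable lborel f \<longleftrightarrow> integrable lborel (\<lambda>x. indicat_real (- {0::real ^ 'd}) x *\<^sub>R f x)"
    using ae mi by (intro integrable_cong_AE) auto
  moreover have "integral\<^sup>L lborel f = integral\<^sup>L lborel (\<lambda>x. indicat_real (- {0::real ^ 'd}) x *\<^sub>R f x)"
    using ae mi by (intro integral_cong_AE) auto
  moreover have d: "density lborel (indicator (- {0::real ^ 'd})) = density lborel (\<lambda>x. ennreal (indicat_real (- {0}) x))"
    by (simp add: ennreal_indicator)
  moreover have "integrable (radial_measure CARD('d) \<Otimes>\<^sub>M sphere_borel) (\<lambda>(\<rho>, n). f (\<rho> *\<^sub>R n)) \<longleftrightarrow>
     integrable lborel (\<lambda>x. indicat_real (- {0::real ^ 'd}) x *\<^sub>R f x)"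
    unfolding polar_measure_eq unfolding polar_measure_def d
    by (subst integrable_distr_eq[OF _ m], measurable, subst integrable_density) auto
  moreover have "integral\<^sup>L (radial_measure CARD('d) \<Otimes>\<^sub>M sphere_borel) (\<lambda>(\<rho>, n). f (\<rho> *\<^sub>R n)) =
     integral\<^sup>L lborel (\<lambda>x. indicat_real (- {0::real ^ 'd}) x *\<^sub>R f x)"
    unfolding polar_measure_eq unfolding polar_measure_def d
    by (subst integral_distr[OF _ m], measurable, subst integral_density) auto
  ultimately show "integrable lborel f \<longleftrightarrow>
      integrable (radial_measure CARD('d) \<Otimes>\<^sub>M sphere_borel) (\<lambda>(\<rho>, n). f (\<rho> *\<^sub>R n))"
    "integral\<^sup>L lborel f =
      integral\<^sup>L (radial_measure CARD('d) \<Otimes>\<^sub>M sphere_borel) (\<lambda>(\<rho>, n). f (\<rho> *\<^sub>R n))"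
    by simp_all
qed

text \<open>A single term of the series of \<open>exp (c * x)\<close> is at most the whole
  sum.\<close>

lemma power_exp_bound:
  fixes x :: real
  assumes "x \<ge> 0" "c > 0"
  shows "x ^ q * exp (- c * x) \<le> fact q / c ^ q"
proof -
  have "(c * x) ^ q / fact q \<le> (\<Sum>n\<le>q. (c * x) ^ n / fact n)"
    using assms by (intro member_le_sum) auto
  also have "\<dots> \<le> suminf (\<lambda>n. (c * x) ^ n / fact n)"
    using assms summable_exp[of "c * x"]
    by (intro sum_le_suminf) (auto simp: divide_inverse mult.commute)
  also have "\<dots> = exp (c * x)"
    by (simp add: exp_def divide_inverse mult.commute)
  finally have "c ^ q * x ^ q \<le> fact q * exp (c * x)"
    by (simp add: field_simps power_mult_distrib)
  then have "x ^ q \<le> fact q / c ^ q * exp (c * x)"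
    using assms by (simp add: field_simps)
  then have "x ^ q * exp (- c * x) \<le> fact q / c ^ q * exp (c * x) * exp (- c * x)"
    by (intro mult_right_mono) auto
  then show ?thesis
    by (simp add: exp_minus field_simps)
qed

lemma radial_measure_eq:
  "radial_measure d = density lborel (\<lambda>\<rho>. ennreal (indicator {0<..} \<rho> * \<rho> ^ (d - 1)))"
  unfolding radial_measure_def by (intro arg_cong2[where f=density] ext) (auto simp: indicator_def)

lemma sigma_finite_radial: "sigma_finite_measure (radial_measure d)"
  unfolding radial_measure_eq
  by (subst sigma_finite_measure.sigma_finite_iff_density_finite') (auto simp: lborel.sigma_finite_measure_axioms)

lemma pair_sigma_finite_polar:
  "pair_sigma_finite (radial_measure d) (sphere_borel :: (real ^ 'd::finite) measure)"
  unfolding pair_sigma_finite_def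
  using finite_measure.axioms(1)[OF finite_sphere_borel] sigma_finite_radial by auto

lemma AE_radial: "AE \<rho> in radial_measure d. \<rho> > 0"
  unfolding radial_measure_eq by (subst AE_density) (auto simp: indicator_def)

text \<open>The sphere is the outer integral, so that for a homogeneous function everything reduces
  to a one-dimensional integral along each ray.\<close>

lemma integral_polar_iterated:
  fixes f :: "real ^ 'd::finite \<Rightarrow> 'b::{banach, second_countable_topology}"
  assumes f: "integrable lborel f"
  shows "integral\<^sup>L lborel f =
    (\<integral>n. (\<integral>\<rho>. (indicator {0<..} \<rho> * \<rho> ^ (CARD('d) - 1)) *\<^sub>R f (\<rho> *\<^sub>R n) \<partial>lborel) \<partial>sphere_borel)"
proof -
  have [measurable]: "f \<in> borel_measurable borel" using f by auto
  interpret pair_sigma_finite "radial_measure CARD('d)" "sphere_borel :: (real ^ 'd) measure"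
    by (rule pair_sigma_finite_polar)
  have i: "integrable (radial_measure CARD('d) \<Otimes>\<^sub>M sphere_borel) (\<lambda>(\<rho>, n). f (\<rho> *\<^sub>R n))"
    using f by (subst integrable_polar_iff[symmetric]) auto
  have "integral\<^sup>L lborel f = integral\<^sup>L (radial_measure CARD('d) \<Otimes>\<^sub>M sphere_borel) (\<lambda>(\<rho>, n). f (\<rho> *\<^sub>R n))"
    by (rule integral_polar) measurable
  also have "\<dots> = (\<integral>n. (\<integral>\<rho>. f (\<rho> *\<^sub>R n) \<partial>radial_measure CARD('d)) \<partial>sphere_borel)"
    using integral_snd[OF i] by simp
  also have "\<dots> = (\<integral>n. (\<integral>\<rho>. (indicator {0<..} \<rho> * \<rho> ^ (CARD('d) - 1)) *\<^sub>R f (\<rho> *\<^sub>R n) \<partial>lborel) \<partial>sphere_borel)"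
  proof (rule Bochner_Integration.integral_cong)
    fix n :: "real ^ 'd"
    show "(\<integral>\<rho>. f (\<rho> *\<^sub>R n) \<partial>radial_measure CARD('d)) = 
      (\<integral>\<rho>. (indicator {0<..} \<rho> * \<rho> ^ (CARD('d) - 1)) *\<^sub>R f (\<rho> *\<^sub>R n) \<partial>lborel)"
      unfolding radial_measure_eq by (subst integral_density) (auto simp: indicator_def)
  qed simp
  finally show ?thesis .
qed

section \<open>Integrability of radial functions\<close>

lemma integrable_radial:
  fixes \<phi> :: "real \<Rightarrow> real"
  assumes [measurable]: "\<phi> \<in> borel_measurable borel"
    and i: "integrable lborel (\<lambda>\<rho>. indicator {0<..} \<rho> * \<rho> ^ (CARD('d) - 1) * \<phi> \<rho>)"
  shows "integrable lborel (\<lambda>x::real ^ 'd::finite. \<phi> (norm x))"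
proof -
  interpret pair_sigma_finite "radial_measure CARD('d)" "sphere_borel :: (real ^ 'd) measure"
    by (rule pair_sigma_finite_polar)
  interpret S: finite_measure "sphere_borel :: (real ^ 'd) measure"
    by (rule finite_sphere_borel)
  have sets[measurable_cong]: "sets (radial_measure CARD('d)) = sets borel" "sets (sphere_borel :: (real ^ 'd) measure) = sets borel"
    by (auto simp: radial_measure_eq sphere_borel_def)
  have \<phi>: "integrable (radial_measure CARD('d)) \<phi>"
    using i unfolding radial_measure_eq by (subst integrable_density) (auto simp: indicator_def)
  have m: "(\<lambda>(\<rho>, n). \<phi> \<rho>) \<in> borel_measurable (radial_measure CARD('d) \<Otimes>\<^sub>M (sphere_borel :: (real ^ 'd) measure))"
    by measurable
  have "integrable (radial_measure CARD('d) \<Otimes>\<^sub>M (sphere_borel :: (real ^ 'd) measure)) (\<lambda>(\<rho>, n). \<phi> \<rho>)"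
    by (rule Fubini_integrable) (use \<phi> in \<open>auto simp: m\<close>)
  moreover have "AE p in radial_measure CARD('d) \<Otimes>\<^sub>M (sphere_borel :: (real ^ 'd) measure). fst p > 0 \<and> norm (snd p) = 1"
  proof (rule AE_pair_measure)
    show "AE x in radial_measure CARD('d). AE y in (sphere_borel :: (real ^ 'd) measure). 0 < fst (x, y) \<and> norm (snd (x, y)) = 1"
      using AE_radial by eventually_elim (use AE_sphere_borel in auto)
  qed measurable
  then have "AE p in radial_measure CARD('d) \<Otimes>\<^sub>M (sphere_borel :: (real ^ 'd) measure).
      (\<lambda>(\<rho>, n). \<phi> (norm (\<rho> *\<^sub>R n))) p = (\<lambda>(\<rho>, n). \<phi> \<rho>) p"
    by eventually_elim auto
  moreover have "(\<lambda>(\<rho>, n). \<phi> (norm (\<rho> *\<^sub>R n))) \<in> borel_measurable (radial_measure CARD('d) \<Otimes>\<^sub>M (sphere_borel :: (real ^ 'd) measure))"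
    by measurable
  ultimately have "integrable (radial_measure CARD('d) \<Otimes>\<^sub>M (sphere_borel :: (real ^ 'd) measure)) (\<lambda>(\<rho>, n). \<phi> (norm (\<rho> *\<^sub>R n)))"
    using integrable_cong_AE m by blast
  then show ?thesis
    by (subst integrable_polar_iff) auto
qed

lemma power_integral_atLeast:
  assumes "R > 0" "m \<ge> 1"
  shows "integrable lborel (\<lambda>\<rho>::real. indicator {R..} \<rho> / \<rho> ^ (m + 1))"
    and "(\<integral>\<rho>. indicator {R..} \<rho> / \<rho> ^ (m + 1) \<partial>lborel) = 1 / (of_nat m * R ^ m)"
proof -
  have "(\<integral>\<^sup>+\<rho>. ennreal (1 / \<rho> ^ (m + 1)) * indicator {R..} \<rho> \<partial>lborel) = ennreal (0 - (- (inverse R ^ m) / of_nat m))"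
  proof (rule nn_integral_FTC_atLeast)
    fix x assume x: "R \<le> x"
    then have "x > 0" using assms by auto
    obtain k where k: "m = Suc k" using assms by (cases m) auto
    show "((\<lambda>x. - (inverse x ^ m) / of_nat m) has_real_derivative 1 / x ^ (m + 1)) (at x)"
    proof -
      have "((\<lambda>x. - (inverse x ^ m) / of_nat m) has_real_derivative
         - (of_nat m * (- (inverse x ^ Suc (Suc 0)) * inverse x ^ (m - Suc 0))) / of_nat m) (at x)"
        using \<open>x > 0\<close> by (intro DERIV_cdivide DERIV_minus DERIV_power DERIV_inverse) auto
      also have "- (of_nat m * (- (inverse x ^ Suc (Suc 0)) * inverse x ^ (m - Suc 0))) / of_nat m = 1 / x ^ (m + 1)"
        using \<open>x > 0\<close> unfolding k by (simp add: field_simps del: of_nat_Suc)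
      finally show ?thesis .
    qed
    show "0 \<le> 1 / x ^ (m + 1)" using \<open>x > 0\<close> by auto
  next
    have "((\<lambda>x::real. - (inverse x ^ m) / of_nat m) \<longlongrightarrow> - (0 ^ m) / of_nat m) at_top"
      by (intro tendsto_intros tendsto_inverse_0_at_top filterlim_ident) (use assms in auto)
    then show "((\<lambda>x::real. - (inverse x ^ m) / of_nat m) \<longlongrightarrow> 0) at_top"
      using assms by (simp add: zero_power)
  qed measurable
  then have "(\<integral>\<^sup>+\<rho>. ennreal (indicator {R..} \<rho> / \<rho> ^ (m + 1)) \<partial>lborel) = ennreal (1 / (of_nat m * R ^ m))"
    by (subst nn_integral_cong[where v="\<lambda>\<rho>. ennreal (1 / \<rho> ^ (m + 1)) * indicator {R..} \<rho>"]) (auto simp: indicator_def field_simps)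
  then have "has_bochner_integral lborel (\<lambda>\<rho>::real. indicator {R..} \<rho> / \<rho> ^ (m + 1)) (1 / (of_nat m * R ^ m))"
    using assms by (intro has_bochner_integral_nn_integral AE_I2) (auto simp: indicator_def)
  then show "integrable lborel (\<lambda>\<rho>::real. indicator {R..} \<rho> / \<rho> ^ (m + 1))"
     "(\<integral>\<rho>. indicator {R..} \<rho> / \<rho> ^ (m + 1) \<partial>lborel) = 1 / (of_nat m * R ^ m)"
    by (auto simp: has_bochner_integral_iff)
qed

text \<open>The exponent \<open>1 - d\<close> exactly cancels the Jacobian
  \<open>\<rho> ^ (d - 1)\<close>. It is the exponent in the assumed bound on
  \<open>Q_hat\<close>.\<close>

lemma integrable_norm_pow_near_0:
  "integrable lborel (\<lambda>x::real ^ 'd::finite. indicator {..R} (norm x) * norm x powi (1 - int CARD('d)))"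
proof (rule integrable_radial[where \<phi>="\<lambda>\<rho>. indicator {..R} \<rho> * \<rho> powi (1 - int CARD('d))"])
  have 1: "\<rho> ^ (CARD('d) - 1) * \<rho> powi (1 - int CARD('d)) = 1" if "\<rho> > 0" for \<rho> :: real
  proof -
    have "CARD('d) > 0" by simp
    then have e: "1 - int CARD('d) = - int (CARD('d) - 1)" by linarith
    have "\<rho> powi (1 - int CARD('d)) = inverse (\<rho> ^ (CARD('d) - 1))"
      unfolding e power_int_minus power_int_of_nat ..
    then show ?thesis using that by simp
  qed
  have "integrable lborel (indicator {0<..R} :: real \<Rightarrow> real)"
    using emeasure_bounded_finite[of "{0<..R}"] by (intro integrable_real_indicator) auto
  then show "integrable lborel (\<lambda>\<rho>. indicator {0<..} \<rho> * \<rho> ^ (CARD('d) - 1) * (indicator {..R} \<rho> * \<rho> powi (1 - int CARD('d))))"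
    by (rule Bochner_Integration.integrable_cong[THEN iffD1, rotated 2, where f1="indicator {0<..R}"]) (auto simp: indicator_def 1[unfolded One_nat_def])
qed (auto simp: power_int_def)

lemma integrable_norm_pow_at_infinity:
  assumes "R > 0" "m \<ge> 1"
  shows "integrable lborel (\<lambda>x::real ^ 'd::finite. indicator {R..} (norm x) / norm x ^ (CARD('d) + m))"
proof (rule integrable_radial[where \<phi>="\<lambda>\<rho>. indicator {R..} \<rho> / \<rho> ^ (CARD('d) + m)"])
  have 1: "\<rho> ^ (CARD('d) - 1) / \<rho> ^ (CARD('d) + m) = 1 / \<rho> ^ (m + 1)" if "\<rho> > 0" for \<rho> :: real
  proof -
    have "CARD('d) > 0" by simp
    then have "CARD('d) + m = (CARD('d) - 1) + (m + 1)" by linarith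
    then have "\<rho> ^ (CARD('d) + m) = \<rho> ^ (CARD('d) - 1) * \<rho> ^ (m + 1)"
      using power_add by metis
    then show ?thesis using that by simp
  qed
  show "integrable lborel (\<lambda>\<rho>. indicator {0<..} \<rho> * \<rho> ^ (CARD('d) - 1) * (indicator {R..} \<rho> / \<rho> ^ (CARD('d) + m)))"
    by (rule Bochner_Integration.integrable_cong[THEN iffD1, rotated 2, OF power_integral_atLeast(1)[OF assms]])
      (use assms in \<open>auto simp: indicator_def 1[unfolded One_nat_def]\<close>)
qed auto

lemma integrable_norm_pow_exp:
  assumes "c > 0" "l \<ge> 1"
  shows "integrable lborel (\<lambda>x::real ^ 'd::finite. norm x ^ n * exp (- c * norm x ^ l))"
proof -
  \<comment> \<open>With this exponent the exponential bound leaves the factor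
    \<open>1 / |x| ^ (d + 1)\<close>, integrable at infinity. Outside the unit ball
    \<open>|x| \<le> |x| ^ l\<close>, so a bound in terms of \<open>|x| ^ l\<close> may be
    used.\<close>
  define q where "q = n + CARD('d) + 1"
  let ?C = "fact q / c ^ q :: real"
  have b: "norm x ^ n * exp (- c * norm x ^ l) \<le> indicator {..1} (norm x) + ?C * (indicator {1..} (norm x) / norm x ^ (CARD('d) + 1))"
    for x :: "real ^ 'd"
  proof (cases "norm x \<ge> 1")
    case True
    have "norm x ^ (CARD('d) + 1) * (norm x ^ n * exp (- c * norm x ^ l)) = norm x ^ q * exp (- c * norm x ^ l)"
      by (simp add: q_def power_add mult_ac)
    also have "\<dots> \<le> (norm x ^ l) ^ q * exp (- c * norm x ^ l)"
      using True assms by (intro mult_right_mono power_mono self_le_power) auto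
    also have "\<dots> \<le> ?C"
      using assms by (intro power_exp_bound) auto
    finally have C: "norm x ^ (CARD('d) + 1) * (norm x ^ n * exp (- c * norm x ^ l)) \<le> ?C" .
    have "norm x ^ n * exp (- c * norm x ^ l) \<le> ?C / norm x ^ (CARD('d) + 1)"
    proof -
      have "norm x ^ (CARD('d) + 1) > 0" using True by (intro zero_less_power) linarith
      with C show ?thesis by (simp only: pos_le_divide_eq mult.commute)
    qed
    also have "\<dots> \<le> indicator {..1} (norm x) + ?C * (indicator {1..} (norm x) / norm x ^ (CARD('d) + 1))"
      using True by (simp add: indicator_def)
    finally show ?thesis .
  next
    case False
    then have "norm x ^ n * exp (- c * norm x ^ l) \<le> 1 * 1"
      using assms by (intro mult_mono power_le_one) auto
    also have "\<dots> \<le> indicator {..1} (norm x) + ?C * (indicator {1..} (norm x) / norm x ^ (CARD('d) + 1))"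
      using False by (auto simp: indicator_def)
    finally show ?thesis .
  qed
  have "integrable lborel (indicator (cball 0 1) :: real ^ 'd \<Rightarrow> real)"
    using emeasure_bounded_finite[of "cball 0 1 :: (real ^ 'd) set"]
    by (intro integrable_real_indicator) auto
  then have "integrable lborel (\<lambda>x::real ^ 'd. indicator {..1} (norm x) :: real)"
    by (rule Bochner_Integration.integrable_cong[THEN iffD1, rotated 2]) (auto simp: indicator_def)
  then have "integrable lborel (\<lambda>x::real ^ 'd. indicator {..1} (norm x) + ?C * (indicator {1..} (norm x) / norm x ^ (CARD('d) + 1)))"
    by (intro Bochner_Integration.integrable_add integrable_mult_right integrable_norm_pow_at_infinity) auto
  then show ?thesis
    by (rule Bochner_Integration.integrable_bound)
      (use order_trans[OF b abs_ge_self] in \<open>auto intro!: AE_I2\<close>)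
qed

subsection \<open>The cube\<close>

lemma cube_iff_component: "x \<in> cube c \<longleftrightarrow> (\<forall>k. \<bar>x $ k\<bar> \<le> c)"
  by (auto simp: cube_def mem_box_cart abs_le_iff minus_le_iff)

lemma infnorm_le_iff: "infnorm (x :: real ^ 'd::finite) \<le> c \<longleftrightarrow> (\<forall>k. \<bar>x $ k\<bar> \<le> c)"
proof
  show "\<forall>k. \<bar>x $ k\<bar> \<le> c" if "infnorm x \<le> c"
    using that component_le_infnorm_cart order_trans by blast
  show "infnorm x \<le> c" if "\<forall>k. \<bar>x $ k\<bar> \<le> c"
    unfolding infnorm_cart by (rule cSup_least) (use that in auto)
qed

lemma mem_cube_iff: "x \<in> cube c \<longleftrightarrow> infnorm x \<le> c"
  by (simp add: cube_iff_component infnorm_le_iff)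

lemma mem_box_cube_iff: "x \<in> box (\<chi> k. - c) (\<chi> k. c) \<longleftrightarrow> infnorm (x :: real ^ 'd::finite) < c"
proof -
  have "infnorm x < c \<longleftrightarrow> (\<forall>k. \<bar>x $ k\<bar> < c)"
  proof
    show "\<forall>k. \<bar>x $ k\<bar> < c" if "infnorm x < c"
      using that component_le_infnorm_cart order.strict_trans1 by blast
    assume *: "\<forall>k. \<bar>x $ k\<bar> < c"
    have fin: "finite {\<bar>x $ i\<bar> |i. i \<in> UNIV}" by (auto simp: full_SetCompr_eq)
    have "infnorm x = Max {\<bar>x $ i\<bar> |i. i \<in> UNIV}"
      unfolding infnorm_cart by (rule cSup_eq_Max[OF fin]) auto
    then show "infnorm x < c" using * by (simp only:) (subst Max_less_iff[OF fin], auto)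
  qed
  then show ?thesis by (auto simp: mem_box_cart abs_less_iff minus_less_iff)
qed

text \<open>The cube is a ball of the sup norm, so its frontier is a level set of
  \<open>infnorm\<close> and each ray meets it exactly once. This resolves the definite description
  and shows that \<open>r_pi\<close> is measurable.\<close>

lemma r_pi_eq:
  fixes n :: "real ^ 'd::finite"
  assumes "n \<noteq> 0"
  shows "r_pi n = pi / infnorm n"
proof -
  have p: "infnorm n > 0" using assms by (simp add: infnorm_pos_lt)
  have fr: "x \<in> frontier (cube pi) \<longleftrightarrow> infnorm x = pi" for x :: "real ^ 'd"
    unfolding cube_def frontier_cbox using mem_cube_iff[of x pi] mem_box_cube_iff[of x pi]
    by (auto simp: cube_def)
  have "s > 0 \<and> s *\<^sub>R n \<in> frontier (cube pi) \<longleftrightarrow> s = pi / infnorm n" for s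
  proof
    assume "s > 0 \<and> s *\<^sub>R n \<in> frontier (cube pi)"
    with fr have "s * infnorm n = pi"
      by (auto simp: infnorm_mul)
    then show "s = pi / infnorm n" using p by (auto simp: field_simps)
  next
    assume "s = pi / infnorm n"
    with fr show "s > 0 \<and> s *\<^sub>R n \<in> frontier (cube pi)"
      using p by (auto simp: infnorm_mul)
  qed
  then show ?thesis
    unfolding r_pi_def by simp
qed

lemma mem_cube_pi_iff_r_pi:
  assumes "norm n = 1" "\<rho> > 0"
  shows "\<rho> *\<^sub>R n \<in> cube pi \<longleftrightarrow> \<rho> \<le> r_pi n"
proof -
  have "n \<noteq> 0" using assms by auto
  then have "infnorm n > 0" by (simp add: infnorm_pos_lt)
  then show ?thesis
    using assms \<open>n \<noteq> 0\<close> by (simp add: mem_cube_iff r_pi_eq infnorm_mul field_simps)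
qed

lemma r_pi_ge_pi: "norm n = 1 \<Longrightarrow> r_pi n \<ge> pi"
  using mem_cube_pi_iff_r_pi[of n pi] infnorm_le_norm[of n]
  by (auto simp: mem_cube_iff infnorm_mul)

lemma borel_measurable_r_pi[measurable]: "r_pi \<in> borel_measurable (borel :: (real ^ 'd::finite) measure)"
proof -
  have [measurable]: "infnorm \<in> borel_measurable (borel :: (real ^ 'd) measure)"
    by (intro borel_measurable_continuous_onI continuous_intros)
  have "r_pi = (\<lambda>n::real ^ 'd. if n = 0 then r_pi (0::real ^ 'd) else pi / infnorm n)"
    by (rule ext) (auto simp: r_pi_eq)
  also have "\<dots> \<in> borel_measurable borel"
    by measurable
  finally show ?thesis .
qed

lemma norm_ge_pi_outside_cube: "x \<notin> cube pi \<Longrightarrow> norm x \<ge> pi"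
  using infnorm_le_norm[of x] by (auto simp: mem_cube_iff)

lemma sets_cube[measurable]: "cube c \<in> sets borel"
  by (simp add: cube_def)

lemma norm_le_cube: "x \<in> cube c \<Longrightarrow> norm (x :: real ^ 'd::finite) \<le> sqrt CARD('d) * c"
  using norm_le_infnorm[of x] by (auto simp: mem_cube_iff intro: order_trans mult_left_mono)

lemma cube_subset_norm: "norm x \<le> c \<Longrightarrow> x \<in> cube c"
  using infnorm_le_norm[of x] by (auto simp: mem_cube_iff)


subsection \<open>Homogeneous functions\<close>

lemma homogeneous_bound:
  fixes q :: "real ^ 'd::finite \<Rightarrow> complex"
  assumes hom: "\<And>c x. c > 0 \<Longrightarrow> x \<noteq> 0 \<Longrightarrow> q (c *\<^sub>R x) = q x * of_real (c powi e)"
    and C: "\<And>x. norm x = 1 \<Longrightarrow> norm (q x) \<le> C" and "x \<noteq> 0"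
  shows "norm (q x) \<le> C * norm x powi e"
proof -
  have "q x = q (norm x *\<^sub>R sgn x)"
    using assms by (simp add: sgn_div_norm)
  also have "\<dots> = q (sgn x) * of_real (norm x powi e)"
    using assms by (intro hom) (auto simp: sgn_zero_iff)
  finally have "norm (q x) = norm (q (sgn x)) * norm x powi e"
    by (simp add: norm_mult del: of_real_power_int)
  also have "\<dots> \<le> C * norm x powi e"
    using assms by (intro mult_right_mono C) (auto simp: norm_sgn)
  finally show ?thesis .
qed

lemma power_diff_eq_powi:
  fixes \<rho> :: real
  assumes "\<rho> > 0" "d > 0"
  shows "\<rho> ^ (d - 1) * \<rho> powi (- int (d + m)) = 1 / \<rho> ^ (m + 1)"
proof -
  have "d + m = (d - 1) + (m + 1)" using assms by simp
  then have "\<rho> ^ (d + m) = \<rho> ^ (d - 1) * \<rho> ^ (m + 1)"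
    using power_add by metis
  then show ?thesis using assms unfolding power_int_minus power_int_of_nat by (simp add: field_simps)
qed

lemma integrable_homogeneous_outside_cube:
  fixes q :: "real ^ 'd::finite \<Rightarrow> complex"
  assumes hom: "\<And>c x. c > 0 \<Longrightarrow> x \<noteq> 0 \<Longrightarrow> q (c *\<^sub>R x) = q x * of_real (c powi (- int (CARD('d) + m)))"
    and C: "\<And>x. norm x = 1 \<Longrightarrow> norm (q x) \<le> C"
    and [measurable]: "q \<in> borel_measurable borel" and m: "m \<ge> 1"
  shows "integrable lborel (\<lambda>x. indicator (- cube pi) x *\<^sub>R q x)"
proof (rule Bochner_Integration.integrable_bound)
  show "integrable lborel (\<lambda>x::real ^ 'd. C * (indicator {pi..} (norm x) / norm x ^ (CARD('d) + m)))"
    by (intro integrable_mult_right integrable_norm_pow_at_infinity) (use m in auto)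
  have "norm (indicator (- cube pi) x *\<^sub>R q x) \<le> norm (C * (indicator {pi..} (norm x) / norm x ^ (CARD('d) + m)))" for x
  proof (cases "x \<in> cube pi")
    case False
    then have n: "norm x \<ge> pi" by (rule norm_ge_pi_outside_cube)
    then have "x \<noteq> 0" by (metis norm_zero not_le pi_gt_zero)
    have "norm (q x) \<le> C * norm x powi (- int (CARD('d) + m))"
      using \<open>x \<noteq> 0\<close> by (intro homogeneous_bound hom C) auto
    also have "\<dots> \<le> norm (C * (indicator {pi..} (norm x) / norm x ^ (CARD('d) + m)))"
      unfolding power_int_minus power_int_of_nat using n by (simp add: divide_inverse)
    finally show ?thesis using False by simp
  qed auto
  then show "AE x in lborel. norm (indicator (- cube pi) x *\<^sub>R q x) \<le>
      norm (C * (indicator {pi..} (norm x) / norm x ^ (CARD('d) + m)))"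
    by (intro AE_I2)
qed measurable

text \<open>On the ray through \<open>n\<close> the integrand times the Jacobian is
  \<open>q n / \<rho> ^ (m + 1)\<close>, and the ray leaves the cube at \<open>r_pi n\<close>. With
  \<open>m = l - d - k\<close> this produces the surface integrals of
  \<open>r_pi n powi (d + k - l)\<close> in \<open>S_fun\<close>.\<close>

lemma integral_homogeneous_outside_cube:
  fixes q :: "real ^ 'd::finite \<Rightarrow> complex"
  assumes hom: "\<And>c x. c > 0 \<Longrightarrow> x \<noteq> 0 \<Longrightarrow> q (c *\<^sub>R x) = q x * of_real (c powi (- int (CARD('d) + m)))"
    and C: "\<And>x. norm x = 1 \<Longrightarrow> norm (q x) \<le> C"
    and [measurable]: "q \<in> borel_measurable borel" and m: "m \<ge> 1"
  shows "(\<integral>x. indicator (- cube pi) x *\<^sub>R q x \<partial>lborel) =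
    1 / of_nat m * (\<integral>n. of_real (r_pi n powi (- int m)) * q n \<partial>surface_measure)"
proof -
  have inner: "(\<integral>\<rho>. (indicator {0<..} \<rho> * \<rho> ^ (CARD('d) - 1)) *\<^sub>R (indicator (- cube pi) (\<rho> *\<^sub>R n) *\<^sub>R q (\<rho> *\<^sub>R n)) \<partial>lborel)
     = 1 / of_nat m * (of_real (r_pi n powi (- int m)) * q n)" if n: "norm n = 1" for n
  proof -
    have r: "r_pi n > 0" using r_pi_ge_pi[OF n] pi_gt_zero by linarith
    have "(\<integral>\<rho>. (indicator {0<..} \<rho> * \<rho> ^ (CARD('d) - 1)) *\<^sub>R (indicator (- cube pi) (\<rho> *\<^sub>R n) *\<^sub>R q (\<rho> *\<^sub>R n)) \<partial>lborel)
      = (\<integral>\<rho>. (indicator {r_pi n..} \<rho> / \<rho> ^ (m + 1)) *\<^sub>R q n \<partial>lborel)"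
    proof (rule integral_cong_AE)
      \<comment> \<open>The frontier point \<open>\<rho> = r_pi n\<close> lies both in the closed
        cube and in the closed half-line, hence an exceptional null set.\<close>
      show "AE \<rho> in lborel. (indicator {0<..} \<rho> * \<rho> ^ (CARD('d) - 1)) *\<^sub>R (indicator (- cube pi) (\<rho> *\<^sub>R n) *\<^sub>R q (\<rho> *\<^sub>R n))
         = (indicator {r_pi n..} \<rho> / \<rho> ^ (m + 1)) *\<^sub>R q n"
        using AE_lborel_singleton[of "r_pi n"]
      proof eventually_elim
        case (elim \<rho>)
        show ?case
        proof (cases "\<rho> > r_pi n")
          case True
          then have p: "\<rho> > 0" using r by auto
          have "\<rho> *\<^sub>R n \<notin> cube pi" using mem_cube_pi_iff_r_pi[OF n p] True by auto
          moreover have "q (\<rho> *\<^sub>R n) = q n * of_real (\<rho> powi (- int (CARD('d) + m)))"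
            using p n by (intro hom) auto
          moreover have "\<rho> ^ (CARD('d) - 1) * \<rho> powi (- int (CARD('d) + m)) = 1 / \<rho> ^ (m + 1)"
            using p by (intro power_diff_eq_powi) auto
          then have "complex_of_real (\<rho> ^ (CARD('d) - 1)) * complex_of_real (\<rho> powi (- int (CARD('d) + m))) = complex_of_real (1 / \<rho> ^ (m + 1))"
            by (metis of_real_mult)
          ultimately show ?thesis using True p
            by (simp add: indicator_def scaleR_conv_of_real mult_ac del: of_real_power of_nat_add of_real_divide of_real_mult of_real_power_int)
        next
          case False
          then show ?thesis using elim mem_cube_pi_iff_r_pi[OF n, of \<rho>] by (auto simp: indicator_def)
        qed
      qed
    qed measurable
    also have "\<dots> = (1 / (of_nat m * r_pi n ^ m)) *\<^sub>R q n"
      using power_integral_atLeast[OF r m] by simp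
    finally show ?thesis
      by (simp add: scaleR_conv_of_real power_int_minus field_simps)
  qed
  have "(\<integral>x. indicator (- cube pi) x *\<^sub>R q x \<partial>lborel) = 
     (\<integral>n. (\<integral>\<rho>. (indicator {0<..} \<rho> * \<rho> ^ (CARD('d) - 1)) *\<^sub>R (indicator (- cube pi) (\<rho> *\<^sub>R n) *\<^sub>R q (\<rho> *\<^sub>R n)) \<partial>lborel) \<partial>sphere_borel)"
    by (intro integral_polar_iterated integrable_homogeneous_outside_cube[where C=C and m=m] assms)
  also have "\<dots> = (\<integral>n. 1 / of_nat m * (of_real (r_pi n powi (- int m)) * q n) \<partial>sphere_borel)"
  proof (rule integral_cong_AE)
    have [measurable_cong]: "sets (sphere_borel :: (real ^ 'd) measure) = sets borel" by (simp add: sphere_borel_def)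
    show "(\<lambda>n. LBINT \<rho>. (indicat_real {0<..} \<rho> * \<rho> ^ (CARD('d) - 1)) *\<^sub>R indicat_real (- cube pi) (\<rho> *\<^sub>R n) *\<^sub>R q (\<rho> *\<^sub>R n))
      \<in> borel_measurable sphere_borel" by measurable
    show "(\<lambda>n. 1 / of_nat m * (complex_of_real (r_pi n powi - int m) * q n)) \<in> borel_measurable sphere_borel"
      unfolding power_int_minus power_int_of_nat by measurable
    show "AE n in sphere_borel. (LBINT \<rho>. (indicat_real {0<..} \<rho> * \<rho> ^ (CARD('d) - 1)) *\<^sub>R indicat_real (- cube pi) (\<rho> *\<^sub>R n) *\<^sub>R q (\<rho> *\<^sub>R n)) =
       1 / of_nat m * (complex_of_real (r_pi n powi - int m) * q n)"
      using AE_sphere_borel by eventually_elim (rule inner)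
  qed
  also have "\<dots> = 1 / of_nat m * (\<integral>n. of_real (r_pi n powi (- int m)) * q n \<partial>sphere_borel)"
    by (rule integral_mult_right_zero)
  also have "(\<integral>n. of_real (r_pi n powi (- int m)) * q n \<partial>sphere_borel) = (\<integral>n. of_real (r_pi n powi (- int m)) * q n \<partial>surface_measure)"
    unfolding power_int_minus power_int_of_nat by (intro integral_sphere_borel) measurable
  finally show ?thesis .
qed

lemma integral_inverse:
  fixes R :: real
  assumes "R \<ge> 1"
  shows "(\<integral>\<rho>. 1 / \<rho> * indicator {1..R} \<rho> \<partial>lborel) = ln R"
proof -
  have "(\<integral>\<rho>. 1 / \<rho> * indicator {1..R} \<rho> \<partial>lborel) = ln R - ln 1"
    by (intro integral_FTC_Icc_real assms) (auto intro!: derivative_eq_intros continuous_intros)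
  then show ?thesis by simp
qed

text \<open>Degree \<open>-d\<close> is the borderline case: with the Jacobian the integrand is
  \<open>q n / \<rho>\<close>, and integration from the unit sphere to the frontier of the cube
  scaled by \<open>1 / s\<close> gives \<open>ln (r_pi n) - ln s\<close>. This is the origin of the
  term with \<open>ln (r_pi n)\<close> in \<open>S_fun\<close>.\<close>

lemma
  fixes q :: "real ^ 'd::finite \<Rightarrow> complex"
  assumes hom: "\<And>c x. c > 0 \<Longrightarrow> x \<noteq> 0 \<Longrightarrow> q (c *\<^sub>R x) = q x * of_real (c powi (- int CARD('d)))"
    and C: "\<And>x. norm x = 1 \<Longrightarrow> norm (q x) \<le> C"
    and [measurable]: "q \<in> borel_measurable borel" and s: "s > 0" "s \<le> pi"
  shows integrable_homogeneous_annulus: "integrable lborel (\<lambda>x. indicator {x. s *\<^sub>R x \<in> cube pi \<and> 1 \<le> norm x} x *\<^sub>R q x)" (is ?i)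
   and integral_homogeneous_annulus: "(\<integral>x. indicator {x. s *\<^sub>R x \<in> cube pi \<and> 1 \<le> norm x} x *\<^sub>R q x \<partial>lborel) =
    (\<integral>n. of_real (ln (r_pi n) - ln s) * q n \<partial>surface_measure)" (is ?e)
proof -
  let ?X = "{x::real ^ 'd. s *\<^sub>R x \<in> cube pi \<and> 1 \<le> norm x}"
  have X[measurable]: "?X \<in> sets borel" by measurable
  have "?X \<subseteq> cball 0 (sqrt CARD('d) * pi / s)"
    using norm_le_cube[of "s *\<^sub>R _" pi] s by (auto simp: field_simps)
  then have "bounded ?X" using bounded_cball bounded_subset by blast
  then have fX: "integrable lborel (\<lambda>x. C * indicator ?X x :: real)"
    using emeasure_bounded_finite by (intro integrable_mult_right integrable_real_indicator) auto
  have "norm (indicator ?X x *\<^sub>R q x) \<le> norm (C * indicator ?X x)" for x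
  proof (cases "x \<in> ?X")
    case True
    then have n: "norm x \<ge> 1" "x \<noteq> 0" by auto
    have "C \<ge> 0" using norm_ge_zero order_trans C[of "sgn x"] n by (metis norm_sgn)
    have "norm (q x) \<le> C * norm x powi (- int CARD('d))"
      using n by (intro homogeneous_bound hom C) auto
    also have "\<dots> \<le> C * 1"
      using n \<open>C \<ge> 0\<close> by (intro mult_left_mono) (auto simp: power_int_minus inverse_le_1_iff)
    finally show ?thesis using True by simp
  qed auto
  then show ?i
    by (intro Bochner_Integration.integrable_bound[OF fX] AE_I2) measurable
  have inner: "(\<integral>\<rho>. (indicator {0<..} \<rho> * \<rho> ^ (CARD('d) - 1)) *\<^sub>R (indicator ?X (\<rho> *\<^sub>R n) *\<^sub>R q (\<rho> *\<^sub>R n)) \<partial>lborel)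
     = of_real (ln (r_pi n) - ln s) * q n" if n: "norm n = 1" for n
  proof -
    have r: "r_pi n > 0" using r_pi_ge_pi[OF n] pi_gt_zero by linarith
    \<comment> \<open>Here \<open>s \<le> pi\<close> enters: the scaled cube contains the unit ball,
      so the radial interval is not empty.\<close>
    have rs: "1 \<le> r_pi n / s" using r_pi_ge_pi[OF n] s by auto
    have "(\<integral>\<rho>. (indicator {0<..} \<rho> * \<rho> ^ (CARD('d) - 1)) *\<^sub>R (indicator ?X (\<rho> *\<^sub>R n) *\<^sub>R q (\<rho> *\<^sub>R n)) \<partial>lborel)
      = (\<integral>\<rho>. (1 / \<rho> * indicator {1..r_pi n / s} \<rho>) *\<^sub>R q n \<partial>lborel)"
    proof (rule Bochner_Integration.integral_cong)
      fix \<rho> :: real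
      have mem: "\<rho> *\<^sub>R n \<in> ?X \<longleftrightarrow> \<rho> \<in> {1..r_pi n / s}" if "\<rho> > 0"
        using mem_cube_pi_iff_r_pi[OF n, of "s * \<rho>"] that s n by (auto simp: field_simps)
      have "q (\<rho> *\<^sub>R n) = q n * of_real (\<rho> powi (- int (CARD('d))))" if "\<rho> > 0"
        using that n by (intro hom) auto
      moreover have "\<rho> ^ (CARD('d) - 1) * \<rho> powi (- int (CARD('d))) = 1 / \<rho>" if "\<rho> > 0"
        using that power_diff_eq_powi[of \<rho> "CARD('d)" 0] by simp
      then have "complex_of_real (\<rho> ^ (CARD('d) - 1)) * complex_of_real (\<rho> powi (- int (CARD('d)))) = complex_of_real (1 / \<rho>)" if "\<rho> > 0"
        using that by (metis of_real_mult)
      ultimately show "(indicator {0<..} \<rho> * \<rho> ^ (CARD('d) - 1)) *\<^sub>R (indicator ?X (\<rho> *\<^sub>R n) *\<^sub>R q (\<rho> *\<^sub>R n)) = 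
         (1 / \<rho> * indicator {1..r_pi n / s} \<rho>) *\<^sub>R q n"
        using mem
        by (cases "\<rho> > 0"; cases "\<rho> \<in> {1..r_pi n / s}")
          (auto simp: scaleR_conv_of_real mult_ac simp del: of_real_power of_nat_add of_real_divide of_real_mult of_real_power_int)
    qed simp
    also have "\<dots> = (ln (r_pi n / s)) *\<^sub>R q n"
    proof (subst integral_scaleR_left)
      have "set_integrable lborel {1..r_pi n / s} (\<lambda>\<rho>. 1 / \<rho>)"
        by (intro borel_integrable_atLeastAtMost' continuous_intros) auto
      then show "integrable lborel (\<lambda>\<rho>. 1 / \<rho> * indicator {1..r_pi n / s} \<rho>)"
        by (simp add: set_integrable_def mult.commute)
    qed (simp only: integral_inverse[OF rs])
    finally show ?thesis
      using r s by (simp add: scaleR_conv_of_real ln_div)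
  qed
  have "(\<integral>x. indicator ?X x *\<^sub>R q x \<partial>lborel) = 
     (\<integral>n. (\<integral>\<rho>. (indicator {0<..} \<rho> * \<rho> ^ (CARD('d) - 1)) *\<^sub>R (indicator ?X (\<rho> *\<^sub>R n) *\<^sub>R q (\<rho> *\<^sub>R n)) \<partial>lborel) \<partial>sphere_borel)"
    by (intro integral_polar_iterated \<open>?i\<close>)
  also have "\<dots> = (\<integral>n. of_real (ln (r_pi n) - ln s) * q n \<partial>sphere_borel)"
  proof (rule integral_cong_AE)
    have [measurable_cong]: "sets (sphere_borel :: (real ^ 'd) measure) = sets borel" by (simp add: sphere_borel_def)
    show "(\<lambda>n. LBINT \<rho>. (indicat_real {0<..} \<rho> * \<rho> ^ (CARD('d) - 1)) *\<^sub>R indicat_real ?X (\<rho> *\<^sub>R n) *\<^sub>R q (\<rho> *\<^sub>R n))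
      \<in> borel_measurable sphere_borel" by measurable
    show "(\<lambda>n. of_real (ln (r_pi n) - ln s) * q n) \<in> borel_measurable sphere_borel"
      by measurable
    show "AE n in sphere_borel. (LBINT \<rho>. (indicat_real {0<..} \<rho> * \<rho> ^ (CARD('d) - 1)) *\<^sub>R indicat_real ?X (\<rho> *\<^sub>R n) *\<^sub>R q (\<rho> *\<^sub>R n)) =
       of_real (ln (r_pi n) - ln s) * q n"
      using AE_sphere_borel by eventually_elim (rule inner)
  qed
  also have "\<dots> = (\<integral>n. of_real (ln (r_pi n) - ln s) * q n \<partial>surface_measure)"
    by (intro integral_sphere_borel) measurable
  finally show ?e .
qed

subsection \<open>Uniqueness for linear differential equations with bounded generator\<close>

text \<open>A Gronwall estimate by iteration: on a segment of length at most
  \<open>1 / (2 * C)\<close> any uniform bound \<beta> improves to \<open>B + \<beta> / 2\<close>.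
  The result does not involve \<open>B'\<close>, which has only to exist, and the segment may run
  backwards in time.\<close>

lemma bounded_growth_step:
  fixes z :: "'x \<Rightarrow> real \<Rightarrow> complex"
  assumes der: "\<And>x t. x \<in> X \<Longrightarrow> t \<ge> 0 \<Longrightarrow> (z x has_vector_derivative z' x t) (at t within {0..})"
    and bound: "\<And>x t B. x \<in> X \<Longrightarrow> t > 0 \<Longrightarrow> (\<And>x. x \<in> X \<Longrightarrow> norm (z x t) \<le> B) \<Longrightarrow> norm (z' x t) \<le> C * B"
    and C: "C > 0"
    and st: "s \<ge> 0" "t \<ge> 0" "\<bar>t - s\<bar> * C \<le> 1 / 2"
    and bdd: "\<And>x \<tau>. x \<in> X \<Longrightarrow> \<tau> \<in> closed_segment s t \<Longrightarrow> norm (z x \<tau>) \<le> B'"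
    and B: "\<And>x. x \<in> X \<Longrightarrow> norm (z x s) \<le> B"
    and x: "x \<in> X" "\<tau> \<in> closed_segment s t"
  shows "norm (z x \<tau>) \<le> 2 * B"
proof -
  have B0: "B \<ge> 0" using B[OF x(1)] norm_ge_zero order_trans by blast
  have B'0: "B' \<ge> 0" using bdd[OF x] norm_ge_zero order_trans by blast
  have cont: "continuous_on {0..} (z x)" if "x \<in> X" for x
    using differentiableI_vector[OF der[OF that]]
    by (intro differentiable_imp_continuous_on) (auto simp: differentiable_on_def)
  have mvt: "norm (z x v - z x u) \<le> (v - u) * (C * \<beta>)"
    if "x \<in> X" "0 \<le> u" "u < v" and \<beta>: "\<And>x \<tau>. x \<in> X \<Longrightarrow> \<tau> \<in> {u..v} \<Longrightarrow> norm (z x \<tau>) \<le> \<beta>" for x u v \<beta>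
  proof -
    have "norm (z x v - z x u) \<le> v * (C * \<beta>) - u * (C * \<beta>)"
    proof (rule differentiable_bound_general[where f'="z' x" and \<phi>'="\<lambda>_. C * \<beta>"])
      show "continuous_on {u..v} (z x)" using that by (intro continuous_on_subset[OF cont]) auto
      fix \<tau> assume \<tau>: "u < \<tau>" "\<tau> < v"
      have "(z x has_vector_derivative z' x \<tau>) (at \<tau> within {0..})"
        using der that \<tau> by auto
      then show "(z x has_vector_derivative z' x \<tau>) (at \<tau>)"
        using \<tau> that by (subst (asm) at_within_interior) auto
      show "norm (z' x \<tau>) \<le> C * \<beta>" using \<tau> that by (intro bound) auto
    qed (use that in \<open>auto intro!: continuous_intros derivative_eq_intros\<close>)
    then show ?thesis by (simp add: algebra_simps)
  qed
  have half: "norm (z x \<tau>) \<le> B + \<beta> / 2"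
    if "x \<in> X" "\<tau> \<in> closed_segment s t" and \<beta>: "\<And>x \<tau>. x \<in> X \<Longrightarrow> \<tau> \<in> closed_segment s t \<Longrightarrow> norm (z x \<tau>) \<le> \<beta>" for x \<tau> \<beta>
  proof -
    have \<beta>0: "\<beta> \<ge> 0" using \<beta>[OF that(1,2)] norm_ge_zero order_trans by blast
    have "norm (z x \<tau> - z x s) \<le> \<bar>\<tau> - s\<bar> * (C * \<beta>)"
    proof -
      consider "\<tau> = s" | "\<tau> < s" | "s < \<tau>" by linarith
      then show ?thesis
      proof cases
        case 2
        have "norm (z x s - z x \<tau>) \<le> (s - \<tau>) * (C * \<beta>)"
          using that st 2 by (intro mvt \<beta>) (auto simp: closed_segment_eq_real_ivl split: if_splits)
        then show ?thesis using 2 by (simp add: norm_minus_commute)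
      next
        case 3
        have "norm (z x \<tau> - z x s) \<le> (\<tau> - s) * (C * \<beta>)"
          using that st 3 by (intro mvt \<beta>) (auto simp: closed_segment_eq_real_ivl split: if_splits)
        then show ?thesis using 3 by simp
      qed simp
    qed
    also have "\<dots> \<le> \<bar>t - s\<bar> * (C * \<beta>)"
      using that C \<beta>0 by (intro mult_right_mono) (auto simp: closed_segment_eq_real_ivl split: if_splits)
    also have "\<dots> \<le> 1 / 2 * \<beta>"
      using mult_right_mono[OF st(3) \<beta>0] by (simp add: mult_ac)
    finally have "norm (z x \<tau> - z x s) \<le> \<beta> / 2" by simp
    moreover have "norm (z x \<tau>) \<le> norm (z x \<tau> - z x s) + norm (z x s)"
      using norm_triangle_sub by (metis add.commute)
    ultimately show ?thesis using B[OF that(1)] by linarith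
  qed
  \<comment> \<open>Passing from \<beta> to \<open>B + \<beta> / 2\<close> fixes
    \<open>2 * B\<close> and halves the excess over it.\<close>
  have iter: "\<forall>x\<in>X. \<forall>\<tau>\<in>closed_segment s t. norm (z x \<tau>) \<le> 2 * B + B' * (1 / 2) ^ n" for n
  proof (induction n)
    case 0
    then show ?case using bdd B0 by (auto intro!: add_increasing)
  next
    case (Suc n)
    then have "norm (z x \<tau>) \<le> B + (2 * B + B' * (1 / 2) ^ n) / 2" if "x \<in> X" "\<tau> \<in> closed_segment s t" for x \<tau>
      using that by (intro half) auto
    then show ?case by (auto simp: field_simps)
  qed
  have "(\<lambda>n. 2 * B + B' * (1 / 2) ^ n) \<longlonglongrightarrow> 2 * B + B' * 0"
    by (intro tendsto_intros LIMSEQ_power_zero) auto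
  then show ?thesis
    using iter x by (intro LIMSEQ_le_const[of "\<lambda>n. 2 * B + B' * (1 / 2) ^ n"]) auto
qed

text \<open>Boundedness in \<open>x\<close> is only assumed separately at each time, so it is first made locally uniform
  in time: by the Baire category theorem, the closed set of times near which \<open>z\<close> is unbounded
  contains a relatively open part on which \<open>z\<close> is uniformly bounded, and the growth estimate carries
  the bound over the gaps of that set.\<close>

lemma linear_ode_unique:
  fixes z :: "'x \<Rightarrow> real \<Rightarrow> complex"
  assumes der: "\<And>x t. x \<in> X \<Longrightarrow> t \<ge> 0 \<Longrightarrow> (z x has_vector_derivative z' x t) (at t within {0..})"
    and bound: "\<And>x t B. x \<in> X \<Longrightarrow> t > 0 \<Longrightarrow> (\<And>x. x \<in> X \<Longrightarrow> norm (z x t) \<le> B) \<Longrightarrow> norm (z' x t) \<le> C * B"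
    and C: "C > 0"
    and zero: "\<And>x. x \<in> X \<Longrightarrow> z x 0 = 0"
    and bdd: "\<And>t. t \<ge> 0 \<Longrightarrow> \<exists>B. \<forall>x\<in>X. norm (z x t) \<le> B"
    and x: "x \<in> X" "t \<ge> 0"
  shows "z x t = 0"
proof -
  define P where "P B t \<longleftrightarrow> (\<forall>x\<in>X. norm (z x t) \<le> B)" for B t
  have P_mono: "P B t \<Longrightarrow> B \<le> B' \<Longrightarrow> P B' t" for B B' t
    unfolding P_def using order_trans by blast
  have step: "P (2 * B) \<tau>" if "s \<ge> 0" "t \<ge> 0" "\<bar>t - s\<bar> * C \<le> 1 / 2"
    "\<And>\<tau>. \<tau> \<in> closed_segment s t \<Longrightarrow> P B' \<tau>" "P B s" "\<tau> \<in> closed_segment s t" for s t B B' \<tau>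
    unfolding P_def
  proof
    fix x assume "x \<in> X"
    show "norm (z x \<tau>) \<le> 2 * B"
    proof (rule bounded_growth_step[of X z z' C s t B' B x \<tau>])
      show "norm (z x \<tau>) \<le> B'" if "x \<in> X" "\<tau> \<in> closed_segment s t" for x \<tau>
        using that \<open>\<And>\<tau>. \<tau> \<in> closed_segment s t \<Longrightarrow> P B' \<tau>\<close> by (auto simp: P_def)
      show "norm (z x s) \<le> B" if "x \<in> X" for x
        using that \<open>P B s\<close> by (auto simp: P_def)
    qed (fact der bound C that \<open>x \<in> X\<close>)+
  qed
  define LB where "LB t \<longleftrightarrow> (\<exists>e>0. \<exists>B. \<forall>\<tau>\<ge>0. \<bar>\<tau> - t\<bar> < e \<longrightarrow> P B \<tau>)" for t
  define F where "F = {t. t \<ge> 0 \<and> \<not> LB t}"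
  have cont: "continuous_on {0..} (z x)" if "x \<in> X" for x
    using differentiableI_vector[OF der[OF that]]
    by (intro differentiable_imp_continuous_on) (auto simp: differentiable_on_def)
  have openLB: "open {t. LB t}"
    unfolding open_dist
  proof safe
    fix t assume "LB t"
    then obtain e B where e: "e > 0" "\<And>\<tau>. \<tau> \<ge> 0 \<Longrightarrow> \<bar>\<tau> - t\<bar> < e \<Longrightarrow> P B \<tau>" unfolding LB_def by blast
    have "LB y" if "dist y t < e / 2" for y
    proof -
      have "P B \<tau>" if \<tau>: "\<tau> \<ge> 0" "\<bar>\<tau> - y\<bar> < e / 2" for \<tau>
      proof -
        have "\<bar>\<tau> - t\<bar> < e" using \<tau> \<open>dist y t < e / 2\<close> unfolding dist_real_def by linarith
        then show ?thesis using e(2) \<tau> by blast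
      qed
      then show ?thesis unfolding LB_def using half_gt_zero[OF e(1)] by blast
    qed
    then show "\<exists>e>0. \<forall>y. dist y t < e \<longrightarrow> y \<in> {t. LB t}" using e by (intro exI[of _ "e/2"]) auto
  qed
  have closedP: "closed {t. t \<ge> 0 \<and> P B t}" for B
  proof -
    have "{t. t \<ge> 0 \<and> P B t} = {0..} \<inter> (\<Inter>x\<in>X. {0..} \<inter> (\<lambda>t. norm (z x t)) -` {..B})"
      by (auto simp: P_def)
    also have "closed \<dots>"
      using cont by (intro closed_Int closed_INT ballI continuous_closed_preimage continuous_intros) auto
    finally show ?thesis .
  qed
  have F_eq: "F = {0..} - {t. LB t}" by (auto simp: F_def)
  have closedF: "closed F" unfolding F_eq using openLB by (intro closed_Diff) auto
  \<comment> \<open>Compactness in the form of bisection: local bounds on an interval free of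
    \<open>F\<close> combine to a single one.\<close>
  have bdd_ivl: "\<exists>B. \<forall>\<tau>\<in>{u..v}. 0 \<le> \<tau> \<longrightarrow> P B \<tau>" if "u \<le> v" and nF: "{u..v} \<inter> F = {}" for u v
    using \<open>u \<le> v\<close>
  proof (induction rule: Bolzano)
    case (trans a b c)
    then obtain B1 B2 where B: "\<And>\<tau>. \<tau>\<in>{a..b} \<Longrightarrow> 0 \<le> \<tau> \<Longrightarrow> P B1 \<tau>" "\<And>\<tau>. \<tau>\<in>{b..c} \<Longrightarrow> 0 \<le> \<tau> \<Longrightarrow> P B2 \<tau>" by blast
    have "P (max B1 B2) \<tau>" if "\<tau>\<in>{a..c}" "0 \<le> \<tau>" for \<tau>
      using P_mono[of B1 \<tau> "max B1 B2"] P_mono[of B2 \<tau> "max B1 B2"] B[of \<tau>] that by (cases "\<tau> \<le> b") auto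
    then show ?case by blast
  next
    case (local w)
    show ?case
    proof (cases "w \<ge> 0")
      case True
      then have "LB w" using nF local by (auto simp: F_def)
      then obtain e B where e: "e > 0" "\<And>\<tau>. \<tau> \<ge> 0 \<Longrightarrow> \<bar>\<tau> - w\<bar> < e \<Longrightarrow> P B \<tau>" unfolding LB_def by blast
      then show ?thesis by (intro exI[of _ e] conjI allI impI exI[of _ B] ballI) auto
    next
      case False
      then show ?thesis by (intro exI[of _ "- w"] conjI allI impI exI[of _ 0] ballI) auto
    qed
  qed
  have "F = {}"
  proof (rule ccontr)
    assume "F \<noteq> {}"
    define \<G> where "\<G> = range (\<lambda>n::nat. {t\<in>F. \<not> P (real n) t})"
    \<comment> \<open>If the relatively open parts of \<open>F\<close> on which the bound
      \<open>n\<close> fails were dense in \<open>F\<close> for every \<open>n\<close>, their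
      intersection would be dense too. It is empty, since every single time has some bound.\<close>
    have "\<exists>n. \<not> F \<subseteq> closure {t\<in>F. \<not> P (real n) t}"
    proof (rule ccontr)
      assume "\<nexists>n. \<not> F \<subseteq> closure {t\<in>F. \<not> P (real n) t}"
      then have "F \<subseteq> closure (\<Inter>\<G>)"
      proof (intro Baire[OF closedF])
        fix T assume T: "T \<in> \<G>"
        then obtain n where n: "T = {t\<in>F. \<not> P (real n) t}" by (auto simp: \<G>_def)
        then have "T = F \<inter> - {t. t \<ge> 0 \<and> P (real n) t}" by (auto simp: F_def)
        moreover have "open (- {t. t \<ge> 0 \<and> P (real n) t})" using closedP by auto
        ultimately have "openin (top_of_set F) T" by (auto simp: openin_open)
        then show "openin (top_of_set F) T \<and> F \<subseteq> closure T"
          using n \<open>\<nexists>n. \<not> F \<subseteq> closure {t\<in>F. \<not> P (real n) t}\<close> by auto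
      qed (auto simp: \<G>_def)
      moreover have "\<Inter>\<G> = {}"
      proof -
        have False if "t \<in> \<Inter>\<G>" for t
        proof -
          have t: "t \<in> F" "\<And>n. \<not> P (real n) t" using that by (auto simp: \<G>_def)
          then obtain B where "P B t" using bdd[of t] by (auto simp: F_def P_def)
          moreover obtain n where "B \<le> real n" using real_arch_simple by blast
          ultimately show False using t(2) P_mono by blast
        qed
        then show ?thesis by blast
      qed
      ultimately show False using \<open>F \<noteq> {}\<close> by auto
    qed
    then obtain n p where p: "p \<in> F" "p \<notin> closure {t\<in>F. \<not> P (real n) t}" by blast
    then obtain e0 where e0: "e0 > 0" "\<And>y. y \<in> F \<Longrightarrow> dist y p < e0 \<Longrightarrow> P (real n) y"
      by (auto simp: closure_approachable)
    \<comment> \<open>Within \<open>e0\<close> the bound \<open>n\<close> holds on \<open>F\<close>;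
      within \<open>1 / (2 * C)\<close> a single application of the growth estimate crosses the
      distance.\<close>
    define e where "e = min e0 (1 / (2 * C))"
    have e: "e > 0" "e \<le> e0" "e * C \<le> 1 / 2" using e0 C by (auto simp: e_def min_def field_simps)
    have "P (2 * real n) \<tau>" if \<tau>: "\<tau> \<ge> 0" "\<bar>\<tau> - p\<bar> < e" for \<tau>
    proof -
      have "compact (F \<inter> closed_segment p \<tau>)" using closedF by (intro closed_Int_compact) auto
      moreover have "F \<inter> closed_segment p \<tau> \<noteq> {}" using p by auto
      \<comment> \<open>The point of \<open>F\<close> nearest to \<open>\<tau>\<close> on the way
        from \<open>p\<close>: strictly between it and \<open>\<tau>\<close> there is no point of
        \<open>F\<close>.\<close>
      ultimately obtain q where q: "q \<in> F" "q \<in> closed_segment p \<tau>"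
         "\<And>y. y \<in> F \<Longrightarrow> y \<in> closed_segment p \<tau> \<Longrightarrow> dist \<tau> q \<le> dist \<tau> y"
        by (metis IntE IntI distance_attains_inf[of "F \<inter> closed_segment p \<tau>" \<tau>] compact_imp_closed)
      have Pq: "P (real n) q" using q \<tau> e by (intro e0) (auto simp: dist_real_def closed_segment_eq_real_ivl split: if_splits)
      have p0: "p \<ge> 0" "q \<ge> 0" using p q by (auto simp: F_def)
      obtain Bt where Bt: "P Bt \<tau>" using bdd[OF \<tau>(1)] by (auto simp: P_def)
      have len: "\<bar>w - q\<bar> * C \<le> 1 / 2" if "w \<in> closed_segment q \<tau>" for w
      proof -
        have "\<bar>w - q\<bar> \<le> e" using that q \<tau> by (auto simp: closed_segment_eq_real_ivl split: if_splits)
        then show ?thesis using e C by (smt (verit) mult_right_mono)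
      qed
      \<comment> \<open>On the gap a bound is carried backwards from \<open>\<tau>\<close>, where
        some \<open>Bt\<close> is valid. It depends on \<open>\<tau>\<close>, but it is the finite
        bound that the growth estimate started at \<open>q\<close> presupposes, and that estimate
        yields \<open>2 * real n\<close>.\<close>
      have bk: "P (max (2 * Bt) (real n)) w" if w: "w \<in> closed_segment q \<tau>" for w
      proof (cases "w = q")
        case True
        then show ?thesis using Pq P_mono by auto
      next
        case False
        have w0: "w \<ge> 0" using w \<tau> p0 by (auto simp: closed_segment_eq_real_ivl split: if_splits)
        have sub: "closed_segment \<tau> w \<inter> F = {}"
        proof -
          have False if "y \<in> closed_segment \<tau> w" "y \<in> F" for y
          proof -
            have "y \<in> closed_segment p \<tau>" "dist \<tau> y < dist \<tau> q"
              using that w q(2) False by (auto simp: closed_segment_eq_real_ivl dist_real_def split: if_splits)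
            then show False using q(3)[of y] that by auto
          qed
          then show ?thesis by blast
        qed
        have "\<exists>B. \<forall>y\<in>closed_segment \<tau> w. 0 \<le> y \<longrightarrow> P B y"
          using bdd_ivl[of "min \<tau> w" "max \<tau> w"] sub by (auto simp: closed_segment_eq_real_ivl split: if_splits)
        then obtain B' where B'': "\<forall>y\<in>closed_segment \<tau> w. 0 \<le> y \<longrightarrow> P B' y" by blast
        have "0 \<le> y" if "y \<in> closed_segment \<tau> w" for y
          using that \<tau> w0 by (auto simp: closed_segment_eq_real_ivl split: if_splits)
        with B'' have B': "\<And>y. y \<in> closed_segment \<tau> w \<Longrightarrow> P B' y" by blast
        have "\<bar>w - \<tau>\<bar> \<le> \<bar>\<tau> - q\<bar>" using w by (auto simp: closed_segment_eq_real_ivl split: if_splits)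
        then have lw: "\<bar>w - \<tau>\<bar> * C \<le> 1 / 2" using len[of \<tau>] C by (smt (verit) mult_right_mono ends_in_segment)
        have "P (2 * Bt) w"
          using step[where s=\<tau> and t=w and B'=B' and B=Bt] \<tau> w0 B' Bt lw by auto
        then show ?thesis using P_mono by auto
      qed
      show ?thesis
        using step[where s=q and t=\<tau> and B'="max (2 * Bt) (real n)" and B="real n"] \<tau> p0 bk Pq len by auto
    qed
    then have "LB p" unfolding LB_def using e by blast
    then show False using p by (auto simp: F_def)
  qed
  \<comment> \<open>With local uniform bounds at every time, uniqueness is the growth estimate with
    \<open>B = 0\<close>, repeated in steps of length \<open>h\<close>.\<close>
  define h where "h = 1 / (2 * C)"
  have h: "h > 0" "h * C \<le> 1 / 2" using C by (auto simp: h_def)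
  have "\<forall>\<tau>\<in>{0..of_nat m * h}. P 0 \<tau>" for m
  proof (induction m)
    case 0
    then show ?case using zero by (auto simp: P_def)
  next
    case (Suc m)
    let ?s = "of_nat m * h" and ?t = "of_nat (Suc m) * h"
    have st: "0 \<le> ?s" "?s \<le> ?t" "?t - ?s = h" using h by (auto simp: algebra_simps)
    obtain B' where "\<forall>y\<in>{?s..?t}. 0 \<le> y \<longrightarrow> P B' y"
      using bdd_ivl[OF st(2)] \<open>F = {}\<close> by blast
    then have B': "P B' y" if "y \<in> {?s..?t}" for y
      using that st(1) order_trans[of 0 ?s y] by (auto simp del: of_nat_Suc)
    have "P 0 \<tau>" if "\<tau> \<in> {?s..?t}" for \<tau>
      using step[where s="?s" and t="?t" and B'=B' and B=0] st B' h Suc that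
      by (auto simp: closed_segment_eq_real_ivl simp del: of_nat_Suc)
    then show ?case using Suc by (metis atLeastAtMost_iff linorder_le_cases)
  qed
  moreover obtain m :: nat where "t / h \<le> of_nat m" using real_arch_simple by blast
  then have "t \<le> of_nat m * h" using h by (simp add: field_simps)
  ultimately have "P 0 t" using x by auto
  then show ?thesis using x by (auto simp: P_def)
qed

subsection \<open>Difference and differential operators as Fourier multipliers\<close>

definition delta_symbol :: "real \<Rightarrow> ('d::finite + 'd \<Rightarrow> nat) \<Rightarrow> real ^ 'd \<Rightarrow> complex" where
  "delta_symbol \<epsilon> \<nu> \<theta> = (\<Prod>k\<in>UNIV. (cis (- (\<epsilon> * \<theta> $ k)) - 1) ^ \<nu> (Inl k) * (cis (\<epsilon> * \<theta> $ k) - 1) ^ \<nu> (Inr k))"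

lemma difference_symbol_delta_symbol:
  "difference_symbol l lhat a (\<epsilon> *\<^sub>R \<theta>) = (\<Sum>\<nu> | l \<le> mi_abs \<nu> \<and> mi_abs \<nu> \<le> lhat. a \<nu> * delta_symbol \<epsilon> \<nu> \<theta>)"
  by (simp add: difference_symbol_def delta_symbol_def)

lemma prod_list_coords: "(\<Prod>k\<leftarrow>(coords :: 'd::finite list). f k) = (\<Prod>k\<in>UNIV. f k :: 'b::comm_monoid_mult)"
  using prod.distinct_set_conv_list[OF coords(1)[where 'd='d], of f] coords(2)[where 'd='d] by simp

text \<open>\<open>\<Phi>\<close> stands for a transform that turns the operator \<open>T\<close>
  into multiplication by \<open>m\<close>, and \<open>G\<close> for a class on which this is valid
  and which is stable under the multiplication. The same induction then serves plane waves,
  integrals over the cube and integrals over the whole space.\<close>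

lemma funpow_multiplier:
  assumes T: "\<And>g. g \<in> G \<Longrightarrow> T (\<Phi> g) = \<Phi> (\<lambda>\<theta>. m \<theta> * g \<theta>) \<and> (\<lambda>\<theta>. m \<theta> * g \<theta>) \<in> G"
    and g: "g \<in> G"
  shows "(T ^^ n) (\<Phi> g) = \<Phi> (\<lambda>\<theta>. (m \<theta> :: complex) ^ n * g \<theta>) \<and> (\<lambda>\<theta>. m \<theta> ^ n * g \<theta>) \<in> G"
proof (induction n)
  case (Suc n)
  then show ?case using T[of "\<lambda>\<theta>. m \<theta> ^ n * g \<theta>"] by (simp add: mult.assoc)
qed (use g in auto)

lemma foldr_multiplier:
  assumes T: "\<And>k g. g \<in> G \<Longrightarrow> T k (\<Phi> g) = \<Phi> (\<lambda>\<theta>. m k \<theta> * g \<theta>) \<and> (\<lambda>\<theta>. m k \<theta> * g \<theta>) \<in> G"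
    and g: "g \<in> G"
  shows "foldr T ks (\<Phi> g) = \<Phi> (\<lambda>\<theta>. (\<Prod>k\<leftarrow>ks. m k \<theta> :: complex) * g \<theta>) \<and> (\<lambda>\<theta>. (\<Prod>k\<leftarrow>ks. m k \<theta>) * g \<theta>) \<in> G"
proof (induction ks)
  case (Cons k ks)
  then show ?case using T[of "\<lambda>\<theta>. (\<Prod>k\<leftarrow>ks. m k \<theta>) * g \<theta>" k] by (simp add: mult.assoc)
qed (use g in auto)

lemma delta_multi_multiplier:
  fixes \<Phi> :: "(real ^ 'd::finite \<Rightarrow> complex) \<Rightarrow> (real ^ 'd \<Rightarrow> complex)"
  assumes minus: "\<And>k g. g \<in> G \<Longrightarrow> delta_minus \<epsilon> k (\<Phi> g) = \<Phi> (\<lambda>\<theta>. (cis (- (\<epsilon> * \<theta> $ k)) - 1) * g \<theta>) \<and> (\<lambda>\<theta>. (cis (- (\<epsilon> * \<theta> $ k)) - 1) * g \<theta>) \<in> G"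
    and plus: "\<And>k g. g \<in> G \<Longrightarrow> delta_plus \<epsilon> k (\<Phi> g) = \<Phi> (\<lambda>\<theta>. (cis (\<epsilon> * \<theta> $ k) - 1) * g \<theta>) \<and> (\<lambda>\<theta>. (cis (\<epsilon> * \<theta> $ k) - 1) * g \<theta>) \<in> G"
    and g: "g \<in> G"
  shows "delta_multi \<epsilon> \<nu> (\<Phi> g) = \<Phi> (\<lambda>\<theta>. delta_symbol \<epsilon> \<nu> \<theta> * g \<theta>)"
    and "(\<lambda>\<theta>. delta_symbol \<epsilon> \<nu> \<theta> * g \<theta>) \<in> G"
proof -
  have "(\<lambda>w. (delta_minus \<epsilon> k ^^ \<nu> (Inl k)) ((delta_plus \<epsilon> k ^^ \<nu> (Inr k)) w)) (\<Phi> g) =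
       \<Phi> (\<lambda>\<theta>. ((cis (- (\<epsilon> * \<theta> $ k)) - 1) ^ \<nu> (Inl k) * (cis (\<epsilon> * \<theta> $ k) - 1) ^ \<nu> (Inr k)) * g \<theta>) \<and>
     (\<lambda>\<theta>. ((cis (- (\<epsilon> * \<theta> $ k)) - 1) ^ \<nu> (Inl k) * (cis (\<epsilon> * \<theta> $ k) - 1) ^ \<nu> (Inr k)) * g \<theta>) \<in> G" if "g \<in> G" for k g
    using funpow_multiplier[of G "delta_plus \<epsilon> k" \<Phi> _ g, OF plus that, of "\<nu> (Inr k)"]
      funpow_multiplier[of G "delta_minus \<epsilon> k" \<Phi> _ "\<lambda>\<theta>. (cis (\<epsilon> * \<theta> $ k) - 1) ^ \<nu> (Inr k) * g \<theta>", OF minus, of "\<nu> (Inl k)"]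
    by (auto simp: mult.assoc)
  from foldr_multiplier[where G=G and \<Phi>=\<Phi> and ks=coords and
      T="\<lambda>k w. (delta_minus \<epsilon> k ^^ \<nu> (Inl k)) ((delta_plus \<epsilon> k ^^ \<nu> (Inr k)) w)" and
      m="\<lambda>k \<theta>. (cis (- (\<epsilon> * \<theta> $ k)) - 1) ^ \<nu> (Inl k) * (cis (\<epsilon> * \<theta> $ k) - 1) ^ \<nu> (Inr k)", OF this g]
  show "delta_multi \<epsilon> \<nu> (\<Phi> g) = \<Phi> (\<lambda>\<theta>. delta_symbol \<epsilon> \<nu> \<theta> * g \<theta>)"
    "(\<lambda>\<theta>. delta_symbol \<epsilon> \<nu> \<theta> * g \<theta>) \<in> G"
    by (simp_all add: delta_multi_def prod_list_coords delta_symbol_def)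
qed

lemma D_multi_multiplier:
  fixes \<Phi> :: "(real ^ 'd::finite \<Rightarrow> complex) \<Rightarrow> (real ^ 'd \<Rightarrow> complex)"
  assumes D: "\<And>k g. g \<in> G \<Longrightarrow> D_coord k (\<Phi> g) = \<Phi> (\<lambda>\<theta>. of_real (\<theta> $ k) * g \<theta>) \<and> (\<lambda>\<theta>. of_real (\<theta> $ k) * g \<theta>) \<in> G"
    and g: "g \<in> G"
  shows "D_multi \<alpha> (\<Phi> g) = \<Phi> (\<lambda>\<theta>. monom_at \<theta> \<alpha> * g \<theta>)"
    and "(\<lambda>\<theta>. monom_at \<theta> \<alpha> * g \<theta>) \<in> G"
proof -
  have "(D_coord k ^^ \<alpha> k) (\<Phi> g) = \<Phi> (\<lambda>\<theta>. complex_of_real (\<theta> $ k) ^ \<alpha> k * g \<theta>) \<and>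
     (\<lambda>\<theta>. complex_of_real (\<theta> $ k) ^ \<alpha> k * g \<theta>) \<in> G" if "g \<in> G" for k g
    using funpow_multiplier[of G "D_coord k" \<Phi> _ g, OF D that] by auto
  from foldr_multiplier[where G=G and \<Phi>=\<Phi> and ks=coords and
      T="\<lambda>k. D_coord k ^^ \<alpha> k" and m="\<lambda>k \<theta>. complex_of_real (\<theta> $ k) ^ \<alpha> k", OF this g]
  show "D_multi \<alpha> (\<Phi> g) = \<Phi> (\<lambda>\<theta>. monom_at \<theta> \<alpha> * g \<theta>)"
    "(\<lambda>\<theta>. monom_at \<theta> \<alpha> * g \<theta>) \<in> G"
    by (simp_all add: D_multi_def prod_list_coords monom_at_def)
qed

section \<open>Rescaling, linearity and boundedness of difference operators\<close>

lemma delta_multi_rel: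
  assumes m: "\<And>u w k. R u w \<Longrightarrow> R (delta_minus \<epsilon> k u) (delta_minus \<epsilon>' k w)"
    and p: "\<And>u w k. R u w \<Longrightarrow> R (delta_plus \<epsilon> k u) (delta_plus \<epsilon>' k w)"
    and R: "R u w"
  shows "R (delta_multi \<epsilon> \<nu> u) (delta_multi \<epsilon>' \<nu> w)"
proof -
  have pp: "R ((delta_plus \<epsilon> k ^^ n) u) ((delta_plus \<epsilon>' k ^^ n) w)" if "R u w" for n k u w
    by (induction n) (use that p in auto)
  have mm: "R ((delta_minus \<epsilon> k ^^ n) u) ((delta_minus \<epsilon>' k ^^ n) w)" if "R u w" for n k u w
    by (induction n) (use that m in auto)
  have "R (foldr (\<lambda>k w. (delta_minus \<epsilon> k ^^ \<nu> (Inl k)) ((delta_plus \<epsilon> k ^^ \<nu> (Inr k)) w)) ks u)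
          (foldr (\<lambda>k w. (delta_minus \<epsilon>' k ^^ \<nu> (Inl k)) ((delta_plus \<epsilon>' k ^^ \<nu> (Inr k)) w)) ks w)" for ks
    by (induction ks) (auto intro: pp mm R)
  then show ?thesis by (simp add: delta_multi_def)
qed

text \<open>Linearity and boundedness are both preserved under composition, and either one thus
  follows from the elementary differences.\<close>

lemma delta_multi_closed:
  assumes id: "Q (\<lambda>u. u)" and comp: "\<And>S T. Q S \<Longrightarrow> Q T \<Longrightarrow> Q (\<lambda>u. S (T u))"
    and m: "\<And>k. Q (delta_minus \<epsilon> k)" and p: "\<And>k. Q (delta_plus \<epsilon> k)"
  shows "Q (delta_multi \<epsilon> \<nu>)"
proof -
  have pp: "Q (\<lambda>u. (T ^^ n) u)" if "Q T" for T n
  proof (induction n)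
    case 0
    then show ?case using id by (simp add: id_def)
  next
    case (Suc n)
    then show ?case using comp[OF that Suc] by (simp add: o_def)
  qed
  have "Q (\<lambda>u. foldr (\<lambda>k w. (delta_minus \<epsilon> k ^^ \<nu> (Inl k)) ((delta_plus \<epsilon> k ^^ \<nu> (Inr k)) w)) ks u)" for ks
  proof (induction ks)
    case (Cons k ks)
    have "Q (\<lambda>w. (delta_minus \<epsilon> k ^^ \<nu> (Inl k)) ((delta_plus \<epsilon> k ^^ \<nu> (Inr k)) w))"
      using comp[OF pp[OF m[of k], of "\<nu> (Inl k)"] pp[OF p[of k], of "\<nu> (Inr k)"]] by simp
    from comp[OF this Cons] show ?case by simp
  qed (simp add: id)
  then show ?thesis by (simp add: delta_multi_def[abs_def])
qed

lemma delta_multi_diff: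
  "delta_multi \<epsilon> \<nu> (\<lambda>x. u x - w x) = (\<lambda>x. delta_multi \<epsilon> \<nu> u x - delta_multi \<epsilon> \<nu> w x)"
proof -
  have "\<forall>u w. delta_multi \<epsilon> \<nu> (\<lambda>x. u x - w x) = (\<lambda>x. delta_multi \<epsilon> \<nu> u x - delta_multi \<epsilon> \<nu> w x)"
    by (rule delta_multi_closed) (auto simp: delta_minus_def[abs_def] delta_plus_def[abs_def])
  then show ?thesis by blast
qed

lemma difference_op_diff:
  "difference_op l lhat a \<epsilon> (\<lambda>x. u x - w x) x = difference_op l lhat a \<epsilon> u x - difference_op l lhat a \<epsilon> w x"
  by (simp add: difference_op_def delta_multi_diff right_diff_distrib sum_subtractf diff_divide_distrib)

lemma lattice_shift:
  assumes "x \<in> lattice \<epsilon>"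
  shows "x - \<epsilon> *\<^sub>R axis k 1 \<in> lattice \<epsilon>" "x + \<epsilon> *\<^sub>R axis k 1 \<in> lattice \<epsilon>"
proof -
  have "\<exists>m::int. (x - \<epsilon> *\<^sub>R axis k 1) $ j = \<epsilon> * of_int m" for j
  proof -
    obtain m where "x $ j = \<epsilon> * of_int m" using assms by (auto simp: lattice_def)
    then show ?thesis by (intro exI[of _ "if j = k then m - 1 else m"]) (auto simp: axis_def algebra_simps)
  qed
  then show "x - \<epsilon> *\<^sub>R axis k 1 \<in> lattice \<epsilon>" by (auto simp: lattice_def)
  have "\<exists>m::int. (x + \<epsilon> *\<^sub>R axis k 1) $ j = \<epsilon> * of_int m" for j
  proof -
    obtain m where "x $ j = \<epsilon> * of_int m" using assms by (auto simp: lattice_def)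
    then show ?thesis by (intro exI[of _ "if j = k then m + 1 else m"]) (auto simp: axis_def algebra_simps)
  qed
  then show "x + \<epsilon> *\<^sub>R axis k 1 \<in> lattice \<epsilon>" by (auto simp: lattice_def)
qed

text \<open>Each elementary difference at most doubles the supremum over the lattice. Boundedness of
  the generator in this norm is what the uniqueness argument rests on.\<close>

lemma delta_multi_bound:
  fixes \<nu> :: "'d::finite + 'd \<Rightarrow> nat"
  shows "\<exists>C\<ge>0. \<forall>u B. (\<forall>x\<in>lattice \<epsilon>. norm (u x) \<le> B) \<longrightarrow> (\<forall>x\<in>lattice \<epsilon>. norm (delta_multi \<epsilon> \<nu> u x) \<le> C * B)"
proof (rule delta_multi_closed[where Q="\<lambda>T. \<exists>C\<ge>0. \<forall>u B. (\<forall>x\<in>lattice \<epsilon>. norm (u x) \<le> B) \<longrightarrow> (\<forall>x\<in>lattice \<epsilon>. norm (T u x) \<le> C * B)"])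
  show "\<exists>C\<ge>0. \<forall>u B. (\<forall>x\<in>lattice \<epsilon>. norm (u x) \<le> B) \<longrightarrow> (\<forall>x\<in>lattice \<epsilon>. norm (u x) \<le> C * B)"
    by (intro exI[of _ 1]) auto
next
  fix S T :: "(real ^ 'd \<Rightarrow> complex) \<Rightarrow> real ^ 'd \<Rightarrow> complex"
  assume "\<exists>C\<ge>0. \<forall>u B. (\<forall>x\<in>lattice \<epsilon>. norm (u x) \<le> B) \<longrightarrow> (\<forall>x\<in>lattice \<epsilon>. norm (S u x) \<le> C * B)"
    "\<exists>C\<ge>0. \<forall>u B. (\<forall>x\<in>lattice \<epsilon>. norm (u x) \<le> B) \<longrightarrow> (\<forall>x\<in>lattice \<epsilon>. norm (T u x) \<le> C * B)"
  then obtain C D where CD: "C \<ge> 0" "D \<ge> 0"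
    "\<And>u B. (\<forall>x\<in>lattice \<epsilon>. norm (u x) \<le> B) \<Longrightarrow> (\<forall>x\<in>lattice \<epsilon>. norm (S u x) \<le> C * B)"
    "\<And>u B. (\<forall>x\<in>lattice \<epsilon>. norm (u x) \<le> B) \<Longrightarrow> (\<forall>x\<in>lattice \<epsilon>. norm (T u x) \<le> D * B)" by blast
  show "\<exists>C\<ge>0. \<forall>u B. (\<forall>x\<in>lattice \<epsilon>. norm (u x) \<le> B) \<longrightarrow> (\<forall>x\<in>lattice \<epsilon>. norm (S (T u) x) \<le> C * B)"
    by (intro exI[of _ "C * D"] conjI allI impI) (use CD in \<open>auto simp: mult.assoc\<close>)
next
  fix k :: 'd
  show "\<exists>C\<ge>0. \<forall>u B. (\<forall>x\<in>lattice \<epsilon>. norm (u x) \<le> B) \<longrightarrow> (\<forall>x\<in>lattice \<epsilon>. norm (delta_minus \<epsilon> k u x) \<le> C * B)"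
  proof (intro exI[of _ 2] conjI allI impI ballI)
    fix u :: "real ^ 'd \<Rightarrow> complex" and B and x :: "real ^ 'd" assume "\<forall>x\<in>lattice \<epsilon>. norm (u x) \<le> B" "x \<in> lattice \<epsilon>"
    then have "norm (u (x - \<epsilon> *\<^sub>R axis k 1)) + norm (u x) \<le> 2 * B"
      using lattice_shift(1)[of x \<epsilon> k] by (metis add_mono mult_2)
    then show "norm (delta_minus \<epsilon> k u x) \<le> 2 * B"
      unfolding delta_minus_def using norm_triangle_ineq4 order_trans by blast
  qed simp
  show "\<exists>C\<ge>0. \<forall>u B. (\<forall>x\<in>lattice \<epsilon>. norm (u x) \<le> B) \<longrightarrow> (\<forall>x\<in>lattice \<epsilon>. norm (delta_plus \<epsilon> k u x) \<le> C * B)"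
  proof (intro exI[of _ 2] conjI allI impI ballI)
    fix u :: "real ^ 'd \<Rightarrow> complex" and B and x :: "real ^ 'd" assume "\<forall>x\<in>lattice \<epsilon>. norm (u x) \<le> B" "x \<in> lattice \<epsilon>"
    then have "norm (u (x + \<epsilon> *\<^sub>R axis k 1)) + norm (u x) \<le> 2 * B"
      using lattice_shift(2)[of x \<epsilon> k] by (metis add_mono mult_2)
    then show "norm (delta_plus \<epsilon> k u x) \<le> 2 * B"
      unfolding delta_plus_def using norm_triangle_ineq4 order_trans by blast
  qed simp
qed

lemma difference_op_bound:
  fixes a :: "('d::finite + 'd \<Rightarrow> nat) \<Rightarrow> complex"
  shows "\<exists>C>0. \<forall>u B. (\<forall>x\<in>lattice 1. norm (u x) \<le> B) \<longrightarrow> (\<forall>x\<in>lattice 1. norm (difference_op l lhat a 1 u x) \<le> C * B)"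
proof -
  obtain C where C: "\<And>\<nu> :: 'd + 'd \<Rightarrow> nat. C \<nu> \<ge> 0"
    "\<And>(\<nu> :: 'd + 'd \<Rightarrow> nat) u B x. (\<forall>x\<in>lattice 1. norm (u x) \<le> B) \<Longrightarrow> x \<in> lattice 1 \<Longrightarrow> norm (delta_multi 1 \<nu> u x) \<le> C \<nu> * B"
    using delta_multi_bound[of 1] by metis
  let ?I = "{\<nu>. l \<le> mi_abs \<nu> \<and> mi_abs \<nu> \<le> lhat}"
  have "norm (difference_op l lhat a 1 u x) \<le> ((\<Sum>\<nu>\<in>?I. norm (a \<nu>) * C \<nu>) + 1) * B"
    if B: "\<forall>x\<in>lattice 1. norm (u x) \<le> B" and x: "x \<in> lattice 1" for u B x
  proof -
    have B0: "B \<ge> 0" using B x norm_ge_zero order_trans by blast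
    have "norm (difference_op l lhat a 1 u x) \<le> (\<Sum>\<nu>\<in>?I. norm (a \<nu> * delta_multi 1 \<nu> u x))"
      by (simp add: difference_op_def norm_sum)
    also have "\<dots> \<le> (\<Sum>\<nu>\<in>?I. norm (a \<nu>) * (C \<nu> * B))"
      by (intro sum_mono) (auto simp: norm_mult intro!: mult_left_mono C B x)
    also have "\<dots> = (\<Sum>\<nu>\<in>?I. norm (a \<nu>) * C \<nu>) * B"
      by (simp add: sum_distrib_right mult.assoc)
    finally show ?thesis using B0 by (simp add: distrib_right)
  qed
  moreover have "(\<Sum>\<nu>\<in>?I. norm (a \<nu>) * C \<nu>) + 1 > 0"
    by (intro add_nonneg_pos sum_nonneg) (auto simp: C)
  ultimately show ?thesis by blast
qed

lemma delta_multi_rescale: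
  "delta_multi 1 \<nu> (\<lambda>y. c * u (\<epsilon> *\<^sub>R y)) = (\<lambda>y. c * delta_multi \<epsilon> \<nu> u (\<epsilon> *\<^sub>R y))"
  by (rule delta_multi_rel[where R="\<lambda>w u. w = (\<lambda>y. c * u (\<epsilon> *\<^sub>R y))"])
    (auto simp: delta_minus_def delta_plus_def algebra_simps fun_eq_iff)

lemma difference_op_rescale:
  assumes "\<epsilon> > 0"
  shows "difference_op l lhat a 1 (\<lambda>y. c * u (\<epsilon> *\<^sub>R y)) y = c * complex_of_real \<epsilon> ^ l * difference_op l lhat a \<epsilon> u (\<epsilon> *\<^sub>R y)"
proof -
  have "(\<Sum>\<nu> | l \<le> mi_abs \<nu> \<and> mi_abs \<nu> \<le> lhat. a \<nu> * (c * delta_multi \<epsilon> \<nu> u (\<epsilon> *\<^sub>R y))) =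
    c * (\<Sum>\<nu> | l \<le> mi_abs \<nu> \<and> mi_abs \<nu> \<le> lhat. a \<nu> * delta_multi \<epsilon> \<nu> u (\<epsilon> *\<^sub>R y))"
    by (simp add: sum_distrib_left mult_ac)
  then show ?thesis
    using assms by (simp add: difference_op_def delta_multi_rescale)
qed

section \<open>Plane waves and the symbols\<close>

lemma cis_shift_minus: "cis ((y - \<epsilon> *\<^sub>R axis k 1) \<bullet> \<xi>) = cis (- (\<epsilon> * \<xi> $ k)) * cis (y \<bullet> \<xi>)"
  by (simp add: inner_diff_left inner_axis' cis_mult algebra_simps)

lemma cis_shift_plus: "cis ((y + \<epsilon> *\<^sub>R axis k 1) \<bullet> \<xi>) = cis (\<epsilon> * \<xi> $ k) * cis (y \<bullet> \<xi>)"
  by (simp add: inner_add_left inner_axis' cis_mult algebra_simps)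

lemma difference_op_cis:
  "difference_op l lhat a \<epsilon> (\<lambda>y. cis (y \<bullet> \<xi>)) y =
     difference_symbol l lhat a (\<epsilon> *\<^sub>R \<xi>) / complex_of_real \<epsilon> ^ l * cis (y \<bullet> \<xi>)"
proof -
  have "delta_multi \<epsilon> \<nu> (\<lambda>y. cis (y \<bullet> \<xi>)) = (\<lambda>y. delta_symbol \<epsilon> \<nu> \<xi> * cis (y \<bullet> \<xi>))" for \<nu>
  proof -
    \<comment> \<open>This transform evaluates \<open>g\<close> at the single frequency
      \<open>\<xi>\<close>, so the class \<open>G\<close> may consist of all functions.\<close>
    have "delta_multi \<epsilon> \<nu> ((\<lambda>g y. g \<xi> * cis (y \<bullet> \<xi>)) (\<lambda>_. 1)) = (\<lambda>g y. g \<xi> * cis (y \<bullet> \<xi>)) (\<lambda>\<theta>. delta_symbol \<epsilon> \<nu> \<theta> * 1)"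
      by (rule delta_multi_multiplier(1)[where G=UNIV and \<Phi>="\<lambda>g y. g \<xi> * cis (y \<bullet> \<xi>)"])
        (auto simp: delta_minus_def delta_plus_def cis_shift_minus cis_shift_plus left_diff_distrib right_diff_distrib mult_ac fun_eq_iff)
    then show ?thesis by simp
  qed
  then show ?thesis
    by (simp add: difference_op_def difference_symbol_delta_symbol sum_distrib_right mult.assoc)
qed

lemma partial_deriv_cis: "partial_deriv k (\<lambda>y. c * cis (y \<bullet> \<xi>)) = (\<lambda>y. (\<i> * of_real (\<xi> $ k) * c) * cis (y \<bullet> \<xi>))"
proof
  fix y
  have "((\<lambda>s. c * cis ((y + s *\<^sub>R axis k 1) \<bullet> \<xi>)) has_vector_derivative (\<i> * of_real (\<xi> $ k) * c) * cis (y \<bullet> \<xi>)) (at 0)"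
    unfolding has_vector_derivative_def inner_add_left inner_scaleR_left inner_axis'
    by (auto intro!: derivative_eq_intros simp: scaleR_conv_of_real mult_ac)
  then show "partial_deriv k (\<lambda>y. c * cis (y \<bullet> \<xi>)) y = (\<i> * of_real (\<xi> $ k) * c) * cis (y \<bullet> \<xi>)"
    unfolding partial_deriv_def by (rule vector_derivative_at)
qed

lemma diff_op_cis: "diff_op l b (\<lambda>y. cis (y \<bullet> \<xi>)) y = diff_symbol l b \<xi> * cis (y \<bullet> \<xi>)"
proof -
  have "D_multi \<alpha> (\<lambda>y. cis (y \<bullet> \<xi>)) = (\<lambda>y. monom_at \<xi> \<alpha> * cis (y \<bullet> \<xi>))" for \<alpha>
  proof -
    have "D_multi \<alpha> ((\<lambda>g y. g \<xi> * cis (y \<bullet> \<xi>)) (\<lambda>_. 1)) = (\<lambda>g y. g \<xi> * cis (y \<bullet> \<xi>)) (\<lambda>\<theta>. monom_at \<theta> \<alpha> * 1)"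
      by (rule D_multi_multiplier(1)[where G=UNIV and \<Phi>="\<lambda>g y. g \<xi> * cis (y \<bullet> \<xi>)"])
        (auto simp: D_coord_def partial_deriv_cis fun_eq_iff mult.assoc[symmetric])
    then show ?thesis by simp
  qed
  then show ?thesis
    by (simp add: diff_op_def diff_symbol_def sum_distrib_right mult.assoc)
qed

lemma smooth_bounded_cis: "smooth_bounded (\<lambda>y. cis (y \<bullet> \<xi>))"
  unfolding smooth_bounded_def
proof (intro allI)
  fix ks
  have "\<exists>c. foldr partial_deriv ks (\<lambda>y. cis (y \<bullet> \<xi>)) = (\<lambda>y. c * cis (y \<bullet> \<xi>))"
  proof (induction ks)
    case (Cons k ks)
    then show ?case by (auto simp: partial_deriv_cis simp del: mult.assoc)
  qed (auto intro: exI[of _ 1])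
  then obtain c where c: "foldr partial_deriv ks (\<lambda>y. cis (y \<bullet> \<xi>)) = (\<lambda>y. c * cis (y \<bullet> \<xi>))" by blast
  have "(\<lambda>y. c * cis (y \<bullet> \<xi>)) differentiable at y" for y
  proof -
    have "((\<lambda>y. y \<bullet> \<xi>) has_derivative (\<lambda>h. h \<bullet> \<xi>)) (at y)" by (auto intro!: derivative_eq_intros)
    from has_derivative_mult_right[OF has_derivative_cis[OF this], of c] show ?thesis
      unfolding differentiable_def by blast
  qed
  moreover have "bounded (range (\<lambda>y. c * cis (y \<bullet> \<xi>)))"
    unfolding bounded_iff by (intro exI[of _ "norm c"]) (auto simp: norm_mult)
  ultimately show "(\<forall>y. foldr partial_deriv ks (\<lambda>y. cis (y \<bullet> \<xi>)) differentiable at y) \<and> 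
     bounded (range (foldr partial_deriv ks (\<lambda>y. cis (y \<bullet> \<xi>))))"
    unfolding c by auto
qed

text \<open>The approximation property is tested on the plane wave of frequency
  \<open>\<xi>\<close>, and at \<open>y = 0\<close> both symbols can be read off. The constant
  depends on \<open>\<xi>\<close> in an uncontrolled way.\<close>

lemma approximates_symbol:
  assumes "approximates_of_order M l lhat a b"
  shows "\<exists>C>0. \<forall>s>0. norm (difference_symbol l lhat a (s *\<^sub>R \<xi>) / complex_of_real s ^ l - diff_symbol l b \<xi>) \<le> C * s ^ M"
proof -
  obtain C where C: "C > 0" "\<And>\<epsilon> y. \<epsilon> > 0 \<Longrightarrow> norm (difference_op l lhat a \<epsilon> (\<lambda>y. cis (y \<bullet> \<xi>)) y - diff_op l b (\<lambda>y. cis (y \<bullet> \<xi>)) y) \<le> C * \<epsilon> ^ M"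
    using assms smooth_bounded_cis[of \<xi>] unfolding approximates_of_order_def by blast
  then show ?thesis
    using C(2)[of _ 0] by (intro exI[of _ C]) (auto simp: difference_op_cis diff_op_cis)
qed

subsection \<open>Fourier integrals\<close>

lemma lborel_integral_prod:
  fixes f :: "'a::euclidean_space \<Rightarrow> real \<Rightarrow> complex"
  assumes "\<And>b. b \<in> Basis \<Longrightarrow> integrable lborel (f b)"
  shows "(\<integral>x. (\<Prod>b\<in>Basis. f b (x \<bullet> b)) \<partial>lborel) = (\<Prod>b\<in>Basis. (\<integral>x. f b x \<partial>lborel))"
proof -
  interpret product_sigma_finite "\<lambda>_::'a. lborel :: real measure" ..
  have [measurable]: "\<And>b. b \<in> Basis \<Longrightarrow> f b \<in> borel_measurable borel" using borel_measurable_integrable[OF assms] by simp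
  have "(\<integral>x. (\<Prod>b\<in>Basis. f b (x \<bullet> b)) \<partial>lborel) = (\<integral>x. (\<Prod>b\<in>Basis. f b (x b)) \<partial>(\<Pi>\<^sub>M b\<in>(Basis :: 'a set). lborel))"
    by (subst lborel_eq, subst integral_distr) (auto intro!: Bochner_Integration.integral_cong prod.cong)
  also have "\<dots> = (\<Prod>b\<in>Basis. (\<integral>x. f b x \<partial>lborel))"
    using assms by (intro product_integral_prod) auto
  finally show ?thesis .
qed

lemma integral_cis_period:
  fixes m :: int
  shows "(\<integral>x. indicator {-pi..pi} x *\<^sub>R cis (of_int m * x) \<partial>lborel) = (if m = 0 then of_real (2 * pi) else 0)"
proof (cases "m = 0")
  case True
  then show ?thesis by (simp add: scaleR_conv_of_real)
next
  case False
  have "(\<integral>x. indicator {-pi..pi} x *\<^sub>R cis (of_int m * x) \<partial>lborel) = 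
     cis (of_int m * pi) / (\<i> * of_int m) - cis (of_int m * (- pi)) / (\<i> * of_int m)"
    using False
    by (intro integral_FTC_atLeastAtMost)
       (auto intro!: continuous_intros derivative_eq_intros simp: has_vector_derivative_def scaleR_conv_of_real field_simps)
  also have "cis (of_int m * pi) = cis (of_int m * (- pi))"
    by (simp add: complex_eq_iff sin_times_pi_eq_0)
  finally show ?thesis using False by simp
qed

lemma prod_cis: "finite S \<Longrightarrow> (\<Prod>b\<in>S. cis (f b)) = cis (\<Sum>b\<in>S. f b)"
  by (induction rule: finite_induct) (auto simp: cis_mult)

text \<open>Orthogonality of characters, one coordinate at a time: lattice coordinates are integers,
  so each factor is integrated over full periods.\<close>

lemma integral_cube_cis:
  fixes x :: "real ^ 'd::finite"
  assumes "x \<in> lattice 1"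
  shows "(\<integral>\<theta>. indicator (cube pi) \<theta> *\<^sub>R cis (x \<bullet> \<theta>) \<partial>lborel) = (if x = 0 then of_real ((2 * pi) ^ CARD('d)) else 0)"
proof -
  obtain m :: "'d \<Rightarrow> int" where m: "\<And>k. x $ k = of_int (m k)"
    using assms by (auto simp: lattice_def) metis
  have B: "(Basis :: (real ^ 'd) set) = range (\<lambda>k. axis k 1)" "inj (\<lambda>k::'d. axis k (1::real))"
    by (auto simp: Basis_vec_def inj_on_def axis_eq_axis)
  have e: "indicator (cube pi) \<theta> *\<^sub>R cis (x \<bullet> \<theta>) = (\<Prod>b\<in>Basis. indicator {-pi..pi} (\<theta> \<bullet> b) *\<^sub>R cis ((x \<bullet> b) * (\<theta> \<bullet> b)))" for \<theta>
  proof -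
    have "(\<Prod>b\<in>Basis. indicator {-pi..pi} (\<theta> \<bullet> b) *\<^sub>R cis ((x \<bullet> b) * (\<theta> \<bullet> b))) = 
      (\<Prod>b\<in>Basis. of_real (indicator {-pi..pi} (\<theta> \<bullet> b))) * (\<Prod>b\<in>Basis. cis ((x \<bullet> b) * (\<theta> \<bullet> b)))"
      by (simp add: scaleR_conv_of_real prod.distrib)
    also have "(\<Prod>b\<in>Basis. cis ((x \<bullet> b) * (\<theta> \<bullet> b))) = cis (\<Sum>b\<in>Basis. (x \<bullet> b) * (\<theta> \<bullet> b))"
      by (rule prod_cis) simp
    also have "(\<Sum>b\<in>Basis. (x \<bullet> b) * (\<theta> \<bullet> b)) = x \<bullet> \<theta>"
      by (simp add: euclidean_inner[of x \<theta>])
    also have "(\<Prod>b\<in>Basis. complex_of_real (indicator {-pi..pi} (\<theta> \<bullet> b))) = of_real (indicator (cube pi) \<theta>)"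
    proof (cases "\<theta> \<in> cube pi")
      case True
      then show ?thesis by (auto simp: B prod.reindex cube_iff_component inner_axis abs_le_iff indicator_def minus_le_iff intro!: prod.neutral)
    next
      case False
      then obtain k where "\<bar>\<theta> $ k\<bar> > pi" by (auto simp: cube_iff_component not_le)
      then have "\<exists>b\<in>Basis. complex_of_real (indicator {-pi..pi} (\<theta> \<bullet> b)) = 0"
        by (intro bexI[of _ "axis k 1"]) (auto simp: inner_axis indicator_def)
      then show ?thesis using False by (simp add: prod_zero_iff)
    qed
    finally show ?thesis by (simp add: scaleR_conv_of_real)
  qed
  have "(\<integral>\<theta>. indicator (cube pi) \<theta> *\<^sub>R cis (x \<bullet> \<theta>) \<partial>lborel) = (\<Prod>b\<in>Basis. \<integral>z. indicator {-pi..pi} z *\<^sub>R cis ((x \<bullet> b) * z) \<partial>lborel)"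
    unfolding e by (intro lborel_integral_prod borel_integrable_compact continuous_intros) auto
  also have "\<dots> = (\<Prod>k\<in>UNIV. \<integral>z. indicator {-pi..pi} z *\<^sub>R cis ((x $ k) * z) \<partial>lborel)"
    unfolding B(1) by (subst prod.reindex[OF B(2)]) (simp add: inner_axis)
  also have "\<dots> = (\<Prod>k\<in>UNIV. if m k = 0 then of_real (2 * pi) else 0)"
    unfolding m integral_cis_period ..
  also have "\<dots> = (if x = 0 then of_real ((2 * pi) ^ CARD('d)) else 0)"
  proof (cases "x = 0")
    case True
    then have "m k = 0" for k using m[of k] by simp
    then show ?thesis using True by simp
  next
    case False
    then obtain k where "m k \<noteq> 0" using m by (metis of_int_0 vec_eq_iff zero_index)
    then show ?thesis using False by (auto simp: prod_zero_iff)
  qed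
  finally show ?thesis .
qed

subsection \<open>The second Green function on the unit lattice\<close>

text \<open>The integral of \<open>exp (- (\<tau> * z))\<close> over \<open>\<tau>\<close> from 0 to
  \<open>t\<close>. The value at \<open>z = 0\<close> fills the removable singularity, which is met
  at \<open>\<theta> = 0\<close>, where the symbol vanishes.\<close>

definition psi :: "real \<Rightarrow> complex \<Rightarrow> complex" where
  "psi t z = (if z = 0 then of_real t else (1 - exp (- (of_real t * z))) / z)"

lemma psi_deriv: "(psi' has_vector_derivative exp (- (of_real t * z))) (at t within S)" if "psi' = (\<lambda>t. psi t z)"
proof (cases "z = 0")
  case True
  then show ?thesis
    unfolding that psi_def has_vector_derivative_def by (auto intro!: derivative_eq_intros simp: scaleR_conv_of_real)
next
  case False
  have "((\<lambda>w. (1 - exp (- (w * z))) / z) has_field_derivative exp (- (of_real t * z))) (at (of_real t))"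
    using False by (auto intro!: derivative_eq_intros)
  then have "((\<lambda>t. (1 - exp (- (of_real t * z))) / z) has_vector_derivative exp (- (of_real t * z))) (at t within S)"
    by (rule has_vector_derivative_real_field)
  then show ?thesis unfolding that psi_def using False by simp
qed

lemma psi_0 [simp]: "psi 0 z = 0"
  by (cases "z = 0") (auto simp: psi_def)

lemma psi_mult: "psi t z * z = 1 - exp (- (of_real t * z))"
  by (simp add: psi_def)

lemma norm_exp_minus_le_1: "Re z \<ge> 0 \<Longrightarrow> t \<ge> 0 \<Longrightarrow> norm (exp (- (complex_of_real t * z))) \<le> 1"
  by (simp add: norm_exp_eq_Re)

text \<open>In the right half plane the derivative in \<open>t\<close> has norm at most 1.\<close>

lemma norm_psi_le:
  assumes "Re z \<ge> 0" "t \<ge> 0"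
  shows "norm (psi t z) \<le> t"
proof (cases "t = 0")
  case True
  then show ?thesis by simp
next
  case False
  have "norm (psi t z - psi 0 z) \<le> t - 0"
  proof (rule differentiable_bound_general[where \<phi>'="\<lambda>_. 1" and f="\<lambda>t. psi t z" and f'="\<lambda>t. exp (- (of_real t * z))"])
    show "continuous_on {0..t} (\<lambda>t. psi t z)"
      using differentiableI_vector[OF psi_deriv[OF refl]] by (intro differentiable_imp_continuous_on) (auto simp: differentiable_on_def)
    show "((\<lambda>t. psi t z) has_vector_derivative exp (- (of_real x * z))) (at x)" for x
      by (rule psi_deriv[OF refl])
    show "norm (exp (- (of_real x * z))) \<le> 1" if "0 < x" for x
      using norm_exp_minus_le_1[of z x] assms that by simp
  qed (use assms False in \<open>auto intro!: continuous_intros derivative_eq_intros\<close>)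
  then show ?thesis by simp
qed

lemma borel_measurable_psi[measurable]: "psi t \<in> borel_measurable borel"
  unfolding psi_def[abs_def] by measurable

lemma difference_symbol_continuous: "continuous_on S (difference_symbol l lhat a)"
  unfolding difference_symbol_def[abs_def] by (intro continuous_intros)

lemma diff_symbol_continuous: "continuous_on S (diff_symbol l b)"
  unfolding diff_symbol_def[abs_def] monom_at_def by (intro continuous_intros)

lemma difference_symbol_measurable[measurable]: "difference_symbol l lhat a \<in> borel_measurable borel"
  by (rule borel_measurable_continuous_onI[OF difference_symbol_continuous])

lemma diff_symbol_measurable[measurable]: "diff_symbol l b \<in> borel_measurable borel"
  by (rule borel_measurable_continuous_onI[OF diff_symbol_continuous])

text \<open>Every multi-index of the sum has modulus at least \<open>l \<ge> 1\<close>, so some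
  factor vanishes.\<close>

lemma difference_symbol_0:
  assumes "1 \<le> l"
  shows "difference_symbol l lhat a 0 = 0"
  unfolding difference_symbol_def
proof (rule sum.neutral, safe)
  fix \<nu> :: "'a + 'a \<Rightarrow> nat" assume "l \<le> mi_abs \<nu>"
  then have "(\<Sum>i\<in>UNIV. \<nu> i) \<noteq> 0" using assms unfolding mi_abs_def by linarith
  then obtain i where i: "\<nu> i \<noteq> 0" using sum.not_neutral_contains_not_neutral by blast
  have "\<exists>k. \<nu> (Inl k) \<noteq> 0 \<or> \<nu> (Inr k) \<noteq> 0"
    using i by (cases i) auto
  then show "a \<nu> * (\<Prod>k\<in>UNIV. (cis (- ((0::real ^ 'a) $ k)) - 1) ^ \<nu> (Inl k) * (cis ((0::real ^ 'a) $ k) - 1) ^ \<nu> (Inr k)) = 0"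
    by (auto simp: prod_zero_iff)
qed

lemma measurable_cis[measurable]: "cis \<in> borel_measurable borel"
  by (intro borel_measurable_continuous_onI continuous_intros)

lemma integrable_cube_bounded:
  fixes f :: "real ^ 'd::finite \<Rightarrow> complex"
  assumes [measurable]: "f \<in> borel_measurable borel" and "\<And>x. x \<in> cube c \<Longrightarrow> norm (f x) \<le> C"
  shows "integrable lborel (\<lambda>x. indicator (cube c) x *\<^sub>R f x)"
proof (rule Bochner_Integration.integrable_bound)
  have "bounded (cube c :: (real ^ 'd) set)" by (simp add: cube_def)
  then show "integrable lborel (\<lambda>x::real ^ 'd. C * indicator (cube c) x :: real)"
    using emeasure_bounded_finite[OF \<open>bounded (cube c :: (real ^ 'd) set)\<close>]
    by (intro integrable_mult_right integrable_real_indicator) auto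
  show "AE x in lborel. norm (indicator (cube c) x *\<^sub>R f x) \<le> norm (C * indicator (cube c) x)"
    using assms(2) by (intro AE_I2) (auto simp: indicator_def intro: order_trans[OF _ abs_ge_self])
qed measurable

definition cube_fourier :: "(real ^ 'd::finite \<Rightarrow> complex) \<Rightarrow> real ^ 'd \<Rightarrow> complex" where
  "cube_fourier g y = (\<integral>\<theta>. indicator (cube pi) \<theta> *\<^sub>R (g \<theta> * cis (y \<bullet> \<theta>)) \<partial>lborel)"

definition cube_bounded :: "(real ^ 'd::finite \<Rightarrow> complex) set" where
  "cube_bounded = {g. g \<in> borel_measurable borel \<and> (\<exists>C. \<forall>\<theta>\<in>cube pi. norm (g \<theta>) \<le> C)}"

lemma cube_bounded_mult: "f \<in> cube_bounded \<Longrightarrow> g \<in> cube_bounded \<Longrightarrow> (\<lambda>\<theta>. f \<theta> * g \<theta>) \<in> cube_bounded"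
proof -
  assume f: "f \<in> cube_bounded" and g: "g \<in> cube_bounded"
  then obtain C D where CD: "\<forall>\<theta>\<in>cube pi. norm (f \<theta>) \<le> C" "\<forall>\<theta>\<in>cube pi. norm (g \<theta>) \<le> D"
    by (auto simp: cube_bounded_def)
  have "norm (f \<theta> * g \<theta>) \<le> C * D" if "\<theta> \<in> cube pi" for \<theta>
    using CD that by (auto simp: norm_mult intro!: mult_mono intro: order_trans[OF norm_ge_zero])
  then show ?thesis using f g by (auto simp: cube_bounded_def)
qed

lemma cube_bounded_continuous: "continuous_on UNIV g \<Longrightarrow> g \<in> cube_bounded"
proof -
  assume g: "continuous_on UNIV g"
  have "compact (g ` cube pi)"
    by (intro compact_continuous_image continuous_on_subset[OF g]) (auto simp: cube_def)
  then obtain C where "\<forall>x\<in>g ` cube pi. norm x \<le> C" using compact_imp_bounded bounded_iff by blast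
  then show ?thesis using g by (auto simp: cube_bounded_def intro: borel_measurable_continuous_onI)
qed

lemma cube_fourier_integrable:
  assumes "g \<in> cube_bounded"
  shows "integrable lborel (\<lambda>\<theta>. indicator (cube pi) \<theta> *\<^sub>R (g \<theta> * cis (y \<bullet> \<theta>)))"
proof -
  obtain C where "\<forall>\<theta>\<in>cube pi. norm (g \<theta>) \<le> C" "g \<in> borel_measurable borel" using assms by (auto simp: cube_bounded_def)
  then show ?thesis by (intro integrable_cube_bounded[where C=C]) (auto simp: norm_mult)
qed

lemma cube_fourier_delta:
  assumes g: "g \<in> cube_bounded"
  shows "delta_minus 1 k (cube_fourier g) = cube_fourier (\<lambda>\<theta>. (cis (- (1 * \<theta> $ k)) - 1) * g \<theta>)"
    and "delta_plus 1 k (cube_fourier g) = cube_fourier (\<lambda>\<theta>. (cis (1 * \<theta> $ k) - 1) * g \<theta>)"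
proof -
  note d = Bochner_Integration.integral_diff[OF cube_fourier_integrable[OF g] cube_fourier_integrable[OF g], symmetric]
  show "delta_minus 1 k (cube_fourier g) = cube_fourier (\<lambda>\<theta>. (cis (- (1 * \<theta> $ k)) - 1) * g \<theta>)"
    unfolding delta_minus_def[abs_def] cube_fourier_def d unfolding cis_shift_minus
    by (intro ext Bochner_Integration.integral_cong) (simp_all add: algebra_simps)
  show "delta_plus 1 k (cube_fourier g) = cube_fourier (\<lambda>\<theta>. (cis (1 * \<theta> $ k) - 1) * g \<theta>)"
    unfolding delta_plus_def[abs_def] cube_fourier_def d unfolding cis_shift_plus
    by (intro ext Bochner_Integration.integral_cong) (simp_all add: algebra_simps)
qed

lemma difference_op_cube_fourier:
  assumes g: "g \<in> cube_bounded"
  shows "difference_op l lhat a 1 (cube_fourier g) = cube_fourier (\<lambda>\<theta>. difference_symbol l lhat a \<theta> * g \<theta>)"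
proof
  fix y
  have m: "(\<lambda>\<theta>. (cis (- (1 * \<theta> $ k)) - 1) * g \<theta>) \<in> cube_bounded" "(\<lambda>\<theta>. (cis (1 * \<theta> $ k) - 1) * g \<theta>) \<in> cube_bounded"
    if "g \<in> cube_bounded" for g :: "real ^ 'a \<Rightarrow> complex" and k
    by (intro cube_bounded_mult[OF cube_bounded_continuous] continuous_intros that)+
  note d = delta_multi_multiplier[where G=cube_bounded and \<Phi>=cube_fourier and \<epsilon>=1 and g=g]
  have d1: "delta_multi 1 \<nu> (cube_fourier g) = cube_fourier (\<lambda>\<theta>. delta_symbol 1 \<nu> \<theta> * g \<theta>)" for \<nu>
    by (rule d(1)) (use cube_fourier_delta m g in auto)
  have d2: "(\<lambda>\<theta>. delta_symbol 1 \<nu> \<theta> * g \<theta>) \<in> cube_bounded" for \<nu> :: "'a + 'a \<Rightarrow> nat"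
    by (rule d(2)) (use cube_fourier_delta m g in auto)
  have "difference_op l lhat a 1 (cube_fourier g) y = (\<Sum>\<nu> | l \<le> mi_abs \<nu> \<and> mi_abs \<nu> \<le> lhat. a \<nu> * cube_fourier (\<lambda>\<theta>. delta_symbol 1 \<nu> \<theta> * g \<theta>) y)"
    by (simp add: difference_op_def d1)
  also have "\<dots> = (\<integral>\<theta>. (\<Sum>\<nu> | l \<le> mi_abs \<nu> \<and> mi_abs \<nu> \<le> lhat. a \<nu> * (indicator (cube pi) \<theta> *\<^sub>R (delta_symbol 1 \<nu> \<theta> * g \<theta> * cis (y \<bullet> \<theta>)))) \<partial>lborel)"
    unfolding cube_fourier_def
    using integrable_mult_right[OF cube_fourier_integrable[OF d2, of _ y]]
    by (subst Bochner_Integration.integral_sum) (simp_all only: integral_mult_right_zero)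
  also have "\<dots> = cube_fourier (\<lambda>\<theta>. difference_symbol l lhat a \<theta> * g \<theta>) y"
    unfolding cube_fourier_def
    by (intro Bochner_Integration.integral_cong)
      (auto simp: difference_symbol_delta_symbol[of _ _ _ 1, simplified] sum_distrib_left sum_distrib_right scaleR_conv_of_real mult_ac)
  finally show "difference_op l lhat a 1 (cube_fourier g) y = cube_fourier (\<lambda>\<theta>. difference_symbol l lhat a \<theta> * g \<theta>) y" .
qed

locale lattice_scheme =
  fixes l lhat :: nat and a :: "('d::finite + 'd \<Rightarrow> nat) \<Rightarrow> complex"
  assumes l_ge_1: "1 \<le> l"
    and Re_pos: "\<And>\<theta>. \<theta> \<in> cube pi - {0} \<Longrightarrow> Re (difference_symbol l lhat a \<theta>) > 0"
begin

abbreviation "A \<equiv> difference_symbol l lhat a"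

lemma Re_nonneg: "\<theta> \<in> cube pi \<Longrightarrow> Re (A \<theta>) \<ge> 0"
  using Re_pos[of \<theta>] difference_symbol_0[OF l_ge_1, of lhat a] by (cases "\<theta> = 0") auto

definition green1 :: "real ^ 'd \<Rightarrow> real \<Rightarrow> complex" where
  "green1 y t = cube_fourier (\<lambda>\<theta>. exp (- (of_real t * A \<theta>))) y / of_real ((2 * pi) ^ CARD('d))"

definition green2 :: "real ^ 'd \<Rightarrow> real \<Rightarrow> complex" where
  "green2 y t = cube_fourier (\<lambda>\<theta>. psi t (A \<theta>)) y / of_real ((2 * pi) ^ CARD('d))"

lemma psi_cube_bounded: "t \<ge> 0 \<Longrightarrow> (\<lambda>\<theta>. psi t (A \<theta>)) \<in> cube_bounded"
  unfolding cube_bounded_def by (auto intro!: exI[of _ t] norm_psi_le Re_nonneg)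

lemma exp_cube_bounded: "t \<ge> 0 \<Longrightarrow> (\<lambda>\<theta>. exp (- (of_real t * A \<theta>))) \<in> cube_bounded"
  unfolding cube_bounded_def by (auto intro!: exI[of _ 1] norm_exp_minus_le_1 Re_nonneg simp del: norm_exp_eq_Re)

text \<open>Passage to the Henstock-Kurzweil integral, for which the Leibniz rule is stated.\<close>

lemma cube_fourier_eq_HK:
  assumes "g \<in> cube_bounded"
  shows "cube_fourier g y = integral (cube pi) (\<lambda>\<theta>. g \<theta> * cis (y \<bullet> \<theta>))"
    and "(\<lambda>\<theta>. g \<theta> * cis (y \<bullet> \<theta>)) integrable_on cube pi"
proof -
  have s: "set_integrable lborel (cube pi) (\<lambda>\<theta>. g \<theta> * cis (y \<bullet> \<theta>))"
    unfolding set_integrable_def by (rule cube_fourier_integrable[OF assms])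
  show "cube_fourier g y = integral (cube pi) (\<lambda>\<theta>. g \<theta> * cis (y \<bullet> \<theta>))"
    using set_borel_integral_eq_integral(2)[OF s] by (simp add: cube_fourier_def set_lebesgue_integral_def)
  show "(\<lambda>\<theta>. g \<theta> * cis (y \<bullet> \<theta>)) integrable_on cube pi"
    using set_borel_integral_eq_integral(1)[OF s] .
qed

lemma green2_deriv:
  assumes "t \<ge> 0"
  shows "(green2 y has_vector_derivative green1 y t) (at t within {0..})"
proof -
  let ?c = "1 / complex_of_real ((2 * pi) ^ CARD('d))"
  let ?W = "\<lambda>t. integral (cube pi) (\<lambda>\<theta>. psi t (A \<theta>) * cis (y \<bullet> \<theta>))"
  have "(?W has_vector_derivative integral (cube pi) (\<lambda>\<theta>. exp (- (of_real t * A \<theta>)) * cis (y \<bullet> \<theta>))) (at t within {0..})"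
    unfolding cube_def
  proof (rule leibniz_rule_vector_derivative)
    fix t :: real and \<theta>
    show "((\<lambda>t. psi t (A \<theta>) * cis (y \<bullet> \<theta>)) has_vector_derivative exp (- (of_real t * A \<theta>)) * cis (y \<bullet> \<theta>)) (at t within {0..})"
      by (intro has_vector_derivative_mult_left psi_deriv refl)
    assume "t \<in> {0..}"
    then show "(\<lambda>\<theta>. psi t (A \<theta>) * cis (y \<bullet> \<theta>)) integrable_on cbox (\<chi> k. - pi) (\<chi> k. pi)"
      using cube_fourier_eq_HK(2)[OF psi_cube_bounded] by (simp add: cube_def)
  next
    have "continuous_on ({0..} \<times> cbox (\<chi> k. - pi) (\<chi> k. pi)) (\<lambda>p. exp (- (of_real (fst p) * A (snd p))) * cis (y \<bullet> snd p))"
      by (intro continuous_intros continuous_on_compose2[OF difference_symbol_continuous[of UNIV]]) auto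
    then show "continuous_on ({0..} \<times> cbox (\<chi> k. - pi) (\<chi> k. pi)) (\<lambda>(t, \<theta>). exp (- (of_real t * A \<theta>)) * cis (y \<bullet> \<theta>))"
      by (simp add: split_beta')
  qed (use assms in auto)
  from has_vector_derivative_mult_right[OF this, of ?c]
  have "((\<lambda>t. ?c * ?W t) has_vector_derivative green1 y t) (at t within {0..})"
    using cube_fourier_eq_HK(1)[OF exp_cube_bounded[OF assms]] by (simp add: green1_def)
  then show ?thesis
    by (rule has_vector_derivative_transform_within[of _ _ _ _ 1])
       (use assms cube_fourier_eq_HK(1)[OF psi_cube_bounded] in \<open>auto simp: green2_def\<close>)
qed

text \<open>Since \<open>psi t z * z = 1 - exp (- (t * z))\<close>, the exponentials cancel and what
  remains is the integral of a character over the cube.\<close>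

lemma green2_equation:
  assumes "x \<in> lattice 1" "t \<ge> 0"
  shows "green1 x t + difference_op l lhat a 1 (\<lambda>z. green2 z t) x = discrete_delta 1 x"
proof -
  let ?c = "1 / complex_of_real ((2 * pi) ^ CARD('d))"
  have "difference_op l lhat a 1 (\<lambda>z. green2 z t) x = ?c * difference_op l lhat a 1 (cube_fourier (\<lambda>\<theta>. psi t (A \<theta>))) x"
    using difference_op_rescale[of 1 l lhat a ?c "cube_fourier (\<lambda>\<theta>. psi t (A \<theta>))" x] by (simp add: green2_def)
  also have "\<dots> = ?c * cube_fourier (\<lambda>\<theta>. 1 - exp (- (of_real t * A \<theta>))) x"
    using difference_op_cube_fourier[OF psi_cube_bounded[OF assms(2)]] psi_mult by (simp add: mult.commute)
  finally have "green1 x t + difference_op l lhat a 1 (\<lambda>z. green2 z t) x = 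
    ?c * (cube_fourier (\<lambda>\<theta>. exp (- (of_real t * A \<theta>))) x + cube_fourier (\<lambda>\<theta>. 1 - exp (- (of_real t * A \<theta>))) x)"
    by (simp add: green1_def distrib_left)
  also have "cube_fourier (\<lambda>\<theta>. exp (- (of_real t * A \<theta>))) x + cube_fourier (\<lambda>\<theta>. 1 - exp (- (of_real t * A \<theta>))) x = 
     cube_fourier (\<lambda>\<theta>. 1) x"
  proof -
    have "(\<lambda>\<theta>. 1 - exp (- (of_real t * A \<theta>))) \<in> cube_bounded"
      by (intro cube_bounded_continuous continuous_intros difference_symbol_continuous)
    from cube_fourier_integrable[OF exp_cube_bounded[OF assms(2)], of x] cube_fourier_integrable[OF this, of x]
    show ?thesis
      unfolding cube_fourier_def
      by (subst Bochner_Integration.integral_add[symmetric]) (auto intro!: Bochner_Integration.integral_cong simp: algebra_simps)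
  qed
  also have "?c * cube_fourier (\<lambda>\<theta>. 1) x = discrete_delta 1 x"
    using integral_cube_cis[OF assms(1)] by (simp add: cube_fourier_def discrete_delta_def)
  finally show ?thesis .
qed

lemma green2_bounded:
  assumes "t \<ge> 0"
  shows "\<exists>B. \<forall>x. norm (green2 x t) \<le> B"
proof -
  let ?g = "\<lambda>\<theta>. psi t (A \<theta>)"
  have "norm (green2 x t) \<le> (\<integral>\<theta>. indicator (cube pi) \<theta> *\<^sub>R norm (?g \<theta>) \<partial>lborel) / (2 * pi) ^ CARD('d)" for x
  proof -
    have "norm (cube_fourier ?g x) \<le> (\<integral>\<theta>. norm (indicator (cube pi) \<theta> *\<^sub>R (?g \<theta> * cis (x \<bullet> \<theta>))) \<partial>lborel)"
      unfolding cube_fourier_def by (rule integral_norm_bound)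
    also have "\<dots> = (\<integral>\<theta>. indicator (cube pi) \<theta> *\<^sub>R norm (?g \<theta>) \<partial>lborel)"
      by (intro Bochner_Integration.integral_cong) (auto simp: norm_mult)
    finally show ?thesis by (simp add: green2_def norm_divide norm_mult norm_power divide_right_mono)
  qed
  then show ?thesis by blast
qed

lemma green_unique:
  assumes v: "second_discrete_green l lhat a 1 v" and x: "x \<in> lattice 1" "t \<ge> 0"
  shows "v x t = green2 x t"
proof -
  obtain v' where v': "\<And>x t. x \<in> lattice 1 \<Longrightarrow> t \<ge> 0 \<Longrightarrow> (v x has_vector_derivative v' x t) (at t within {0..})"
    "\<And>x t. x \<in> lattice 1 \<Longrightarrow> t > 0 \<Longrightarrow> v' x t + difference_op l lhat a 1 (\<lambda>z. v z t) x = discrete_delta 1 x"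
    using v unfolding second_discrete_green_def by metis
  obtain C where C: "C > 0" "\<And>u B. (\<forall>x\<in>lattice 1. norm (u x) \<le> B) \<Longrightarrow> (\<forall>x\<in>lattice 1. norm (difference_op l lhat a 1 u x) \<le> C * B)"
    using difference_op_bound[of l lhat a] by blast
  define z where "z x t = v x t - green2 x t" for x t
  define z' where "z' x t = v' x t - green1 x t" for x t
  have "z x t = 0"
  proof (rule linear_ode_unique[where X="lattice 1" and z'=z' and C=C])
    fix x :: "real ^ 'd" and t :: real assume "x \<in> lattice 1" "t \<ge> 0"
    then show "(z x has_vector_derivative z' x t) (at t within {0..})"
      unfolding z_def[abs_def] z'_def by (intro has_vector_derivative_diff v' green2_deriv)
  next
    fix x :: "real ^ 'd" and t B :: real assume x: "x \<in> lattice 1" "t > 0" and B: "\<And>x. x \<in> lattice 1 \<Longrightarrow> norm (z x t) \<le> B"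
    have "z' x t = - difference_op l lhat a 1 (\<lambda>x. z x t) x"
      using v'(2)[OF x] green2_equation[OF x(1), of t] x unfolding z_def z'_def difference_op_diff
      by (simp add: algebra_simps eq_diff_eq)
    then show "norm (z' x t) \<le> C * B" using C(2)[of "\<lambda>x. z x t" B] B x by auto
  next
    fix x :: "real ^ 'd" assume "x \<in> lattice 1"
    then show "z x 0 = 0" using v unfolding z_def second_discrete_green_def
      by (auto simp: green2_def cube_fourier_def)
  next
    fix t :: real assume t: "t \<ge> 0"
    \<comment> \<open>Rapid decrease with exponent 0 is boundedness on the lattice at the time
      \<open>t\<close>; the bound may vary with \<open>t\<close> without any control.\<close>
    obtain B1 where B1: "\<And>x. x \<in> lattice 1 \<Longrightarrow> norm x ^ 0 * norm (v x t) \<le> B1"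
      using v t unfolding second_discrete_green_def rapidly_decreasing_on_def by blast
    obtain B2 where B2: "\<And>x. norm (green2 x t) \<le> B2" using green2_bounded[OF t] by blast
    have "norm (z x t) \<le> B1 + B2" if "x \<in> lattice 1" for x
      unfolding z_def using norm_triangle_ineq4[of "v x t" "green2 x t"] B1[OF that] B2[of x] by simp
    then show "\<exists>B. \<forall>x\<in>lattice 1. norm (z x t) \<le> B" by blast
  qed (use C x in auto)
  then show ?thesis by (simp add: z_def)
qed

end

text \<open>Differentiation in the new time produces a factor \<open>\<epsilon> ^ l\<close>, and the
  discrete delta has height \<open>1 / \<epsilon> ^ d\<close>. The prefactor
  \<open>\<epsilon> ^ d / \<epsilon> ^ l\<close> compensates both.\<close>

lemma second_discrete_green_rescale:
  fixes v :: "real ^ 'd::finite \<Rightarrow> real \<Rightarrow> complex"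
  assumes v: "second_discrete_green l lhat a \<epsilon> v" and \<epsilon>: "\<epsilon> > 0"
  shows "second_discrete_green l lhat a 1
     (\<lambda>y \<tau>. complex_of_real (\<epsilon> ^ CARD('d) / \<epsilon> ^ l) * v (\<epsilon> *\<^sub>R y) (\<epsilon> ^ l * \<tau>))"
proof -
  let ?c = "\<epsilon> ^ CARD('d) / \<epsilon> ^ l"
  have lat: "\<epsilon> *\<^sub>R y \<in> lattice \<epsilon>" if "y \<in> lattice 1" for y :: "real ^ 'd"
    using that by (auto simp: lattice_def)
  show ?thesis
    unfolding second_discrete_green_def
  proof (intro conjI allI impI ballI)
    fix t :: real assume t: "t \<ge> 0"
    show "rapidly_decreasing_on (lattice 1) (\<lambda>x. complex_of_real ?c * v (\<epsilon> *\<^sub>R x) (\<epsilon> ^ l * t))"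
      unfolding rapidly_decreasing_on_def
    proof
      fix N :: nat
      have "0 \<le> \<epsilon> ^ l * t" using t \<epsilon> by simp
      then obtain C where C: "\<And>x. x \<in> lattice \<epsilon> \<Longrightarrow> norm x ^ N * norm (v x (\<epsilon> ^ l * t)) \<le> C"
        using v unfolding second_discrete_green_def rapidly_decreasing_on_def by blast
      have "norm x ^ N * norm (complex_of_real ?c * v (\<epsilon> *\<^sub>R x) (\<epsilon> ^ l * t)) \<le> ?c * C / \<epsilon> ^ N" if "x \<in> lattice 1" for x
      proof -
        have "norm x ^ N * norm (complex_of_real ?c * v (\<epsilon> *\<^sub>R x) (\<epsilon> ^ l * t)) = 
          (?c / \<epsilon> ^ N) * (norm (\<epsilon> *\<^sub>R x) ^ N * norm (v (\<epsilon> *\<^sub>R x) (\<epsilon> ^ l * t)))"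
          using \<epsilon> by (simp add: norm_mult norm_divide norm_power power_mult_distrib)
        also have "\<dots> \<le> (?c / \<epsilon> ^ N) * C"
          using C[OF lat[OF that]] \<epsilon> by (intro mult_left_mono) auto
        finally show ?thesis by simp
      qed
      then show "\<exists>C. \<forall>x\<in>lattice 1. norm x ^ N * norm (complex_of_real ?c * v (\<epsilon> *\<^sub>R x) (\<epsilon> ^ l * t)) \<le> C" by blast
    qed
  next
    fix y :: "real ^ 'd" assume y: "y \<in> lattice 1"
    have ey: "\<epsilon> *\<^sub>R y \<in> lattice \<epsilon>" using lat y .
    show "complex_of_real ?c * v (\<epsilon> *\<^sub>R y) (\<epsilon> ^ l * 0) = 0"
      using v ey unfolding second_discrete_green_def by auto
    obtain v' where v': "continuous_on {0..} v'" "\<And>t. t \<ge> 0 \<Longrightarrow> (v (\<epsilon> *\<^sub>R y) has_vector_derivative v' t) (at t within {0..})"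
      "\<And>t. t > 0 \<Longrightarrow> v' t + difference_op l lhat a \<epsilon> (\<lambda>z. v z t) (\<epsilon> *\<^sub>R y) = discrete_delta \<epsilon> (\<epsilon> *\<^sub>R y)"
      using v ey unfolding second_discrete_green_def by blast
    define w where "w t = complex_of_real ?c * (of_real (\<epsilon> ^ l) * v' (\<epsilon> ^ l * t))" for t
    show "\<exists>v'. continuous_on {0..} v' \<and>
         (\<forall>t\<ge>0. ((\<lambda>\<tau>. complex_of_real ?c * v (\<epsilon> *\<^sub>R y) (\<epsilon> ^ l * \<tau>)) has_vector_derivative v' t) (at t within {0..})) \<and>
         (\<forall>t>0. v' t + difference_op l lhat a 1 (\<lambda>y. complex_of_real ?c * v (\<epsilon> *\<^sub>R y) (\<epsilon> ^ l * t)) y = discrete_delta 1 y)"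
    proof (intro exI[of _ w] conjI allI impI)
      show "continuous_on {0..} w" unfolding w_def using \<epsilon>
        by (intro continuous_intros continuous_on_compose2[OF v'(1)]) auto
      fix t :: real
      show "((\<lambda>\<tau>. complex_of_real ?c * v (\<epsilon> *\<^sub>R y) (\<epsilon> ^ l * \<tau>)) has_vector_derivative w t) (at t within {0..})" if t: "t \<ge> 0"
      proof -
        have "(v (\<epsilon> *\<^sub>R y) \<circ> (\<lambda>\<tau>. \<epsilon> ^ l * \<tau>) has_vector_derivative \<epsilon> ^ l *\<^sub>R v' (\<epsilon> ^ l * t)) (at t within {0..})"
        proof (rule vector_diff_chain_within)
          show "((*) (\<epsilon> ^ l) has_vector_derivative \<epsilon> ^ l) (at t within {0..})"
            by (auto intro!: derivative_eq_intros simp: has_vector_derivative_def)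
          show "(v (\<epsilon> *\<^sub>R y) has_vector_derivative v' (\<epsilon> ^ l * t)) (at (\<epsilon> ^ l * t) within (*) (\<epsilon> ^ l) ` {0..})"
            by (rule has_vector_derivative_within_subset[OF v'(2)]) (use t \<epsilon> in auto)
        qed
        from has_vector_derivative_mult_right[OF this, of "complex_of_real ?c"] show ?thesis
          by (simp add: w_def o_def scaleR_conv_of_real)
      qed
      show "w t + difference_op l lhat a 1 (\<lambda>y. complex_of_real ?c * v (\<epsilon> *\<^sub>R y) (\<epsilon> ^ l * t)) y = discrete_delta 1 y" if t: "t > 0"
      proof -
        have "w t + difference_op l lhat a 1 (\<lambda>y. complex_of_real ?c * v (\<epsilon> *\<^sub>R y) (\<epsilon> ^ l * t)) y = 
          complex_of_real ?c * of_real (\<epsilon> ^ l) * (v' (\<epsilon> ^ l * t) + difference_op l lhat a \<epsilon> (\<lambda>z. v z (\<epsilon> ^ l * t)) (\<epsilon> *\<^sub>R y))"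
          using difference_op_rescale[OF \<epsilon>, of l lhat a "complex_of_real ?c" "\<lambda>z. v z (\<epsilon> ^ l * t)" y]
          by (simp add: w_def distrib_left mult.assoc)
        also have "\<dots> = complex_of_real ?c * of_real (\<epsilon> ^ l) * discrete_delta \<epsilon> (\<epsilon> *\<^sub>R y)"
          using v'(3)[of "\<epsilon> ^ l * t"] t \<epsilon> by simp
        also have "\<dots> = discrete_delta 1 y" using \<epsilon> by (simp add: discrete_delta_def)
        finally show ?thesis .
      qed
    qed
  qed
qed

subsection \<open>Uniform expansion of the exponential of the rescaled symbol\<close>

text \<open>Mean value inequality on the convex half plane where the real part is at least
  \<open>m\<close> and the derivative of \<open>exp (- z)\<close> at most
  \<open>exp (- m)\<close>.\<close>

lemma norm_exp_minus_diff_le: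
  assumes "Re z \<ge> m" "Re w \<ge> m"
  shows "norm (exp (- z) - exp (- w)) \<le> norm (z - w) * exp (- m)"
proof -
  have "norm (exp (- z) - exp (- w)) \<le> exp (- m) * norm (z - w)"
  proof (rule field_differentiable_bound[where S="{z. Re z \<ge> m}" and f'="\<lambda>z. - exp (- z)"])
    show "convex {z. m \<le> Re z}" by (simp add: convex_halfspace_Re_ge)
    show "((\<lambda>z. exp (- z)) has_field_derivative - exp (- z)) (at z within {z. m \<le> Re z})" for z
      by (auto intro!: derivative_eq_intros)
  qed (use assms in \<open>auto simp: norm_exp_eq_Re\<close>)
  then show ?thesis by (simp add: mult.commute)
qed

section \<open>Quantitative Taylor expansion of entire functions\<close>

definition taylor_coeff :: "(complex \<Rightarrow> complex) \<Rightarrow> nat \<Rightarrow> complex" where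
  "taylor_coeff f m = (deriv ^^ m) f 0 / fact m"

lemma taylor_coeff_bound:
  assumes f: "f holomorphic_on UNIV" and r: "r > 0" and B: "\<And>z. norm z \<le> r \<Longrightarrow> norm (f z) \<le> B"
  shows "norm (taylor_coeff f m) \<le> B / r ^ m"
proof -
  have "norm ((deriv ^^ m) f 0) \<le> fact m * B / r ^ m"
    using f r B by (intro Cauchy_inequality) (auto intro: holomorphic_on_subset holomorphic_on_imp_continuous_on continuous_on_subset)
  then show ?thesis by (simp add: taylor_coeff_def norm_divide field_simps)
qed

text \<open>Cauchy's inequality bounds the terms by a geometric series of ratio
  \<open>q = norm z / r \<le> 1 / 2\<close>; the factor 2 bounds \<open>1 / (1 - q)\<close>.\<close>

lemma taylor_remainder_bound:
  assumes f: "f holomorphic_on UNIV" and r: "r > 0" and B: "\<And>z. norm z \<le> r \<Longrightarrow> norm (f z) \<le> B"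
    and z: "norm z \<le> r / 2"
  shows "norm (f z - (\<Sum>m\<le>K. taylor_coeff f m * z ^ m)) \<le> 2 * B * (norm z / r) ^ (K + 1)"
proof -
  define q where "q = norm z / r"
  have q: "0 \<le> q" "q \<le> 1 / 2" using z r by (auto simp: q_def field_simps)
  have B0: "B \<ge> 0" using B[of 0] r norm_ge_zero order_trans by (metis norm_zero less_imp_le)
  have "(\<lambda>m. (deriv ^^ m) f 0 / fact m * (z - 0) ^ m) sums f z"
    using f r z by (intro holomorphic_power_series[of _ _ r]) (auto intro: holomorphic_on_subset)
  then have s: "(\<lambda>m. taylor_coeff f m * z ^ m) sums f z" by (simp add: taylor_coeff_def)
  have le: "norm (taylor_coeff f m * z ^ m) \<le> B * q ^ m" for m
    using mult_right_mono[OF taylor_coeff_bound[OF f r B, of m], of "norm z ^ m"]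
    by (simp add: norm_mult norm_power q_def power_divide)
  have "(\<lambda>m. taylor_coeff f (m + (K + 1)) * z ^ (m + (K + 1))) sums (f z - (\<Sum>m<K + 1. taylor_coeff f m * z ^ m))"
    by (rule sums_split_initial_segment[OF s])
  then have e: "f z - (\<Sum>m\<le>K. taylor_coeff f m * z ^ m) = suminf (\<lambda>m. taylor_coeff f (m + (K + 1)) * z ^ (m + (K + 1)))"
    by (simp add: sums_iff lessThan_Suc_atMost)
  have g: "(\<lambda>m. B * q ^ (m + (K + 1))) sums (B * q ^ (K + 1) * (1 / (1 - q)))"
    using sums_mult[OF geometric_sums[of q], of "B * q ^ (K + 1)"] q by (simp add: power_add mult_ac)
  have "norm (suminf (\<lambda>m. taylor_coeff f (m + (K + 1)) * z ^ (m + (K + 1)))) \<le> suminf (\<lambda>m. B * q ^ (m + (K + 1)))"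
  proof (rule norm_suminf_le)
    show "norm (taylor_coeff f (m + (K + 1)) * z ^ (m + (K + 1))) \<le> B * q ^ (m + (K + 1))" for m
      by (rule le)
    show "summable (\<lambda>m. B * q ^ (m + (K + 1)))" using g by (rule sums_summable)
  qed
  also have "\<dots> = B * q ^ (K + 1) * (1 / (1 - q))" using g by (simp add: sums_iff)
  also have "\<dots> \<le> B * q ^ (K + 1) * 2"
    using q B0 by (intro mult_left_mono) (auto simp: field_simps)
  finally show ?thesis unfolding e q_def by (simp add: mult_ac)
qed

section \<open>The rescaled symbol as an entire function of the scaling parameter\<close>

definition exp_quot :: "complex \<Rightarrow> complex" where
  "exp_quot z = (if z = 0 then 1 else (exp z - 1) / z)"

lemma exp_quot_mult: "z * exp_quot z = exp z - 1"
  by (simp add: exp_quot_def)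

lemma exp_quot_holomorphic: "exp_quot holomorphic_on UNIV"
proof -
  have "(\<lambda>z::complex. if z = 0 then deriv (\<lambda>z. exp z - 1) 0 else (exp z - 1) / z - (exp 0 - 1) / (z - 0)) holomorphic_on UNIV"
    by (intro pole_theorem holomorphic_intros) auto
  moreover have "deriv (\<lambda>z::complex. exp z - 1) 0 = 1"
    by (rule DERIV_imp_deriv) (auto intro!: derivative_eq_intros)
  ultimately show ?thesis by (simp add: exp_quot_def[abs_def] cong: if_cong)
qed

lemma norm_exp_quot_le: "norm (exp_quot z) \<le> exp (norm z)"
proof (cases "z = 0")
  case False
  have "norm (exp z - exp 0) \<le> exp (norm z) * norm (z - 0)"
  proof (rule field_differentiable_bound[where S="cball 0 (norm z)" and f'=exp])
    show "norm (exp w) \<le> exp (norm z)" if "w \<in> cball 0 (norm z)" for w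
      using that norm_exp[of w] by (auto intro: order_trans)
  qed (auto intro!: derivative_eq_intros)
  then show ?thesis using False by (simp add: exp_quot_def norm_divide field_simps)
qed (simp add: exp_quot_def)

text \<open>Dividing each factor \<open>exp (\<plusminus> i s \<xi>\<^sub>k) - 1\<close> by \<open>s\<close> makes \<open>s\<^sup>-\<^sup>l A (s \<xi>)\<close> an entire function of \<open>s\<close>.\<close>

definition scaled_term :: "('d::finite + 'd \<Rightarrow> nat) \<Rightarrow> real ^ 'd \<Rightarrow> complex \<Rightarrow> complex" where
  "scaled_term \<nu> \<xi> s = (\<Prod>k\<in>UNIV. (- (\<i> * of_real (\<xi> $ k)) * exp_quot (- (\<i> * of_real (\<xi> $ k)) * s)) ^ \<nu> (Inl k) *
      ((\<i> * of_real (\<xi> $ k)) * exp_quot ((\<i> * of_real (\<xi> $ k)) * s)) ^ \<nu> (Inr k))"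

text \<open>The subtraction in the exponent is exact because only multi-indices of modulus at least
  \<open>l\<close> occur; so no negative power of \<open>s\<close> arises.\<close>

definition scaled_symbol :: "nat \<Rightarrow> nat \<Rightarrow> (('d::finite + 'd \<Rightarrow> nat) \<Rightarrow> complex) \<Rightarrow> real ^ 'd \<Rightarrow> complex \<Rightarrow> complex" where
  "scaled_symbol l lhat a \<xi> s = (\<Sum>\<nu> | l \<le> mi_abs \<nu> \<and> mi_abs \<nu> \<le> lhat. a \<nu> * (s ^ (mi_abs \<nu> - l) * scaled_term \<nu> \<xi> s))"

lemma mi_abs_sum: "mi_abs (\<nu> :: 'd::finite + 'd \<Rightarrow> nat) = (\<Sum>k\<in>UNIV. \<nu> (Inl k) + \<nu> (Inr k))"
proof -
  have "mi_abs \<nu> = (\<Sum>i\<in>UNIV <+> UNIV. \<nu> i)" by (simp add: mi_abs_def UNIV_Plus_UNIV)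
  also have "\<dots> = (\<Sum>k\<in>UNIV. \<nu> (Inl k)) + (\<Sum>k\<in>UNIV. \<nu> (Inr k))"
    by (subst sum.Plus) auto
  finally show ?thesis by (simp add: sum.distrib)
qed

lemma delta_symbol_scaled:
  "delta_symbol 1 \<nu> (s *\<^sub>R \<xi>) = of_real s ^ mi_abs \<nu> * scaled_term \<nu> \<xi> (of_real s)"
proof -
  have 1: "cis x - 1 = of_real s * ((\<i> * of_real z) * exp_quot ((\<i> * of_real z) * of_real s))" if "x = s * z" for x z
    using exp_quot_mult[of "\<i> * of_real z * of_real s"] that by (simp add: cis_conv_exp mult_ac)
  have 2: "cis (- (s * z)) - 1 = of_real s * (- (\<i> * of_real z) * exp_quot (- (\<i> * of_real z) * of_real s))" for z
    using 1[of "- (s * z)" "- z"] by simp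
  have "delta_symbol 1 \<nu> (s *\<^sub>R \<xi>) = (\<Prod>k\<in>UNIV. of_real s ^ (\<nu> (Inl k) + \<nu> (Inr k)) * 
     ((- (\<i> * of_real (\<xi> $ k)) * exp_quot (- (\<i> * of_real (\<xi> $ k)) * of_real s)) ^ \<nu> (Inl k) *
      ((\<i> * of_real (\<xi> $ k)) * exp_quot ((\<i> * of_real (\<xi> $ k)) * of_real s)) ^ \<nu> (Inr k)))"
    unfolding delta_symbol_def
  proof (intro prod.cong refl)
    fix k
    have e: "cis (- (1 * (s *\<^sub>R \<xi>) $ k)) - 1 = of_real s * (- (\<i> * of_real (\<xi> $ k)) * exp_quot (- (\<i> * of_real (\<xi> $ k)) * of_real s))"
      "cis (1 * (s *\<^sub>R \<xi>) $ k) - 1 = of_real s * ((\<i> * of_real (\<xi> $ k)) * exp_quot ((\<i> * of_real (\<xi> $ k)) * of_real s))"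
      using 1[of "s * \<xi> $ k" "\<xi> $ k"] 2[of "\<xi> $ k"] by simp_all
    have c: "(x * y) ^ i * (x * z) ^ j = x ^ (i + j) * (y ^ i * z ^ j)" for x y z :: complex and i j
      by (simp add: power_mult_distrib power_add mult_ac)
    show "(cis (- (1 * (s *\<^sub>R \<xi>) $ k)) - 1) ^ \<nu> (Inl k) * (cis (1 * (s *\<^sub>R \<xi>) $ k) - 1) ^ \<nu> (Inr k) =
      of_real s ^ (\<nu> (Inl k) + \<nu> (Inr k)) * 
     ((- (\<i> * of_real (\<xi> $ k)) * exp_quot (- (\<i> * of_real (\<xi> $ k)) * of_real s)) ^ \<nu> (Inl k) *
      ((\<i> * of_real (\<xi> $ k)) * exp_quot ((\<i> * of_real (\<xi> $ k)) * of_real s)) ^ \<nu> (Inr k))"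
      unfolding e c ..
  qed
  then show ?thesis
    unfolding prod.distrib[of "\<lambda>k. of_real s ^ (\<nu> (Inl k) + \<nu> (Inr k))"] mi_abs_sum scaled_term_def power_sum .
qed

lemma scaled_symbol_eq:
  assumes "s > 0"
  shows "scaled_symbol l lhat a \<xi> (of_real s) = difference_symbol l lhat a (s *\<^sub>R \<xi>) / of_real s ^ l"
proof -
  have "difference_symbol l lhat a (s *\<^sub>R \<xi>) = (\<Sum>\<nu> | l \<le> mi_abs \<nu> \<and> mi_abs \<nu> \<le> lhat. a \<nu> * (of_real s ^ mi_abs \<nu> * scaled_term \<nu> \<xi> (of_real s)))"
    using difference_symbol_delta_symbol[of l lhat a 1 "s *\<^sub>R \<xi>"] by (simp add: delta_symbol_scaled)
  then show ?thesis
    using assms unfolding scaled_symbol_def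
    by (auto simp: sum_divide_distrib power_diff intro!: sum.cong)
qed

lemma scaled_term_holomorphic: "scaled_term \<nu> \<xi> holomorphic_on UNIV"
  unfolding scaled_term_def[abs_def]
  by (intro holomorphic_intros holomorphic_on_compose_gen[OF _ exp_quot_holomorphic, unfolded o_def]) auto

lemma scaled_symbol_holomorphic: "scaled_symbol l lhat a \<xi> holomorphic_on UNIV"
  unfolding scaled_symbol_def[abs_def]
  by (intro holomorphic_intros scaled_term_holomorphic)

lemma norm_scaled_term_le:
  assumes "norm s * norm \<xi> \<le> 1"
  shows "norm (scaled_term \<nu> \<xi> s) \<le> (norm \<xi> * exp 1) ^ mi_abs \<nu>"
proof -
  have 1: "norm (c * of_real (\<xi> $ k) * exp_quot (c * of_real (\<xi> $ k) * s)) \<le> norm \<xi> * exp 1" if "norm c = 1" for k c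
  proof -
    have n: "\<bar>\<xi> $ k\<bar> \<le> norm \<xi>" by (rule component_le_norm_cart)
    have "norm (c * of_real (\<xi> $ k) * s) \<le> norm \<xi> * norm s"
      using n that by (auto simp: norm_mult intro: mult_right_mono)
    then have "norm (exp_quot (c * of_real (\<xi> $ k) * s)) \<le> exp 1"
      using assms by (intro order_trans[OF norm_exp_quot_le]) (auto simp: mult.commute)
    then have "\<bar>\<xi> $ k\<bar> * norm (exp_quot (c * of_real (\<xi> $ k) * s)) \<le> norm \<xi> * exp 1"
      using n by (intro mult_mono) auto
    then show ?thesis using that by (simp add: norm_mult)
  qed
  have "norm (scaled_term \<nu> \<xi> s) \<le> (\<Prod>k\<in>UNIV. (norm \<xi> * exp 1) ^ (\<nu> (Inl k) + \<nu> (Inr k)))"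
    unfolding scaled_term_def prod_norm[symmetric]
  proof (intro prod_mono conjI norm_ge_zero)
    fix k
    show "norm ((- (\<i> * of_real (\<xi> $ k)) * exp_quot (- (\<i> * of_real (\<xi> $ k)) * s)) ^ \<nu> (Inl k) *
      ((\<i> * of_real (\<xi> $ k)) * exp_quot ((\<i> * of_real (\<xi> $ k)) * s)) ^ \<nu> (Inr k)) \<le> (norm \<xi> * exp 1) ^ (\<nu> (Inl k) + \<nu> (Inr k))"
      unfolding norm_mult[of "_ ^ _"] norm_power power_add
      using 1[of "-\<i>" k] 1[of \<i> k] by (intro mult_mono power_mono) auto
  qed
  then show ?thesis by (simp add: mi_abs_sum power_sum)
qed

text \<open>For \<open>|s| |\<xi>| \<le> 1\<close> each difference quotient is at most
  \<open>e |\<xi>|\<close>, and the surplus factor \<open>|s \<xi>| ^ (mi_abs \<nu> - l)\<close> is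
  at most 1. The estimate is valid for complex \<open>s\<close>, on a disc whose radius shrinks like
  \<open>1 / |\<xi>|\<close>; the Cauchy estimates with uniform constants use discs of this
  kind.\<close>

lemma norm_scaled_symbol_le:
  fixes a :: "('d::finite + 'd \<Rightarrow> nat) \<Rightarrow> complex"
  shows "\<exists>C>0. \<forall>\<xi> s. norm s * norm \<xi> \<le> 1 \<longrightarrow> norm (scaled_symbol l lhat a \<xi> s) \<le> C * norm \<xi> ^ l"
proof -
  let ?I = "{\<nu>::'d + 'd \<Rightarrow> nat. l \<le> mi_abs \<nu> \<and> mi_abs \<nu> \<le> lhat}"
  let ?C = "\<Sum>\<nu>\<in>?I. norm (a \<nu>) * exp 1 ^ lhat"
  have "norm (scaled_symbol l lhat a \<xi> s) \<le> (?C + 1) * norm \<xi> ^ l" if s: "norm s * norm \<xi> \<le> 1" for \<xi> :: "real ^ 'd" and s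
  proof -
    have "norm (scaled_symbol l lhat a \<xi> s) \<le> (\<Sum>\<nu>\<in>?I. (norm (a \<nu>) * exp 1 ^ lhat) * norm \<xi> ^ l)"
      unfolding scaled_symbol_def
    proof (rule sum_norm_le)
      fix \<nu> :: "'d + 'd \<Rightarrow> nat" assume \<nu>: "\<nu> \<in> ?I"
      then have m: "mi_abs \<nu> = (mi_abs \<nu> - l) + l" by simp
      have "norm (s ^ (mi_abs \<nu> - l) * scaled_term \<nu> \<xi> s) \<le> norm s ^ (mi_abs \<nu> - l) * (norm \<xi> * exp 1) ^ mi_abs \<nu>"
        using norm_scaled_term_le[OF s] by (simp add: norm_mult norm_power mult_left_mono)
      also have "\<dots> = (norm s * norm \<xi>) ^ (mi_abs \<nu> - l) * norm \<xi> ^ l * exp 1 ^ mi_abs \<nu>"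
      proof -
        have "norm \<xi> ^ mi_abs \<nu> = norm \<xi> ^ (mi_abs \<nu> - l) * norm \<xi> ^ l"
          using m power_add by metis
        then show ?thesis by (simp add: power_mult_distrib)
      qed
      also have "\<dots> \<le> 1 * norm \<xi> ^ l * exp 1 ^ lhat"
      proof -
        have "(norm s * norm \<xi>) ^ (mi_abs \<nu> - l) \<le> 1" using s by (intro power_le_one) auto
        moreover have "exp 1 ^ mi_abs \<nu> \<le> (exp 1 ^ lhat :: real)" using \<nu> by (intro power_increasing) auto
        ultimately show ?thesis by (intro mult_mono) auto
      qed
      finally show "norm (a \<nu> * (s ^ (mi_abs \<nu> - l) * scaled_term \<nu> \<xi> s)) \<le> (norm (a \<nu>) * exp 1 ^ lhat) * norm \<xi> ^ l"
        by (simp add: norm_mult[of "a \<nu>"] mult_left_mono mult.assoc mult.commute[of "exp 1 ^ lhat"])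
    qed
    also have "\<dots> = ?C * norm \<xi> ^ l" by (simp add: sum_distrib_right)
    also have "\<dots> \<le> (?C + 1) * norm \<xi> ^ l" by (intro mult_right_mono) auto
    finally show ?thesis .
  qed
  moreover have "?C + 1 > 0" by (intro add_nonneg_pos sum_nonneg) auto
  ultimately show ?thesis by blast
qed

text \<open>Uniqueness of asymptotic coefficients: once the coefficients below \<open>m\<close> are
  known to vanish, division by \<open>s ^ m\<close> leaves \<open>d m\<close> as the limit, while
  the bound tends to 0.\<close>

lemma poly_bigo_zero:
  fixes d :: "nat \<Rightarrow> complex"
  assumes ev: "eventually (\<lambda>s. norm (\<Sum>m\<le>K. d m * of_real s ^ m) \<le> C * s ^ (K + 1)) (at_right 0)"
    and "m \<le> K"
  shows "d m = 0"
  using \<open>m \<le> K\<close>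
proof (induction m rule: less_induct)
  case (less m)
  let ?D = "\<lambda>s::real. \<Sum>j=m..K. d j * of_real s ^ (j - m)"
  have e: "(\<Sum>j\<le>K. d j * of_real s ^ j) = of_real s ^ m * ?D s" for s
  proof -
    have "(\<Sum>j\<le>K. d j * of_real s ^ j) = (\<Sum>j=m..K. d j * of_real s ^ j)"
      using less by (intro sum.mono_neutral_right) (auto simp: not_le)
    also have "\<dots> = of_real s ^ m * ?D s"
      by (auto simp: sum_distrib_left power_add[symmetric] mult_ac intro!: sum.cong)
    finally show ?thesis .
  qed
  have "(?D \<longlongrightarrow> (\<Sum>j=m..K. d j * of_real 0 ^ (j - m))) (at_right 0)"
    by (intro tendsto_intros)
  also have "(\<Sum>j=m..K. d j * of_real 0 ^ (j - m)) = (\<Sum>j=m..K. if j = m then d j else 0)"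
    by (intro sum.cong) auto
  also have "\<dots> = d m" using less by simp
  finally have 1: "(?D \<longlongrightarrow> d m) (at_right 0)" .
  have 2: "(?D \<longlongrightarrow> 0) (at_right 0)"
  proof (rule Lim_null_comparison)
    show "eventually (\<lambda>s. norm (?D s) \<le> C * s ^ (K + 1 - m)) (at_right 0)"
      using ev eventually_at_right_less[of 0]
    proof eventually_elim
      case (elim s)
      then have "s ^ m * norm (?D s) \<le> C * (s ^ m * s ^ (K + 1 - m))"
        using less unfolding e by (simp add: norm_mult norm_power power_add[symmetric])
      then have "s ^ m * norm (?D s) \<le> s ^ m * (C * s ^ (K + 1 - m))" by (simp add: mult_ac)
      then show ?case using elim by simp
    qed
    have "((\<lambda>s::real. C * s ^ (K + 1 - m)) \<longlongrightarrow> C * 0 ^ (K + 1 - m)) (at_right 0)"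
      by (intro tendsto_intros)
    then show "((\<lambda>s::real. C * s ^ (K + 1 - m)) \<longlongrightarrow> 0) (at_right 0)" using less by (simp add: zero_power)
  qed
  show ?case using tendsto_unique[OF _ 1 2] by simp
qed

section \<open>Taylor coefficients and the assumed expansion\<close>

locale green_expansion = lattice_scheme l lhat a
  for l lhat :: nat and a :: "('d::finite + 'd \<Rightarrow> nat) \<Rightarrow> complex" +
  fixes M :: nat and b :: "('d \<Rightarrow> nat) \<Rightarrow> complex" and P :: "nat \<Rightarrow> 'd polyn"
  assumes M_ge_1: "1 \<le> M" and elliptic: "strongly_elliptic l b"
    and approx: "approximates_of_order M l lhat a b"
    and expansion: "exp_expansion l lhat a b P"
begin

abbreviation "B \<equiv> diff_symbol l b"

text \<open>The full coefficient of \<open>s ^ m\<close>, with the factor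
  \<open>exp (- B \<xi>)\<close> included. It turns out to be the Taylor coefficient of the rescaled
  exponential, and its Fourier integral is \<open>H_fun l b P m\<close>.\<close>

definition exp_coeff :: "nat \<Rightarrow> real ^ 'd \<Rightarrow> complex" where
  "exp_coeff m \<xi> = exp (- B \<xi>) * (if m = 0 then 1 else peval (P (m + l)) \<xi>)"

text \<open>The limit for positive \<open>s\<close> tending to 0 is computed twice: by continuity of
  the entire function, and by approximation of order at least 1.\<close>

lemma scaled_symbol_0: "scaled_symbol l lhat a \<xi> 0 = B \<xi>"
proof -
  have "isCont (scaled_symbol l lhat a \<xi>) 0"
    using holomorphic_on_imp_continuous_on[OF scaled_symbol_holomorphic[of l lhat a \<xi>]]
      continuous_on_eq_continuous_at[OF open_UNIV] by blast
  then have "((\<lambda>s. scaled_symbol l lhat a \<xi> (of_real s)) \<longlongrightarrow> scaled_symbol l lhat a \<xi> 0) (at_right 0)"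
    by (rule isCont_tendsto_compose) (auto intro!: tendsto_eq_intros)
  moreover obtain C where C: "C > 0" "\<And>s. s > 0 \<Longrightarrow> norm (A (s *\<^sub>R \<xi>) / complex_of_real s ^ l - B \<xi>) \<le> C * s ^ M"
    using approximates_symbol[OF approx] by blast
  have "((\<lambda>s. scaled_symbol l lhat a \<xi> (of_real s) - B \<xi>) \<longlongrightarrow> 0) (at_right 0)"
  proof (rule Lim_null_comparison)
    show "eventually (\<lambda>s. norm (scaled_symbol l lhat a \<xi> (of_real s) - B \<xi>) \<le> C * s ^ M) (at_right 0)"
      using eventually_at_right_less[of 0] by eventually_elim (simp add: scaled_symbol_eq C)
    have "((\<lambda>s::real. C * s ^ M) \<longlongrightarrow> C * 0 ^ M) (at_right 0)" by (intro tendsto_intros)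
    then show "((\<lambda>s::real. C * s ^ M) \<longlongrightarrow> 0) (at_right 0)" using M_ge_1 by (simp add: zero_power)
  qed
  then have "((\<lambda>s. scaled_symbol l lhat a \<xi> (of_real s)) \<longlongrightarrow> B \<xi>) (at_right 0)"
    by (rule LIM_zero_cancel)
  ultimately show ?thesis using tendsto_unique trivial_limit_at_right_real by blast
qed

definition exp_scaled :: "real ^ 'd \<Rightarrow> complex \<Rightarrow> complex" where
  "exp_scaled \<xi> s = exp (- scaled_symbol l lhat a \<xi> s)"

lemma exp_scaled_holomorphic: "exp_scaled \<xi> holomorphic_on UNIV"
  unfolding exp_scaled_def[abs_def] by (intro holomorphic_intros scaled_symbol_holomorphic)

lemma exp_scaled_of_real: "s > 0 \<Longrightarrow> exp_scaled \<xi> (of_real s) = exp (- (A (s *\<^sub>R \<xi>) / of_real s ^ l))"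
  by (simp add: exp_scaled_def scaled_symbol_eq)

text \<open>The constants may depend on \<open>\<xi>\<close>, as this serves to identify
  coefficients at each \<open>\<xi>\<close>; uniform estimates follow only after the lower bounds on
  the symbols.\<close>

lemma exp_scaled_taylor_local:
  "\<exists>C r. r > 0 \<and> (\<forall>s. norm s \<le> r \<longrightarrow> norm (exp_scaled \<xi> s - (\<Sum>m\<le>K. taylor_coeff (exp_scaled \<xi>) m * s ^ m)) \<le> C * norm s ^ (K + 1))"
proof -
  have "compact (exp_scaled \<xi> ` cball 0 1)"
    by (intro compact_continuous_image holomorphic_on_imp_continuous_on holomorphic_on_subset[OF exp_scaled_holomorphic]) auto
  then obtain D where D: "\<And>z. norm z \<le> 1 \<Longrightarrow> norm (exp_scaled \<xi> z) \<le> D"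
    using compact_imp_bounded bounded_iff by (metis (no_types, lifting) imageI mem_cball_0)
  show ?thesis
    using taylor_remainder_bound[OF exp_scaled_holomorphic zero_less_one D, where K=K] by (intro exI[of _ "2 * D"] exI[of _ "1/2"]) auto
qed

text \<open>Taylor expansion and assumed expansion approximate the same function to the same order,
  so the coefficients coincide. This is what makes the polynomials \<open>P\<close> accessible to
  Cauchy estimates.\<close>

lemma taylor_coeff_exp_scaled: "taylor_coeff (exp_scaled \<xi>) m = exp_coeff m \<xi>"
proof -
  obtain C r where C: "r > 0" "\<And>s. norm s \<le> r \<Longrightarrow> norm (exp_scaled \<xi> s - (\<Sum>j\<le>m. taylor_coeff (exp_scaled \<xi>) j * s ^ j)) \<le> C * norm s ^ (m + 1)"
    using exp_scaled_taylor_local[of \<xi> m] by blast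
  have "(\<lambda>s::real. exp (- (A (s *\<^sub>R \<xi>) / complex_of_real s ^ l)) - exp (- B \<xi>) *
                   (1 + (\<Sum>j=1..m. complex_of_real s ^ j * peval (P (j + l)) \<xi>)))
             \<in> O[at_right 0](\<lambda>s. complex_of_real s ^ (m + 1))"
    using expansion unfolding exp_expansion_def by blast
  then obtain c where c: "eventually (\<lambda>s::real. norm (exp (- (A (s *\<^sub>R \<xi>) / complex_of_real s ^ l)) - exp (- B \<xi>) *
                   (1 + (\<Sum>j=1..m. complex_of_real s ^ j * peval (P (j + l)) \<xi>))) \<le> c * norm (complex_of_real s ^ (m + 1))) (at_right 0)"
    by (elim landau_o.bigE)
  have e: "exp (- B \<xi>) * (1 + (\<Sum>j=1..m. complex_of_real s ^ j * peval (P (j + l)) \<xi>)) = (\<Sum>j\<le>m. exp_coeff j \<xi> * of_real s ^ j)" for s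
  proof -
    have "(\<Sum>j\<le>m. exp_coeff j \<xi> * of_real s ^ j) = exp_coeff 0 \<xi> + (\<Sum>j=1..m. exp_coeff j \<xi> * of_real s ^ j)"
      by (simp add: atMost_atLeast0 sum.atLeast_Suc_atMost)
    then show ?thesis by (simp add: exp_coeff_def distrib_left sum_distrib_left mult_ac)
  qed
  have r: "eventually (\<lambda>s::real. s < r) (at_right 0)" using C(1) by (intro eventually_at_rightI) auto
  have "eventually (\<lambda>s. norm (\<Sum>j\<le>m. (taylor_coeff (exp_scaled \<xi>) j - exp_coeff j \<xi>) * of_real s ^ j) \<le> (C + c) * s ^ (m + 1)) (at_right 0)"
    using c r eventually_at_right_less[of 0]
  proof eventually_elim
    case (elim s)
    have "(\<Sum>j\<le>m. (taylor_coeff (exp_scaled \<xi>) j - exp_coeff j \<xi>) * of_real s ^ j) = 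
      (exp_scaled \<xi> (of_real s) - (\<Sum>j\<le>m. exp_coeff j \<xi> * of_real s ^ j)) - (exp_scaled \<xi> (of_real s) - (\<Sum>j\<le>m. taylor_coeff (exp_scaled \<xi>) j * of_real s ^ j))"
      by (simp add: left_diff_distrib sum_subtractf)
    also have "norm \<dots> \<le> c * s ^ (m + 1) + C * s ^ (m + 1)"
      using elim(1) C(2)[of "of_real s"] elim exp_scaled_of_real[of s \<xi>] unfolding e
      by (intro order_trans[OF norm_triangle_ineq4 add_mono]) (auto simp: norm_mult norm_power)
    finally show ?case by (simp add: algebra_simps)
  qed
  from poly_bigo_zero[OF this, of m] show ?thesis by simp
qed

text \<open>Approximation of order \<open>M\<close> makes the rescaled exponential agree with
  \<open>exp (- B \<xi>)\<close> up to \<open>O (s ^ M)\<close>, which leaves no room for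
  coefficients of order 1 to \<open>M - 1\<close>.\<close>

lemma exp_coeff_vanish:
  assumes "1 \<le> m" "m < M"
  shows "exp_coeff m \<xi> = 0"
proof -
  let ?K = "M - 1"
  obtain C r where C: "r > 0" "\<And>s. norm s \<le> r \<Longrightarrow> norm (exp_scaled \<xi> s - (\<Sum>j\<le>?K. taylor_coeff (exp_scaled \<xi>) j * s ^ j)) \<le> C * norm s ^ (?K + 1)"
    using exp_scaled_taylor_local[of \<xi> ?K] by blast
  obtain D where D: "D > 0" "\<And>s. s > 0 \<Longrightarrow> norm (A (s *\<^sub>R \<xi>) / complex_of_real s ^ l - B \<xi>) \<le> D * s ^ M"
    using approximates_symbol[OF approx] by blast
  have r: "eventually (\<lambda>s::real. s < min r 1) (at_right 0)"
    unfolding eventually_at_right_field using C(1) by (intro exI[of _ "min r 1"]) auto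
  \<comment> \<open>Without its coefficient of order 0 the Taylor polynomial of degree
    \<open>M - 1\<close> must be \<open>O (s ^ M)\<close>. For \<open>s \<le> 1\<close> the two
    exponents differ by at most \<open>D\<close>, whence the factor
    \<open>exp (- (Re (B \<xi>) - D))\<close>.\<close>
  have "eventually (\<lambda>s. norm (\<Sum>j\<le>?K. (exp_coeff j \<xi> - (if j = 0 then exp_coeff 0 \<xi> else 0)) * of_real s ^ j) \<le> (D * exp (- (Re (B \<xi>) - D)) + C) * s ^ (?K + 1)) (at_right 0)"
    using r eventually_at_right_less[of 0]
  proof eventually_elim
    case (elim s)
    have M: "?K + 1 = M" using M_ge_1 by simp
    have "(\<Sum>j\<le>?K. (exp_coeff j \<xi> - (if j = 0 then exp_coeff 0 \<xi> else 0)) * of_real s ^ j) = 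
      (exp_scaled \<xi> (of_real s) - exp_coeff 0 \<xi>) - (exp_scaled \<xi> (of_real s) - (\<Sum>j\<le>?K. taylor_coeff (exp_scaled \<xi>) j * of_real s ^ j))"
      by (simp add: left_diff_distrib sum_subtractf taylor_coeff_exp_scaled if_distrib[of "\<lambda>x. x * _"] cong: if_cong)
    also have "norm \<dots> \<le> D * exp (- (Re (B \<xi>) - D)) * s ^ (?K + 1) + C * s ^ (?K + 1)"
    proof (rule order_trans[OF norm_triangle_ineq4 add_mono])
      let ?a = "A (s *\<^sub>R \<xi>) / complex_of_real s ^ l"
      have d: "norm (?a - B \<xi>) \<le> D * s ^ M" using D elim by auto
      also have "\<dots> \<le> D * 1" using D elim by (intro mult_left_mono power_le_one) auto
      finally have "Re ?a \<ge> Re (B \<xi>) - D" using abs_Re_le_cmod[of "?a - B \<xi>"] by simp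
      then have "norm (exp (- ?a) - exp (- B \<xi>)) \<le> norm (?a - B \<xi>) * exp (- (Re (B \<xi>) - D))"
        using D by (intro norm_exp_minus_diff_le) auto
      also have "\<dots> \<le> (D * s ^ M) * exp (- (Re (B \<xi>) - D))" using d by (intro mult_right_mono) auto
      finally show "norm (exp_scaled \<xi> (of_real s) - exp_coeff 0 \<xi>) \<le> D * exp (- (Re (B \<xi>) - D)) * s ^ (?K + 1)"
        using elim unfolding M by (simp add: exp_scaled_of_real exp_coeff_def mult_ac)
      show "norm (exp_scaled \<xi> (of_real s) - (\<Sum>j\<le>?K. taylor_coeff (exp_scaled \<xi>) j * of_real s ^ j)) \<le> C * s ^ (?K + 1)"
        using C(2)[of "of_real s"] elim by auto
    qed
    finally show ?case by (simp add: algebra_simps)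
  qed
  from poly_bigo_zero[OF this, of m] show ?thesis using assms by simp
qed


section \<open>Upper and lower bounds for the symbols\<close>

lemma symbol_upper_bounds:
  "\<exists>C>0. (\<forall>\<xi> s. norm s * norm \<xi> \<le> 1 \<longrightarrow> norm (scaled_symbol l lhat a \<xi> s) \<le> C * norm \<xi> ^ l) \<and>
     (\<forall>\<theta>\<in>cube pi. norm (A \<theta>) \<le> C * norm \<theta> ^ l) \<and> (\<forall>\<xi>. norm (B \<xi>) \<le> C * norm \<xi> ^ l)"
proof -
  obtain C where C: "C > 0" "\<And>\<xi> s. norm s * norm \<xi> \<le> 1 \<Longrightarrow> norm (scaled_symbol l lhat a \<xi> s) \<le> C * norm \<xi> ^ l"
    using norm_scaled_symbol_le[of l lhat a] by blast
  obtain D where D: "\<And>\<theta>. \<theta> \<in> cube pi \<Longrightarrow> norm (A \<theta>) \<le> D"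
    using cube_bounded_continuous[OF difference_symbol_continuous[of UNIV l lhat a]] by (auto simp: cube_bounded_def)
  have le: "X \<le> C * norm (\<xi> :: real ^ 'd) ^ l \<Longrightarrow> X \<le> max C D * norm \<xi> ^ l" for X \<xi>
    by (erule order_trans) (intro mult_right_mono, auto)
  have "norm (A \<theta>) \<le> max C D * norm \<theta> ^ l" if "\<theta> \<in> cube pi" for \<theta>
  proof (cases "norm \<theta> \<le> 1")
    case True
    then show ?thesis using C(2)[of 1 \<theta>] scaled_symbol_eq[of 1 l lhat a \<theta>] by (intro le) auto
  next
    case False
    have "norm (A \<theta>) \<le> max C D * 1" using D[OF that] by simp
    also have "\<dots> \<le> max C D * norm \<theta> ^ l" using False C by (intro mult_left_mono) auto
    finally show ?thesis .
  qed
  moreover have "norm (B \<xi>) \<le> max C D * norm \<xi> ^ l" for \<xi>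
    using C(2)[of 0 \<xi>] scaled_symbol_0[of \<xi>] by (intro le) auto
  ultimately show ?thesis using C le by (intro exI[of _ "max C D"]) auto
qed

text \<open>Taylor's formula of order 0 on the disc of radius \<open>1 / |\<xi>|\<close> bounds the
  difference by \<open>2 C |s| |\<xi>| |\<xi>| ^ l\<close>. So \<open>\<delta>\<close> is chosen
  with \<open>2 * C * \<delta> \<le> c / 2\<close>, and at most \<open>1 / 2\<close> because the
  remainder estimate works on half the radius.\<close>

lemma symbol_lower_bound_local:
  "\<exists>c \<delta>. c > 0 \<and> \<delta> > 0 \<and> \<delta> \<le> 1 \<and> (\<forall>\<xi>. Re (B \<xi>) \<ge> c * norm \<xi> ^ l) \<and>
    (\<forall>\<xi> s. norm s * norm \<xi> \<le> \<delta> \<longrightarrow> norm (scaled_symbol l lhat a \<xi> s - B \<xi>) \<le> c / 2 * norm \<xi> ^ l)"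
proof -
  obtain c where c: "c > 0" "\<And>\<xi>. Re (B \<xi>) \<ge> c * norm \<xi> ^ l"
    using elliptic unfolding strongly_elliptic_def by blast
  obtain C where C: "C > 0" "\<And>\<xi> s. norm s * norm \<xi> \<le> 1 \<Longrightarrow> norm (scaled_symbol l lhat a \<xi> s) \<le> C * norm \<xi> ^ l"
    using symbol_upper_bounds by blast
  define \<delta> where "\<delta> = min (1 / 2) (c / (4 * C))"
  have \<delta>: "\<delta> > 0" "\<delta> \<le> 1 / 2" "2 * C * \<delta> \<le> c / 2" using c C by (auto simp: \<delta>_def min_def field_simps)
  have "norm (scaled_symbol l lhat a \<xi> s - B \<xi>) \<le> c / 2 * norm \<xi> ^ l" if s: "norm s * norm \<xi> \<le> \<delta>" for \<xi> s
  proof (cases "\<xi> = 0")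
    case True
    then show ?thesis using C(2)[where \<xi>=\<xi> and s=s] C(2)[where \<xi>=\<xi> and s=0] l_ge_1 scaled_symbol_0[of \<xi>] by (simp add: zero_power)
  next
    case False
    then have n: "norm \<xi> > 0" by simp
    have bd: "norm (scaled_symbol l lhat a \<xi> z) \<le> C * norm \<xi> ^ l" if "norm z \<le> 1 / norm \<xi>" for z
      using that n by (intro C) (simp add: field_simps)
    have "norm s \<le> (1 / norm \<xi>) / 2" using s \<delta> n by (simp add: field_simps)
    from taylor_remainder_bound[OF scaled_symbol_holomorphic _ bd this, where K=0]
    have "norm (scaled_symbol l lhat a \<xi> s - B \<xi>) \<le> 2 * (C * norm \<xi> ^ l) * (norm s * norm \<xi>)"
      using n by (simp add: taylor_coeff_def scaled_symbol_0)
    also have "\<dots> \<le> 2 * (C * norm \<xi> ^ l) * \<delta>" using s C by (intro mult_left_mono) auto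
    also have "\<dots> = (2 * C * \<delta>) * norm \<xi> ^ l" by simp
    also have "\<dots> \<le> c / 2 * norm \<xi> ^ l" using \<delta> by (intro mult_right_mono) auto
    finally show ?thesis .
  qed
  then show ?thesis using c \<delta> by (intro exI[of _ c] exI[of _ \<delta>]) auto
qed

text \<open>Near the origin the comparison with \<open>B\<close> is used at \<open>s = 1\<close>. On
  the rest of the cube \<open>Re A\<close> has a positive minimum by compactness, and
  \<open>|\<theta>| ^ l\<close> is bounded there.\<close>

lemma symbol_lower_bound:
  "\<exists>c>0. (\<forall>\<xi>. Re (B \<xi>) \<ge> c * norm \<xi> ^ l) \<and> (\<forall>\<theta>\<in>cube pi. Re (A \<theta>) \<ge> c * norm \<theta> ^ l) \<and>
    (\<exists>\<delta>>0. \<forall>\<xi> s. norm s * norm \<xi> \<le> \<delta> \<longrightarrow> Re (scaled_symbol l lhat a \<xi> s) \<ge> c * norm \<xi> ^ l)"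
proof -
  obtain c \<delta> where c: "c > 0" "\<delta> > 0" "\<delta> \<le> 1" "\<And>\<xi>. Re (B \<xi>) \<ge> c * norm \<xi> ^ l"
    "\<And>\<xi> s. norm s * norm \<xi> \<le> \<delta> \<Longrightarrow> norm (scaled_symbol l lhat a \<xi> s - B \<xi>) \<le> c / 2 * norm \<xi> ^ l"
    using symbol_lower_bound_local by blast
  have loc: "Re (scaled_symbol l lhat a \<xi> s) \<ge> c / 2 * norm \<xi> ^ l" if "norm s * norm \<xi> \<le> \<delta>" for \<xi> s
    using c(4)[of \<xi>] c(5)[OF that] abs_Re_le_cmod[of "scaled_symbol l lhat a \<xi> s - B \<xi>"] by simp
  let ?K = "cube pi - ball 0 \<delta> :: (real ^ 'd) set"
  have "\<exists>\<mu>>0. \<forall>\<theta>\<in>?K. Re (A \<theta>) \<ge> \<mu>"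
  proof (cases "?K = {}")
    case True
    then show ?thesis by (metis zero_less_one empty_iff)
  next
    case False
    have "compact ?K" by (intro compact_diff) (auto simp: cube_def)
    moreover have "continuous_on ?K (\<lambda>\<theta>. Re (A \<theta>))"
      by (intro continuous_on_Re difference_symbol_continuous)
    ultimately obtain \<theta> where \<theta>: "\<theta> \<in> ?K" "\<And>\<theta>'. \<theta>' \<in> ?K \<Longrightarrow> Re (A \<theta>) \<le> Re (A \<theta>')"
      using continuous_attains_inf[OF _ False, of "\<lambda>\<theta>. Re (A \<theta>)"] by blast
    then have "\<theta> \<noteq> 0" using c(2) by auto
    then have "Re (A \<theta>) > 0" using Re_pos[of \<theta>] \<theta>(1) by auto
    then show ?thesis using \<theta> by blast
  qed
  then obtain \<mu> where \<mu>: "\<mu> > 0" "\<And>\<theta>. \<theta> \<in> ?K \<Longrightarrow> Re (A \<theta>) \<ge> \<mu>" by blast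
  define D where "D = (sqrt CARD('d) * pi) ^ l"
  have D: "D > 0" by (auto simp: D_def)
  define c' where "c' = min (c / 2) (\<mu> / D)"
  have c': "c' > 0" "c' \<le> c / 2" "c' * D \<le> \<mu>" using c \<mu> D by (auto simp: c'_def min_def field_simps)
  have mono: "c / 2 * norm (\<xi> :: real ^ 'd) ^ l \<ge> c' * norm \<xi> ^ l" for \<xi> using c' by (intro mult_right_mono) auto
  have "Re (A \<theta>) \<ge> c' * norm \<theta> ^ l" if "\<theta> \<in> cube pi" for \<theta>
  proof (cases "norm \<theta> < \<delta>")
    case True
    then show ?thesis using loc[of 1 \<theta>] scaled_symbol_eq[of 1 l lhat a \<theta>] mono[of \<theta>] by simp
  next
    case False
    have "c' * norm \<theta> ^ l \<le> c' * D"
      unfolding D_def using c' norm_le_cube[OF that] by (intro mult_left_mono power_mono) auto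
    also have "\<dots> \<le> Re (A \<theta>)" using c' \<mu>(2)[of \<theta>] that False by auto
    finally show ?thesis .
  qed
  moreover have "Re (B \<xi>) \<ge> c' * norm \<xi> ^ l" for \<xi>
  proof -
    have "0 \<le> c * norm \<xi> ^ l" using c by simp
    then show ?thesis using c(4)[of \<xi>] mono[of \<xi>] by linarith
  qed
  moreover have "Re (scaled_symbol l lhat a \<xi> s) \<ge> c' * norm \<xi> ^ l" if "norm s * norm \<xi> \<le> \<delta>" for \<xi> s
    using loc[OF that] mono[of \<xi>] by linarith
  ultimately show ?thesis using c' c by blast
qed

text \<open>One constant that serves for \<open>B\<close>, for \<open>A\<close> on the cube, and for complex scaling parameters near 0.\<close>

definition decay :: real where
  "decay = (SOME c. c > 0 \<and> (\<forall>\<xi>. Re (B \<xi>) \<ge> c * norm \<xi> ^ l) \<and> (\<forall>\<theta>\<in>cube pi. Re (A \<theta>) \<ge> c * norm \<theta> ^ l) \<and>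
    (\<exists>\<delta>>0. \<forall>\<xi> s. norm s * norm \<xi> \<le> \<delta> \<longrightarrow> Re (scaled_symbol l lhat a \<xi> s) \<ge> c * norm \<xi> ^ l))"

lemma decay: "decay > 0" "Re (B \<xi>) \<ge> decay * norm \<xi> ^ l" "\<theta> \<in> cube pi \<Longrightarrow> Re (A \<theta>) \<ge> decay * norm \<theta> ^ l"
    "\<exists>\<delta>>0. \<forall>\<xi> s. norm s * norm \<xi> \<le> \<delta> \<longrightarrow> Re (scaled_symbol l lhat a \<xi> s) \<ge> decay * norm \<xi> ^ l"
  using someI_ex[OF symbol_lower_bound] unfolding decay_def[symmetric] by auto

abbreviation dec :: "real ^ 'd \<Rightarrow> real" where
  "dec \<xi> \<equiv> exp (- decay * norm \<xi> ^ l)"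

lemma norm_exp_B_le: "norm (exp (- B \<xi>)) \<le> dec \<xi>"
  using decay(2)[of \<xi>] by (simp add: norm_exp_eq_Re)

lemma Re_scaled_cube:
  assumes "s > 0" "s *\<^sub>R \<xi> \<in> cube pi"
  shows "Re (A (s *\<^sub>R \<xi>) / of_real s ^ l) \<ge> decay * norm \<xi> ^ l"
proof -
  have "Re (A (s *\<^sub>R \<xi>) / of_real s ^ l) = Re (A (s *\<^sub>R \<xi>)) / s ^ l"
    by (metis Re_divide_of_real of_real_power)
  also have "\<dots> \<ge> decay * norm (s *\<^sub>R \<xi>) ^ l / s ^ l"
    using decay(3)[OF assms(2)] assms by (intro divide_right_mono) auto
  also have "decay * norm (s *\<^sub>R \<xi>) ^ l / s ^ l = decay * norm \<xi> ^ l"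
    using assms by (simp add: power_mult_distrib)
  finally show ?thesis .
qed

text \<open>Both exponents have real part at least \<open>decay * norm \<xi> ^ l\<close>, so the
  half-plane estimate keeps the full exponential decay. Subtracting \<open>exp (- B \<xi>)\<close>
  gains the factor \<open>norm \<xi> ^ l\<close>, which later compensates the singularity of
  \<open>Q\<close> at the origin.\<close>

lemma exp_scaled_diff_bounds:
  "\<exists>C \<delta>. C > 0 \<and> \<delta> > 0 \<and> \<delta> \<le> 1 \<and>
    (\<forall>\<xi> s. norm s * norm \<xi> \<le> \<delta> \<longrightarrow> norm (exp_scaled \<xi> s - exp (- B \<xi>)) \<le> C * norm \<xi> ^ l * dec \<xi>) \<and>
    (\<forall>\<xi> s. s > 0 \<longrightarrow> s *\<^sub>R \<xi> \<in> cube pi \<longrightarrow> norm (exp_scaled \<xi> (of_real s) - exp (- B \<xi>)) \<le> C * norm \<xi> ^ l * dec \<xi>)"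
proof -
  obtain C where C: "C > 0" "\<And>\<xi> s. norm s * norm \<xi> \<le> 1 \<Longrightarrow> norm (scaled_symbol l lhat a \<xi> s) \<le> C * norm \<xi> ^ l"
     "\<And>\<theta>. \<theta>\<in>cube pi \<Longrightarrow> norm (A \<theta>) \<le> C * norm \<theta> ^ l" "\<And>\<xi>. norm (B \<xi>) \<le> C * norm \<xi> ^ l"
    using symbol_upper_bounds by blast
  obtain \<delta> where \<delta>: "\<delta> > 0" "\<And>\<xi> s. norm s * norm \<xi> \<le> \<delta> \<Longrightarrow> Re (scaled_symbol l lhat a \<xi> s) \<ge> decay * norm \<xi> ^ l"
    using decay(4) by blast
  have main: "norm (exp_scaled \<xi> s - exp (- B \<xi>)) \<le> (2 * C) * norm \<xi> ^ l * dec \<xi>"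
    if "Re (scaled_symbol l lhat a \<xi> s) \<ge> decay * norm \<xi> ^ l" "norm (scaled_symbol l lhat a \<xi> s) \<le> C * norm \<xi> ^ l" for \<xi> s
  proof -
    have "norm (exp_scaled \<xi> s - exp (- B \<xi>)) \<le> norm (scaled_symbol l lhat a \<xi> s - B \<xi>) * exp (- (decay * norm \<xi> ^ l))"
      unfolding exp_scaled_def using that decay(2) by (intro norm_exp_minus_diff_le) auto
    also have "\<dots> \<le> (C * norm \<xi> ^ l + C * norm \<xi> ^ l) * exp (- (decay * norm \<xi> ^ l))"
      using that C(4)[of \<xi>] by (intro mult_right_mono order_trans[OF norm_triangle_ineq4 add_mono]) auto
    finally show ?thesis by (simp add: algebra_simps)
  qed
  have 1: "norm (exp_scaled \<xi> s - exp (- B \<xi>)) \<le> (2 * C) * norm \<xi> ^ l * dec \<xi>" if "norm s * norm \<xi> \<le> min 1 \<delta>" for \<xi> s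
    using that by (intro main \<delta> C) auto
  have 2: "norm (exp_scaled \<xi> (of_real s) - exp (- B \<xi>)) \<le> (2 * C) * norm \<xi> ^ l * dec \<xi>" if s: "s > 0" "s *\<^sub>R \<xi> \<in> cube pi" for \<xi> s
  proof (rule main)
    show "Re (scaled_symbol l lhat a \<xi> (of_real s)) \<ge> decay * norm \<xi> ^ l"
      using Re_scaled_cube[OF s] s by (simp only: scaled_symbol_eq)
    have "norm (A (s *\<^sub>R \<xi>)) / s ^ l \<le> C * norm (s *\<^sub>R \<xi>) ^ l / s ^ l"
      using C(3)[OF s(2)] s by (intro divide_right_mono) auto
    then show "norm (scaled_symbol l lhat a \<xi> (of_real s)) \<le> C * norm \<xi> ^ l"
      using s by (simp add: scaled_symbol_eq norm_divide norm_power power_mult_distrib)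
  qed
  show ?thesis
    using 1 2 C \<delta> by (intro exI[of _ "2 * C"] exI[of _ "min 1 \<delta>"]) auto
qed

text \<open>For \<open>s |\<xi>| \<le> \<delta> / 2\<close> the second estimate is the Taylor
  remainder on the disc of radius \<open>\<delta> / |\<xi>|\<close>. For larger
  \<open>s |\<xi>|\<close> the expansion gives nothing, but there the function and each term can be
  bounded separately, because lower powers of \<open>s |\<xi>|\<close> are dominated by a multiple
  of the power \<open>K + 1\<close>.\<close>

lemma exp_expansion_uniform:
  "\<exists>D C. (\<forall>m\<ge>1. \<forall>\<xi>. norm (exp_coeff m \<xi>) \<le> D m * norm \<xi> ^ (m + l) * dec \<xi>) \<and>
     (\<forall>K \<xi> s. s > 0 \<longrightarrow> s *\<^sub>R \<xi> \<in> cube pi \<longrightarrow>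
       norm (exp (- (A (s *\<^sub>R \<xi>) / of_real s ^ l)) - (\<Sum>m\<le>K. of_real s ^ m * exp_coeff m \<xi>))
         \<le> C K * norm \<xi> ^ l * (s * norm \<xi>) ^ (K + 1) * dec \<xi>) \<and> (\<forall>m. D m \<ge> 0) \<and> (\<forall>m. C m \<ge> 0)"
proof -
  obtain C \<delta> where C: "C > 0" "\<delta> > 0" "\<delta> \<le> 1"
    "\<And>\<xi> s. norm s * norm \<xi> \<le> \<delta> \<Longrightarrow> norm (exp_scaled \<xi> s - exp (- B \<xi>)) \<le> C * norm \<xi> ^ l * dec \<xi>"
    "\<And>\<xi> s. s > 0 \<Longrightarrow> s *\<^sub>R \<xi> \<in> cube pi \<Longrightarrow> norm (exp_scaled \<xi> (of_real s) - exp (- B \<xi>)) \<le> C * norm \<xi> ^ l * dec \<xi>"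
    using exp_scaled_diff_bounds by blast
  define G where "G \<xi> s = exp_scaled \<xi> s - exp (- B \<xi>)" for \<xi> s
  have holG: "G \<xi> holomorphic_on UNIV" for \<xi>
    unfolding G_def[abs_def] by (intro holomorphic_intros exp_scaled_holomorphic)
  have coeffG: "taylor_coeff (G \<xi>) m = (if m = 0 then 0 else exp_coeff m \<xi>)" for \<xi> m
  proof (cases "m = 0")
    case True
    then show ?thesis by (simp add: taylor_coeff_def G_def exp_scaled_def scaled_symbol_0)
  next
    case False
    then have "(deriv ^^ m) (G \<xi>) 0 = (deriv ^^ m) (exp_scaled \<xi>) 0"
      unfolding G_def[abs_def] using exp_scaled_holomorphic[of \<xi>]
      by (subst higher_deriv_diff[of _ UNIV]) (auto simp: holomorphic_on_const)
    then show ?thesis using False taylor_coeff_exp_scaled[of \<xi> m] by (simp add: taylor_coeff_def)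
  qed
  define D where "D m = C / \<delta> ^ m" for m :: nat
  have D0: "D m \<ge> 0" for m using C by (simp add: D_def)
  have D: "norm (exp_coeff m \<xi>) \<le> D m * norm \<xi> ^ (m + l) * dec \<xi>" if m: "m \<ge> 1" for m \<xi>
  proof (cases "\<xi> = 0")
    case True
    \<comment> \<open>At \<open>\<xi> = 0\<close> the disc of radius
      \<open>\<delta> / |\<xi>|\<close> becomes the whole plane and \<open>G\<close> vanishes
      identically, so any radius will do.\<close>
    have "norm (taylor_coeff (G \<xi>) m) \<le> 0 / 1 ^ m"
    proof (rule taylor_coeff_bound[OF holG])
      show "norm (G \<xi> z) \<le> 0" for z using C(4)[where \<xi>=\<xi> and s=z] C True l_ge_1 by (simp add: G_def zero_power)
    qed simp
    then show ?thesis using m True D0 by (simp add: coeffG)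
  next
    case False
    then have n: "norm \<xi> > 0" by simp
    have "norm (taylor_coeff (G \<xi>) m) \<le> (C * norm \<xi> ^ l * dec \<xi>) / (\<delta> / norm \<xi>) ^ m"
      by (rule taylor_coeff_bound[OF holG]) (use C n in \<open>auto simp: G_def field_simps\<close>)
    also have "\<dots> = D m * norm \<xi> ^ (m + l) * dec \<xi>" by (simp add: D_def power_divide power_add mult_ac)
    finally show ?thesis using m by (simp add: coeffG)
  qed
  \<comment> \<open>The first summand is the constant of the Taylor regime. The others belong to
    \<open>s |\<xi>| > \<delta> / 2\<close>, where each missing power of \<open>s |\<xi>|\<close>
    costs a factor \<open>2 / \<delta>\<close>.\<close>
  define E where "E K = 2 * C / \<delta> ^ (K + 1) + (C * (2 / \<delta>) ^ (K + 1) + (\<Sum>m=1..K. D m * (2 / \<delta>) ^ (K + 1 - m)))" for K :: nat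
  have E0: "E K \<ge> 0" for K unfolding E_def using C D0 by (intro add_nonneg_nonneg sum_nonneg) auto
  have E: "norm (exp (- (A (s *\<^sub>R \<xi>) / of_real s ^ l)) - (\<Sum>m\<le>K. of_real s ^ m * exp_coeff m \<xi>))
         \<le> E K * norm \<xi> ^ l * (s * norm \<xi>) ^ (K + 1) * dec \<xi>" if s: "s > 0" "s *\<^sub>R \<xi> \<in> cube pi" for K \<xi> s
  proof -
    have e: "exp (- (A (s *\<^sub>R \<xi>) / of_real s ^ l)) - (\<Sum>m\<le>K. of_real s ^ m * exp_coeff m \<xi>) = 
       G \<xi> (of_real s) - (\<Sum>m=1..K. of_real s ^ m * exp_coeff m \<xi>)"
      using s by (simp add: G_def exp_scaled_of_real atMost_atLeast0 sum.atLeast_Suc_atMost exp_coeff_def)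
    have e': "(\<Sum>m=1..K. of_real s ^ m * exp_coeff m \<xi>) = (\<Sum>m\<le>K. taylor_coeff (G \<xi>) m * of_real s ^ m)"
      by (simp add: coeffG atMost_atLeast0 sum.atLeast_Suc_atMost mult.commute)
    show ?thesis
    proof (cases "s * norm \<xi> \<le> \<delta> / 2")
      case True
      have "norm (G \<xi> (of_real s) - (\<Sum>m\<le>K. taylor_coeff (G \<xi>) m * of_real s ^ m)) \<le> 2 * C / \<delta> ^ (K + 1) * norm \<xi> ^ l * (s * norm \<xi>) ^ (K + 1) * dec \<xi>"
      proof (cases "\<xi> = 0")
        case True
        have "norm (G \<xi> (of_real s) - (\<Sum>m\<le>K. taylor_coeff (G \<xi>) m * of_real s ^ m)) \<le> 2 * 0 * (norm (complex_of_real s) / (2 * s)) ^ (K + 1)"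
          by (rule taylor_remainder_bound[OF holG]) (use C True l_ge_1 s C(4)[where \<xi>=\<xi>] in \<open>auto simp: G_def zero_power\<close>)
        then show ?thesis using True by simp
      next
        case False
        then have n: "norm \<xi> > 0" by simp
        have "norm (G \<xi> (of_real s) - (\<Sum>m\<le>K. taylor_coeff (G \<xi>) m * of_real s ^ m)) \<le> 2 * (C * norm \<xi> ^ l * dec \<xi>) * (norm (complex_of_real s) / (\<delta> / norm \<xi>)) ^ (K + 1)"
          by (rule taylor_remainder_bound[OF holG]) (use C n s True in \<open>auto simp: G_def field_simps\<close>)
        also have "\<dots> = 2 * C / \<delta> ^ (K + 1) * norm \<xi> ^ l * (s * norm \<xi>) ^ (K + 1) * dec \<xi>"
          using s by (simp add: power_divide power_mult_distrib mult_ac)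
        finally show ?thesis .
      qed
      also have "\<dots> \<le> E K * norm \<xi> ^ l * (s * norm \<xi>) ^ (K + 1) * dec \<xi>"
        unfolding E_def using C D0 s by (intro mult_right_mono) (auto intro!: add_nonneg_nonneg sum_nonneg)
      finally show ?thesis unfolding e e' .
    next
      case False
      define x where "x = s * norm \<xi>"
      have x: "x > 0" "1 \<le> 2 / \<delta> * x" using False C by (auto simp: x_def field_simps)
      have pw: "x ^ m \<le> (2 / \<delta>) ^ (K + 1 - m) * x ^ (K + 1)" if "m \<le> K + 1" for m
      proof -
        have "1 * x ^ m \<le> (2 / \<delta> * x) ^ (K + 1 - m) * x ^ m"
          using x by (intro mult_right_mono one_le_power) auto
        also have "\<dots> = (2 / \<delta>) ^ (K + 1 - m) * x ^ (K + 1)"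
          using that by (simp only: power_mult_distrib mult.assoc power_add[symmetric]) simp
        finally show ?thesis by simp
      qed
      have "norm (G \<xi> (of_real s)) \<le> C * norm \<xi> ^ l * dec \<xi> * 1" using C(5)[OF s] by (simp add: G_def)
      also have "\<dots> \<le> C * norm \<xi> ^ l * dec \<xi> * ((2 / \<delta>) ^ (K + 1) * x ^ (K + 1))"
        using pw[of 0] C by (intro mult_left_mono) auto
      finally have 1: "norm (G \<xi> (of_real s)) \<le> C * (2 / \<delta>) ^ (K + 1) * (norm \<xi> ^ l * x ^ (K + 1) * dec \<xi>)"
        by (simp add: mult_ac)
      have 2: "norm (\<Sum>m=1..K. of_real s ^ m * exp_coeff m \<xi>) \<le> (\<Sum>m=1..K. D m * (2 / \<delta>) ^ (K + 1 - m) * (norm \<xi> ^ l * x ^ (K + 1) * dec \<xi>))"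
      proof (rule sum_norm_le)
        fix m assume m: "m \<in> {1..K}"
        have "norm (of_real s ^ m * exp_coeff m \<xi>) \<le> s ^ m * (D m * norm \<xi> ^ (m + l) * dec \<xi>)"
          using D[of m \<xi>] m s by (simp add: norm_mult norm_power mult_left_mono)
        also have "\<dots> = D m * norm \<xi> ^ l * dec \<xi> * x ^ m" by (simp add: x_def power_mult_distrib power_add mult_ac)
        also have "\<dots> \<le> D m * norm \<xi> ^ l * dec \<xi> * ((2 / \<delta>) ^ (K + 1 - m) * x ^ (K + 1))"
          using pw[of m] m D0 by (intro mult_left_mono) auto
        finally show "norm (of_real s ^ m * exp_coeff m \<xi>) \<le> D m * (2 / \<delta>) ^ (K + 1 - m) * (norm \<xi> ^ l * x ^ (K + 1) * dec \<xi>)"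
          by (simp add: mult_ac)
      qed
      have "norm (G \<xi> (of_real s) - (\<Sum>m=1..K. of_real s ^ m * exp_coeff m \<xi>)) \<le> 
         (C * (2 / \<delta>) ^ (K + 1) + (\<Sum>m=1..K. D m * (2 / \<delta>) ^ (K + 1 - m))) * (norm \<xi> ^ l * x ^ (K + 1) * dec \<xi>)"
        using order_trans[OF norm_triangle_ineq4 add_mono[OF 1 2]] by (simp add: distrib_right sum_distrib_right)
      also have "\<dots> \<le> E K * (norm \<xi> ^ l * x ^ (K + 1) * dec \<xi>)"
        unfolding E_def using C x by (intro mult_right_mono) auto
      finally show ?thesis unfolding e x_def by (simp add: mult_ac)
    qed
  qed
  show ?thesis using D E D0 E0 by blast
qed

end

subsection \<open>Fourier integrals of rapidly decaying functions\<close>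

definition fourier :: "(real ^ 'd::finite \<Rightarrow> complex) \<Rightarrow> real ^ 'd \<Rightarrow> complex" where
  "fourier g y = (\<integral>\<xi>. g \<xi> * cis (y \<bullet> \<xi>) \<partial>lborel) / of_real ((2 * pi) ^ CARD('d))"

lemma has_vector_derivative_quadratic:
  fixes f :: "real \<Rightarrow> complex"
  assumes "\<And>h. norm (f (x + h) - f x - of_real h * D) \<le> C * h\<^sup>2"
  shows "(f has_vector_derivative D) (at x)"
  unfolding has_vector_derivative_def has_derivative_at
proof (intro conjI bounded_linear_scaleR_left)
  show "((\<lambda>h. norm (f (x + h) - f x - h *\<^sub>R D) / norm h) \<longlongrightarrow> 0) (at 0)"
  proof (rule Lim_null_comparison)
    have "norm (norm (f (x + h) - f x - h *\<^sub>R D) / norm h) \<le> C * norm h" for h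
    proof (cases "h = 0")
      case False
      have "norm (f (x + h) - f x - h *\<^sub>R D) / norm h \<le> (C * h\<^sup>2) / norm h"
        using assms[of h] by (intro divide_right_mono) (auto simp: scaleR_conv_of_real)
      also have "\<dots> = C * norm h" using False by (simp add: power2_eq_square field_simps abs_if)
      finally show ?thesis by simp
    qed simp
    then show "eventually (\<lambda>h. norm (norm (f (x + h) - f x - h *\<^sub>R D) / norm h) \<le> C * norm h) (at 0)" by simp
    show "((\<lambda>h. C * norm h) \<longlongrightarrow> 0) (at 0)" by (auto intro!: tendsto_eq_intros)
  qed
qed

lemma norm_cis_taylor: "norm (cis x - (\<Sum>j\<le>J. (\<i> * of_real x) ^ j / fact j)) \<le> \<bar>x\<bar> ^ Suc J"
proof -
  have "norm (cis x - (\<Sum>j\<le>J. (\<i> * of_real x) ^ j / fact j)) \<le> \<bar>x\<bar> ^ Suc J / fact J"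
    using Taylor_exp[of "\<i> * of_real x" J] by (simp add: cis_conv_exp norm_mult)
  also have "\<dots> \<le> \<bar>x\<bar> ^ Suc J" using fact_ge_1[of J, where 'a=real] by (simp add: divide_le_eq mult_le_cancel_left1 del: power_Suc)
  finally show ?thesis .
qed

lemma peval_continuous: "continuous_on S (peval p)"
  unfolding peval_def[abs_def] monom_at_def by (intro continuous_intros)

lemma peval_measurable[measurable]: "peval p \<in> borel_measurable borel"
  by (rule borel_measurable_continuous_onI[OF peval_continuous])

text \<open>The degree \<open>q\<close> is left free so that the class is stable under
  multiplication by polynomials, as the multiplier scheme demands, while the rate \<open>c\<close>
  stays fixed.\<close>

definition weakly_decaying :: "real \<Rightarrow> nat \<Rightarrow> (real ^ 'd::finite \<Rightarrow> complex) set" where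
  "weakly_decaying c l = {g. g \<in> borel_measurable borel \<and> (\<exists>C q. \<forall>\<xi>. norm (g \<xi>) \<le> C * (1 + norm \<xi>) ^ q * exp (- c * norm \<xi> ^ l))}"

lemma power_one_plus_le: "0 \<le> (x::real) \<Longrightarrow> (1 + x) ^ q \<le> 2 ^ q * (1 + x ^ q)"
proof -
  assume x: "0 \<le> x"
  have "(1 + x) ^ q \<le> (2 * max 1 x) ^ q" using x by (intro power_mono) auto
  also have "\<dots> = 2 ^ q * (max 1 x) ^ q" by (simp add: power_mult_distrib)
  also have "(max 1 x) ^ q \<le> 1 + x ^ q" using x by (auto simp: max_def)
  finally show ?thesis by simp
qed

lemma integrable_weight:
  assumes "c > 0" "l \<ge> 1"
  shows "integrable lborel (\<lambda>\<xi>::real ^ 'd::finite. (1 + norm \<xi>) ^ q * exp (- c * norm \<xi> ^ l))"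
proof (rule Bochner_Integration.integrable_bound)
  show "integrable lborel (\<lambda>\<xi>::real ^ 'd. 2 ^ q * (norm \<xi> ^ 0 * exp (- c * norm \<xi> ^ l) + norm \<xi> ^ q * exp (- c * norm \<xi> ^ l)))"
    by (intro integrable_mult_right Bochner_Integration.integrable_add integrable_norm_pow_exp assms)
  have "norm ((1 + norm \<xi>) ^ q * exp (- c * norm \<xi> ^ l)) \<le>
      norm (2 ^ q * (norm \<xi> ^ 0 * exp (- c * norm \<xi> ^ l) + norm \<xi> ^ q * exp (- c * norm \<xi> ^ l)))" for \<xi> :: "real ^ 'd"
    using mult_right_mono[OF power_one_plus_le[of "norm \<xi>" q], of "exp (- c * norm \<xi> ^ l)"]
    by (simp add: abs_mult algebra_simps)
  then show "AE \<xi> in lborel. norm ((1 + norm \<xi>) ^ q * exp (- c * norm (\<xi> :: real ^ 'd) ^ l)) \<le>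
      norm (2 ^ q * (norm \<xi> ^ 0 * exp (- c * norm \<xi> ^ l) + norm \<xi> ^ q * exp (- c * norm \<xi> ^ l)))" by simp
qed measurable

lemma weakly_decaying_mult:
  assumes g: "g \<in> weakly_decaying c l" and [measurable]: "m \<in> borel_measurable borel"
    and m: "\<And>\<xi>. norm (m \<xi>) \<le> D * (1 + norm \<xi>) ^ p"
  shows "(\<lambda>\<xi>. m \<xi> * g \<xi>) \<in> weakly_decaying c l"
proof -
  obtain C q where C: "\<And>\<xi>. norm (g \<xi>) \<le> C * (1 + norm \<xi>) ^ q * exp (- c * norm \<xi> ^ l)" and [measurable]: "g \<in> borel_measurable borel"
    using g by (auto simp: weakly_decaying_def)
  have "norm (m \<xi> * g \<xi>) \<le> (D * C) * (1 + norm \<xi>) ^ (p + q) * exp (- c * norm \<xi> ^ l)" for \<xi>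
  proof -
    have "norm (m \<xi> * g \<xi>) \<le> (D * (1 + norm \<xi>) ^ p) * (C * (1 + norm \<xi>) ^ q * exp (- c * norm \<xi> ^ l))"
      unfolding norm_mult using order_trans[OF norm_ge_zero m[of \<xi>]] by (intro mult_mono m C) auto
    then show ?thesis by (simp add: power_add mult_ac)
  qed
  then show ?thesis by (auto simp: weakly_decaying_def)
qed

lemma weakly_decaying_inner:
  assumes "g \<in> weakly_decaying c l"
  shows "(\<lambda>\<xi>. of_real (v \<bullet> \<xi>) * g \<xi>) \<in> weakly_decaying c l" "(\<lambda>\<xi>. (\<i> * of_real (v \<bullet> \<xi>)) * g \<xi>) \<in> weakly_decaying c l"
proof -
  have "\<bar>v \<bullet> \<xi>\<bar> \<le> norm v * (1 + norm \<xi>) ^ 1" for \<xi>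
    using Cauchy_Schwarz_ineq2[of v \<xi>] by (auto simp: algebra_simps intro: add_increasing)
  then show "(\<lambda>\<xi>. of_real (v \<bullet> \<xi>) * g \<xi>) \<in> weakly_decaying c l" "(\<lambda>\<xi>. (\<i> * of_real (v \<bullet> \<xi>)) * g \<xi>) \<in> weakly_decaying c l"
    using weakly_decaying_mult[OF assms, of "\<lambda>\<xi>. of_real (v \<bullet> \<xi>)" "norm v" 1]
      weakly_decaying_mult[OF assms, of "\<lambda>\<xi>. \<i> * of_real (v \<bullet> \<xi>)" "norm v" 1]
    by (simp_all add: norm_mult)
qed

lemma weakly_decaying_integrable:
  assumes "c > 0" "l \<ge> 1" and g: "g \<in> weakly_decaying c l"
  shows "integrable lborel (\<lambda>\<xi>::real ^ 'd::finite. norm \<xi> ^ j * norm (g \<xi>))" "integrable lborel (\<lambda>\<xi>. g \<xi> * cis (y \<bullet> \<xi>))"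
   "integrable lborel g"
proof -
  obtain C q where C: "\<And>\<xi>. norm (g \<xi>) \<le> C * (1 + norm \<xi>) ^ q * exp (- c * norm \<xi> ^ l)" and [measurable]: "g \<in> borel_measurable borel"
    using g by (auto simp: weakly_decaying_def)
  have i: "integrable lborel (\<lambda>\<xi>::real ^ 'd. C * ((1 + norm \<xi>) ^ q * exp (- c * norm \<xi> ^ l)))" for C q
    by (intro integrable_mult_right integrable_weight assms)
  show "integrable lborel g"
    by (rule Bochner_Integration.integrable_bound[OF i[of C q]])
       (auto intro!: AE_I2 order_trans[OF C] simp: mult.assoc intro: order_trans[OF _ abs_ge_self])
  then have n: "integrable lborel (\<lambda>\<xi>. norm (g \<xi>))" by simp
  show "integrable lborel (\<lambda>\<xi>. g \<xi> * cis (y \<bullet> \<xi>))"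
    by (rule Bochner_Integration.integrable_bound[OF n]) (auto simp: norm_mult)
  have "norm \<xi> ^ j * norm (g \<xi>) \<le> C * ((1 + norm \<xi>) ^ (j + q) * exp (- c * norm \<xi> ^ l))" for \<xi>
  proof -
    have "norm \<xi> ^ j * norm (g \<xi>) \<le> (1 + norm \<xi>) ^ j * (C * (1 + norm \<xi>) ^ q * exp (- c * norm \<xi> ^ l))"
      by (intro mult_mono C power_mono) auto
    then show ?thesis by (simp add: power_add mult_ac)
  qed
  then show "integrable lborel (\<lambda>\<xi>. norm \<xi> ^ j * norm (g \<xi>))"
    by (intro Bochner_Integration.integrable_bound[OF i[of C "j + q"]])
       (auto intro!: AE_I2 intro: order_trans[OF _ abs_ge_self])
qed

lemma norm_fourier_le:
  assumes "integrable lborel (\<lambda>\<xi>. norm (g \<xi>))"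
  shows "norm (fourier g y) \<le> (\<integral>\<xi>. norm (g \<xi>) \<partial>lborel)"
proof -
  have "norm (\<integral>\<xi>. g \<xi> * cis (y \<bullet> \<xi>) \<partial>lborel) \<le> (\<integral>\<xi>. norm (g \<xi> * cis (y \<bullet> \<xi>)) \<partial>lborel)"
    by (rule integral_norm_bound)
  also have "\<dots> = (\<integral>\<xi>. norm (g \<xi>) \<partial>lborel)" by (simp add: norm_mult)
  finally have le: "norm (\<integral>\<xi>. g \<xi> * cis (y \<bullet> \<xi>) \<partial>lborel) \<le> (\<integral>\<xi>. norm (g \<xi>) \<partial>lborel)" .
  have "1 \<le> 2 * pi" using pi_ge_two by linarith
  then have "1 \<le> (2 * pi) ^ CARD('a)" by (rule one_le_power)
  then have "norm (\<integral>\<xi>. g \<xi> * cis (y \<bullet> \<xi>) \<partial>lborel) / (2 * pi) ^ CARD('a) \<le> norm (\<integral>\<xi>. g \<xi> * cis (y \<bullet> \<xi>) \<partial>lborel)"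
    by (auto simp: divide_le_eq mult_le_cancel_left1)
  with le show ?thesis by (simp add: fourier_def norm_divide norm_mult norm_power)
qed

context
  fixes c :: real and l :: nat and g :: "real ^ 'd::finite \<Rightarrow> complex"
  assumes cl: "c > 0" "l \<ge> 1" and g: "g \<in> weakly_decaying c l"
begin

text \<open>Taylor's formula for \<open>cis\<close> under the integral, with a remainder independent
  of \<open>y\<close>. Order 0 gives Lipschitz continuity, order 1 differentiability along lines,
  and general order the expansion of \<open>H_fun\<close> along rays.\<close>

lemma fourier_taylor:
  "norm (fourier g (y + h *\<^sub>R v) - (\<Sum>j\<le>J. of_real h ^ j * fourier (\<lambda>\<xi>. (\<i> * of_real (v \<bullet> \<xi>)) ^ j * g \<xi>) y / fact j))
     \<le> \<bar>h\<bar> ^ Suc J * (norm v ^ Suc J * (\<integral>\<xi>. norm \<xi> ^ Suc J * norm (g \<xi>) \<partial>lborel))"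
proof -
  have wd: "(\<lambda>\<xi>. (\<i> * of_real (v \<bullet> \<xi>)) ^ j * g \<xi>) \<in> weakly_decaying c l" for j
  proof (induction j)
    case (Suc j)
    from weakly_decaying_inner(2)[OF this, of v] show ?case by (simp add: mult.assoc)
  qed (use g in simp)
  have [measurable]: "g \<in> borel_measurable borel" using g by (auto simp: weakly_decaying_def)
  let ?R = "\<lambda>\<xi>. g \<xi> * cis (y \<bullet> \<xi>) * (cis (h * (v \<bullet> \<xi>)) - (\<Sum>j\<le>J. (\<i> * of_real (h * (v \<bullet> \<xi>))) ^ j / fact j))"
  have i: "integrable lborel (\<lambda>\<xi>. of_real h ^ j / fact j * ((\<i> * of_real (v \<bullet> \<xi>)) ^ j * g \<xi> * cis (y \<bullet> \<xi>)))" for j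
    by (intro integrable_mult_right weakly_decaying_integrable(2)[OF cl wd])
  have "(\<integral>\<xi>. g \<xi> * cis ((y + h *\<^sub>R v) \<bullet> \<xi>) \<partial>lborel) - (\<Sum>j\<le>J. of_real h ^ j / fact j * (\<integral>\<xi>. (\<i> * of_real (v \<bullet> \<xi>)) ^ j * g \<xi> * cis (y \<bullet> \<xi>) \<partial>lborel))
     = (\<integral>\<xi>. g \<xi> * cis ((y + h *\<^sub>R v) \<bullet> \<xi>) - (\<Sum>j\<le>J. of_real h ^ j / fact j * ((\<i> * of_real (v \<bullet> \<xi>)) ^ j * g \<xi> * cis (y \<bullet> \<xi>))) \<partial>lborel)"
    using i by (subst Bochner_Integration.integral_diff) 
      (auto simp: Bochner_Integration.integral_sum intro!: weakly_decaying_integrable(2)[OF cl g] simp del: times_divide_eq_left)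
  also have "\<dots> = (\<integral>\<xi>. ?R \<xi> \<partial>lborel)"
    by (intro Bochner_Integration.integral_cong)
      (auto simp: inner_add_left cis_mult[symmetric] right_diff_distrib sum_distrib_left power_mult_distrib mult_ac)
  finally have "norm ((\<integral>\<xi>. g \<xi> * cis ((y + h *\<^sub>R v) \<bullet> \<xi>) \<partial>lborel) - (\<Sum>j\<le>J. of_real h ^ j / fact j * (\<integral>\<xi>. (\<i> * of_real (v \<bullet> \<xi>)) ^ j * g \<xi> * cis (y \<bullet> \<xi>) \<partial>lborel)))
    = norm (\<integral>\<xi>. ?R \<xi> \<partial>lborel)" by simp
  also have "\<dots> \<le> (\<integral>\<xi>. (\<bar>h\<bar> ^ Suc J * norm v ^ Suc J) * (norm \<xi> ^ Suc J * norm (g \<xi>)) \<partial>lborel)"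
  proof -
    have bnd: "norm (?R \<xi>) \<le> (\<bar>h\<bar> ^ Suc J * norm v ^ Suc J) * (norm \<xi> ^ Suc J * norm (g \<xi>))" for \<xi>
    proof -
      have "norm (?R \<xi>) \<le> norm (g \<xi>) * \<bar>h * (v \<bullet> \<xi>)\<bar> ^ Suc J"
        using norm_cis_taylor[of "h * (v \<bullet> \<xi>)" J] by (simp add: norm_mult mult_left_mono del: power_Suc of_real_mult)
      also have "\<dots> \<le> norm (g \<xi>) * (\<bar>h\<bar> * (norm v * norm \<xi>)) ^ Suc J"
        using Cauchy_Schwarz_ineq2[of v \<xi>] by (intro mult_left_mono power_mono) (auto simp: abs_mult intro: mult_left_mono)
      finally show ?thesis by (simp add: power_mult_distrib mult_ac)
    qed
    have iR: "integrable lborel (\<lambda>\<xi>. (\<bar>h\<bar> ^ Suc J * norm v ^ Suc J) * (norm \<xi> ^ Suc J * norm (g \<xi>)))"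
      by (intro integrable_mult_right weakly_decaying_integrable(1)[OF cl g])
    have "norm (\<integral>\<xi>. ?R \<xi> \<partial>lborel) \<le> (\<integral>\<xi>. norm (?R \<xi>) \<partial>lborel)"
      by (rule integral_norm_bound)
    also have "\<dots> \<le> (\<integral>\<xi>. (\<bar>h\<bar> ^ Suc J * norm v ^ Suc J) * (norm \<xi> ^ Suc J * norm (g \<xi>)) \<partial>lborel)"
      by (rule integral_mono_AE') (use iR bnd in auto)
    finally show ?thesis .
  qed
  also have "\<dots> = \<bar>h\<bar> ^ Suc J * (norm v ^ Suc J * (\<integral>\<xi>. norm \<xi> ^ Suc J * norm (g \<xi>) \<partial>lborel))"
    by (simp add: mult.assoc del: power_Suc)
  finally have main: "norm ((\<integral>\<xi>. g \<xi> * cis ((y + h *\<^sub>R v) \<bullet> \<xi>) \<partial>lborel) - (\<Sum>j\<le>J. of_real h ^ j / fact j * (\<integral>\<xi>. (\<i> * of_real (v \<bullet> \<xi>)) ^ j * g \<xi> * cis (y \<bullet> \<xi>) \<partial>lborel)))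
    \<le> \<bar>h\<bar> ^ Suc J * (norm v ^ Suc J * (\<integral>\<xi>. norm \<xi> ^ Suc J * norm (g \<xi>) \<partial>lborel))" (is "norm ?L \<le> ?X") .
  have e: "fourier g (y + h *\<^sub>R v) - (\<Sum>j\<le>J. of_real h ^ j * fourier (\<lambda>\<xi>. (\<i> * of_real (v \<bullet> \<xi>)) ^ j * g \<xi>) y / fact j) = ?L / of_real ((2 * pi) ^ CARD('d))"
    by (simp add: fourier_def diff_divide_distrib sum_divide_distrib mult_ac)
  have "1 \<le> 2 * pi" using pi_ge_two by linarith
  then have "1 \<le> (2 * pi) ^ CARD('d)" by (rule one_le_power)
  then have "norm ?L / (2 * pi) ^ CARD('d) \<le> norm ?L"
    by (auto simp: divide_le_eq mult_le_cancel_left1)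
  then show ?thesis
    using main unfolding e norm_divide by (simp add: norm_mult norm_power del: power_Suc)
qed

lemma fourier_deriv:
  "((\<lambda>\<rho>. fourier g (y + \<rho> *\<^sub>R v)) has_vector_derivative fourier (\<lambda>\<xi>. (\<i> * of_real (v \<bullet> \<xi>)) * g \<xi>) (y + \<rho> *\<^sub>R v)) (at \<rho>)"
proof (rule has_vector_derivative_quadratic)
  fix h
  show "norm (fourier g (y + (\<rho> + h) *\<^sub>R v) - fourier g (y + \<rho> *\<^sub>R v) - of_real h * fourier (\<lambda>\<xi>. (\<i> * of_real (v \<bullet> \<xi>)) * g \<xi>) (y + \<rho> *\<^sub>R v))
     \<le> (norm v ^ 2 * (\<integral>\<xi>. norm \<xi> ^ 2 * norm (g \<xi>) \<partial>lborel)) * h\<^sup>2"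
    using fourier_taylor[of "y + \<rho> *\<^sub>R v" h v 1]
    by (simp add: scaleR_add_left add.assoc power2_eq_square mult_ac diff_diff_eq)
qed

lemma fourier_continuous: "continuous_on UNIV (fourier g)"
proof -
  have "norm (fourier g x - fourier g y) \<le> (\<integral>\<xi>. norm \<xi> * norm (g \<xi>) \<partial>lborel) * norm (x - y)" for x y
    using fourier_taylor[of y 1 "x - y" 0] by (simp add: mult.commute)
  moreover have "0 \<le> (\<integral>\<xi>. norm \<xi> * norm (g \<xi>) \<partial>lborel)" by (intro integral_nonneg_AE) auto
  ultimately have "(\<integral>\<xi>. norm \<xi> * norm (g \<xi>) \<partial>lborel)-lipschitz_on UNIV (fourier g)"
    by (intro lipschitz_onI) (auto simp: dist_norm)
  then show ?thesis by (rule lipschitz_on_continuous_on)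
qed

end

lemma D_coord_fourier:
  assumes cl: "c > 0" "l \<ge> 1" and g: "g \<in> weakly_decaying c l"
  shows "D_coord k (fourier g) = fourier (\<lambda>\<xi>. of_real (\<xi> $ k) * g \<xi>)"
proof
  fix y
  have "((\<lambda>\<rho>. fourier g (y + \<rho> *\<^sub>R axis k 1)) has_vector_derivative fourier (\<lambda>\<xi>. (\<i> * of_real (axis k 1 \<bullet> \<xi>)) * g \<xi>) (y + 0 *\<^sub>R axis k 1)) (at 0)"
    by (rule fourier_deriv[OF cl g])
  then have "partial_deriv k (fourier g) y = fourier (\<lambda>\<xi>. \<i> * (of_real (\<xi> $ k) * g \<xi>)) y"
    unfolding partial_deriv_def by (simp add: vector_derivative_at inner_axis' mult.assoc)
  also have "\<dots> = \<i> * fourier (\<lambda>\<xi>. of_real (\<xi> $ k) * g \<xi>) y"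
    by (simp add: fourier_def mult.assoc)
  finally show "D_coord k (fourier g) y = fourier (\<lambda>\<xi>. of_real (\<xi> $ k) * g \<xi>) y"
    by (simp add: D_coord_def)
qed

lemma peval_D_fourier:
  assumes cl: "c > 0" "l \<ge> 1" and g: "g \<in> weakly_decaying c l"
  shows "peval_D p (fourier g) y = fourier (\<lambda>\<xi>. peval p \<xi> * g \<xi>) y"
proof -
  have c: "D_coord k (fourier g) = fourier (\<lambda>\<xi>. of_real (\<xi> $ k) * g \<xi>) \<and> (\<lambda>\<xi>. of_real (\<xi> $ k) * g \<xi>) \<in> weakly_decaying c l"
    if "g \<in> weakly_decaying c l" for k g
    using D_coord_fourier[OF cl that, of k] weakly_decaying_inner(1)[OF that, of "axis k 1"] by (simp add: inner_axis')
  have D: "D_multi \<alpha> (fourier g) = fourier (\<lambda>\<xi>. monom_at \<xi> \<alpha> * g \<xi>)" "(\<lambda>\<xi>. monom_at \<xi> \<alpha> * g \<xi>) \<in> weakly_decaying c l" for \<alpha>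
    using D_multi_multiplier[where G="weakly_decaying c l" and \<Phi>=fourier, OF c g] by auto
  have "peval_D p (fourier g) y = (\<Sum>\<alpha>\<in>Poly_Mapping.keys p. Poly_Mapping.lookup p \<alpha> * (\<integral>\<xi>. monom_at \<xi> \<alpha> * g \<xi> * cis (y \<bullet> \<xi>) \<partial>lborel)) / of_real ((2 * pi) ^ CARD('a))"
    by (simp add: peval_D_def D fourier_def sum_divide_distrib)
  also have "(\<Sum>\<alpha>\<in>Poly_Mapping.keys p. Poly_Mapping.lookup p \<alpha> * (\<integral>\<xi>. monom_at \<xi> \<alpha> * g \<xi> * cis (y \<bullet> \<xi>) \<partial>lborel)) = 
    (\<integral>\<xi>. (\<Sum>\<alpha>\<in>Poly_Mapping.keys p. Poly_Mapping.lookup p \<alpha> * (monom_at \<xi> \<alpha> * g \<xi> * cis (y \<bullet> \<xi>))) \<partial>lborel)"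
    using integrable_mult_right[OF weakly_decaying_integrable(2)[OF cl D(2), where y=y]]
    by (subst Bochner_Integration.integral_sum) (simp_all only: integral_mult_right_zero)
  also have "\<dots> = (\<integral>\<xi>. peval p \<xi> * g \<xi> * cis (y \<bullet> \<xi>) \<partial>lborel)"
    by (simp add: peval_def sum_distrib_right mult.assoc)
  finally show ?thesis by (simp only: fourier_def[where g="\<lambda>\<xi>. peval p \<xi> * g \<xi>"])
qed


text \<open>The restriction to shifts of length at most one keeps the class closed under products.\<close>

definition poly_lipschitz :: "(real ^ 'd::finite \<Rightarrow> complex) \<Rightarrow> bool" where
  "poly_lipschitz p \<longleftrightarrow> (\<exists>C\<ge>0. \<exists>q. \<forall>\<xi>. norm (p \<xi>) \<le> C * (1 + norm \<xi>) ^ q \<and>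
     (\<forall>\<eta>. norm \<eta> \<le> 1 \<longrightarrow> norm (p (\<xi> + \<eta>) - p \<xi>) \<le> C * norm \<eta> * (1 + norm \<xi>) ^ q))"

lemma poly_lipschitz_const: "poly_lipschitz (\<lambda>_. c)"
  unfolding poly_lipschitz_def by (intro exI[of _ "norm c"] conjI exI[of _ 0]) auto

lemma poly_lipschitz_component: "poly_lipschitz (\<lambda>\<xi>. of_real (\<xi> $ k))"
  unfolding poly_lipschitz_def
proof (intro exI[of _ 1] conjI exI[of _ 1] allI impI)
  fix \<xi> \<eta> :: "real ^ 'a"
  show "norm (complex_of_real (\<xi> $ k)) \<le> 1 * (1 + norm \<xi>) ^ 1"
    using component_le_norm_cart[of \<xi> k] by simp
  have "norm \<eta> * 1 \<le> norm \<eta> * (1 + norm \<xi>)" by (intro mult_left_mono) auto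
  then show "norm (complex_of_real ((\<xi> + \<eta>) $ k) - of_real (\<xi> $ k)) \<le> 1 * norm \<eta> * (1 + norm \<xi>) ^ 1"
    using component_le_norm_cart[of \<eta> k] by simp
qed simp

lemma poly_lipschitz_mono:
  fixes C C' x :: real
  assumes "0 \<le> C" "C \<le> C'" "q \<le> q'" "0 \<le> x"
  shows "C * (1 + x) ^ q \<le> C' * (1 + x) ^ q'"
  using assms by (intro mult_mono power_increasing) auto

lemma poly_lipschitz_add:
  assumes "poly_lipschitz f" "poly_lipschitz g"
  shows "poly_lipschitz (\<lambda>\<xi>. f \<xi> + g \<xi>)"
proof -
  obtain C p where f: "C \<ge> 0" "\<And>\<xi>. norm (f \<xi>) \<le> C * (1 + norm \<xi>) ^ p"
     "\<And>\<xi> \<eta>. norm \<eta> \<le> 1 \<Longrightarrow> norm (f (\<xi> + \<eta>) - f \<xi>) \<le> C * norm \<eta> * (1 + norm \<xi>) ^ p"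
    using assms(1) unfolding poly_lipschitz_def by blast
  obtain D q where g: "D \<ge> 0" "\<And>\<xi>. norm (g \<xi>) \<le> D * (1 + norm \<xi>) ^ q"
     "\<And>\<xi> \<eta>. norm \<eta> \<le> 1 \<Longrightarrow> norm (g (\<xi> + \<eta>) - g \<xi>) \<le> D * norm \<eta> * (1 + norm \<xi>) ^ q"
    using assms(2) unfolding poly_lipschitz_def by blast
  have 1: "norm (f \<xi> + g \<xi>) \<le> (C + D) * (1 + norm \<xi>) ^ (p + q)" for \<xi>
    using order_trans[OF f(2)[of \<xi>] poly_lipschitz_mono[of C C p "p + q" "norm \<xi>"]]
      order_trans[OF g(2)[of \<xi>] poly_lipschitz_mono[of D D q "p + q" "norm \<xi>"]] f(1) g(1)
    by (simp add: distrib_right) (meson add_mono norm_triangle_le)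
  have 2: "norm ((f (\<xi> + \<eta>) + g (\<xi> + \<eta>)) - (f \<xi> + g \<xi>)) \<le> (C + D) * norm \<eta> * (1 + norm \<xi>) ^ (p + q)" if "norm \<eta> \<le> 1" for \<xi> \<eta>
  proof -
    have "norm (f (\<xi> + \<eta>) - f \<xi>) \<le> C * norm \<eta> * (1 + norm \<xi>) ^ (p + q)"
      using order_trans[OF f(3)[OF that, of \<xi>] poly_lipschitz_mono[of "C * norm \<eta>" "C * norm \<eta>" p "p + q" "norm \<xi>"]] f(1) by simp
    moreover have "norm (g (\<xi> + \<eta>) - g \<xi>) \<le> D * norm \<eta> * (1 + norm \<xi>) ^ (p + q)"
      using order_trans[OF g(3)[OF that, of \<xi>] poly_lipschitz_mono[of "D * norm \<eta>" "D * norm \<eta>" q "p + q" "norm \<xi>"]] g(1) by simp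
    ultimately have "norm ((f (\<xi> + \<eta>) - f \<xi>) + (g (\<xi> + \<eta>) - g \<xi>)) \<le> (C + D) * norm \<eta> * (1 + norm \<xi>) ^ (p + q)"
      using norm_triangle_ineq[of "f (\<xi> + \<eta>) - f \<xi>" "g (\<xi> + \<eta>) - g \<xi>"] by (simp add: distrib_right)
    moreover have "(f (\<xi> + \<eta>) + g (\<xi> + \<eta>)) - (f \<xi> + g \<xi>) = (f (\<xi> + \<eta>) - f \<xi>) + (g (\<xi> + \<eta>) - g \<xi>)" by simp
    ultimately show ?thesis by metis
  qed
  show ?thesis unfolding poly_lipschitz_def
    using 1 2 f(1) g(1) by (intro exI[of _ "C + D"] conjI exI[of _ "p + q"]) auto
qed

lemma poly_lipschitz_mult:
  assumes "poly_lipschitz f" "poly_lipschitz g"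
  shows "poly_lipschitz (\<lambda>\<xi>. f \<xi> * g \<xi>)"
proof -
  obtain C p where f: "C \<ge> 0" "\<And>\<xi>. norm (f \<xi>) \<le> C * (1 + norm \<xi>) ^ p"
     "\<And>\<xi> \<eta>. norm \<eta> \<le> 1 \<Longrightarrow> norm (f (\<xi> + \<eta>) - f \<xi>) \<le> C * norm \<eta> * (1 + norm \<xi>) ^ p"
    using assms(1) unfolding poly_lipschitz_def by blast
  obtain D q where g: "D \<ge> 0" "\<And>\<xi>. norm (g \<xi>) \<le> D * (1 + norm \<xi>) ^ q"
     "\<And>\<xi> \<eta>. norm \<eta> \<le> 1 \<Longrightarrow> norm (g (\<xi> + \<eta>) - g \<xi>) \<le> D * norm \<eta> * (1 + norm \<xi>) ^ q"
    using assms(2) unfolding poly_lipschitz_def by blast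
  have 1: "norm (f \<xi> * g \<xi>) \<le> (C * D) * (1 + norm \<xi>) ^ (p + q)" for \<xi>
    using mult_mono[OF f(2)[of \<xi>] g(2)[of \<xi>]] f(1) by (simp add: norm_mult power_add mult_ac)
  have 2: "norm (f (\<xi> + \<eta>) * g (\<xi> + \<eta>) - f \<xi> * g \<xi>) \<le> (3 * C * D) * norm \<eta> * (1 + norm \<xi>) ^ (p + q)" if \<eta>: "norm \<eta> \<le> 1" for \<xi> \<eta>
  proof -
    have "norm (g (\<xi> + \<eta>)) \<le> norm (g \<xi>) + norm (g (\<xi> + \<eta>) - g \<xi>)"
      using norm_triangle_sub[of "g (\<xi> + \<eta>)" "g \<xi>"] by simp
    also have "\<dots> \<le> D * (1 + norm \<xi>) ^ q + D * 1 * (1 + norm \<xi>) ^ q"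
    proof (intro add_mono g(2))
      have "D * norm \<eta> * (1 + norm \<xi>) ^ q \<le> D * 1 * (1 + norm \<xi>) ^ q"
        using g(1) \<eta> by (intro mult_right_mono mult_left_mono) auto
      then show "norm (g (\<xi> + \<eta>) - g \<xi>) \<le> D * 1 * (1 + norm \<xi>) ^ q" using g(3)[OF \<eta>, of \<xi>] by linarith
    qed
    finally have g2: "norm (g (\<xi> + \<eta>)) \<le> 2 * D * (1 + norm \<xi>) ^ q" by simp
    have "f (\<xi> + \<eta>) * g (\<xi> + \<eta>) - f \<xi> * g \<xi> = (f (\<xi> + \<eta>) - f \<xi>) * g (\<xi> + \<eta>) + f \<xi> * (g (\<xi> + \<eta>) - g \<xi>)"
      by (simp add: algebra_simps)
    also have "norm \<dots> \<le> norm (f (\<xi> + \<eta>) - f \<xi>) * norm (g (\<xi> + \<eta>)) + norm (f \<xi>) * norm (g (\<xi> + \<eta>) - g \<xi>)"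
      by (metis norm_mult norm_triangle_ineq)
    also have "\<dots> \<le> (C * norm \<eta> * (1 + norm \<xi>) ^ p) * (2 * D * (1 + norm \<xi>) ^ q) + (C * (1 + norm \<xi>) ^ p) * (D * norm \<eta> * (1 + norm \<xi>) ^ q)"
      using f g g2 \<eta> by (intro add_mono mult_mono) auto
    also have "\<dots> = (3 * C * D) * norm \<eta> * (1 + norm \<xi>) ^ (p + q)" by (simp add: power_add algebra_simps)
    finally show ?thesis .
  qed
  have bnd: "norm (f \<xi> * g \<xi>) \<le> (3 * C * D) * (1 + norm \<xi>) ^ (p + q)" for \<xi>
    using order_trans[OF 1[of \<xi>] poly_lipschitz_mono[of "C * D" "3 * C * D" "p + q" "p + q" "norm \<xi>"]] f(1) g(1) by simp
  show ?thesis unfolding poly_lipschitz_def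
    using bnd 2 f(1) g(1) by (intro exI[of _ "3 * C * D"] conjI exI[of _ "p + q"]) auto
qed

lemma poly_lipschitz_sum: "(\<And>i. i \<in> I \<Longrightarrow> poly_lipschitz (f i)) \<Longrightarrow> poly_lipschitz (\<lambda>\<xi>. \<Sum>i\<in>I. f i \<xi>)"
  by (induction I rule: infinite_finite_induct) (auto intro: poly_lipschitz_const poly_lipschitz_add)

lemma poly_lipschitz_monom: "poly_lipschitz (\<lambda>\<xi>. monom_at \<xi> \<alpha>)"
proof -
  have "poly_lipschitz (\<lambda>\<xi>. f \<xi> ^ n)" if "poly_lipschitz f" for f :: "real ^ 'a \<Rightarrow> complex" and n
    by (induction n) (auto intro: poly_lipschitz_const poly_lipschitz_mult that)
  then have "poly_lipschitz (\<lambda>\<xi>. \<Prod>k\<in>I. complex_of_real (\<xi> $ k) ^ \<alpha> k)" for I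
    by (induction I rule: infinite_finite_induct) (auto intro!: poly_lipschitz_const poly_lipschitz_mult poly_lipschitz_component)
  then show ?thesis by (simp add: monom_at_def[abs_def])
qed

lemma poly_lipschitz_peval: "poly_lipschitz (peval p)"
  unfolding peval_def[abs_def] by (intro poly_lipschitz_sum poly_lipschitz_mult poly_lipschitz_const poly_lipschitz_monom)

lemma poly_lipschitz_diff_symbol: "poly_lipschitz (diff_symbol l b)"
  unfolding diff_symbol_def[abs_def] by (intro poly_lipschitz_sum poly_lipschitz_mult poly_lipschitz_const poly_lipschitz_monom)

section \<open>Decay of Fourier integrals\<close>

lemma integral_translation:
  fixes f :: "real ^ 'd::finite \<Rightarrow> complex"
  assumes [measurable]: "f \<in> borel_measurable borel"
  shows "(\<integral>x. f (x + c) \<partial>lborel) = (\<integral>x. f x \<partial>lborel)"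
    and "integrable lborel f \<Longrightarrow> integrable lborel (\<lambda>x. f (x + c))"
proof -
  have "(\<integral>x. f x \<partial>lborel) = (\<integral>x. f x \<partial>distr lborel borel ((+) c))" by (simp add: lborel_distr_plus)
  also have "\<dots> = (\<integral>x. f (c + x) \<partial>lborel)" by (subst integral_distr) auto
  finally show "(\<integral>x. f (x + c) \<partial>lborel) = (\<integral>x. f x \<partial>lborel)" by (simp add: add.commute)
  assume "integrable lborel f"
  then have "integrable (distr lborel borel ((+) c)) f" by (simp add: lborel_distr_plus)
  then show "integrable lborel (\<lambda>x. f (x + c))" by (subst (asm) integrable_distr_eq) (auto simp: add.commute)
qed

text \<open>Shifting the integrand by \<open>\<pi> y / |y|\<^sup>2\<close> changes the sign of the exponential factor, so a Lipschitz
  bound in the mean yields the decay of the transform.\<close>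

lemma fourier_decay:
  fixes g :: "real ^ 'd::finite \<Rightarrow> complex"
  assumes cl: "c > 0" "l \<ge> 1" and g: "g \<in> weakly_decaying c l"
    and W: "integrable lborel W" and L: "\<And>\<xi> \<eta>. norm \<eta> \<le> 1 \<Longrightarrow> norm (g (\<xi> + \<eta>) - g \<xi>) \<le> norm \<eta> * W \<xi>"
  shows "\<exists>C\<ge>0. \<forall>y. norm (fourier g y) \<le> C \<and> norm y * norm (fourier g y) \<le> C"
proof -
  have [measurable]: "g \<in> borel_measurable borel" using g by (auto simp: weakly_decaying_def)
  let ?I = "\<integral>\<xi>. norm (g \<xi>) \<partial>lborel" and ?W = "\<integral>\<xi>. W \<xi> \<partial>lborel"
  have ig: "integrable lborel (\<lambda>\<xi>. norm (g \<xi>))" using weakly_decaying_integrable(3)[OF cl g] by simp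
  have I0: "?I \<ge> 0" by (intro integral_nonneg_AE) auto
  \<comment> \<open>The Lipschitz bound, tested with some unit vector, forces the majorant to be
    nonnegative.\<close>
  have W0: "W \<xi> \<ge> 0" for \<xi>
  proof -
    define \<eta> :: "real ^ 'd" where "\<eta> = axis (SOME k. True) 1"
    have "norm \<eta> = 1" by (simp add: \<eta>_def)
    then show ?thesis using order_trans[OF norm_ge_zero L[of \<eta> \<xi>]] by simp
  qed
  have WI: "?W \<ge> 0" by (intro integral_nonneg_AE) (auto simp: W0)
  have far: "norm y * norm (fourier g y) \<le> 2 * ?W" if y: "norm y \<ge> pi" for y
  proof -
    have yp: "norm y > 0" using y pi_gt_zero by linarith
    define \<eta> where "\<eta> = (pi / (norm y)\<^sup>2) *\<^sub>R y"
    have n\<eta>: "norm \<eta> = pi / norm y" using yp by (simp add: \<eta>_def power2_eq_square)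
    then have n1: "norm \<eta> \<le> 1" using y yp by simp
    have y\<eta>: "y \<bullet> \<eta> = pi" using yp by (simp add: \<eta>_def dot_square_norm)
    let ?F = "\<integral>\<xi>. g \<xi> * cis (y \<bullet> \<xi>) \<partial>lborel"
    have "?F = (\<integral>\<xi>. g (\<xi> + \<eta>) * cis (y \<bullet> (\<xi> + \<eta>)) \<partial>lborel)"
      by (rule integral_translation(1)[symmetric]) measurable
    also have "\<dots> = (\<integral>\<xi>. - (g (\<xi> + \<eta>) * cis (y \<bullet> \<xi>)) \<partial>lborel)"
      by (simp add: inner_add_right y\<eta> cis_mult[symmetric])
    finally have F: "?F = - (\<integral>\<xi>. g (\<xi> + \<eta>) * cis (y \<bullet> \<xi>) \<partial>lborel)" by simp
    have "integrable lborel (\<lambda>\<xi>. (\<lambda>\<xi>. g \<xi> * cis (y \<bullet> \<xi>) * cis (- pi)) (\<xi> + \<eta>))"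
      by (intro integral_translation(2) integrable_mult_left weakly_decaying_integrable(2)[OF cl g]) measurable
    then have i2: "integrable lborel (\<lambda>\<xi>. g (\<xi> + \<eta>) * cis (y \<bullet> \<xi>))"
      by (simp add: inner_add_right y\<eta> cis_mult mult.assoc)
    have "2 * ?F = ?F - (\<integral>\<xi>. g (\<xi> + \<eta>) * cis (y \<bullet> \<xi>) \<partial>lborel)" using F by simp
    also have "\<dots> = (\<integral>\<xi>. g \<xi> * cis (y \<bullet> \<xi>) - g (\<xi> + \<eta>) * cis (y \<bullet> \<xi>) \<partial>lborel)"
      by (rule Bochner_Integration.integral_diff[symmetric, OF weakly_decaying_integrable(2)[OF cl g] i2])
    finally have "norm (2 * ?F) = norm (\<integral>\<xi>. g \<xi> * cis (y \<bullet> \<xi>) - g (\<xi> + \<eta>) * cis (y \<bullet> \<xi>) \<partial>lborel)" by simp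
    also have "\<dots> \<le> (\<integral>\<xi>. norm (g \<xi> * cis (y \<bullet> \<xi>) - g (\<xi> + \<eta>) * cis (y \<bullet> \<xi>)) \<partial>lborel)"
      by (rule integral_norm_bound)
    also have "\<dots> \<le> (\<integral>\<xi>. norm \<eta> * W \<xi> \<partial>lborel)"
    proof (rule integral_mono_AE')
      show "AE \<xi> in lborel. norm (g \<xi> * cis (y \<bullet> \<xi>) - g (\<xi> + \<eta>) * cis (y \<bullet> \<xi>)) \<le> norm \<eta> * W \<xi>"
        using L[OF n1] by (intro AE_I2) (simp add: left_diff_distrib[symmetric] norm_mult norm_minus_commute)
    qed (use W W0 in auto)
    also have "\<dots> = pi / norm y * ?W" by (simp add: n\<eta>)
    finally have "norm y * (2 * norm ?F) \<le> pi * ?W" using yp by (simp add: norm_mult field_simps)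
    moreover have "norm (fourier g y) \<le> norm ?F"
    proof -
      have "1 \<le> 2 * pi" using pi_ge_two by linarith
      then have "1 \<le> (2 * pi) ^ CARD('d)" by (rule one_le_power)
      then have "norm ?F / (2 * pi) ^ CARD('d) \<le> norm ?F"
        by (auto simp: divide_le_eq mult_le_cancel_left1)
      then show ?thesis by (simp add: fourier_def norm_divide norm_mult norm_power)
    qed
    then have "norm y * norm (fourier g y) \<le> norm y * norm ?F" by (intro mult_left_mono) auto
    moreover have "pi * ?W \<le> 4 * ?W" using WI pi_less_4 by (intro mult_right_mono) auto
    ultimately show ?thesis by linarith
  qed
  have near: "norm (fourier g y) \<le> ?I" for y by (rule norm_fourier_le[OF ig])
  have "norm y * norm (fourier g y) \<le> 4 * ?I + 2 * ?W" for y
  proof (cases "norm y \<ge> pi")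
    case True
    then show ?thesis using far[of y] I0 by linarith
  next
    case False
    then have "norm y * norm (fourier g y) \<le> 4 * ?I"
      using near[of y] pi_less_4 by (intro mult_mono) auto
    then show ?thesis using WI by linarith
  qed
  moreover have "norm (fourier g y) \<le> 4 * ?I + 2 * ?W" for y
    using near[of y] I0 WI by linarith
  ultimately show ?thesis using I0 WI by (intro exI[of _ "4 * ?I + 2 * ?W"]) auto
qed

subsection \<open>The functions \<open>H\<^sub>k\<close>\<close>

context green_expansion
begin

lemma exp_coeff_measurable[measurable]: "exp_coeff k \<in> borel_measurable borel"
  unfolding exp_coeff_def[abs_def] by measurable

lemma exp_coeff_decaying: "exp_coeff k \<in> weakly_decaying decay l"
proof (cases "k = 0")
  case True
  have "norm (exp_coeff 0 \<xi>) \<le> 1 * (1 + norm \<xi>) ^ 0 * dec \<xi>" for \<xi>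
    using norm_exp_B_le[of \<xi>] by (simp add: exp_coeff_def)
  then have "\<exists>C q. \<forall>\<xi>. norm (exp_coeff 0 \<xi>) \<le> C * (1 + norm \<xi>) ^ q * dec \<xi>" by blast
  then show ?thesis using True by (simp add: weakly_decaying_def)
next
  case False
  obtain D where D: "D \<ge> 0" "\<And>\<xi>. norm (exp_coeff k \<xi>) \<le> D * norm \<xi> ^ (k + l) * dec \<xi>"
    using exp_expansion_uniform False by (metis less_one not_le)
  have "norm (exp_coeff k \<xi>) \<le> D * (1 + norm \<xi>) ^ (k + l) * dec \<xi>" for \<xi>
    using D(1) by (intro order_trans[OF D(2)] mult_right_mono mult_left_mono power_mono) auto
  then show ?thesis by (auto simp: weakly_decaying_def)
qed

lemmas decay_l = decay(1) l_ge_1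

text \<open>Under the integral \<open>peval_D p\<close> becomes multiplication by
  \<open>peval p\<close>. Thus all \<open>H_fun\<close> are transforms of one family, and the
  estimates for \<open>exp_coeff\<close> apply to them.\<close>

lemma H_fun_fourier: "H_fun l b P k = fourier (exp_coeff k)"
proof (cases "k = 0")
  case True
  then show ?thesis
    by (auto simp: H_fun_def H_ker_def[abs_def] fourier_def exp_coeff_def)
next
  case False
  have "H_ker l b = fourier (exp_coeff 0)"
    by (auto simp: H_ker_def[abs_def] fourier_def exp_coeff_def)
  then have "H_fun l b P k y = fourier (\<lambda>\<xi>. peval (P (k + l)) \<xi> * exp_coeff 0 \<xi>) y" for y
    using False peval_D_fourier[OF decay_l exp_coeff_decaying] by (simp add: H_fun_def)
  moreover have "(\<lambda>\<xi>. peval (P (k + l)) \<xi> * exp_coeff 0 \<xi>) = exp_coeff k"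
    using False by (auto simp: exp_coeff_def)
  ultimately show ?thesis by auto
qed

text \<open>The polynomial and the exponential are varied in turn. A shift of length at most 1
  reduces the modulus to no less than \<open>|\<xi>| - 1\<close>, which is at least
  \<open>|\<xi>| / 2\<close> once \<open>|\<xi>| \<ge> 2\<close>; this explains the rate
  \<open>decay / 2 ^ l\<close>. For smaller \<open>|\<xi>|\<close> the constant
  \<open>exp decay\<close> makes up for the difference.\<close>

lemma exp_coeff_lipschitz:
  "\<exists>W. integrable lborel W \<and> (\<forall>\<xi> \<eta>. norm \<eta> \<le> 1 \<longrightarrow> norm (exp_coeff k (\<xi> + \<eta>) - exp_coeff k \<xi>) \<le> norm \<eta> * W \<xi>)"
proof -
  define p where "p = (\<lambda>\<xi>. if k = 0 then 1 else peval (P (k + l)) \<xi>)"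
  have "poly_lipschitz p" by (cases "k = 0") (auto simp: p_def poly_lipschitz_const poly_lipschitz_peval)
  then obtain C q where p: "C \<ge> 0" "\<And>\<xi>. norm (p \<xi>) \<le> C * (1 + norm \<xi>) ^ q"
     "\<And>\<xi> \<eta>. norm \<eta> \<le> 1 \<Longrightarrow> norm (p (\<xi> + \<eta>) - p \<xi>) \<le> C * norm \<eta> * (1 + norm \<xi>) ^ q"
    unfolding poly_lipschitz_def by blast
  obtain D q' where D: "D \<ge> 0" "\<And>\<xi> \<eta>. norm \<eta> \<le> 1 \<Longrightarrow> norm (B (\<xi> + \<eta>) - B \<xi>) \<le> D * norm \<eta> * (1 + norm \<xi>) ^ q'"
    using poly_lipschitz_diff_symbol[of l b] unfolding poly_lipschitz_def by blast
  let ?c = "decay / 2 ^ l"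
  have c: "?c > 0" using decay(1) by simp
  let ?W = "\<lambda>\<xi>::real ^ 'd. ((C + C * D) * exp decay) * ((1 + norm \<xi>) ^ (q + q') * exp (- ?c * norm \<xi> ^ l))"
  have "norm (exp_coeff k (\<xi> + \<eta>) - exp_coeff k \<xi>) \<le> norm \<eta> * ?W \<xi>" if \<eta>: "norm \<eta> \<le> 1" for \<xi> \<eta>
  proof -
    define m where "m = decay * (max 0 (norm \<xi> - 1)) ^ l"
    have mm: "m \<le> decay * norm \<zeta> ^ l" if "norm \<zeta> \<ge> norm \<xi> - 1" for \<zeta> :: "real ^ 'd"
      unfolding m_def using that decay(1) by (intro mult_left_mono power_mono) auto
    have m1: "m \<le> Re (B \<xi>)" using mm[of \<xi>] decay(2)[of \<xi>] by simp
    have m2: "m \<le> Re (B (\<xi> + \<eta>))"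
      using mm[of "\<xi> + \<eta>"] decay(2)[of "\<xi> + \<eta>"] norm_triangle_ineq4[of "\<xi> + \<eta>" \<eta>] \<eta> by simp
    have em: "exp (- m) \<le> exp decay * exp (- ?c * norm \<xi> ^ l)"
    proof (cases "norm \<xi> \<ge> 2")
      case True
      then have "norm \<xi> / 2 \<le> max 0 (norm \<xi> - 1)" by auto
      then have "decay * (norm \<xi> / 2) ^ l \<le> m"
        unfolding m_def using decay(1) by (intro mult_left_mono power_mono) auto
      then have "?c * norm \<xi> ^ l \<le> m" by (simp add: power_divide)
      then have "- m \<le> decay + - ?c * norm \<xi> ^ l" using decay(1) by simp
      then show ?thesis by (simp add: exp_add[symmetric])
    next
      case False
      then have "norm \<xi> ^ l \<le> 2 ^ l" by (intro power_mono) auto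
      then have "?c * norm \<xi> ^ l \<le> ?c * 2 ^ l" using c by (intro mult_left_mono) auto
      moreover have "0 \<le> m" unfolding m_def using decay(1) by simp
      ultimately have "- m \<le> decay + - ?c * norm \<xi> ^ l" by simp
      then show ?thesis by (simp add: exp_add[symmetric])
    qed
    have e1: "norm (exp (- B (\<xi> + \<eta>))) \<le> exp (- m)" using m2 by (simp add: norm_exp_eq_Re)
    have "exp_coeff k (\<xi> + \<eta>) - exp_coeff k \<xi> = exp (- B (\<xi> + \<eta>)) * (p (\<xi> + \<eta>) - p \<xi>) + p \<xi> * (exp (- B (\<xi> + \<eta>)) - exp (- B \<xi>))"
      by (simp add: exp_coeff_def p_def algebra_simps)
    also have "norm \<dots> \<le> norm (exp (- B (\<xi> + \<eta>))) * norm (p (\<xi> + \<eta>) - p \<xi>) + norm (p \<xi>) * norm (exp (- B (\<xi> + \<eta>)) - exp (- B \<xi>))"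
      by (metis norm_mult norm_triangle_ineq)
    also have "\<dots> \<le> exp (- m) * (C * norm \<eta> * (1 + norm \<xi>) ^ q) + (C * (1 + norm \<xi>) ^ q) * ((D * norm \<eta> * (1 + norm \<xi>) ^ q') * exp (- m))"
    proof (intro add_mono mult_mono e1 p \<eta>)
      have "norm (exp (- B (\<xi> + \<eta>)) - exp (- B \<xi>)) \<le> norm (B (\<xi> + \<eta>) - B \<xi>) * exp (- m)"
        using m1 m2 by (rule norm_exp_minus_diff_le[rotated])
      also have "\<dots> \<le> (D * norm \<eta> * (1 + norm \<xi>) ^ q') * exp (- m)"
        using D(2)[OF \<eta>] by (intro mult_right_mono) auto
      finally show "norm (exp (- B (\<xi> + \<eta>)) - exp (- B \<xi>)) \<le> (D * norm \<eta> * (1 + norm \<xi>) ^ q') * exp (- m)" .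
    qed (use p(1) in auto)
    also have "\<dots> = exp (- m) * norm \<eta> * (C * (1 + norm \<xi>) ^ q + C * D * (1 + norm \<xi>) ^ (q + q'))"
      by (simp add: power_add algebra_simps)
    also have "\<dots> \<le> exp (- m) * norm \<eta> * (C * (1 + norm \<xi>) ^ (q + q') + C * D * (1 + norm \<xi>) ^ (q + q'))"
      by (rule mult_left_mono[OF add_right_mono[OF poly_lipschitz_mono]]) (use p(1) in auto)
    also have "\<dots> = norm \<eta> * ((C + C * D) * (1 + norm \<xi>) ^ (q + q')) * exp (- m)" by (simp add: algebra_simps)
    also have "\<dots> \<le> norm \<eta> * ((C + C * D) * (1 + norm \<xi>) ^ (q + q')) * (exp decay * exp (- ?c * norm \<xi> ^ l))"
      using p(1) D(1) by (intro mult_left_mono em) auto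
    finally show ?thesis by (simp add: mult_ac)
  qed
  moreover have "integrable lborel ?W"
    by (intro integrable_mult_right integrable_weight[OF c l_ge_1])
  ultimately show ?thesis by blast
qed

text \<open>One power of decay is enough: in the tail integrals defining \<open>F_fun\<close> the
  weight is at worst \<open>1 / \<rho>\<close>, for \<open>k = l - d\<close>, and the product is
  then integrable at infinity.\<close>

lemma H_decay: "\<exists>C\<ge>0. \<forall>y. norm (H_fun l b P k y) \<le> C \<and> norm y * norm (H_fun l b P k y) \<le> C"
proof -
  obtain W where W: "integrable lborel W" "\<And>\<xi> \<eta>. norm \<eta> \<le> 1 \<Longrightarrow> norm (exp_coeff k (\<xi> + \<eta>) - exp_coeff k \<xi>) \<le> norm \<eta> * W \<xi>"
    using exp_coeff_lipschitz by blast
  show ?thesis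
    unfolding H_fun_fourier by (rule fourier_decay[OF decay_l exp_coeff_decaying W])
qed

lemma H_fun_continuous: "continuous_on S (H_fun l b P k)"
  using fourier_continuous[OF decay_l exp_coeff_decaying[of k]] unfolding H_fun_fourier by (rule continuous_on_subset) simp

lemma exp_coeff_power_decaying: "(\<lambda>\<xi>. (\<i> * of_real (n \<bullet> \<xi>)) ^ j * exp_coeff k \<xi>) \<in> weakly_decaying decay l"
proof (induction j)
  case (Suc j)
  from weakly_decaying_inner(2)[OF this, of n] show ?case by (simp add: mult.assoc)
qed (simp add: exp_coeff_decaying)

lemma H_dir_fourier: "H_dir l b P k j n = fourier (\<lambda>\<xi>. (\<i> * of_real (n \<bullet> \<xi>)) ^ j * exp_coeff k \<xi>) 0"
proof -
  have "((\<lambda>f \<rho>. vector_derivative f (at \<rho>)) ^^ j) (\<lambda>\<rho>::real. H_fun l b P k (\<rho> *\<^sub>R n)) = 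
    (\<lambda>\<rho>. fourier (\<lambda>\<xi>. (\<i> * of_real (n \<bullet> \<xi>)) ^ j * exp_coeff k \<xi>) (\<rho> *\<^sub>R n))"
  proof (induction j)
    case 0
    then show ?case by (simp add: H_fun_fourier)
  next
    case (Suc j)
    have "((\<lambda>\<rho>. fourier (\<lambda>\<xi>. (\<i> * of_real (n \<bullet> \<xi>)) ^ j * exp_coeff k \<xi>) (0 + \<rho> *\<^sub>R n)) has_vector_derivative
      fourier (\<lambda>\<xi>. (\<i> * of_real (n \<bullet> \<xi>)) * ((\<i> * of_real (n \<bullet> \<xi>)) ^ j * exp_coeff k \<xi>)) (0 + \<rho> *\<^sub>R n)) (at \<rho>)" for \<rho>
      by (rule fourier_deriv[OF decay_l exp_coeff_power_decaying])
    then show ?case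
      unfolding funpow.simps o_def Suc by (auto simp: mult.assoc intro!: vector_derivative_at)
  qed
  then show ?thesis by (simp add: H_dir_def)
qed

lemma H_taylor:
  "\<exists>C\<ge>0. \<forall>n \<rho>. norm n = 1 \<longrightarrow> norm (H_fun l b P k (\<rho> *\<^sub>R n) - (\<Sum>j\<le>J. H_dir l b P k j n / fact j * of_real \<rho> ^ j)) \<le> C * \<bar>\<rho>\<bar> ^ Suc J"
proof -
  let ?C = "\<integral>\<xi>. norm \<xi> ^ Suc J * norm (exp_coeff k \<xi>) \<partial>lborel"
  have "norm (H_fun l b P k (\<rho> *\<^sub>R n) - (\<Sum>j\<le>J. H_dir l b P k j n / fact j * of_real \<rho> ^ j)) \<le> ?C * \<bar>\<rho>\<bar> ^ Suc J" if "norm n = 1" for n \<rho>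
    using fourier_taylor[OF decay_l exp_coeff_decaying[of k], of 0 \<rho> n J] that
    by (simp add: H_fun_fourier H_dir_fourier mult_ac del: power_Suc)
  moreover have "?C \<ge> 0" by (intro integral_nonneg_AE) auto
  ultimately show ?thesis by blast
qed

lemma H_fun_vanish:
  assumes "1 \<le> k" "k < M"
  shows "H_fun l b P k y = 0"
  unfolding H_fun_fourier fourier_def using exp_coeff_vanish[OF assms] by simp

subsection \<open>Expansion of the first Green function\<close>

text \<open>The exponential of the first Green function after the substitution
  \<open>\<theta> = s *\<^sub>R \<xi>\<close>, extended by 0, so that the domain of integration no
  longer depends on \<open>s\<close>.\<close>

definition truncated_exp :: "real \<Rightarrow> real ^ 'd \<Rightarrow> complex" where
  "truncated_exp s \<xi> = indicator (cube pi) (s *\<^sub>R \<xi>) *\<^sub>R exp (- (A (s *\<^sub>R \<xi>) / of_real s ^ l))"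

lemma truncated_exp_measurable[measurable]: "truncated_exp s \<in> borel_measurable borel"
  unfolding truncated_exp_def[abs_def] by measurable

text \<open>Inside the scaled cube this is the uniform expansion. Outside, the truncated exponential
  is 0 but the sum is not; there \<open>s |\<xi>| \<ge> pi\<close>, so every lower power is
  dominated by the power \<open>K + 1\<close>. The term of order 0 lacks the factor
  \<open>|\<xi>| ^ l\<close>, whence \<open>1 + norm \<xi> ^ l\<close>.\<close>

lemma truncated_exp_expansion:
  "\<exists>C\<ge>0. \<forall>s>0. \<forall>\<xi>. norm (truncated_exp s \<xi> - (\<Sum>m\<le>K. of_real s ^ m * exp_coeff m \<xi>))
     \<le> C * (s * norm \<xi>) ^ (K + 1) * (1 + norm \<xi> ^ l) * dec \<xi>"
proof -
  obtain D C' where D': "\<forall>m\<ge>1. \<forall>\<xi>. norm (exp_coeff m \<xi>) \<le> D m * norm \<xi> ^ (m + l) * dec \<xi>"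
    "\<forall>K \<xi> s. s > 0 \<longrightarrow> s *\<^sub>R \<xi> \<in> cube pi \<longrightarrow>
       norm (exp (- (A (s *\<^sub>R \<xi>) / of_real s ^ l)) - (\<Sum>m\<le>K. of_real s ^ m * exp_coeff m \<xi>))
         \<le> C' K * norm \<xi> ^ l * (s * norm \<xi>) ^ (K + 1) * dec \<xi>" "\<forall>m. D m \<ge> 0" "\<forall>m. C' m \<ge> 0"
    using exp_expansion_uniform by blast
  define C where "C = C' K"
  have D: "\<And>m \<xi>. m \<ge> 1 \<Longrightarrow> norm (exp_coeff m \<xi>) \<le> D m * norm \<xi> ^ (m + l) * dec \<xi>" "\<And>m. D m \<ge> 0" "C \<ge> 0"
    "\<And>\<xi> s. s > 0 \<Longrightarrow> s *\<^sub>R \<xi> \<in> cube pi \<Longrightarrow> norm (exp (- (A (s *\<^sub>R \<xi>) / of_real s ^ l)) - (\<Sum>m\<le>K. of_real s ^ m * exp_coeff m \<xi>))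
         \<le> C * norm \<xi> ^ l * (s * norm \<xi>) ^ (K + 1) * dec \<xi>"
    using D' unfolding C_def by auto
  let ?E = "C + (1 + (\<Sum>m=1..K. D m))"
  have S0: "(\<Sum>m=1..K. D m) \<ge> 0" by (intro sum_nonneg D)
  have "norm (truncated_exp s \<xi> - (\<Sum>m\<le>K. of_real s ^ m * exp_coeff m \<xi>)) \<le> ?E * (s * norm \<xi>) ^ (K + 1) * (1 + norm \<xi> ^ l) * dec \<xi>" if s: "s > 0" for s \<xi>
  proof (cases "s *\<^sub>R \<xi> \<in> cube pi")
    case True
    have "norm (truncated_exp s \<xi> - (\<Sum>m\<le>K. of_real s ^ m * exp_coeff m \<xi>)) \<le> C * norm \<xi> ^ l * (s * norm \<xi>) ^ (K + 1) * dec \<xi>"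
      using D(4)[OF s True] True by (simp add: truncated_exp_def)
    also have "\<dots> = C * (s * norm \<xi>) ^ (K + 1) * norm \<xi> ^ l * dec \<xi>" by (simp add: mult_ac)
    also have "\<dots> \<le> ?E * (s * norm \<xi>) ^ (K + 1) * (1 + norm \<xi> ^ l) * dec \<xi>"
      using D S0 s by (intro mult_right_mono mult_mono) auto
    finally show ?thesis .
  next
    case False
    have x: "s * norm \<xi> \<ge> 1" using norm_ge_pi_outside_cube[OF False] s pi_ge_two by simp
    have t: "norm (of_real s ^ m * exp_coeff m \<xi>) \<le> D m * ((s * norm \<xi>) ^ (K + 1) * (1 + norm \<xi> ^ l) * dec \<xi>)" if m: "m \<in> {1..K}" for m
    proof -
      have "norm (of_real s ^ m * exp_coeff m \<xi>) \<le> s ^ m * (D m * norm \<xi> ^ (m + l) * dec \<xi>)"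
        using D(1)[of m \<xi>] m s by (simp add: norm_mult norm_power mult_left_mono)
      also have "\<dots> = D m * ((s * norm \<xi>) ^ m * norm \<xi> ^ l * dec \<xi>)" by (simp add: power_mult_distrib power_add mult_ac)
      also have "\<dots> \<le> D m * ((s * norm \<xi>) ^ (K + 1) * (1 + norm \<xi> ^ l) * dec \<xi>)"
        using m x s by (intro mult_left_mono mult_mono power_increasing D) auto
      finally show ?thesis .
    qed
    have "norm (exp_coeff 0 \<xi>) \<le> 1 * 1 * dec \<xi>" using norm_exp_B_le[of \<xi>] by (simp add: exp_coeff_def)
    also have "\<dots> \<le> (s * norm \<xi>) ^ (K + 1) * (1 + norm \<xi> ^ l) * dec \<xi>"
      using x by (intro mult_right_mono mult_mono one_le_power) auto
    finally have t0: "norm (exp_coeff 0 \<xi>) \<le> (s * norm \<xi>) ^ (K + 1) * (1 + norm \<xi> ^ l) * dec \<xi>" .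
    have "truncated_exp s \<xi> - (\<Sum>m\<le>K. of_real s ^ m * exp_coeff m \<xi>) = - (exp_coeff 0 \<xi> + (\<Sum>m=1..K. of_real s ^ m * exp_coeff m \<xi>))"
      using False by (simp add: truncated_exp_def atMost_atLeast0 sum.atLeast_Suc_atMost)
    then have "norm (truncated_exp s \<xi> - (\<Sum>m\<le>K. of_real s ^ m * exp_coeff m \<xi>)) = norm (exp_coeff 0 \<xi> + (\<Sum>m=1..K. of_real s ^ m * exp_coeff m \<xi>))"
      by (simp only: norm_minus_cancel)
    also have "\<dots> \<le> norm (exp_coeff 0 \<xi>) + (\<Sum>m=1..K. norm (of_real s ^ m * exp_coeff m \<xi>))"
      by (intro order_trans[OF norm_triangle_ineq] add_left_mono norm_sum)
    also have "\<dots> \<le> (s * norm \<xi>) ^ (K + 1) * (1 + norm \<xi> ^ l) * dec \<xi> + (\<Sum>m=1..K. D m * ((s * norm \<xi>) ^ (K + 1) * (1 + norm \<xi> ^ l) * dec \<xi>))"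
      by (intro add_mono t0 sum_mono t)
    also have "\<dots> = (1 + (\<Sum>m=1..K. D m)) * ((s * norm \<xi>) ^ (K + 1) * (1 + norm \<xi> ^ l) * dec \<xi>)"
      by (simp add: sum_distrib_right distrib_right)
    also have "\<dots> \<le> ?E * ((s * norm \<xi>) ^ (K + 1) * (1 + norm \<xi> ^ l) * dec \<xi>)"
      using D s by (intro mult_right_mono) auto
    finally show ?thesis by (simp add: mult_ac)
  qed
  moreover have "?E \<ge> 0" using D S0 by auto
  ultimately show ?thesis by blast
qed

lemma integrable_norm_pow_dec: "integrable lborel (\<lambda>\<xi>. norm \<xi> ^ j * (1 + norm \<xi> ^ l) * dec \<xi>)"
proof -
  have "integrable lborel (\<lambda>\<xi>::real ^ 'd. norm \<xi> ^ j * exp (- decay * norm \<xi> ^ l) + norm \<xi> ^ (j + l) * exp (- decay * norm \<xi> ^ l))"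
    by (intro Bochner_Integration.integrable_add integrable_norm_pow_exp decay_l)
  then show ?thesis by (simp add: power_add algebra_simps)
qed

lemma green1_rescaled:
  assumes "s > 0"
  shows "green1 y (1 / s ^ l) = of_real (s ^ CARD('d)) * fourier (truncated_exp s) (s *\<^sub>R y)"
proof -
  let ?f = "\<lambda>\<theta>. indicator (cube pi) \<theta> *\<^sub>R (exp (- (of_real (1 / s ^ l) * A \<theta>)) * cis (y \<bullet> \<theta>))"
  have "(\<integral>\<theta>. ?f \<theta> \<partial>lborel) = s ^ CARD('d) *\<^sub>R (\<integral>\<xi>. ?f (s *\<^sub>R \<xi>) \<partial>lborel)"
    by (rule lborel_integral_scaleR[OF assms])
  also have "(\<integral>\<xi>. ?f (s *\<^sub>R \<xi>) \<partial>lborel) = (\<integral>\<xi>. truncated_exp s \<xi> * cis ((s *\<^sub>R y) \<bullet> \<xi>) \<partial>lborel)"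
    by (intro Bochner_Integration.integral_cong) (auto simp: truncated_exp_def)
  finally show ?thesis
    by (simp add: green1_def cube_fourier_def fourier_def scaleR_conv_of_real)
qed

text \<open>The error is bounded by the integral of its modulus, from which \<open>y\<close> has
  disappeared; this is the source of uniformity in \<open>y\<close>.\<close>

lemma green1_expansion:
  "\<exists>C\<ge>0. \<forall>s>0. \<forall>y. norm (green1 y (1 / s ^ l) - (\<Sum>k\<le>K. of_real (s ^ (CARD('d) + k)) * H_fun l b P k (s *\<^sub>R y))) \<le> C * s ^ (CARD('d) + K + 1)"
proof -
  obtain C where C: "C \<ge> 0" "\<And>s \<xi>. s > 0 \<Longrightarrow> norm (truncated_exp s \<xi> - (\<Sum>m\<le>K. of_real s ^ m * exp_coeff m \<xi>))
     \<le> C * (s * norm \<xi>) ^ (K + 1) * (1 + norm \<xi> ^ l) * dec \<xi>"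
    using truncated_exp_expansion by blast
  let ?W = "\<lambda>\<xi>::real ^ 'd. norm \<xi> ^ (K + 1) * (1 + norm \<xi> ^ l) * dec \<xi>"
  let ?I = "C * (\<integral>\<xi>. ?W \<xi> \<partial>lborel)"
  have "norm (green1 y (1 / s ^ l) - (\<Sum>k\<le>K. of_real (s ^ (CARD('d) + k)) * H_fun l b P k (s *\<^sub>R y))) \<le> ?I * s ^ (CARD('d) + K + 1)" if s: "s > 0" for s y
  proof -
    let ?R = "\<lambda>\<xi>. truncated_exp s \<xi> - (\<Sum>m\<le>K. of_real s ^ m * exp_coeff m \<xi>)"
    have bnd: "norm (?R \<xi>) \<le> C * s ^ (K + 1) * ?W \<xi>" for \<xi>
      using C(2)[OF s, of \<xi>] by (simp add: power_mult_distrib mult_ac)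
    have iW: "integrable lborel (\<lambda>\<xi>. C * s ^ (K + 1) * ?W \<xi>)"
      by (intro integrable_mult_right integrable_norm_pow_dec)
    have iR: "integrable lborel ?R"
      by (rule Bochner_Integration.integrable_bound[OF iW]) (use bnd in \<open>auto intro!: AE_I2 intro: order_trans[OF _ abs_ge_self]\<close>)
    have iR': "integrable lborel (\<lambda>\<xi>. ?R \<xi> * cis ((s *\<^sub>R y) \<bullet> \<xi>))"
      by (rule Bochner_Integration.integrable_bound[OF iR]) (auto simp: norm_mult)
    have ie: "integrable lborel (\<lambda>\<xi>. of_real s ^ m * (exp_coeff m \<xi> * cis ((s *\<^sub>R y) \<bullet> \<xi>)))" for m
      by (intro integrable_mult_right weakly_decaying_integrable(2)[OF decay_l exp_coeff_decaying])
    have "fourier (truncated_exp s) (s *\<^sub>R y) = fourier (\<lambda>\<xi>. ?R \<xi> + (\<Sum>m\<le>K. of_real s ^ m * exp_coeff m \<xi>)) (s *\<^sub>R y)"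
      by simp
    also have "\<dots> = fourier ?R (s *\<^sub>R y) + (\<Sum>m\<le>K. of_real s ^ m * H_fun l b P m (s *\<^sub>R y))"
    proof -
      have "(\<integral>\<xi>. (?R \<xi> + (\<Sum>m\<le>K. of_real s ^ m * exp_coeff m \<xi>)) * cis ((s *\<^sub>R y) \<bullet> \<xi>) \<partial>lborel) = 
        (\<integral>\<xi>. ?R \<xi> * cis ((s *\<^sub>R y) \<bullet> \<xi>) + (\<Sum>m\<le>K. of_real s ^ m * (exp_coeff m \<xi> * cis ((s *\<^sub>R y) \<bullet> \<xi>))) \<partial>lborel)"
        by (intro Bochner_Integration.integral_cong) (simp_all add: left_diff_distrib sum_distrib_right mult.assoc)
      also have "\<dots> = (\<integral>\<xi>. ?R \<xi> * cis ((s *\<^sub>R y) \<bullet> \<xi>) \<partial>lborel) + (\<Sum>m\<le>K. of_real s ^ m * (\<integral>\<xi>. exp_coeff m \<xi> * cis ((s *\<^sub>R y) \<bullet> \<xi>) \<partial>lborel))"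
        using iR' ie by (simp only: Bochner_Integration.integral_add Bochner_Integration.integrable_sum Bochner_Integration.integral_sum integral_mult_right_zero)
      finally show ?thesis
        by (simp only: fourier_def H_fun_fourier add_divide_distrib sum_divide_distrib times_divide_eq_right)
    qed
    finally have "green1 y (1 / s ^ l) - (\<Sum>k\<le>K. of_real (s ^ (CARD('d) + k)) * H_fun l b P k (s *\<^sub>R y)) = 
       of_real (s ^ CARD('d)) * fourier ?R (s *\<^sub>R y)"
      unfolding green1_rescaled[OF s] by (simp add: distrib_left sum_distrib_left power_add mult_ac)
    then have "norm (green1 y (1 / s ^ l) - (\<Sum>k\<le>K. of_real (s ^ (CARD('d) + k)) * H_fun l b P k (s *\<^sub>R y))) = s ^ CARD('d) * norm (fourier ?R (s *\<^sub>R y))"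
      using s by (simp add: norm_mult norm_power)
    also have "\<dots> \<le> s ^ CARD('d) * (\<integral>\<xi>. norm (?R \<xi>) \<partial>lborel)"
      using s iR by (intro mult_left_mono norm_fourier_le) auto
    also have "\<dots> \<le> s ^ CARD('d) * (\<integral>\<xi>. C * s ^ (K + 1) * ?W \<xi> \<partial>lborel)"
      using s bnd C(1) by (intro mult_left_mono integral_mono_AE'[OF iW]) auto
    also have "(\<integral>\<xi>. C * s ^ (K + 1) * ?W \<xi> \<partial>lborel) = C * s ^ (K + 1) * (\<integral>\<xi>. ?W \<xi> \<partial>lborel)"
      by (rule integral_mult_right_zero)
    also have "s ^ CARD('d) * (C * s ^ (K + 1) * (\<integral>\<xi>. ?W \<xi> \<partial>lborel)) = ?I * s ^ (CARD('d) + K + 1)"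
      by (simp add: power_add)
    finally show ?thesis .
  qed
  moreover have "?I \<ge> 0" using C by (intro mult_nonneg_nonneg integral_nonneg_AE) auto
  ultimately show ?thesis by blast
qed

end

subsection \<open>Large-time expansion of the second Green function at a fixed point\<close>

lemma peval_scale:
  assumes "homogeneous i p"
  shows "peval p (c *\<^sub>R x) = of_real c ^ i * peval p x"
proof -
  have "monom_at (c *\<^sub>R x) \<alpha> = of_real c ^ i * monom_at x \<alpha>" if "\<alpha> \<in> Poly_Mapping.keys p" for \<alpha>
  proof -
    have "(\<Sum>k\<in>UNIV. \<alpha> k) = i" using assms that by (auto simp: homogeneous_def mi_abs_def)
    then show ?thesis
      by (simp add: monom_at_def power_mult_distrib prod.distrib power_sum[symmetric])
  qed
  then show ?thesis by (simp add: peval_def sum_distrib_left mult_ac)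
qed

text \<open>The majorant is required off the origin only, because the values of \<open>Q\<close> are
  controlled there alone.\<close>

lemma integrable_norm_bound:
  fixes f :: "real ^ 'd::finite \<Rightarrow> complex" and W :: "real ^ 'd \<Rightarrow> real"
  assumes "integrable lborel W" "f \<in> borel_measurable borel" "\<And>\<xi>. \<xi> \<noteq> 0 \<Longrightarrow> norm (f \<xi>) \<le> W \<xi>"
  shows "integrable lborel f" "norm (\<integral>\<xi>. f \<xi> \<partial>lborel) \<le> (\<integral>\<xi>. W \<xi> \<partial>lborel)"
proof -
  have ae: "AE \<xi> in lborel. norm (f \<xi>) \<le> W \<xi>"
    using AE_lborel_singleton[of "0 :: real ^ 'd"] by eventually_elim (rule assms(3))
  have ae': "AE \<xi> in lborel. norm (f \<xi>) \<le> norm (W \<xi>)"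
    using ae by eventually_elim auto
  show i: "integrable lborel f"
    by (rule Bochner_Integration.integrable_bound[OF assms(1) _ ae']) (use assms in auto)
  have "norm (\<integral>\<xi>. f \<xi> \<partial>lborel) \<le> (\<integral>\<xi>. norm (f \<xi>) \<partial>lborel)" by (rule integral_norm_bound)
  also have "\<dots> \<le> (\<integral>\<xi>. W \<xi> \<partial>lborel)"
    by (rule integral_mono_AE[OF integrable_norm[OF i] assms(1) ae])
  finally show "norm (\<integral>\<xi>. f \<xi> \<partial>lborel) \<le> (\<integral>\<xi>. W \<xi> \<partial>lborel)" .
qed

text \<open>\<open>N\<close> names the largest index \<open>l - d\<close> of a homogeneous term of
  the inverse symbol; \<open>dim_le\<close> keeps the subtraction exact.\<close>

locale green_setting = green_expansion l lhat a M b P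
  for l lhat :: nat and a :: "('d::finite + 'd \<Rightarrow> nat) \<Rightarrow> complex" and M b P +
  fixes Q :: "nat \<Rightarrow> real ^ 'd \<Rightarrow> real ^ 'd \<Rightarrow> complex"
    and N :: nat
  assumes Q_expansion: "Q_expansion l lhat a Q" and dim_le: "CARD('d) \<le> l" and N_eq: "N = l - CARD('d)"
begin

lemma Q_degree: "k \<le> N \<Longrightarrow> int k - int l = - int (CARD('d) + (N - k))"
  using dim_le N_eq by auto

lemma Q_rational:
  assumes "k \<le> N"
  shows "\<exists>p q i j. homogeneous i p \<and> homogeneous j q \<and> int i - int j = - int (CARD('d) + (N - k)) \<and>
        (\<forall>\<theta>. \<theta> \<noteq> 0 \<longrightarrow> peval q \<theta> \<noteq> 0 \<and> Q k \<theta> y = peval p \<theta> / peval q \<theta>)"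
  using Q_expansion assms unfolding Q_degree[OF assms, symmetric] Q_expansion_def N_eq[symmetric] by blast

lemma Q_scale:
  assumes "k \<le> N" "c > 0" "x \<noteq> 0"
  shows "Q k (c *\<^sub>R x) y = Q k x y * of_real (c powi (- int (CARD('d) + (N - k))))"
proof -
  obtain p q i j where pq: "homogeneous i p" "homogeneous j q" "int i - int j = - int (CARD('d) + (N - k))"
        "\<And>\<theta>. \<theta> \<noteq> 0 \<Longrightarrow> peval q \<theta> \<noteq> 0 \<and> Q k \<theta> y = peval p \<theta> / peval q \<theta>"
    using Q_rational[OF assms(1)] by blast
  have "c powi (int i - int j) = c ^ i / c ^ j" using assms by (simp add: power_int_diff)
  then have "complex_of_real (c powi (int i - int j)) = of_real c ^ i / of_real c ^ j" by (metis of_real_divide of_real_power)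
  then show ?thesis
    using assms pq(4)[of x] pq(4)[of "c *\<^sub>R x"] unfolding pq(3)[symmetric] by (simp add: peval_scale[OF pq(1)] peval_scale[OF pq(2)] mult_ac)
qed

lemma Q_measurable: "k \<le> N \<Longrightarrow> (\<lambda>\<theta>. Q k \<theta> y) \<in> borel_measurable borel"
proof -
  assume "k \<le> N"
  then obtain p q where pq: "\<And>\<theta>. \<theta> \<noteq> 0 \<Longrightarrow> Q k \<theta> y = peval p \<theta> / peval q \<theta>"
    using Q_rational[of k y] by blast
  have "(\<lambda>\<theta>. Q k \<theta> y) = (\<lambda>\<theta>. if \<theta> = 0 then Q k 0 y else peval p \<theta> / peval q \<theta>)"
    using pq by auto
  also have "\<dots> \<in> borel_measurable borel" by measurable
  finally show ?thesis .
qed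

text \<open>The denominator has no zero on the compact sphere; homogeneity carries the bound to all
  nonzero points.\<close>

lemma Q_bound:
  assumes "k \<le> N"
  shows "\<exists>C\<ge>0. (\<forall>x. norm x = 1 \<longrightarrow> norm (Q k x y) \<le> C) \<and> (\<forall>x. x \<noteq> 0 \<longrightarrow> norm (Q k x y) \<le> C / norm x ^ (CARD('d) + (N - k)))"
proof -
  obtain p q where pq: "\<And>\<theta>. \<theta> \<noteq> 0 \<Longrightarrow> peval q \<theta> \<noteq> 0 \<and> Q k \<theta> y = peval p \<theta> / peval q \<theta>"
    using Q_rational[OF assms, of y] by blast
  have nz: "x \<noteq> 0" if "x \<in> sphere (0 :: real ^ 'd) 1" for x using that by auto
  have "continuous_on (sphere 0 1) (\<lambda>\<theta>. peval p \<theta> / peval q \<theta>)"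
    using pq nz by (intro continuous_intros peval_continuous) blast
  then have "compact ((\<lambda>\<theta>. peval p \<theta> / peval q \<theta>) ` sphere 0 1)"
    by (intro compact_continuous_image) auto
  then obtain C where C: "\<And>x. x \<in> sphere 0 1 \<Longrightarrow> norm (peval p x / peval q x) \<le> C"
    using compact_imp_bounded[THEN bounded_iff[THEN iffD1]] by (metis (no_types, lifting) imageI)
  have 1: "norm (Q k x y) \<le> max C 0" if "norm x = 1" for x
    using C[of x] pq[of x] nz[of x] that by auto
  have "norm (Q k x y) \<le> max C 0 / norm x ^ (CARD('d) + (N - k))" if "x \<noteq> 0" for x
    using homogeneous_bound[of "\<lambda>x. Q k x y" "- int (CARD('d) + (N - k))" "max C 0" x, OF Q_scale[OF assms] 1 that]
    unfolding power_int_minus power_int_of_nat by (simp add: divide_inverse)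
  with 1 show ?thesis by (intro exI[of _ "max C 0"]) auto
qed

text \<open>A common majorant for integrals against \<open>Q\<close>. The power \<open>i - d\<close>
  is locally integrable exactly for \<open>i \<ge> 1\<close>, so the other factor must vanish at the
  origin to one order more than is needed to reduce \<open>Q\<close> to degree
  \<open>-d\<close>.\<close>

definition weight :: "nat \<Rightarrow> real ^ 'd \<Rightarrow> real" where
  "weight i \<xi> = norm \<xi> powi (int i - int CARD('d)) * (1 + norm \<xi> ^ l) * dec \<xi>"

lemma weight_measurable[measurable]: "weight i \<in> borel_measurable borel"
  unfolding weight_def[abs_def] power_int_def by measurable

lemma integrable_weight_1: "i \<ge> 1 \<Longrightarrow> integrable lborel (weight i)"
proof -
  assume i: "i \<ge> 1"
  let ?V = "\<lambda>\<xi>::real ^ 'd. 2 * (indicator {..1} (norm \<xi>) * norm \<xi> powi (1 - int CARD('d))) + norm \<xi> ^ i * (1 + norm \<xi> ^ l) * dec \<xi>"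
  have V: "integrable lborel ?V"
    by (intro Bochner_Integration.integrable_add integrable_mult_right integrable_norm_pow_near_0 integrable_norm_pow_dec)
  have "norm (weight i \<xi>) \<le> norm (?V \<xi>)" if "\<xi> \<noteq> 0" for \<xi>
  proof (cases "norm \<xi> \<le> 1")
    case True
    have "norm \<xi> powi (int i - int CARD('d)) \<le> norm \<xi> powi (1 - int CARD('d))"
      using True that i by (intro power_int_decreasing) auto
    moreover have "(1 + norm \<xi> ^ l) * dec \<xi> \<le> 2 * 1"
      using True decay(1) by (intro mult_mono) (auto simp: power_le_one)
    ultimately have "weight i \<xi> \<le> norm \<xi> powi (1 - int CARD('d)) * 2"
      unfolding weight_def mult.assoc by (intro mult_mono) auto
    also have "\<dots> \<le> ?V \<xi>" using True by (auto simp: indicator_def)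
    finally show ?thesis unfolding weight_def by (simp add: abs_mult)
  next
    case False
    have "norm \<xi> powi (int i - int CARD('d)) \<le> norm \<xi> powi (int i)"
      using False by (intro power_int_increasing) auto
    then have "weight i \<xi> \<le> norm \<xi> ^ i * (1 + norm \<xi> ^ l) * dec \<xi>"
      unfolding weight_def by (intro mult_right_mono) auto
    also have "\<dots> \<le> ?V \<xi>" by auto
    finally show ?thesis unfolding weight_def by (simp add: abs_mult)
  qed
  then have "AE \<xi> in lborel. norm (weight i \<xi>) \<le> norm (?V \<xi>)"
    using AE_lborel_singleton[of "0 :: real ^ 'd"] by (auto elim!: eventually_mono)
  then show ?thesis by (intro Bochner_Integration.integrable_bound[OF V]) auto
qed

text \<open>The factor \<open>norm \<xi> ^ (N - k)\<close> in the bound for \<open>f\<close> lowers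
  the singularity of \<open>Q k\<close>, of order \<open>d + N - k\<close>, to order
  \<open>d\<close>; \<open>i\<close> counts the powers left over.\<close>

lemma weight_Q:
  assumes "\<xi> \<noteq> 0" "k \<le> N" and f: "norm f \<le> C * norm \<xi> ^ (i + (N - k)) * (1 + norm \<xi> ^ l) * dec \<xi>"
    and D: "norm (Q k \<xi> y) \<le> D / norm \<xi> ^ (CARD('d) + (N - k))"
  shows "norm (f * Q k \<xi> y) \<le> C * D * weight i \<xi>"
proof -
  have n: "norm \<xi> > 0" using assms by simp
  have "norm (f * Q k \<xi> y) \<le> (C * norm \<xi> ^ (i + (N - k)) * (1 + norm \<xi> ^ l) * dec \<xi>) * (D / norm \<xi> ^ (CARD('d) + (N - k)))"
    unfolding norm_mult by (intro mult_mono f D order_trans[OF norm_ge_zero f]) auto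
  also have "\<dots> = C * D * ((norm \<xi> ^ i / norm \<xi> ^ CARD('d)) * (1 + norm \<xi> ^ l) * dec \<xi>)"
    using n by (simp add: power_add)
  also have "norm \<xi> ^ i / norm \<xi> ^ CARD('d) = norm \<xi> powi (int i - int CARD('d))"
    using n by (simp add: power_int_diff)
  finally show ?thesis by (simp add: weight_def)
qed

lemma integrable_exp_coeff_Q:
  assumes "k \<le> N" "1 \<le> j"
  shows "integrable lborel (\<lambda>\<xi>. exp_coeff j \<xi> * Q k \<xi> y)"
proof -
  note [measurable] = Q_measurable[OF assms(1), of y]
  obtain C where C: "C \<ge> 0" "\<And>x. x \<noteq> 0 \<Longrightarrow> norm (Q k x y) \<le> C / norm x ^ (CARD('d) + (N - k))"
    using Q_bound[OF assms(1)] by blast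
  obtain D where D: "D \<ge> 0" "\<And>\<xi>. norm (exp_coeff j \<xi>) \<le> D * norm \<xi> ^ (j + l) * dec \<xi>"
    using exp_expansion_uniform assms(2) by metis
  have e: "j + l = (j + k + CARD('d)) + (N - k)" using assms dim_le N_eq by auto
  have "norm (exp_coeff j \<xi> * Q k \<xi> y) \<le> D * C * weight (j + k + CARD('d)) \<xi>" if "\<xi> \<noteq> 0" for \<xi>
  proof (rule weight_Q[OF that assms(1) _ C(2)[OF that]])
    have "norm (exp_coeff j \<xi>) \<le> D * norm \<xi> ^ (j + l) * 1 * dec \<xi>" using D(2)[of \<xi>] by simp
    also have "\<dots> \<le> D * norm \<xi> ^ (j + l) * (1 + norm \<xi> ^ l) * dec \<xi>" using D(1) by (intro mult_right_mono mult_left_mono) auto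
    finally show "norm (exp_coeff j \<xi>) \<le> D * norm \<xi> ^ (j + k + CARD('d) + (N - k)) * (1 + norm \<xi> ^ l) * dec \<xi>"
      unfolding e .
  qed
  then show ?thesis
    using assms by (intro integrable_norm_bound(1)[OF integrable_mult_right[OF integrable_weight_1[of "j + k + CARD('d)"]]]) auto
qed

lemma one_minus_exp_bound:
  "\<exists>C\<ge>0. (\<forall>\<xi>. norm (1 - exp (- B \<xi>)) \<le> C * norm \<xi> ^ l) \<and> (\<forall>\<theta>\<in>cube pi. \<forall>t\<ge>0. norm (1 - exp (- (of_real t * A \<theta>))) \<le> t * C * norm \<theta> ^ l)"
proof -
  obtain C where C: "C > 0" "\<And>\<theta>. \<theta>\<in>cube pi \<Longrightarrow> norm (A \<theta>) \<le> C * norm \<theta> ^ l" "\<And>\<xi>. norm (B \<xi>) \<le> C * norm \<xi> ^ l"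
    using symbol_upper_bounds by blast
  have 1: "norm (1 - exp (- z)) \<le> norm z" if "Re z \<ge> 0" for z
    using norm_exp_minus_diff_le[of 0 0 z] that by simp
  have "norm (1 - exp (- B \<xi>)) \<le> C * norm \<xi> ^ l" for \<xi>
  proof -
    have "0 \<le> decay * norm \<xi> ^ l" using decay(1) by simp
    then show ?thesis using 1[of "B \<xi>"] decay(2)[of \<xi>] C(3)[of \<xi>] by linarith
  qed
  moreover have "norm (1 - exp (- (of_real t * A \<theta>))) \<le> t * C * norm \<theta> ^ l" if "\<theta> \<in> cube pi" "t \<ge> 0" for \<theta> t
  proof -
    have "norm (1 - exp (- (of_real t * A \<theta>))) \<le> norm (of_real t * A \<theta>)"
      using Re_nonneg[OF that(1)] that(2) by (intro 1) auto
    also have "\<dots> \<le> t * (C * norm \<theta> ^ l)" using C(2)[OF that(1)] that(2) by (simp add: norm_mult mult_left_mono)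
    finally show ?thesis by (simp add: mult_ac)
  qed
  ultimately show ?thesis using C by (intro exI[of _ C]) auto
qed

lemma integrable_one_minus_exp_Q_ball:
  assumes "k \<le> N"
  shows "integrable lborel (\<lambda>\<xi>. indicator (ball 0 1) \<xi> *\<^sub>R ((1 - exp (- B \<xi>)) * Q k \<xi> y))"
proof -
  note [measurable] = Q_measurable[OF assms(1), of y]
  obtain C where C: "C \<ge> 0" "\<And>x. x \<noteq> 0 \<Longrightarrow> norm (Q k x y) \<le> C / norm x ^ (CARD('d) + (N - k))"
    using Q_bound[OF assms(1)] by blast
  obtain D where D: "D \<ge> 0" "\<And>\<xi>. norm (1 - exp (- B \<xi>)) \<le> D * norm \<xi> ^ l"
    using one_minus_exp_bound by blast
  have "norm (indicator (ball 0 1) \<xi> *\<^sub>R ((1 - exp (- B \<xi>)) * Q k \<xi> y)) \<le> D * C * indicator (ball 0 1) \<xi>" if "\<xi> \<noteq> 0" for \<xi>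
  proof (cases "norm \<xi> < 1")
    case True
    have n: "norm \<xi> > 0" using that by simp
    have e: "l = k + (CARD('d) + (N - k))" using assms dim_le N_eq by auto
    have "norm ((1 - exp (- B \<xi>)) * Q k \<xi> y) \<le> (D * norm \<xi> ^ l) * (C / norm \<xi> ^ (CARD('d) + (N - k)))"
      unfolding norm_mult using D(1) by (intro mult_mono D C that) auto
    also have "norm \<xi> ^ l = norm \<xi> ^ k * norm \<xi> ^ (CARD('d) + (N - k))" using e power_add by metis
    also have "(D * (norm \<xi> ^ k * norm \<xi> ^ (CARD('d) + (N - k)))) * (C / norm \<xi> ^ (CARD('d) + (N - k))) = D * C * norm \<xi> ^ k"
      using n by simp
    also have "\<dots> \<le> D * C * 1" using True D C by (intro mult_left_mono power_le_one) auto
    finally show ?thesis using True by simp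
  qed auto
  moreover have "integrable lborel (\<lambda>\<xi>::real ^ 'd. D * C * indicator (ball 0 1) \<xi> :: real)"
    using emeasure_bounded_finite[OF bounded_ball[of "0 :: real ^ 'd" 1]] by (intro integrable_mult_right integrable_real_indicator) auto
  moreover have "(\<lambda>\<xi>. indicator (ball 0 1) \<xi> *\<^sub>R ((1 - exp (- B \<xi>)) * Q k \<xi> y)) \<in> borel_measurable borel"
    by (intro borel_measurable_scaleR borel_measurable_indicator borel_measurable_times) auto
  ultimately show ?thesis using integrable_norm_bound(1) by blast
qed

lemma integrable_exp_Q_outside:
  assumes "k \<le> N"
  shows "integrable lborel (\<lambda>\<xi>. indicator (- ball 0 1) \<xi> *\<^sub>R (exp (- B \<xi>) * Q k \<xi> y))"
proof -
  note [measurable] = Q_measurable[OF assms(1), of y]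
  obtain C where C: "C \<ge> 0" "\<And>x. x \<noteq> 0 \<Longrightarrow> norm (Q k x y) \<le> C / norm x ^ (CARD('d) + (N - k))"
    using Q_bound[OF assms(1)] by blast
  have "norm (indicator (- ball 0 1) \<xi> *\<^sub>R (exp (- B \<xi>) * Q k \<xi> y)) \<le> C * (norm \<xi> ^ 0 * (1 + norm \<xi> ^ l) * dec \<xi>)" if "\<xi> \<noteq> 0" for \<xi>
  proof (cases "norm \<xi> < 1")
    case False
    then have "1 \<le> norm \<xi> ^ (CARD('d) + (N - k))" by (intro one_le_power) auto
    then have "C / norm \<xi> ^ (CARD('d) + (N - k)) \<le> C" using C(1) by (simp add: divide_le_eq mult_le_cancel_left1)
    then have "norm (Q k \<xi> y) \<le> C" using C(2)[OF that] by linarith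
    then have "norm (exp (- B \<xi>) * Q k \<xi> y) \<le> dec \<xi> * C"
      unfolding norm_mult using norm_exp_B_le[of \<xi>] by (intro mult_mono) auto
    also have "\<dots> \<le> C * (norm \<xi> ^ 0 * (1 + norm \<xi> ^ l) * dec \<xi>)"
      using mult_left_mono[OF mult_right_mono[of 1 "1 + norm \<xi> ^ l" "dec \<xi>"] C(1)] by (simp add: mult_ac)
    finally show ?thesis using False by simp
  qed (use C in auto)
  then show ?thesis
    by (intro integrable_norm_bound(1)[OF integrable_mult_right[OF integrable_norm_pow_dec[of 0]]]) auto
qed

text \<open>For \<open>k < N\<close> the degree of \<open>Q k\<close> lies below \<open>-d\<close>,
  so the constant 1 is harmless at infinity. For \<open>k = N\<close> the bound fails
  logarithmically, and the integral has to be split at the unit sphere as in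
  \<open>S_fun\<close>.\<close>

lemma integrable_one_minus_exp_Q:
  assumes "k < N"
  shows "integrable lborel (\<lambda>\<xi>. (1 - exp (- B \<xi>)) * Q k \<xi> y)"
proof -
  have k: "k \<le> N" using assms by simp
  note [measurable] = Q_measurable[OF k, of y]
  obtain C where C: "C \<ge> 0" "\<And>x. x \<noteq> 0 \<Longrightarrow> norm (Q k x y) \<le> C / norm x ^ (CARD('d) + (N - k))"
    using Q_bound[OF k] by blast
  have "norm (indicator (- ball 0 1) \<xi> *\<^sub>R Q k \<xi> y) \<le> C * (indicator {1..} (norm \<xi>) / norm \<xi> ^ (CARD('d) + (N - k)))" if "\<xi> \<noteq> 0" for \<xi>
    using C(2)[OF that] by (auto simp: indicator_def)
  then have "integrable lborel (\<lambda>\<xi>. indicator (- ball 0 1) \<xi> *\<^sub>R Q k \<xi> y)"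
    using assms by (intro integrable_norm_bound(1)[OF integrable_mult_right[OF integrable_norm_pow_at_infinity[of 1 "N - k"]]]) auto
  from Bochner_Integration.integrable_add[OF integrable_one_minus_exp_Q_ball[OF k] Bochner_Integration.integrable_diff[OF this integrable_exp_Q_outside[OF k]], of y]
  show ?thesis
    by (rule Bochner_Integration.integrable_cong[THEN iffD1, rotated 2]) (auto simp: indicator_def algebra_simps)
qed

text \<open>After the substitution \<open>\<theta> = s *\<^sub>R \<xi>\<close> the homogeneity of
  \<open>Q k\<close>, of degree \<open>- (d + N - k)\<close>, leaves the factor
  \<open>1 / s ^ (N - k)\<close>.\<close>

lemma main_part_eq:
  assumes k: "k \<le> N" and s: "s > 0"
  shows "integrable lborel (\<lambda>\<theta>. indicator (cube pi) \<theta> *\<^sub>R ((1 - exp (- (of_real (1 / s ^ l) * A \<theta>))) * Q k \<theta> y))" (is ?i)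
    and "(\<integral>\<theta>. indicator (cube pi) \<theta> *\<^sub>R ((1 - exp (- (of_real (1 / s ^ l) * A \<theta>))) * Q k \<theta> y) \<partial>lborel) =
     (\<integral>\<xi>. (indicator (cube pi) (s *\<^sub>R \<xi>) - truncated_exp s \<xi>) * Q k \<xi> y \<partial>lborel) / of_real s ^ (N - k)" (is ?e)
    and "integrable lborel (\<lambda>\<xi>. (indicator (cube pi) (s *\<^sub>R \<xi>) - truncated_exp s \<xi>) * Q k \<xi> y)" (is ?j)
proof -
  note [measurable] = Q_measurable[OF k, of y]
  let ?t = "1 / s ^ l"
  let ?f = "\<lambda>\<theta>. indicator (cube pi) \<theta> *\<^sub>R ((1 - exp (- (of_real ?t * A \<theta>))) * Q k \<theta> y)"
  obtain C where C: "C \<ge> 0" "\<And>x. x \<noteq> 0 \<Longrightarrow> norm (Q k x y) \<le> C / norm x ^ (CARD('d) + (N - k))"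
    using Q_bound[OF k] by blast
  obtain D where D: "D \<ge> 0" "\<And>\<theta> t. \<theta> \<in> cube pi \<Longrightarrow> t \<ge> 0 \<Longrightarrow> norm (1 - exp (- (of_real t * A \<theta>))) \<le> t * D * norm \<theta> ^ l"
    using one_minus_exp_bound by blast
  show ?i
  proof (rule integrable_cube_bounded)
    fix \<theta> :: "real ^ 'd" assume \<theta>: "\<theta> \<in> cube pi"
    show "norm ((1 - exp (- (of_real ?t * A \<theta>))) * Q k \<theta> y) \<le> ?t * D * C * (sqrt CARD('d) * pi) ^ k"
    proof (cases "\<theta> = 0")
      case True
      then show ?thesis using difference_symbol_0[OF l_ge_1, of lhat a] C D s by simp
    next
      case False
      then have n: "norm \<theta> > 0" by simp
      have e: "l = k + (CARD('d) + (N - k))" using k dim_le N_eq by auto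
      have "norm ((1 - exp (- (of_real ?t * A \<theta>))) * Q k \<theta> y) \<le> (?t * D * norm \<theta> ^ l) * (C / norm \<theta> ^ (CARD('d) + (N - k)))"
        unfolding norm_mult using D(1) s by (intro mult_mono D C False \<theta>) auto
      also have "norm \<theta> ^ l = norm \<theta> ^ k * norm \<theta> ^ (CARD('d) + (N - k))" using e power_add by metis
      also have "(?t * D * (norm \<theta> ^ k * norm \<theta> ^ (CARD('d) + (N - k)))) * (C / norm \<theta> ^ (CARD('d) + (N - k))) = ?t * D * C * norm \<theta> ^ k"
        using n by simp
      also have "\<dots> \<le> ?t * D * C * (sqrt CARD('d) * pi) ^ k"
        using D C s norm_le_cube[OF \<theta>] by (intro mult_left_mono power_mono) auto
      finally show ?thesis .
    qed
  qed measurable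
  then have "integrable lborel (\<lambda>\<xi>. of_real (s ^ (CARD('d) + (N - k))) * ?f (s *\<^sub>R \<xi>))"
    using lborel_integrable_scaleR_iff[OF s, of ?f] by (intro integrable_mult_right) blast
  moreover have eq: "of_real (s ^ (CARD('d) + (N - k))) * ?f (s *\<^sub>R \<xi>) = (indicator (cube pi) (s *\<^sub>R \<xi>) - truncated_exp s \<xi>) * Q k \<xi> y" for \<xi>
  proof (cases "\<xi> = 0")
    case True
    then show ?thesis using difference_symbol_0[OF l_ge_1, of lhat a] by (simp add: truncated_exp_def indicator_def)
  next
    case False
    have "Q k (s *\<^sub>R \<xi>) y = Q k \<xi> y * of_real (s powi (- int (CARD('d) + (N - k))))" by (rule Q_scale[OF k s False])
    also have "s powi (- int (CARD('d) + (N - k))) = 1 / s ^ (CARD('d) + (N - k))"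
      unfolding power_int_minus power_int_of_nat by (simp add: divide_inverse)
    finally have "Q k (s *\<^sub>R \<xi>) y * of_real (s ^ (CARD('d) + (N - k))) = Q k \<xi> y" using s by simp
    moreover have "of_real (s ^ (CARD('d) + (N - k))) * ?f (s *\<^sub>R \<xi>) = (indicator (cube pi) (s *\<^sub>R \<xi>) - truncated_exp s \<xi>) * (Q k (s *\<^sub>R \<xi>) y * of_real (s ^ (CARD('d) + (N - k))))"
      by (simp add: truncated_exp_def scaleR_conv_of_real indicator_def algebra_simps)
    ultimately show ?thesis by simp
  qed
  ultimately show ?j by (simp only: eq)
  have "(\<integral>\<theta>. ?f \<theta> \<partial>lborel) = s ^ CARD('d) *\<^sub>R (\<integral>\<xi>. ?f (s *\<^sub>R \<xi>) \<partial>lborel)" by (rule lborel_integral_scaleR[OF s])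
  also have "\<dots> = (of_real (s ^ (CARD('d) + (N - k))) * (\<integral>\<xi>. ?f (s *\<^sub>R \<xi>) \<partial>lborel)) / of_real s ^ (N - k)"
    using s by (simp add: scaleR_conv_of_real power_add)
  also have "of_real (s ^ (CARD('d) + (N - k))) * (\<integral>\<xi>. ?f (s *\<^sub>R \<xi>) \<partial>lborel) = (\<integral>\<xi>. of_real (s ^ (CARD('d) + (N - k))) * ?f (s *\<^sub>R \<xi>) \<partial>lborel)"
    by (rule integral_mult_right_zero[symmetric])
  finally show ?e unfolding eq .
qed

text \<open>The exponential is expanded to order \<open>N - k\<close>, so that the error still tends
  to 0 after division by \<open>s ^ (N - k)\<close>. The remainder carries \<open>N - k + 1\<close>
  powers of \<open>|\<xi>|\<close>, just enough to make its product with \<open>Q k\<close>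
  integrable at the origin.\<close>

lemma truncated_exp_integral_expansion:
  assumes k: "k \<le> N"
  shows "\<exists>C\<ge>0. \<forall>s>0. norm ((\<integral>\<xi>. (indicator (cube pi) (s *\<^sub>R \<xi>) - truncated_exp s \<xi>) * Q k \<xi> y \<partial>lborel)
     - (\<integral>\<xi>. (indicator (cube pi) (s *\<^sub>R \<xi>) - exp (- B \<xi>)) * Q k \<xi> y \<partial>lborel)
     + (\<Sum>j=1..N-k. of_real s ^ j * (\<integral>\<xi>. exp_coeff j \<xi> * Q k \<xi> y \<partial>lborel))) \<le> C * s ^ (N - k + 1)"
   and "s > 0 \<Longrightarrow> integrable lborel (\<lambda>\<xi>. (indicator (cube pi) (s *\<^sub>R \<xi>) - exp (- B \<xi>)) * Q k \<xi> y)"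
proof -
  note [measurable] = Q_measurable[OF k, of y]
  let ?m = "N - k"
  obtain C where C: "C \<ge> 0" "\<And>x. x \<noteq> 0 \<Longrightarrow> norm (Q k x y) \<le> C / norm x ^ (CARD('d) + ?m)"
    using Q_bound[OF k] by blast
  obtain D where D: "D \<ge> 0" "\<And>s \<xi>. s > 0 \<Longrightarrow> norm (truncated_exp s \<xi> - (\<Sum>j\<le>?m. of_real s ^ j * exp_coeff j \<xi>))
     \<le> D * (s * norm \<xi>) ^ (?m + 1) * (1 + norm \<xi> ^ l) * dec \<xi>"
    using truncated_exp_expansion by blast
  define R where "R s \<xi> = truncated_exp s \<xi> - (\<Sum>j\<le>?m. of_real s ^ j * exp_coeff j \<xi>)" for s \<xi>
  have mR[measurable]: "R s \<in> borel_measurable borel" for s unfolding R_def[abs_def] by measurable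
  have bR: "norm (R s \<xi> * Q k \<xi> y) \<le> (D * s ^ (?m + 1)) * C * weight 1 \<xi>" if "s > 0" "\<xi> \<noteq> 0" for s \<xi>
  proof (rule weight_Q[OF that(2) k _ C(2)[OF that(2)]])
    show "norm (R s \<xi>) \<le> D * s ^ (?m + 1) * norm \<xi> ^ (1 + ?m) * (1 + norm \<xi> ^ l) * dec \<xi>"
      using D(2)[OF that(1), of \<xi>] by (simp add: R_def power_mult_distrib mult_ac)
  qed
  have iW: "integrable lborel (\<lambda>\<xi>. (D * s ^ (?m + 1)) * C * weight 1 \<xi>)" for s
    by (intro integrable_mult_right integrable_weight_1) simp
  have iR: "integrable lborel (\<lambda>\<xi>. R s \<xi> * Q k \<xi> y)" "norm (\<integral>\<xi>. R s \<xi> * Q k \<xi> y \<partial>lborel) \<le> (D * s ^ (?m + 1)) * C * (\<integral>\<xi>. weight 1 \<xi> \<partial>lborel)"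
    if "s > 0" for s
    using integrable_norm_bound[OF iW _ bR[OF that]] by auto
  have ie: "integrable lborel (\<lambda>\<xi>. of_real s ^ j * (exp_coeff j \<xi> * Q k \<xi> y))" if "j \<in> {1..?m}" for j and s :: real
    using that k by (intro integrable_mult_right integrable_exp_coeff_Q) auto
  have eq: "(indicator (cube pi) (s *\<^sub>R \<xi>) - exp (- B \<xi>)) * Q k \<xi> y = 
     (indicator (cube pi) (s *\<^sub>R \<xi>) - truncated_exp s \<xi>) * Q k \<xi> y + R s \<xi> * Q k \<xi> y + (\<Sum>j=1..?m. of_real s ^ j * (exp_coeff j \<xi> * Q k \<xi> y))" for s \<xi>
  proof -
    have "R s \<xi> = truncated_exp s \<xi> - exp (- B \<xi>) - (\<Sum>j=1..?m. of_real s ^ j * exp_coeff j \<xi>)"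
      by (simp add: R_def atMost_atLeast0 sum.atLeast_Suc_atMost exp_coeff_def[of 0])
    then show ?thesis by (simp add: left_diff_distrib sum_distrib_right mult.assoc)
  qed
  show "integrable lborel (\<lambda>\<xi>. (indicator (cube pi) (s *\<^sub>R \<xi>) - exp (- B \<xi>)) * Q k \<xi> y)" if "s > 0" for s
    unfolding eq by (intro Bochner_Integration.integrable_add Bochner_Integration.integrable_sum ie iR main_part_eq k that)
  have "(\<integral>\<xi>. (indicator (cube pi) (s *\<^sub>R \<xi>) - truncated_exp s \<xi>) * Q k \<xi> y \<partial>lborel)
     - (\<integral>\<xi>. (indicator (cube pi) (s *\<^sub>R \<xi>) - exp (- B \<xi>)) * Q k \<xi> y \<partial>lborel)
     + (\<Sum>j=1..?m. of_real s ^ j * (\<integral>\<xi>. exp_coeff j \<xi> * Q k \<xi> y \<partial>lborel)) = - (\<integral>\<xi>. R s \<xi> * Q k \<xi> y \<partial>lborel)" if s: "s > 0" for s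
  proof -
    have "(\<integral>\<xi>. (indicator (cube pi) (s *\<^sub>R \<xi>) - exp (- B \<xi>)) * Q k \<xi> y \<partial>lborel) = 
      (\<integral>\<xi>. (indicator (cube pi) (s *\<^sub>R \<xi>) - truncated_exp s \<xi>) * Q k \<xi> y \<partial>lborel) + (\<integral>\<xi>. R s \<xi> * Q k \<xi> y \<partial>lborel)
      + (\<integral>\<xi>. (\<Sum>j=1..?m. of_real s ^ j * (exp_coeff j \<xi> * Q k \<xi> y)) \<partial>lborel)"
      unfolding eq
      by (subst Bochner_Integration.integral_add, intro Bochner_Integration.integrable_add iR main_part_eq k s,
          intro Bochner_Integration.integrable_sum ie, assumption,
          subst Bochner_Integration.integral_add, intro main_part_eq k s, intro iR s, rule refl)
    also have "(\<integral>\<xi>. (\<Sum>j=1..?m. of_real s ^ j * (exp_coeff j \<xi> * Q k \<xi> y)) \<partial>lborel) = (\<Sum>j=1..?m. of_real s ^ j * (\<integral>\<xi>. exp_coeff j \<xi> * Q k \<xi> y \<partial>lborel))"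
      by (subst Bochner_Integration.integral_sum[OF ie], assumption, rule sum.cong[OF refl integral_mult_right_zero])
    finally show ?thesis by simp
  qed
  then have "norm ((\<integral>\<xi>. (indicator (cube pi) (s *\<^sub>R \<xi>) - truncated_exp s \<xi>) * Q k \<xi> y \<partial>lborel)
     - (\<integral>\<xi>. (indicator (cube pi) (s *\<^sub>R \<xi>) - exp (- B \<xi>)) * Q k \<xi> y \<partial>lborel)
     + (\<Sum>j=1..?m. of_real s ^ j * (\<integral>\<xi>. exp_coeff j \<xi> * Q k \<xi> y \<partial>lborel))) \<le> (D * C * (\<integral>\<xi>. weight 1 \<xi> \<partial>lborel)) * s ^ (?m + 1)" if s: "s > 0" for s
    using iR(2)[OF s] that by (simp add: mult_ac)
  moreover have "(\<integral>\<xi>. weight 1 \<xi> \<partial>lborel) \<ge> 0" by (intro integral_nonneg_AE) (auto simp: weight_def)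
  ultimately show "\<exists>C\<ge>0. \<forall>s>0. norm ((\<integral>\<xi>. (indicator (cube pi) (s *\<^sub>R \<xi>) - truncated_exp s \<xi>) * Q k \<xi> y \<partial>lborel)
     - (\<integral>\<xi>. (indicator (cube pi) (s *\<^sub>R \<xi>) - exp (- B \<xi>)) * Q k \<xi> y \<partial>lborel)
     + (\<Sum>j=1..N-k. of_real s ^ j * (\<integral>\<xi>. exp_coeff j \<xi> * Q k \<xi> y \<partial>lborel))) \<le> C * s ^ (N - k + 1)"
    using C D by (intro exI[of _ "D * C * (\<integral>\<xi>. weight 1 \<xi> \<partial>lborel)"]) auto
qed

end

text \<open>The singular coefficients are quantified away, so that only \<open>c\<close> has to be
  tracked. The second Green function and all the antiderivatives subtracted from it have expansions
  of this form.\<close>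

definition constant_term :: "nat \<Rightarrow> (real \<Rightarrow> complex) \<Rightarrow> complex \<Rightarrow> bool" where
  "constant_term N F c \<longleftrightarrow> (\<exists>\<alpha> \<beta>. ((\<lambda>s. F s - (\<Sum>m=1..N. \<alpha> m / of_real s ^ m) - \<beta> * of_real (ln s)) \<longlongrightarrow> c) (at_right 0))"

lemma constant_term_add:
  assumes "constant_term N F c" "constant_term N G d"
  shows "constant_term N (\<lambda>s. F s + G s) (c + d)"
proof -
  obtain \<alpha> \<beta> where 1: "((\<lambda>s. F s - (\<Sum>m=1..N. \<alpha> m / of_real s ^ m) - \<beta> * of_real (ln s)) \<longlongrightarrow> c) (at_right 0)"
    using assms(1) by (auto simp: constant_term_def)
  obtain \<alpha>' \<beta>' where 2: "((\<lambda>s. G s - (\<Sum>m=1..N. \<alpha>' m / of_real s ^ m) - \<beta>' * of_real (ln s)) \<longlongrightarrow> d) (at_right 0)"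
    using assms(2) by (auto simp: constant_term_def)
  have "((\<lambda>s. (F s + G s) - (\<Sum>m=1..N. (\<alpha> m + \<alpha>' m) / of_real s ^ m) - (\<beta> + \<beta>') * of_real (ln s)) \<longlongrightarrow> c + d) (at_right 0)"
    using tendsto_add[OF 1 2] by (simp add: add_divide_distrib sum.distrib algebra_simps)
  then show ?thesis by (auto simp: constant_term_def)
qed

lemma constant_term_cmult:
  assumes "constant_term N F c"
  shows "constant_term N (\<lambda>s. a * F s) (a * c)"
proof -
  obtain \<alpha> \<beta> where 1: "((\<lambda>s. F s - (\<Sum>m=1..N. \<alpha> m / of_real s ^ m) - \<beta> * of_real (ln s)) \<longlongrightarrow> c) (at_right 0)"
    using assms(1) by (auto simp: constant_term_def)
  have "((\<lambda>s. a * F s - (\<Sum>m=1..N. (a * \<alpha> m) / of_real s ^ m) - (a * \<beta>) * of_real (ln s)) \<longlongrightarrow> a * c) (at_right 0)"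
    using tendsto_mult_left[OF 1, of a] by (simp add: sum_distrib_left right_diff_distrib mult.assoc)
  then show ?thesis unfolding constant_term_def by (intro exI)
qed

lemma constant_term_tendsto: "(F \<longlongrightarrow> c) (at_right 0) \<Longrightarrow> constant_term N F c"
  unfolding constant_term_def by (intro exI[of _ "\<lambda>_. 0"] exI[of _ 0]) simp

lemma constant_term_sum:
  "(\<And>i. i \<in> I \<Longrightarrow> constant_term N (F i) (c i)) \<Longrightarrow> constant_term N (\<lambda>s. \<Sum>i\<in>I. F i s) (\<Sum>i\<in>I. c i)"
proof (induction I rule: infinite_finite_induct)
  case (insert x I)
  then have "constant_term N (\<lambda>s. F x s + (\<Sum>i\<in>I. F i s)) (c x + sum c I)"
    by (intro constant_term_add) auto
  then show ?case using insert by simp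
qed (auto intro!: constant_term_tendsto)

lemma constant_term_power:
  assumes "1 \<le> m" "m \<le> N"
  shows "constant_term N (\<lambda>s. x / of_real s ^ m) 0"
proof -
  have "(\<Sum>i=1..N. (if i = m then x else 0) / complex_of_real s ^ i) = x / of_real s ^ m" for s
  proof -
    have "(\<Sum>i=1..N. (if i = m then x else 0) / complex_of_real s ^ i) = (\<Sum>i=1..N. if i = m then x / of_real s ^ m else 0)"
      by (intro sum.cong) auto
    then show ?thesis using assms by simp
  qed
  then show ?thesis
    unfolding constant_term_def by (intro exI[of _ "\<lambda>i. if i = m then x else 0"] exI[of _ 0]) simp
qed

lemma constant_term_ln: "constant_term N (\<lambda>s. x * of_real (ln s)) 0"
  unfolding constant_term_def by (intro exI[of _ "\<lambda>_. 0"] exI[of _ x]) simp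

lemma constant_term_cong:
  assumes "constant_term N F c" "eventually (\<lambda>s. F s = G s) (at_right 0)"
  shows "constant_term N G c"
proof -
  obtain \<alpha> \<beta> where 1: "((\<lambda>s. F s - (\<Sum>m=1..N. \<alpha> m / of_real s ^ m) - \<beta> * of_real (ln s)) \<longlongrightarrow> c) (at_right 0)"
    using assms(1) by (auto simp: constant_term_def)
  have "((\<lambda>s. G s - (\<Sum>m=1..N. \<alpha> m / of_real s ^ m) - \<beta> * of_real (ln s)) \<longlongrightarrow> c) (at_right 0)"
    by (rule Lim_transform_eventually[OF 1]) (use assms(2) in \<open>auto elim!: eventually_mono\<close>)
  then show ?thesis by (auto simp: constant_term_def)
qed

lemma power_times_ln_tendsto_0: "((\<lambda>s::real. s * ln s) \<longlongrightarrow> 0) (at_right 0)"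
proof -
  have "((\<lambda>x::real. - (ln x / x)) \<longlongrightarrow> 0) at_top"
    using tendsto_minus[OF ln_x_over_x_tendsto_0] by simp
  then have "((\<lambda>x::real. inverse x * ln (inverse x)) \<longlongrightarrow> 0) at_top"
  proof (rule Lim_transform_eventually)
    show "eventually (\<lambda>x::real. - (ln x / x) = inverse x * ln (inverse x)) at_top"
      using eventually_gt_at_top[of 0] by eventually_elim (simp add: ln_inverse divide_inverse)
  qed
  then show ?thesis by (simp add: filterlim_at_right_to_top)
qed

text \<open>The functions \<open>s\<^sup>-\<^sup>m\<close> and \<open>ln s\<close> are unbounded and of different orders at 0.\<close>

lemma constant_term_bounded:
  assumes "constant_term N F c" and b: "eventually (\<lambda>s. norm (F s) \<le> C) (at_right 0)"
  shows "(F \<longlongrightarrow> c) (at_right 0)"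
proof -
  obtain \<alpha> \<beta> where 1: "((\<lambda>s. F s - (\<Sum>m=1..N. \<alpha> m / of_real s ^ m) - \<beta> * of_real (ln s)) \<longlongrightarrow> c) (at_right 0)"
    using assms(1) by (auto simp: constant_term_def)
  have sF: "((\<lambda>s. of_real s ^ m * F s) \<longlongrightarrow> 0) (at_right 0)" if "m \<ge> 1" for m
  proof (rule Lim_null_comparison)
    show "eventually (\<lambda>s. norm (of_real s ^ m * F s) \<le> s ^ m * C) (at_right 0)"
      using b eventually_at_right_less[of 0] by eventually_elim (auto simp: norm_mult norm_power intro!: mult_left_mono)
    show "((\<lambda>s. s ^ m * C) \<longlongrightarrow> 0) (at_right 0)" using that by (auto intro!: tendsto_eq_intros simp: zero_power)
  qed
  have sl: "((\<lambda>s. complex_of_real s ^ m * (\<beta> * of_real (ln s))) \<longlongrightarrow> 0) (at_right 0)" if "m \<ge> 1" for m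
  proof -
    have "((\<lambda>s. \<beta> * of_real (s ^ (m - 1)) * complex_of_real (s * ln s)) \<longlongrightarrow> \<beta> * of_real (0 ^ (m - 1)) * of_real 0) (at_right 0)"
      by (intro tendsto_intros power_times_ln_tendsto_0)
    moreover obtain k where "m = Suc k" using \<open>m \<ge> 1\<close> by (cases m) auto
    ultimately show ?thesis by (simp add: mult_ac)
  qed
  \<comment> \<open>Descent over the powers: when the coefficients above \<open>n\<close> vanish,
    multiplication by the highest remaining power isolates its coefficient, while \<open>F\<close>
    and the logarithm disappear in the limit.\<close>
  have sum_0: "\<alpha> m = 0" if "m \<in> {1..n}" "\<forall>m\<in>{n<..N}. \<alpha> m = 0" "n \<le> N" for n m
    using that
  proof (induction n)
    case (Suc n)
    have trunc: "(\<Sum>m=1..N. \<alpha> m / complex_of_real s ^ m) = (\<Sum>m=1..Suc n. \<alpha> m / complex_of_real s ^ m)" for s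
      using Suc.prems by (intro sum.mono_neutral_right) auto
    have "((\<lambda>s. of_real s ^ Suc n * (F s - (\<Sum>m=1..N. \<alpha> m / of_real s ^ m) - \<beta> * of_real (ln s))) \<longlongrightarrow> of_real 0 ^ Suc n * c) (at_right 0)"
      by (intro tendsto_intros 1)
    then have "((\<lambda>s. of_real s ^ Suc n * (F s - (\<Sum>m=1..N. \<alpha> m / of_real s ^ m) - \<beta> * of_real (ln s))) \<longlongrightarrow> 0) (at_right 0)" by simp
    from tendsto_diff[OF tendsto_diff[OF sF[of "Suc n"] sl[of "Suc n"]] this]
    have "((\<lambda>s. of_real s ^ Suc n * (\<Sum>m=1..Suc n. \<alpha> m / complex_of_real s ^ m)) \<longlongrightarrow> 0) (at_right 0)"
      unfolding trunc by (simp add: algebra_simps)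
    moreover have "((\<lambda>s. of_real s ^ Suc n * (\<Sum>m=1..Suc n. \<alpha> m / complex_of_real s ^ m)) \<longlongrightarrow> \<alpha> (Suc n)) (at_right 0)"
    proof -
      have "((\<lambda>s. \<Sum>m=1..Suc n. \<alpha> m * complex_of_real s ^ (Suc n - m)) \<longlongrightarrow> (\<Sum>m=1..Suc n. \<alpha> m * of_real 0 ^ (Suc n - m))) (at_right 0)"
        by (intro tendsto_intros)
      also have "(\<Sum>m=1..Suc n. \<alpha> m * complex_of_real 0 ^ (Suc n - m)) = (\<Sum>m=1..Suc n. if m = Suc n then \<alpha> m else 0)"
        by (intro sum.cong) auto
      also have "\<dots> = \<alpha> (Suc n)" by simp
      finally show ?thesis
      proof (rule Lim_transform_eventually)
        show "eventually (\<lambda>s. (\<Sum>m=1..Suc n. \<alpha> m * complex_of_real s ^ (Suc n - m)) = of_real s ^ Suc n * (\<Sum>m=1..Suc n. \<alpha> m / complex_of_real s ^ m)) (at_right 0)"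
          using eventually_at_right_less[of 0]
        proof eventually_elim
          case (elim s)
          then show ?case
            unfolding sum_distrib_left by (intro sum.cong refl) (simp add: power_diff del: power_Suc)
        qed
      qed
    qed
    ultimately have z: "\<alpha> (Suc n) = 0" using tendsto_unique trivial_limit_at_right_real by blast
    show ?case
    proof (cases "m = Suc n")
      case False
      have "\<forall>m\<in>{n<..N}. \<alpha> m = 0"
      proof
        fix i assume "i \<in> {n<..N}"
        then show "\<alpha> i = 0" using Suc.prems(2) z by (cases "i = Suc n") auto
      qed
      then show ?thesis using Suc False by auto
    qed (use z in simp)
  qed auto
  have a0: "\<alpha> m = 0" if "m \<in> {1..N}" for m using sum_0[of m N] that by auto
  then have 2: "((\<lambda>s. F s - \<beta> * of_real (ln s)) \<longlongrightarrow> c) (at_right 0)" using 1 by simp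
  \<comment> \<open>Now \<open>F\<close> differs from a multiple of \<open>ln s\<close> by a
    convergent term, and boundedness of \<open>F\<close> excludes a nonzero multiple.\<close>
  have "\<beta> = 0"
  proof (rule ccontr)
    assume "\<beta> \<noteq> 0"
    have "eventually (\<lambda>s. norm (F s - \<beta> * of_real (ln s) - c) < 1) (at_right 0)"
      using tendstoD[OF 2, of 1] by (simp add: dist_norm)
    moreover have "filterlim (\<lambda>s. norm \<beta> * (- ln s)) at_top (at_right (0::real))"
      using \<open>\<beta> \<noteq> 0\<close> ln_at_0
      by (intro filterlim_tendsto_pos_mult_at_top[OF tendsto_const]) (auto simp: filterlim_uminus_at_top)
    then have "eventually (\<lambda>s. norm \<beta> * (- ln s) \<ge> C + norm c + 1) (at_right 0)"
      by (simp add: filterlim_at_top)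
    ultimately have "eventually (\<lambda>s::real. False) (at_right 0)"
      using b eventually_at_right_less[of 0]
    proof eventually_elim
      case (elim s)
      have "norm \<beta> * (- ln s) \<le> norm (\<beta> * of_real (ln s))" unfolding norm_mult by (intro mult_left_mono) auto
      also have "\<dots> = norm (F s - c - (F s - \<beta> * of_real (ln s) - c))" by simp
      also have "\<dots> \<le> norm (F s) + norm c + norm (F s - \<beta> * of_real (ln s) - c)"
        by (intro order_trans[OF norm_triangle_ineq4] add_right_mono norm_triangle_ineq4)
      finally show False using elim by linarith
    qed
    then show False by simp
  qed
  then show ?thesis using 2 by simp
qed

section \<open>The constant term of the second Green function\<close>

context green_setting
begin

text \<open>The indicator of the scaled cube is 1 minus that of its complement. By homogeneity the
  complement contributes \<open>s ^ (N - k)\<close> times the integral of \<open>Q k\<close> outside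
  the fixed cube, which is a surface integral.\<close>

lemma Q_integral_cube_term:
  assumes k: "k < N" and s: "s > 0"
  shows "(\<integral>\<xi>. (indicator (cube pi) (s *\<^sub>R \<xi>) - exp (- B \<xi>)) * Q k \<xi> y \<partial>lborel) =
    (\<integral>\<xi>. (1 - exp (- B \<xi>)) * Q k \<xi> y \<partial>lborel) -
    of_real s ^ (N - k) * (1 / of_nat (N - k) * (\<integral>n. of_real (r_pi n powi (- int (N - k))) * Q k n y \<partial>surface_measure))"
proof -
  have kN: "k \<le> N" using k by simp
  note [measurable] = Q_measurable[OF kN, of y]
  obtain C where C: "\<And>x. norm x = 1 \<Longrightarrow> norm (Q k x y) \<le> C" using Q_bound[OF kN, of y] by blast
  have m: "N - k \<ge> 1" using k by simp
  let ?f = "\<lambda>\<theta>. indicator (- cube pi) \<theta> *\<^sub>R Q k \<theta> y"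
  have i: "integrable lborel ?f"
    by (rule integrable_homogeneous_outside_cube[OF Q_scale[OF kN] C _ m]) auto
  have eq: "of_real (s ^ (CARD('d) + (N - k))) * ?f (s *\<^sub>R \<xi>) = (1 - indicator (cube pi) (s *\<^sub>R \<xi>)) * Q k \<xi> y" for \<xi>
  proof (cases "\<xi> = 0")
    case True
    then show ?thesis by (simp add: indicator_def cube_iff_component)
  next
    case False
    have "Q k (s *\<^sub>R \<xi>) y = Q k \<xi> y * of_real (s powi (- int (CARD('d) + (N - k))))" by (rule Q_scale[OF kN s False])
    also have "s powi (- int (CARD('d) + (N - k))) = 1 / s ^ (CARD('d) + (N - k))"
      unfolding power_int_minus power_int_of_nat by (simp add: divide_inverse)
    finally have "Q k (s *\<^sub>R \<xi>) y * of_real (s ^ (CARD('d) + (N - k))) = Q k \<xi> y" using s by simp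
    then show ?thesis by (simp add: indicator_def mult_ac)
  qed
  have "integrable lborel (\<lambda>\<xi>. of_real (s ^ (CARD('d) + (N - k))) * ?f (s *\<^sub>R \<xi>))"
    using lborel_integrable_scaleR_iff[OF s, of ?f] i by (intro integrable_mult_right) blast
  then have i2: "integrable lborel (\<lambda>\<xi>. (1 - indicator (cube pi) (s *\<^sub>R \<xi>)) * Q k \<xi> y)" by (simp only: eq)
  have "(\<integral>\<xi>. (1 - indicator (cube pi) (s *\<^sub>R \<xi>)) * Q k \<xi> y \<partial>lborel) = of_real (s ^ (CARD('d) + (N - k))) * (\<integral>\<xi>. ?f (s *\<^sub>R \<xi>) \<partial>lborel)"
    unfolding eq[symmetric] by (rule integral_mult_right_zero)
  also have "\<dots> = of_real s ^ (N - k) * (s ^ CARD('d) *\<^sub>R (\<integral>\<xi>. ?f (s *\<^sub>R \<xi>) \<partial>lborel))"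
    by (simp add: scaleR_conv_of_real power_add)
  also have "s ^ CARD('d) *\<^sub>R (\<integral>\<xi>. ?f (s *\<^sub>R \<xi>) \<partial>lborel) = (\<integral>\<theta>. ?f \<theta> \<partial>lborel)" by (rule lborel_integral_scaleR[OF s, symmetric])
  also have "\<dots> = 1 / of_nat (N - k) * (\<integral>n. of_real (r_pi n powi (- int (N - k))) * Q k n y \<partial>surface_measure)"
    by (rule integral_homogeneous_outside_cube[OF Q_scale[OF kN] C _ m]) auto
  finally have e1: "(\<integral>\<xi>. (1 - indicator (cube pi) (s *\<^sub>R \<xi>)) * Q k \<xi> y \<partial>lborel) = 
     of_real s ^ (N - k) * (1 / of_nat (N - k) * (\<integral>n. of_real (r_pi n powi (- int (N - k))) * Q k n y \<partial>surface_measure))" .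
  have "(\<integral>\<xi>. (indicator (cube pi) (s *\<^sub>R \<xi>) - exp (- B \<xi>)) * Q k \<xi> y \<partial>lborel) = 
     (\<integral>\<xi>. (1 - exp (- B \<xi>)) * Q k \<xi> y - (1 - indicator (cube pi) (s *\<^sub>R \<xi>)) * Q k \<xi> y \<partial>lborel)"
    by (intro Bochner_Integration.integral_cong) (auto simp: algebra_simps)
  also have "\<dots> = (\<integral>\<xi>. (1 - exp (- B \<xi>)) * Q k \<xi> y \<partial>lborel) - (\<integral>\<xi>. (1 - indicator (cube pi) (s *\<^sub>R \<xi>)) * Q k \<xi> y \<partial>lborel)"
    by (rule Bochner_Integration.integral_diff[OF integrable_one_minus_exp_Q[OF k] i2])
  finally show ?thesis unfolding e1 .
qed

lemma r_pi_le: "norm (n :: real ^ 'd) = 1 \<Longrightarrow> r_pi n \<le> sqrt CARD('d) * pi"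
proof -
  assume n: "norm n = 1"
  have p: "r_pi n > 0" using r_pi_ge_pi[OF n] pi_gt_zero by linarith
  then have "r_pi n *\<^sub>R n \<in> cube pi" using mem_cube_pi_iff_r_pi[OF n p] by simp
  from norm_le_cube[OF this] n p show ?thesis by simp
qed

lemma integrable_surface:
  fixes f :: "real ^ 'd \<Rightarrow> complex"
  assumes "f \<in> borel_measurable borel" "\<And>n. norm n = 1 \<Longrightarrow> norm (f n) \<le> C"
  shows "integrable sphere_borel f"
proof -
  interpret finite_measure "sphere_borel :: (real ^ 'd) measure" by (rule finite_sphere_borel)
  have "AE n in (sphere_borel :: (real ^ 'd) measure). norm (f n) \<le> C"
    using AE_sphere_borel by eventually_elim (rule assms(2))
  then show ?thesis using assms(1) by (intro integrable_const_bound) (auto simp: sphere_borel_def)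
qed

text \<open>In degree \<open>-d\<close> the decomposition into whole space and complement of the
  cube is not integrable at infinity. Instead the unit ball and its exterior are separated, and the
  part of the scaled cube outside the ball supplies \<open>ln (r_pi n) - ln s\<close>.\<close>

lemma Q_integral_log_term:
  assumes s: "s > 0" "s \<le> pi"
  shows "(\<integral>\<xi>. (indicator (cube pi) (s *\<^sub>R \<xi>) - exp (- B \<xi>)) * Q N \<xi> y \<partial>lborel) =
    (\<integral>\<xi>. indicator (ball 0 1) \<xi> *\<^sub>R ((1 - exp (- B \<xi>)) * Q N \<xi> y) \<partial>lborel) -
    (\<integral>\<xi>. indicator (- ball 0 1) \<xi> *\<^sub>R (exp (- B \<xi>) * Q N \<xi> y) \<partial>lborel) +
    (\<integral>n. of_real (ln (r_pi n)) * Q N n y \<partial>surface_measure) - of_real (ln s) * (\<integral>n. Q N n y \<partial>surface_measure)"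
proof -
  note [measurable] = Q_measurable[OF order_refl, of y]
  obtain C where C: "C \<ge> 0" "\<And>x. norm x = 1 \<Longrightarrow> norm (Q N x y) \<le> C" using Q_bound[OF order_refl, of y] by blast
  have sc: "Q N (c *\<^sub>R x) y = Q N x y * of_real (c powi (- int CARD('d)))" if "c > 0" "x \<noteq> 0" for c x
    using Q_scale[OF order_refl that, of y] by simp
  let ?X = "{x::real ^ 'd. s *\<^sub>R x \<in> cube pi \<and> 1 \<le> norm x}"
  note i1 = integrable_one_minus_exp_Q_ball[OF order_refl, of y]
  note i2 = integrable_exp_Q_outside[OF order_refl, of y]
  have i3: "integrable lborel (\<lambda>x. indicator ?X x *\<^sub>R Q N x y)"
    by (rule integrable_homogeneous_annulus[OF sc C(2) _ s]) auto
  have eq: "(indicator (cube pi) (s *\<^sub>R \<xi>) - exp (- B \<xi>)) * Q N \<xi> y = 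
     indicator (ball 0 1) \<xi> *\<^sub>R ((1 - exp (- B \<xi>)) * Q N \<xi> y) - indicator (- ball 0 1) \<xi> *\<^sub>R (exp (- B \<xi>) * Q N \<xi> y) + indicator ?X \<xi> *\<^sub>R Q N \<xi> y" for \<xi>
  proof (cases "norm \<xi> < 1")
    case True
    then have "s * norm \<xi> \<le> pi * 1" using s by (intro mult_mono) auto
    then have "s *\<^sub>R \<xi> \<in> cube pi" using s by (intro cube_subset_norm) simp
    then show ?thesis using True by (simp add: indicator_def)
  next
    case False
    then show ?thesis by (simp add: indicator_def algebra_simps)
  qed
  have l: "integrable sphere_borel (\<lambda>n. complex_of_real (ln (r_pi n)) * Q N n y)"
  proof (rule integrable_surface[where C="(sqrt CARD('d) * pi) * C"])
    fix n :: "real ^ 'd" assume n: "norm n = 1"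
    have r: "r_pi n \<ge> 1" using r_pi_ge_pi[OF n] pi_ge_two by linarith
    then have "\<bar>ln (r_pi n)\<bar> \<le> r_pi n" using ln_le_minus_one[of "r_pi n"] by simp
    then have "\<bar>ln (r_pi n)\<bar> \<le> sqrt CARD('d) * pi" using r_pi_le[OF n] by linarith
    then show "norm (complex_of_real (ln (r_pi n)) * Q N n y) \<le> (sqrt CARD('d) * pi) * C"
      unfolding norm_mult using C(2)[OF n] by (intro mult_mono) auto
  qed measurable
  have q: "integrable sphere_borel (\<lambda>n. complex_of_real (ln s) * Q N n y)"
    by (intro integrable_mult_right integrable_surface[where C=C] C) measurable
  have "(\<integral>x. indicator ?X x *\<^sub>R Q N x y \<partial>lborel) = (\<integral>n. of_real (ln (r_pi n) - ln s) * Q N n y \<partial>surface_measure)"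
    by (rule integral_homogeneous_annulus[OF sc C(2) _ s]) auto
  also have "\<dots> = (\<integral>n. of_real (ln (r_pi n)) * Q N n y - of_real (ln s) * Q N n y \<partial>sphere_borel)"
    by (subst integral_sphere_borel[symmetric]) (auto simp: left_diff_distrib)
  also have "\<dots> = (\<integral>n. of_real (ln (r_pi n)) * Q N n y \<partial>sphere_borel) - of_real (ln s) * (\<integral>n. Q N n y \<partial>sphere_borel)"
    by (subst Bochner_Integration.integral_diff[OF l q]) simp
  also have "(\<integral>n. of_real (ln (r_pi n)) * Q N n y \<partial>sphere_borel) = (\<integral>n. of_real (ln (r_pi n)) * Q N n y \<partial>surface_measure)"
    by (rule integral_sphere_borel) measurable
  also have "(\<integral>n. Q N n y \<partial>sphere_borel) = (\<integral>n. Q N n y \<partial>surface_measure)"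
    by (rule integral_sphere_borel) measurable
  finally have e3: "(\<integral>x. indicator ?X x *\<^sub>R Q N x y \<partial>lborel) = (\<integral>n. of_real (ln (r_pi n)) * Q N n y \<partial>surface_measure) - of_real (ln s) * (\<integral>n. Q N n y \<partial>surface_measure)" .
  show ?thesis
    unfolding eq Bochner_Integration.integral_add[OF Bochner_Integration.integrable_diff[OF i1 i2] i3] Bochner_Integration.integral_diff[OF i1 i2] e3 by simp
qed

definition main_part :: "nat \<Rightarrow> real ^ 'd \<Rightarrow> real \<Rightarrow> complex" where
  "main_part k y s = (\<integral>\<theta>. indicator (cube pi) \<theta> *\<^sub>R ((1 - exp (- (of_real (1 / s ^ l) * A \<theta>))) * Q k \<theta> y) \<partial>lborel)"

text \<open>What survives the division by \<open>s ^ (N - k)\<close>. For \<open>k < N\<close> this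
  comes from the complement of the cube and from the expansion term of order \<open>N - k\<close>;
  for \<open>k = N\<close> the divisor is 1 and the integrals themselves remain.\<close>

definition main_const :: "nat \<Rightarrow> real ^ 'd \<Rightarrow> complex" where
  "main_const k y = (if k < N then
      - (1 / of_nat (N - k) * (\<integral>n. of_real (r_pi n powi (- int (N - k))) * Q k n y \<partial>surface_measure)) - (\<integral>\<xi>. exp_coeff (N - k) \<xi> * Q k \<xi> y \<partial>lborel)
    else (\<integral>\<xi>. indicator (ball 0 1) \<xi> *\<^sub>R ((1 - exp (- B \<xi>)) * Q N \<xi> y) \<partial>lborel) -
    (\<integral>\<xi>. indicator (- ball 0 1) \<xi> *\<^sub>R (exp (- B \<xi>) * Q N \<xi> y) \<partial>lborel) +
    (\<integral>n. of_real (ln (r_pi n)) * Q N n y \<partial>surface_measure))"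

lemma constant_term_main_part:
  assumes k: "k \<le> N"
  shows "constant_term N (main_part k y) (main_const k y)"
proof -
  let ?m = "N - k"
  define T where "T s = (\<integral>\<xi>. (indicator (cube pi) (s *\<^sub>R \<xi>) - exp (- B \<xi>)) * Q k \<xi> y \<partial>lborel)" for s
  define e where "e j = (\<integral>\<xi>. exp_coeff j \<xi> * Q k \<xi> y \<partial>lborel)" for j
  define R where "R s = main_part k y s - (T s - (\<Sum>j=1..?m. of_real s ^ j * e j)) / of_real s ^ ?m" for s
  obtain C where C: "C \<ge> 0" "\<And>s. s > 0 \<Longrightarrow> norm ((\<integral>\<xi>. (indicator (cube pi) (s *\<^sub>R \<xi>) - truncated_exp s \<xi>) * Q k \<xi> y \<partial>lborel)
     - T s + (\<Sum>j=1..?m. of_real s ^ j * e j)) \<le> C * s ^ (?m + 1)"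
    using truncated_exp_integral_expansion(1)[OF k, of y] unfolding T_def e_def by blast
  have "(R \<longlongrightarrow> 0) (at_right 0)"
  proof (rule Lim_null_comparison)
    show "eventually (\<lambda>s. norm (R s) \<le> C * s) (at_right 0)"
      using eventually_at_right_less[of 0]
    proof eventually_elim
      case (elim s)
      have "R s = ((\<integral>\<xi>. (indicator (cube pi) (s *\<^sub>R \<xi>) - truncated_exp s \<xi>) * Q k \<xi> y \<partial>lborel)
        - T s + (\<Sum>j=1..?m. of_real s ^ j * e j)) / of_real s ^ ?m"
        unfolding R_def main_part_def main_part_eq(2)[OF k elim] by (simp add: diff_divide_distrib add_divide_distrib)
      then have "norm (R s) = norm ((\<integral>\<xi>. (indicator (cube pi) (s *\<^sub>R \<xi>) - truncated_exp s \<xi>) * Q k \<xi> y \<partial>lborel)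
        - T s + (\<Sum>j=1..?m. of_real s ^ j * e j)) / s ^ ?m"
        using elim by (simp add: norm_divide norm_power)
      also have "\<dots> \<le> C * s ^ (?m + 1) / s ^ ?m"
        using elim by (intro divide_right_mono C(2)) auto
      finally have "norm (R s) \<le> C * s ^ (?m + 1) / s ^ ?m" .
      then show ?case using elim by simp
    qed
    show "((\<lambda>s. C * s) \<longlongrightarrow> 0) (at_right 0)" by (auto intro!: tendsto_eq_intros)
  qed
  then have R: "constant_term N R 0" by (rule constant_term_tendsto)
  \<comment> \<open>Only the summand with \<open>j = N - k\<close> is constant after the division;
    those with smaller \<open>j\<close> are negative powers. For \<open>k = N\<close> the sum is
    empty.\<close>
  have E: "constant_term N (\<lambda>s. (\<Sum>j=1..?m. of_real s ^ j * e j) / of_real s ^ ?m) (if k < N then e ?m else 0)"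
  proof -
    have "constant_term N (\<lambda>s. \<Sum>j=1..?m. e j / of_real s ^ (?m - j)) (\<Sum>j=1..?m. if j = ?m then e ?m else 0)"
    proof (rule constant_term_sum)
      fix j assume j: "j \<in> {1..?m}"
      show "constant_term N (\<lambda>s. e j / of_real s ^ (?m - j)) (if j = ?m then e ?m else 0)"
      proof (cases "j = ?m")
        case True
        then show ?thesis by (auto intro!: constant_term_tendsto)
      next
        case False
        then show ?thesis using j constant_term_power[of "?m - j" N "e j"] by auto
      qed
    qed
    then have "constant_term N (\<lambda>s. (\<Sum>j=1..?m. of_real s ^ j * e j) / of_real s ^ ?m) (\<Sum>j=1..?m. if j = ?m then e ?m else 0)"
    proof (rule constant_term_cong)
      show "eventually (\<lambda>s. (\<Sum>j=1..?m. e j / of_real s ^ (?m - j)) = (\<Sum>j=1..?m. of_real s ^ j * e j) / complex_of_real s ^ ?m) (at_right 0)"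
        using eventually_at_right_less[of 0]
      proof eventually_elim
        case (elim s)
        have "e j / of_real s ^ (?m - j) = of_real s ^ j * e j / complex_of_real s ^ ?m" if "j \<in> {1..?m}" for j
        proof -
          have "j \<le> ?m" using that by simp
          then have "?m = (?m - j) + j" by (rule le_add_diff_inverse2[symmetric])
          then have "complex_of_real s ^ ?m = of_real s ^ (?m - j) * of_real s ^ j" by (metis power_add)
          then show ?thesis using elim by simp
        qed
        then show ?case unfolding sum_divide_distrib by (intro sum.cong refl)
      qed
    qed
    moreover have "(\<Sum>j=1..?m. if j = ?m then e ?m else 0) = (if k < N then e ?m else 0)" by auto
    ultimately show ?thesis by simp
  qed
  have T: "constant_term N (\<lambda>s. T s / of_real s ^ ?m) (if k < N then main_const k y + e ?m else main_const k y)"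
  proof (cases "k < N")
    case True
    let ?r = "1 / of_nat ?m * (\<integral>n. of_real (r_pi n powi (- int ?m)) * Q k n y \<partial>surface_measure)"
    let ?c = "\<integral>\<xi>. (1 - exp (- B \<xi>)) * Q k \<xi> y \<partial>lborel"
    have "constant_term N (\<lambda>s. ?c / of_real s ^ ?m + (- ?r)) (0 + (- ?r))"
      using True by (intro constant_term_add constant_term_power constant_term_tendsto) auto
    then have "constant_term N (\<lambda>s. T s / of_real s ^ ?m) (0 + (- ?r))"
    proof (rule constant_term_cong)
      show "eventually (\<lambda>s. ?c / of_real s ^ ?m + (- ?r) = T s / of_real s ^ ?m) (at_right 0)"
        using eventually_at_right_less[of 0]
        by eventually_elim (simp add: T_def Q_integral_cube_term[OF True] diff_divide_distrib)
    qed
    then show ?thesis using True by (simp add: main_const_def e_def)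
  next
    case False
    then have kN: "k = N" using k by simp
    let ?q = "\<integral>n. Q N n y \<partial>surface_measure"
    have "constant_term N (\<lambda>s. main_const N y + (- ?q) * of_real (ln s)) (main_const N y + 0)"
      by (intro constant_term_add constant_term_ln constant_term_tendsto) auto
    then have "constant_term N (\<lambda>s. T s / of_real s ^ ?m) (main_const N y + 0)"
    proof (rule constant_term_cong)
      have "eventually (\<lambda>s::real. s < pi) (at_right 0)"
        unfolding eventually_at_right_field by (intro exI[of _ pi]) auto
      then show "eventually (\<lambda>s. main_const N y + (- ?q) * of_real (ln s) = T s / of_real s ^ ?m) (at_right 0)"
        using eventually_at_right_less[of 0]
        by eventually_elim (simp add: T_def kN Q_integral_log_term main_const_def)
    qed
    then show ?thesis using kN by simp
  qed
  have "constant_term N (\<lambda>s. R s + (T s / of_real s ^ ?m + (-1) * ((\<Sum>j=1..?m. of_real s ^ j * e j) / of_real s ^ ?m)))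
     (0 + ((if k < N then main_const k y + e ?m else main_const k y) + (-1) * (if k < N then e ?m else 0)))"
    by (intro constant_term_add R T constant_term_cmult E)
  then have "constant_term N (main_part k y)
     (0 + ((if k < N then main_const k y + e ?m else main_const k y) + (-1) * (if k < N then e ?m else 0)))"
    by (rule constant_term_cong) (simp add: R_def diff_divide_distrib)
  then show ?thesis by (cases "k < N") auto
qed

lemma Q_hat_integrable: "integrable lborel (\<lambda>\<theta>. indicator (cube pi) \<theta> *\<^sub>R Q_hat l lhat a Q \<theta> y)"
  and Q_hat_measurable: "(\<lambda>\<theta>. Q_hat l lhat a Q \<theta> y) \<in> borel_measurable borel"
proof -
  have "(\<lambda>\<theta>. \<Sum>k=0..N. Q k \<theta> y) \<in> borel_measurable borel"
    using Q_measurable by (intro borel_measurable_sum) auto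
  then show m[measurable]: "(\<lambda>\<theta>. Q_hat l lhat a Q \<theta> y) \<in> borel_measurable borel"
    unfolding Q_hat_def N_eq[symmetric] by measurable
  obtain c where c: "\<And>\<theta>. \<theta> \<in> cube pi - {0} \<Longrightarrow> norm (Q_hat l lhat a Q \<theta> y) \<le> c * norm \<theta> powi (1 - int CARD('d))"
    using Q_expansion unfolding Q_expansion_def by meson
  show "integrable lborel (\<lambda>\<theta>. indicator (cube pi) \<theta> *\<^sub>R Q_hat l lhat a Q \<theta> y)"
  proof (rule integrable_norm_bound(1))
    show "integrable lborel (\<lambda>\<theta>::real ^ 'd. \<bar>c\<bar> * (indicator {..sqrt CARD('d) * pi} (norm \<theta>) * norm \<theta> powi (1 - int CARD('d))))"
      by (intro integrable_mult_right integrable_norm_pow_near_0)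
    show "norm (indicator (cube pi) \<theta> *\<^sub>R Q_hat l lhat a Q \<theta> y) \<le> \<bar>c\<bar> * (indicator {..sqrt CARD('d) * pi} (norm \<theta>) * norm \<theta> powi (1 - int CARD('d)))"
      if "\<theta> \<noteq> 0" for \<theta>
    proof (cases "\<theta> \<in> cube pi")
      case True
      have "c * norm \<theta> powi (1 - int CARD('d)) \<le> \<bar>c\<bar> * norm \<theta> powi (1 - int CARD('d))" by (intro mult_right_mono) auto
      with c[of \<theta>] True that have "norm (Q_hat l lhat a Q \<theta> y) \<le> \<bar>c\<bar> * norm \<theta> powi (1 - int CARD('d))"
        using order_trans by blast
      then show ?thesis using True norm_le_cube[OF True] by (simp add: indicator_def)
    qed simp
  qed measurable
qed

text \<open>Dominated convergence with majorant \<open>2 |Q_hat|\<close>: off the origin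
  \<open>Re A\<close> is positive, so the exponential disappears as \<open>s\<close> tends to 0. The
  substitution \<open>x = 1 / s\<close> moves the limit to infinity.\<close>

lemma Q_hat_tendsto:
  "((\<lambda>s. \<integral>\<theta>. indicator (cube pi) \<theta> *\<^sub>R ((1 - exp (- (of_real (1 / s ^ l) * A \<theta>))) * Q_hat l lhat a Q \<theta> y) \<partial>lborel)
     \<longlongrightarrow> (\<integral>\<theta>. indicator (cube pi) \<theta> *\<^sub>R Q_hat l lhat a Q \<theta> y \<partial>lborel)) (at_right 0)"
proof -
  note [measurable] = Q_hat_measurable[of y]
  let ?q = "\<lambda>\<theta>. Q_hat l lhat a Q \<theta> y"
  let ?F = "\<lambda>s \<theta>. indicator (cube pi) \<theta> *\<^sub>R ((1 - exp (- (of_real (1 / s ^ l) * A \<theta>))) * ?q \<theta>)"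
  have "((\<lambda>x. \<integral>\<theta>. ?F (inverse x) \<theta> \<partial>lborel) \<longlongrightarrow> (\<integral>\<theta>. indicator (cube pi) \<theta> *\<^sub>R ?q \<theta> \<partial>lborel)) at_top"
  proof (rule integral_dominated_convergence_at_top)
    show "integrable lborel (\<lambda>\<theta>. 2 * norm (indicator (cube pi) \<theta> *\<^sub>R ?q \<theta>))"
      by (intro integrable_mult_right integrable_norm Q_hat_integrable)
    show "eventually (\<lambda>x. AE \<theta> in lborel. norm (?F (inverse x) \<theta>) \<le> 2 * norm (indicator (cube pi) \<theta> *\<^sub>R ?q \<theta>)) at_top"
      using eventually_gt_at_top[of 0]
    proof eventually_elim
      case (elim x)
      have "norm (?F (inverse x) \<theta>) \<le> 2 * norm (indicator (cube pi) \<theta> *\<^sub>R ?q \<theta>)" for \<theta>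
      proof (cases "\<theta> \<in> cube pi")
        case True
        have "norm (1 - exp (- (of_real (1 / inverse x ^ l) * A \<theta>))) \<le> 1 + 1"
          using norm_exp_minus_le_1[OF Re_nonneg[OF True], of "1 / inverse x ^ l"] elim
          by (intro order_trans[OF norm_triangle_ineq4] add_mono) auto
        then have "norm (1 - exp (- (of_real (1 / inverse x ^ l) * A \<theta>))) * norm (?q \<theta>) \<le> 2 * norm (?q \<theta>)"
          by (intro mult_right_mono) auto
        then show ?thesis using True by (simp add: norm_mult)
      qed simp
      then show ?case by simp
    qed
    show "AE \<theta> in lborel. ((\<lambda>x. ?F (inverse x) \<theta>) \<longlongrightarrow> indicator (cube pi) \<theta> *\<^sub>R ?q \<theta>) at_top"
      using AE_lborel_singleton[of "0 :: real ^ 'd"]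
    proof eventually_elim
      case (elim \<theta>)
      show ?case
      proof (cases "\<theta> \<in> cube pi")
        case True
        then have r: "Re (A \<theta>) > 0" using Re_pos[of \<theta>] elim by auto
        have "((\<lambda>x. exp (- (of_real (1 / inverse x ^ l) * A \<theta>))) \<longlongrightarrow> 0) at_top"
        proof (rule Lim_null_comparison)
          have e: "1 / inverse x ^ l = x ^ l" for x :: real by (simp add: divide_inverse power_inverse)
          show "eventually (\<lambda>x. norm (exp (- (of_real (1 / inverse x ^ l) * A \<theta>))) \<le> exp (- (Re (A \<theta>) * x ^ l))) at_top"
            unfolding e by (simp add: norm_exp_eq_Re mult.commute del: of_real_power)
          have "filterlim (\<lambda>x. Re (A \<theta>) * x ^ l) at_top at_top"
            using r l_ge_1 by (intro filterlim_tendsto_pos_mult_at_top[OF tendsto_const] filterlim_pow_at_top filterlim_ident) auto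
          then have "filterlim (\<lambda>x. - (Re (A \<theta>) * x ^ l)) at_bot at_top" by (simp add: filterlim_uminus_at_bot)
          then show "((\<lambda>x. exp (- (Re (A \<theta>) * x ^ l))) \<longlongrightarrow> 0) at_top"
            by (rule filterlim_compose[OF exp_at_bot])
        qed
        then have "((\<lambda>x. ?F (inverse x) \<theta>) \<longlongrightarrow> indicator (cube pi) \<theta> *\<^sub>R ((1 - 0) * ?q \<theta>)) at_top"
          by (intro tendsto_intros)
        then show ?thesis by simp
      qed simp
    qed
  qed measurable
  then show ?thesis by (simp add: filterlim_at_right_to_top)
qed

lemma green2_split:
  assumes s: "s > 0"
  shows "of_real ((2 * pi) ^ CARD('d)) * green2 y (1 / s ^ l) = (\<Sum>k\<le>N. main_part k y s) +
     (\<integral>\<theta>. indicator (cube pi) \<theta> *\<^sub>R ((1 - exp (- (of_real (1 / s ^ l) * A \<theta>))) * Q_hat l lhat a Q \<theta> y) \<partial>lborel)"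
proof -
  let ?t = "1 / s ^ l"
  let ?E = "\<lambda>\<theta>. 1 - exp (- (of_real ?t * A \<theta>))"
  let ?q = "\<lambda>\<theta>. indicator (cube pi) \<theta> *\<^sub>R (?E \<theta> * Q_hat l lhat a Q \<theta> y)"
  let ?k = "\<lambda>k \<theta>. indicator (cube pi) \<theta> *\<^sub>R (?E \<theta> * Q k \<theta> y)"
  note [measurable] = Q_hat_measurable[of y] Q_measurable[of _ y]
  have t: "?t \<ge> 0" using s by simp
  have ik: "integrable lborel (?k k)" if "k \<in> {..N}" for k using main_part_eq(1)[OF _ s, of k y] that by simp
  have iq: "integrable lborel ?q"
  proof (rule Bochner_Integration.integrable_bound)
    show "integrable lborel (\<lambda>\<theta>. 2 * norm (indicator (cube pi) \<theta> *\<^sub>R Q_hat l lhat a Q \<theta> y))"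
      by (intro integrable_mult_right integrable_norm Q_hat_integrable)
    have "norm (?q \<theta>) \<le> norm (2 * norm (indicator (cube pi) \<theta> *\<^sub>R Q_hat l lhat a Q \<theta> y))" for \<theta>
    proof (cases "\<theta> \<in> cube pi")
      case True
      have "norm (?E \<theta>) \<le> 1 + 1"
        using norm_exp_minus_le_1[OF Re_nonneg[OF True] t]
        by (intro order_trans[OF norm_triangle_ineq4] add_mono) auto
      then have "norm (?E \<theta>) * norm (Q_hat l lhat a Q \<theta> y) \<le> 2 * norm (Q_hat l lhat a Q \<theta> y)"
        by (intro mult_right_mono) auto
      then show ?thesis using True by (simp add: norm_mult)
    qed simp
    then show "AE \<theta> in lborel. norm (?q \<theta>) \<le> norm (2 * norm (indicator (cube pi) \<theta> *\<^sub>R Q_hat l lhat a Q \<theta> y))" by simp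
  qed measurable
  have "of_real ((2 * pi) ^ CARD('d)) * green2 y ?t = (\<integral>\<theta>. indicator (cube pi) \<theta> *\<^sub>R (psi ?t (A \<theta>) * cis (y \<bullet> \<theta>)) \<partial>lborel)"
    by (simp add: green2_def cube_fourier_def)
  also have "\<dots> = (\<integral>\<theta>. (\<Sum>k\<le>N. ?k k \<theta>) + ?q \<theta> \<partial>lborel)"
  proof (rule integral_cong_AE)
    show "AE \<theta> in lborel. indicator (cube pi) \<theta> *\<^sub>R (psi ?t (A \<theta>) * cis (y \<bullet> \<theta>)) = (\<Sum>k\<le>N. ?k k \<theta>) + ?q \<theta>"
      using AE_lborel_singleton[of "0 :: real ^ 'd"]
    proof eventually_elim
      case (elim \<theta>)
      show ?case
      proof (cases "\<theta> \<in> cube pi")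
        case True
        then have A0: "A \<theta> \<noteq> 0" using Re_pos[of \<theta>] elim by auto
        have "psi ?t (A \<theta>) * cis (y \<bullet> \<theta>) = ?E \<theta> * (cis (y \<bullet> \<theta>) / A \<theta>)" using A0 by (simp add: psi_def)
        also have "cis (y \<bullet> \<theta>) / A \<theta> = (\<Sum>k\<le>N. Q k \<theta> y) + Q_hat l lhat a Q \<theta> y"
          by (simp add: Q_hat_def N_eq atMost_atLeast0)
        finally show ?thesis using True by (simp add: distrib_left sum_distrib_left)
      qed simp
    qed
    show "(\<lambda>\<theta>. (\<Sum>k\<le>N. ?k k \<theta>) + ?q \<theta>) \<in> borel_measurable lborel"
      using iq ik by (intro borel_measurable_add borel_measurable_sum borel_measurable_integrable) auto
  qed measurable
  also have "\<dots> = (\<integral>\<theta>. (\<Sum>k\<le>N. ?k k \<theta>) \<partial>lborel) + (\<integral>\<theta>. ?q \<theta> \<partial>lborel)"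
    by (rule Bochner_Integration.integral_add[OF Bochner_Integration.integrable_sum iq]) (rule ik)
  also have "(\<integral>\<theta>. (\<Sum>k\<le>N. ?k k \<theta>) \<partial>lborel) = (\<Sum>k\<le>N. main_part k y s)"
    unfolding main_part_def by (rule Bochner_Integration.integral_sum[OF ik])
  finally show ?thesis .
qed

text \<open>The sum over \<open>k \<le> l - d - M\<close> in \<open>S_fun\<close> extends to all
  \<open>k < N\<close>, since coefficients of positive order below \<open>M\<close> vanish. The
  index \<open>2 * l - d - k\<close> is \<open>(N - k) + l\<close>, that of the polynomial in
  \<open>exp_coeff (N - k)\<close>.\<close>

lemma S_fun_eq:
  "S_fun M l lhat a b P Q y = ((\<Sum>k\<le>N. main_const k y) + (\<integral>\<theta>. indicator (cube pi) \<theta> *\<^sub>R Q_hat l lhat a Q \<theta> y \<partial>lborel)) / of_real ((2 * pi) ^ CARD('d))"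
proof -
  let ?e = "\<lambda>k. \<integral>\<xi>. exp_coeff (N - k) \<xi> * Q k \<xi> y \<partial>lborel"
  let ?r = "\<lambda>k. 1 / of_nat (N - k) * (\<integral>n. of_real (r_pi n powi (- int (N - k))) * Q k n y \<partial>surface_measure)"
  have "(\<Sum>k\<le>N. main_const k y) = (\<Sum>k<N. main_const k y) + main_const N y"
    by (simp add: lessThan_Suc_atMost[symmetric])
  also have "(\<Sum>k<N. main_const k y) = - (\<Sum>k<N. ?r k) - (\<Sum>k<N. ?e k)"
    by (simp add: main_const_def sum_subtractf sum_negf)
  also have "(\<Sum>k<N. ?r k) = (\<Sum>k<N. 1 / of_nat (N - k) *
           (LINT n|surface_measure. complex_of_real (r_pi n powi (int CARD('d) + int k - int l)) * Q k n y))"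
  proof (intro sum.cong refl)
    fix k assume "k \<in> {..<N}"
    then have "- int (N - k) = int CARD('d) + int k - int l" using N_eq dim_le by auto
    then show "?r k = 1 / of_nat (N - k) * (LINT n|surface_measure. complex_of_real (r_pi n powi (int CARD('d) + int k - int l)) * Q k n y)"
      by simp
  qed
  also have "(\<Sum>k<N. ?e k) = (\<Sum>k | k + CARD('d) + M \<le> l. LINT \<xi>|lborel. exp (- diff_symbol l b \<xi>) * Q k \<xi> y * peval (P (2 * l - CARD('d) - k)) \<xi>)"
  proof -
    have sub: "{k. k + CARD('d) + M \<le> l} \<subseteq> {..<N}" using M_ge_1 N_eq by auto
    have "(\<Sum>k<N. ?e k) = (\<Sum>k | k + CARD('d) + M \<le> l. ?e k)"
    proof (rule sum.mono_neutral_right[OF _ sub])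
      show "\<forall>k\<in>{..<N} - {k. k + CARD('d) + M \<le> l}. ?e k = 0"
      proof
        fix k assume k: "k \<in> {..<N} - {k. k + CARD('d) + M \<le> l}"
        then have "1 \<le> N - k" "N - k < M" using N_eq dim_le by auto
        then show "?e k = 0" using exp_coeff_vanish by simp
      qed
    qed simp
    also have "\<dots> = (\<Sum>k | k + CARD('d) + M \<le> l. LINT \<xi>|lborel. exp (- diff_symbol l b \<xi>) * Q k \<xi> y * peval (P (2 * l - CARD('d) - k)) \<xi>)"
    proof (intro sum.cong refl Bochner_Integration.integral_cong)
      fix k \<xi> assume "k \<in> {k. k + CARD('d) + M \<le> l}"
      then have "N - k + l = 2 * l - CARD('d) - k" "N - k \<noteq> 0" using N_eq M_ge_1 by auto
      then show "exp_coeff (N - k) \<xi> * Q k \<xi> y = exp (- diff_symbol l b \<xi>) * Q k \<xi> y * peval (P (2 * l - CARD('d) - k)) \<xi>"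
        by (simp add: exp_coeff_def mult_ac)
    qed
    finally show ?thesis .
  qed
  finally show ?thesis
    unfolding S_fun_def N_eq[symmetric] main_const_def set_lebesgue_integral_def by (simp add: algebra_simps)
qed

lemma constant_term_green2: "constant_term N (\<lambda>s. green2 y (1 / s ^ l)) (S_fun M l lhat a b P Q y)"
proof -
  let ?c = "1 / complex_of_real ((2 * pi) ^ CARD('d))"
  let ?J = "\<lambda>s. \<integral>\<theta>. indicator (cube pi) \<theta> *\<^sub>R ((1 - exp (- (of_real (1 / s ^ l) * A \<theta>))) * Q_hat l lhat a Q \<theta> y) \<partial>lborel"
  have "constant_term N (\<lambda>s. ?c * ((\<Sum>k\<le>N. main_part k y s) + ?J s))
    (?c * ((\<Sum>k\<le>N. main_const k y) + (\<integral>\<theta>. indicator (cube pi) \<theta> *\<^sub>R Q_hat l lhat a Q \<theta> y \<partial>lborel)))"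
    by (intro constant_term_cmult constant_term_add constant_term_sum constant_term_main_part constant_term_tendsto[OF Q_hat_tendsto]) auto
  then have "constant_term N (\<lambda>s. green2 y (1 / s ^ l)) (?c * ((\<Sum>k\<le>N. main_const k y) + (\<integral>\<theta>. indicator (cube pi) \<theta> *\<^sub>R Q_hat l lhat a Q \<theta> y \<partial>lborel)))"
  proof (rule constant_term_cong)
    show "eventually (\<lambda>s. ?c * ((\<Sum>k\<le>N. main_part k y s) + ?J s) = green2 y (1 / s ^ l)) (at_right 0)"
      using eventually_at_right_less[of 0]
    proof eventually_elim
      case (elim s)
      show ?case unfolding green2_split[OF elim, symmetric] by simp
    qed
  qed
  then show ?thesis by (simp add: S_fun_eq)
qed

end

subsection \<open>Antiderivatives of the terms of the expansion\<close>

text \<open>The tail is a constant minus an integral over a compact interval with a fixed left end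
  below \<open>r\<close>, and to that the fundamental theorem applies.\<close>

lemma tail_integral_deriv:
  fixes h :: "real \<Rightarrow> complex"
  assumes cont: "continuous_on {0<..} h" and int: "\<And>r. r > 0 \<Longrightarrow> set_integrable lborel {r..} h" and r: "r > 0"
  shows "((\<lambda>r. LINT \<rho>:{r..}|lborel. h \<rho>) has_vector_derivative - h r) (at r)"
proof -
  define r1 where "r1 = r / 2"
  have r1: "0 < r1" "r1 < r" using r by (auto simp: r1_def)
  have cont': "continuous_on {r1..x} h" for x by (rule continuous_on_subset[OF cont]) (use r1 in auto)
  have eq: "(LINT \<rho>:{x..}|lborel. h \<rho>) = (LINT \<rho>:{r1..}|lborel. h \<rho>) - integral {r1..x} h" if x: "x \<ge> r1" for x
  proof -
    have i1: "set_integrable lborel {r1..x} h" by (rule borel_integrable_atLeastAtMost'[OF cont'])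
    have "(LINT \<rho>:{r1..}|lborel. h \<rho>) = (LINT \<rho>:{r1..x} \<union> {x<..}|lborel. h \<rho>)"
      using x by (intro arg_cong[where f="\<lambda>S. LINT \<rho>:S|lborel. h \<rho>"]) auto
    also have "\<dots> = (LINT \<rho>:{r1..x}|lborel. h \<rho>) + (LINT \<rho>:{x<..}|lborel. h \<rho>)"
      by (rule set_integral_Un) (use i1 x in \<open>auto intro!: set_integrable_subset[OF int[OF r1(1)], of "{x<..}"]\<close>)
    also have "(LINT \<rho>:{x<..}|lborel. h \<rho>) = (LINT \<rho>:{x..}|lborel. h \<rho>)"
    proof (rule set_integral_cong_set)
      show "AE \<rho> in lborel. (\<rho> \<in> {x..}) = (\<rho> \<in> {x<..})"
        using AE_lborel_singleton[of x] by eventually_elim auto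
      show "set_borel_measurable lborel {x<..} h" "set_borel_measurable lborel {x..} h"
        using borel_measurable_integrable[OF set_integrable_subset[OF int[OF r1(1)], of "{x<..}", unfolded set_integrable_def]]
          borel_measurable_integrable[OF set_integrable_subset[OF int[OF r1(1)], of "{x..}", unfolded set_integrable_def]] x
        unfolding set_borel_measurable_def by (auto simp: subset_eq)
    qed
    also have "(LINT \<rho>:{r1..x}|lborel. h \<rho>) = integral {r1..x} h"
      by (rule set_borel_integral_eq_integral(2)[OF i1])
    finally show ?thesis by simp
  qed
  have "((\<lambda>x. integral {r1..x} h) has_vector_derivative h r) (at r within {r1..r + 1})"
    by (rule integral_has_vector_derivative[OF cont']) (use r1 in auto)
  then have "((\<lambda>x. integral {r1..x} h) has_vector_derivative h r) (at r)"
    using r1 by (subst (asm) at_within_interior) auto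
  then have d: "((\<lambda>x. (LINT \<rho>:{r1..}|lborel. h \<rho>) - integral {r1..x} h) has_vector_derivative - h r) (at r)"
    by (auto intro!: derivative_eq_intros)
  show ?thesis
    by (rule has_vector_derivative_transform_within_open[OF d, of "{r1<..}"]) (use r1 in \<open>auto intro: eq[symmetric]\<close>)
qed

lemma initial_integral_deriv:
  fixes h :: "real \<Rightarrow> complex"
  assumes cont: "continuous_on UNIV h" and r: "r > 0"
  shows "((\<lambda>r. LINT \<rho>:{0..r}|lborel. h \<rho>) has_vector_derivative h r) (at r)"
proof -
  have cont': "continuous_on S h" for S by (rule continuous_on_subset[OF cont]) auto
  have "((\<lambda>x. integral {0..x} h) has_vector_derivative h r) (at r within {0..r + 1})"
    by (rule integral_has_vector_derivative[OF cont']) (use r in auto)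
  then have d: "((\<lambda>x. integral {0..x} h) has_vector_derivative h r) (at r)"
    using r by (subst (asm) at_within_interior) auto
  show ?thesis
    by (rule has_vector_derivative_transform_within_open[OF d, of "{0<..}"])
       (use r set_borel_integral_eq_integral(2)[OF borel_integrable_atLeastAtMost'[OF cont']] in auto)
qed

lemma set_integral_bound_const:
  fixes h :: "real \<Rightarrow> complex"
  assumes "0 \<le> r" and b: "\<And>\<rho>. 0 \<le> \<rho> \<Longrightarrow> \<rho> \<le> r \<Longrightarrow> norm (h \<rho>) \<le> C"
  shows "norm (LINT \<rho>:{0..r}|lborel. h \<rho>) \<le> C * r"
proof -
  have "C \<ge> 0" using b[of 0] assms(1) norm_ge_zero order_trans by blast
  have "norm (LINT \<rho>:{0..r}|lborel. h \<rho>) \<le> (\<integral>\<rho>. norm (indicator {0..r} \<rho> *\<^sub>R h \<rho>) \<partial>lborel)"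
    unfolding set_lebesgue_integral_def by (rule integral_norm_bound)
  also have "\<dots> \<le> (\<integral>\<rho>. C * indicator {0..r} \<rho> \<partial>lborel)"
  proof (rule integral_mono_AE')
    show "integrable lborel (\<lambda>\<rho>. C * indicator {0..r} \<rho>)"
      by (intro integrable_mult_right integrable_real_indicator) (auto simp: emeasure_lborel_Icc_eq)
  qed (use assms \<open>C \<ge> 0\<close> in \<open>auto simp: indicator_def\<close>)
  also have "\<dots> = C * r" using assms(1) by simp
  finally show ?thesis .
qed

lemma integral_power_ratio:
  assumes "0 < r" "r \<le> 1" "j < m"
  shows "(LINT \<rho>:{r..1}|lborel. complex_of_real \<rho> ^ j / of_real \<rho> ^ (m + 1)) = 1 / of_nat (m - j) * (1 / of_real r ^ (m - j) - 1)"
proof -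
  have "(LINT \<rho>:{r..1}|lborel. complex_of_real \<rho> ^ j / of_real \<rho> ^ (m + 1)) = 
    - (1 / of_nat (m - j) * inverse (complex_of_real 1) ^ (m - j)) - (- (1 / of_nat (m - j) * inverse (of_real r) ^ (m - j)))"
    unfolding set_lebesgue_integral_def
  proof (rule integral_FTC_atLeastAtMost[OF assms(2)])
    fix x assume x: "r \<le> x" "x \<le> 1"
    obtain i where i: "m - j = Suc i" using assms by (cases "m - j") auto
    have "((\<lambda>w::complex. - (1 / of_nat (m - j) * inverse w ^ (m - j))) has_field_derivative
       - (1 / of_nat (m - j) * (of_nat (m - j) * (- (inverse (of_real x) ^ Suc (Suc 0)) * inverse (of_real x) ^ (m - j - Suc 0))))) (at (of_real x))"
      using x assms by (intro DERIV_minus DERIV_cmult DERIV_power DERIV_inverse) auto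
    moreover have "- (1 / of_nat (m - j) * (of_nat (m - j) * (- (inverse (complex_of_real x) ^ Suc (Suc 0)) * inverse (of_real x) ^ (m - j - Suc 0)))) = of_real x ^ j / of_real x ^ (m + 1)"
    proof -
      have "m + 1 = j + (i + 2)" using i assms by auto
      then have "complex_of_real x ^ (m + 1) = of_real x ^ j * of_real x ^ (i + 2)" by (metis power_add)
      then show ?thesis using x assms unfolding i by (simp add: field_simps del: of_nat_Suc)
    qed
    ultimately show "((\<lambda>x. - (1 / of_nat (m - j) * inverse (complex_of_real x) ^ (m - j))) has_vector_derivative of_real x ^ j / of_real x ^ (m + 1)) (at x within {r..1})"
      using has_vector_derivative_real_field[of "\<lambda>w. - (1 / of_nat (m - j) * inverse w ^ (m - j))" "of_real x ^ j / of_real x ^ (m + 1)" x] by simp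
  next
    show "continuous_on {r..1} (\<lambda>x. complex_of_real x ^ j / of_real x ^ (m + 1))"
      using assms by (intro continuous_intros) auto
  qed
  then show ?thesis by (simp add: right_diff_distrib power_inverse divide_inverse)
qed

lemma integral_power_ratio_log:
  assumes "0 < r" "r \<le> 1"
  shows "(LINT \<rho>:{r..1}|lborel. complex_of_real \<rho> ^ m / of_real \<rho> ^ (m + 1)) = - of_real (ln r)"
proof -
  have "(LINT \<rho>:{r..1}|lborel. complex_of_real \<rho> ^ m / of_real \<rho> ^ (m + 1)) = complex_of_real (ln 1) - of_real (ln r)"
    unfolding set_lebesgue_integral_def
  proof (rule integral_FTC_atLeastAtMost[OF assms(2)])
    fix x assume x: "r \<le> x" "x \<le> 1"
    have "(ln has_real_derivative 1 / x) (at x)"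
      using DERIV_ln_divide[of x] x assms by simp
    then have "(ln has_real_derivative 1 / x) (at x within {r..1})"
      by (rule has_field_derivative_at_within)
    then have "((\<lambda>x. complex_of_real (ln x)) has_vector_derivative of_real (1 / x)) (at x within {r..1})"
      by (rule has_vector_derivative_of_real)
    then show "((\<lambda>x. complex_of_real (ln x)) has_vector_derivative of_real x ^ m / of_real x ^ (m + 1)) (at x within {r..1})"
      using x assms by (simp add: field_simps)
  next
    show "continuous_on {r..1} (\<lambda>x. complex_of_real x ^ m / of_real x ^ (m + 1))"
      using assms by (intro continuous_intros) auto
  qed
  then show ?thesis by simp
qed

section \<open>The antiderivatives and their constant terms\<close>

context green_setting
begin

abbreviation "H \<equiv> H_fun l b P"

lemma H_ray_continuous: "continuous_on S (\<lambda>\<rho>. H k (\<rho> *\<^sub>R n))"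
  by (rule continuous_on_compose2[OF H_fun_continuous[of UNIV]]) (auto intro!: continuous_intros)

lemma H_ray_measurable[measurable]: "(\<lambda>\<rho>. H k (\<rho> *\<^sub>R n)) \<in> borel_measurable borel"
  by (rule borel_measurable_continuous_onI[OF H_ray_continuous])

lemma H_tail_integrable:
  assumes n: "norm n = 1" and r: "r > 0"
  shows "set_integrable lborel {r..} (\<lambda>\<rho>. H k (\<rho> *\<^sub>R n) / of_real \<rho> ^ (m + 1))"
proof -
  obtain C where C: "C \<ge> 0" "\<And>y. norm y * norm (H k y) \<le> C" using H_decay by blast
  have i: "integrable lborel (\<lambda>\<rho>. C * (indicator {r..} \<rho> / \<rho> ^ (m + 1 + 1)))"
    by (intro integrable_mult_right power_integral_atLeast(1)) (use r in auto)
  have "norm (indicator {r..} \<rho> *\<^sub>R (H k (\<rho> *\<^sub>R n) / of_real \<rho> ^ (m + 1))) \<le> norm (C * (indicator {r..} \<rho> / \<rho> ^ (m + 1 + 1)))" for \<rho>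
  proof (cases "\<rho> \<ge> r")
    case True
    then have p: "\<rho> > 0" using r by simp
    have "\<rho> * norm (H k (\<rho> *\<^sub>R n)) \<le> C" using C(2)[of "\<rho> *\<^sub>R n"] p n by simp
    then have "norm (H k (\<rho> *\<^sub>R n)) \<le> C / \<rho>" using p by (simp add: field_simps)
    then have "norm (H k (\<rho> *\<^sub>R n)) / \<rho> ^ (m + 1) \<le> (C / \<rho>) / \<rho> ^ (m + 1)" using p by (intro divide_right_mono) auto
    then show ?thesis using True p C(1) by (simp add: norm_divide norm_power norm_mult abs_mult mult_ac)
  qed simp
  then show ?thesis
    unfolding set_integrable_def by (intro Bochner_Integration.integrable_bound[OF i]) auto
qed

text \<open>An antiderivative in \<open>s\<close> of \<open>- l s\<^sup>k\<^sup>-\<^sup>N\<^sup>-\<^sup>1 H\<^sub>k (s y)\<close>.\<close>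

definition G_fun :: "nat \<Rightarrow> real ^ 'd \<Rightarrow> real \<Rightarrow> complex" where
  "G_fun k y s = (if y \<noteq> 0 then of_real (s powi (int k - int N)) * F_fun l b P k (s *\<^sub>R y)
     else if k = N then - of_nat l * H N 0 * of_real (ln s)
     else of_real (s powi (int k - int N)) * (of_nat l * H k 0 / of_real (real N - real k)))"

text \<open>The power of \<open>s\<close> cancels against that of
  \<open>norm (s *\<^sub>R y)\<close>, so that \<open>s\<close> survives only as a limit of
  integration.\<close>

lemma G_fun_le:
  assumes "y \<noteq> 0" "k \<le> N" "s > 0"
  shows "G_fun k y s = of_nat l * of_real (norm y) ^ (N - k) * (LINT \<rho>:{norm y * s..}|lborel. H k (\<rho> *\<^sub>R sgn y) / of_real \<rho> ^ (N - k + 1))"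
proof -
  have "int k - int N = - int (N - k)" using assms by simp
  then have "s powi (int k - int N) = 1 / s ^ (N - k)" by (simp only: power_int_minus power_int_of_nat divide_inverse mult_1)
  then show ?thesis
    using assms by (simp add: G_fun_def F_fun_def N_eq[symmetric] sgn_scaleR power_mult_distrib mult.commute[of s])
qed

lemma G_fun_gt:
  assumes "y \<noteq> 0" "k > N" "s > 0"
  shows "G_fun k y s = - (of_nat l / of_real (norm y) ^ (k - N)) * (LINT \<rho>:{0..norm y * s}|lborel. of_real \<rho> ^ (k - N - 1) * H k (\<rho> *\<^sub>R sgn y))"
proof -
  have "int k - int N = int (k - N)" using assms by simp
  then have "s powi (int k - int N) = s ^ (k - N)" by (simp only: power_int_of_nat)
  moreover have "CARD('d) + k - l = k - N" using N_eq dim_le by simp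
  ultimately show ?thesis
    using assms by (simp add: G_fun_def F_fun_def N_eq[symmetric] sgn_scaleR power_mult_distrib mult.commute[of s])
qed

lemma has_vector_derivative_rescale:
  fixes J :: "real \<Rightarrow> complex"
  assumes "(J has_vector_derivative D) (at (c * s))"
  shows "((\<lambda>s. w * J (c * s)) has_vector_derivative w * (of_real c * D)) (at s)"
proof -
  have "(J \<circ> (\<lambda>s. c * s) has_vector_derivative c *\<^sub>R D) (at s)"
    by (rule vector_diff_chain_at[of "\<lambda>s. c * s" c s J, OF _ assms])
      (auto intro!: derivative_eq_intros simp: has_real_derivative_iff_has_vector_derivative[symmetric])
  from has_vector_derivative_mult_right[OF this, of w] show ?thesis
    by (simp add: o_def scaleR_conv_of_real)
qed

text \<open>For \<open>y \<noteq> 0\<close> only the limit of integration depends on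
  \<open>s\<close>. For \<open>y = 0\<close> a power is differentiated, or the logarithm when
  \<open>k = N\<close>; this fixes the coefficient \<open>l * H k 0 / (N - k)\<close> of the
  expansion at the origin.\<close>

lemma G_fun_deriv:
  assumes s: "s > 0"
  shows "(G_fun k y has_vector_derivative - of_nat l * of_real (s powi (int k - int N - 1)) * H k (s *\<^sub>R y)) (at s)"
proof (cases "y = 0")
  case True
  show ?thesis
  proof (cases "k = N")
    case True
    have "(ln has_real_derivative 1 / s) (at s)" using s by (auto intro!: derivative_eq_intros)
    then have "((\<lambda>x. complex_of_real (ln x)) has_vector_derivative of_real (1 / s)) (at s)"
      by (rule has_vector_derivative_of_real)
    from has_vector_derivative_mult_right[OF this, of "- of_nat l * H N 0"]
    show ?thesis using True \<open>y = 0\<close> by (simp add: G_fun_def[abs_def] power_int_minus divide_inverse mult_ac)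
  next
    case False
    have d: "((\<lambda>x. x powi (int k - int N)) has_real_derivative of_int (int k - int N) * s powi (int k - int N - 1) * 1) (at s)"
      using s by (intro DERIV_power_int DERIV_ident) auto
    then have "((\<lambda>x. x powi (int k - int N)) has_real_derivative of_int (int k - int N) * s powi (int k - int N - 1)) (at s)"
      by simp
    then have "((\<lambda>x. complex_of_real (x powi (int k - int N))) has_vector_derivative of_real (of_int (int k - int N) * s powi (int k - int N - 1))) (at s)"
      by (rule has_vector_derivative_of_real)
    from has_vector_derivative_mult_left[OF this, of "of_nat l * H k 0 / of_real (real N - real k)"]
    have "(G_fun k y has_vector_derivative of_real (of_int (int k - int N) * s powi (int k - int N - 1)) * (of_nat l * H k 0 / of_real (real N - real k))) (at s)"
      using False \<open>y = 0\<close> by (simp add: G_fun_def[abs_def])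
    moreover have "of_real (of_int (int k - int N) * s powi (int k - int N - 1)) * (of_nat l * H k 0 / of_real (real N - real k)) = - of_nat l * of_real (s powi (int k - int N - 1)) * H k (s *\<^sub>R y)"
    proof -
      define d where "d = complex_of_real (real N - real k)"
      have "d \<noteq> 0" using False by (simp add: d_def del: of_real_diff)
      moreover have "complex_of_real (of_int (int k - int N)) = - d" by (simp add: d_def)
      ultimately show ?thesis unfolding of_real_mult d_def[symmetric] using \<open>y = 0\<close>
        by (simp add: mult_ac del: of_real_of_int_eq of_real_power_int)
    qed
    ultimately show ?thesis by simp
  qed
next
  case False
  let ?n = "sgn y"
  have n: "norm ?n = 1" using False by (simp add: norm_sgn)
  have r: "norm y * s > 0" using False s by simp
  have yn: "(norm y * s) *\<^sub>R ?n = s *\<^sub>R y" using False by (simp add: sgn_div_norm)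
  show ?thesis
  proof (cases "k \<le> N")
    case True
    let ?h = "\<lambda>\<rho>. H k (\<rho> *\<^sub>R ?n) / of_real \<rho> ^ (N - k + 1)"
    have "((\<lambda>r. LINT \<rho>:{r..}|lborel. ?h \<rho>) has_vector_derivative - ?h (norm y * s)) (at (norm y * s))"
      by (intro tail_integral_deriv H_tail_integrable n r continuous_intros H_ray_continuous) auto
    from has_vector_derivative_rescale[OF this, of "of_nat l * of_real (norm y) ^ (N - k)"]
    have d: "((\<lambda>s. of_nat l * of_real (norm y) ^ (N - k) * (LINT \<rho>:{norm y * s..}|lborel. ?h \<rho>)) has_vector_derivative
       of_nat l * of_real (norm y) ^ (N - k) * (of_real (norm y) * - ?h (norm y * s))) (at s)" .
    have "int k - int N - 1 = - int (N - k + 1)" using True by simp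
    then have p: "s powi (int k - int N - 1) = 1 / s ^ (N - k + 1)" by (simp only: power_int_minus power_int_of_nat divide_inverse mult_1)
    have e: "of_nat l * of_real (norm y) ^ (N - k) * (of_real (norm y) * - ?h (norm y * s)) = - of_nat l * of_real (s powi (int k - int N - 1)) * H k (s *\<^sub>R y)"
      unfolding yn p using False s by (simp add: power_mult_distrib)
    show ?thesis
      by (rule has_vector_derivative_transform_within_open[OF d[unfolded e], of "{0<..}"]) (use s G_fun_le[OF False True] in auto)
  next
    case k: False
    let ?h = "\<lambda>\<rho>. of_real \<rho> ^ (k - N - 1) * H k (\<rho> *\<^sub>R ?n)"
    have "((\<lambda>r. LINT \<rho>:{0..r}|lborel. ?h \<rho>) has_vector_derivative ?h (norm y * s)) (at (norm y * s))"
      by (intro initial_integral_deriv r continuous_intros H_ray_continuous)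
    from has_vector_derivative_rescale[OF this, of "- (of_nat l / of_real (norm y) ^ (k - N))"]
    have d: "((\<lambda>s. - (of_nat l / of_real (norm y) ^ (k - N)) * (LINT \<rho>:{0..norm y * s}|lborel. ?h \<rho>)) has_vector_derivative
       - (of_nat l / of_real (norm y) ^ (k - N)) * (of_real (norm y) * ?h (norm y * s))) (at s)" .
    obtain i where i: "k - N = Suc i" using k by (cases "k - N") auto
    have "int k - int N - 1 = int i" using i by linarith
    then have p: "s powi (int k - int N - 1) = s ^ i" by (simp only: power_int_of_nat)
    have e: "- (of_nat l / of_real (norm y) ^ (k - N)) * (of_real (norm y) * ?h (norm y * s)) = - of_nat l * of_real (s powi (int k - int N - 1)) * H k (s *\<^sub>R y)"
      unfolding yn p i using False s by (simp add: power_mult_distrib)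
    show ?thesis
      by (rule has_vector_derivative_transform_within_open[OF d[unfolded e], of "{0<..}"]) (use s k G_fun_gt[OF False] in auto)
  qed
qed

text \<open>The first summand is the \<open>k\<close>-th term of \<open>F_hat\<close>, so the sum
  over \<open>k\<close> is exactly what \<open>Omega\<close> subtracts from
  \<open>S_fun\<close>.\<close>

definition G_const :: "nat \<Rightarrow> real ^ 'd \<Rightarrow> complex" where
  "G_const k y = of_nat l * of_real (norm y) ^ (N - k) *
        (LINT \<rho>:{0..1}|lborel. H_hat l b P k \<rho> (sgn y) / of_real \<rho> ^ (N - k + 1)) + Omega_k l b P k y"

text \<open>\<open>H_hat\<close> is the Taylor remainder of order \<open>N - k\<close> along a ray,
  so the quotient by one power more stays bounded; at \<open>\<rho> = 0\<close> division by zero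
  gives 0.\<close>

lemma H_hat_bound:
  assumes "k \<le> N"
  shows "\<exists>C\<ge>0. \<forall>n \<rho>. norm n = 1 \<longrightarrow> norm (H_hat l b P k \<rho> n / of_real \<rho> ^ (N - k + 1)) \<le> C"
proof -
  obtain C where C: "C \<ge> 0" "\<And>n \<rho>. norm n = 1 \<Longrightarrow> norm (H k (\<rho> *\<^sub>R n) - (\<Sum>j\<le>N-k. H_dir l b P k j n / fact j * of_real \<rho> ^ j)) \<le> C * \<bar>\<rho>\<bar> ^ Suc (N - k)"
    using H_taylor[of k "N - k"] by blast
  have "norm (H_hat l b P k \<rho> n / of_real \<rho> ^ (N - k + 1)) \<le> C" if "norm n = 1" for n \<rho>
  proof (cases "\<rho> = 0")
    case False
    have "norm (H_hat l b P k \<rho> n) \<le> C * \<bar>\<rho>\<bar> ^ (N - k + 1)"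
      using C(2)[OF that, of \<rho>] by (simp add: H_hat_def N_eq atMost_atLeast0)
    then have "norm (H_hat l b P k \<rho> n) / \<bar>\<rho>\<bar> ^ (N - k + 1) \<le> C" using False by (simp add: pos_divide_le_eq del: power_Suc)
    then show ?thesis by (simp add: norm_divide norm_mult norm_power)
  qed (use C in simp)
  then show ?thesis using C by blast
qed

lemma H_hat_measurable: "(\<lambda>\<rho>. H_hat l b P k \<rho> n) \<in> borel_measurable borel"
  unfolding H_hat_def by measurable

text \<open>The tail is cut at 1, and between \<open>r\<close> and 1 the Taylor polynomial of
  \<open>H\<close> is split off. Its monomials integrate to negative powers of \<open>r\<close>, the
  one of degree \<open>m\<close> to the logarithm. The quotient of \<open>H_hat\<close> is bounded,
  so its integral may be extended down to 0 at the price of a term that tends to 0 with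
  \<open>r\<close>.\<close>

lemma tail_integral_expansion:
  assumes n: "norm n = 1" and k: "k \<le> N" and r: "0 < r" "r \<le> 1"
  defines "m \<equiv> N - k" and "c \<equiv> \<lambda>j. H_dir l b P k j n / fact j"
  shows "(LINT \<rho>:{r..}|lborel. H k (\<rho> *\<^sub>R n) / of_real \<rho> ^ (m + 1)) =
     (LINT \<rho>:{1..}|lborel. H k (\<rho> *\<^sub>R n) / of_real \<rho> ^ (m + 1))
     + (LINT \<rho>:{0..1}|lborel. H_hat l b P k \<rho> n / of_real \<rho> ^ (m + 1))
     - (LINT \<rho>:{0..r}|lborel. H_hat l b P k \<rho> n / of_real \<rho> ^ (m + 1))
     + (\<Sum>j<m. c j / of_nat (m - j) * (1 / of_real r ^ (m - j) - 1)) - c m * of_real (ln r)"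
proof -
  let ?h = "\<lambda>\<rho>. H k (\<rho> *\<^sub>R n) / of_real \<rho> ^ (m + 1)" and ?g = "\<lambda>\<rho>. H_hat l b P k \<rho> n / of_real \<rho> ^ (m + 1)"
  note [measurable] = H_hat_measurable[of k n]
  have ih: "set_integrable lborel {r..} ?h" by (rule H_tail_integrable[OF n r(1)])
  obtain C where C: "C \<ge> 0" "\<And>\<rho>. norm (?g \<rho>) \<le> C" using H_hat_bound[OF k] n unfolding m_def by blast
  have ig: "set_integrable lborel {0..1} ?g"
    unfolding set_integrable_def
  proof (rule Bochner_Integration.integrable_bound)
    show "integrable lborel (\<lambda>\<rho>::real. C * indicator {0..1} \<rho>)" by simp
    show "AE \<rho> in lborel. norm (indicator {0..1} \<rho> *\<^sub>R ?g \<rho>) \<le> norm (C * indicator {0..1} \<rho>)"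
      using C by (intro AE_I2) (auto simp: indicator_def)
  qed measurable
  have ig1: "set_integrable lborel {0..r} ?g" "set_integrable lborel {r<..1} ?g" "set_integrable lborel {r..1} ?g"
    by (rule set_integrable_subset[OF ig]; use r in auto)+
  have ih1: "set_integrable lborel {r..1} ?h" "set_integrable lborel {1<..} ?h" "set_integrable lborel {1..} ?h"
    by (rule set_integrable_subset[OF ih]; use r in auto)+
  have "(LINT \<rho>:{r..}|lborel. ?h \<rho>) = (LINT \<rho>:{r..1} \<union> {1<..}|lborel. ?h \<rho>)"
    using r by (intro arg_cong[where f="\<lambda>S. LINT \<rho>:S|lborel. ?h \<rho>"]) auto
  also have "\<dots> = (LINT \<rho>:{r..1}|lborel. ?h \<rho>) + (LINT \<rho>:{1<..}|lborel. ?h \<rho>)"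
    by (rule set_integral_Un[OF _ ih1(1,2)]) auto
  also have "(LINT \<rho>:{1<..}|lborel. ?h \<rho>) = (LINT \<rho>:{1..}|lborel. ?h \<rho>)"
  proof (rule set_integral_cong_set)
    show "AE \<rho>::real in lborel. (\<rho> \<in> {1..}) = (\<rho> \<in> {1<..})"
      using AE_lborel_singleton[of "1::real"] by eventually_elim auto
    show "set_borel_measurable lborel {1<..} ?h" "set_borel_measurable lborel {1..} ?h"
      using ih1 unfolding set_integrable_def set_borel_measurable_def by auto
  qed
  also have "(LINT \<rho>:{r..1}|lborel. ?h \<rho>) = (LINT \<rho>:{r..1}|lborel. ?g \<rho>) + (\<Sum>j\<le>m. c j * (LINT \<rho>:{r..1}|lborel. of_real \<rho> ^ j / of_real \<rho> ^ (m + 1)))"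
  proof -
    have ip: "set_integrable lborel {r..1} (\<lambda>\<rho>. complex_of_real \<rho> ^ j / of_real \<rho> ^ (m + 1))" for j
      using r by (intro borel_integrable_atLeastAtMost' continuous_intros) auto
    have ip': "integrable lborel (\<lambda>\<rho>. indicator {r..1} \<rho> *\<^sub>R (c j * (complex_of_real \<rho> ^ j / of_real \<rho> ^ (m + 1))))" for j
      using integrable_mult_right[OF ip[of j, unfolded set_integrable_def], of "c j"] by (simp add: mult_ac)
    have "?h \<rho> = ?g \<rho> + (\<Sum>j\<le>m. c j * (of_real \<rho> ^ j / of_real \<rho> ^ (m + 1)))" for \<rho>
      by (simp add: H_hat_def N_eq[symmetric] m_def[symmetric] c_def atMost_atLeast0 diff_divide_distrib sum_divide_distrib)
    then have "(LINT \<rho>:{r..1}|lborel. ?h \<rho>) = (\<integral>\<rho>. indicator {r..1} \<rho> *\<^sub>R ?g \<rho> + (\<Sum>j\<le>m. indicator {r..1} \<rho> *\<^sub>R (c j * (of_real \<rho> ^ j / of_real \<rho> ^ (m + 1)))) \<partial>lborel)"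
      unfolding set_lebesgue_integral_def by (simp only: scaleR_add_right scaleR_sum_right)
    also have "\<dots> = (\<integral>\<rho>. indicator {r..1} \<rho> *\<^sub>R ?g \<rho> \<partial>lborel) + (\<Sum>j\<le>m. \<integral>\<rho>. indicator {r..1} \<rho> *\<^sub>R (c j * (of_real \<rho> ^ j / of_real \<rho> ^ (m + 1))) \<partial>lborel)"
      using ig1(3) unfolding set_integrable_def
      by (simp only: Bochner_Integration.integral_add[OF _ Bochner_Integration.integrable_sum[OF ip']] Bochner_Integration.integral_sum[OF ip'])
    also have "(\<Sum>j\<le>m. \<integral>\<rho>. indicator {r..1} \<rho> *\<^sub>R (c j * (of_real \<rho> ^ j / of_real \<rho> ^ (m + 1))) \<partial>lborel) = (\<Sum>j\<le>m. c j * (LINT \<rho>:{r..1}|lborel. of_real \<rho> ^ j / of_real \<rho> ^ (m + 1)))"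
      unfolding set_lebesgue_integral_def by (intro sum.cong refl) (simp only: mult_scaleR_right[symmetric] integral_mult_right_zero)
    finally show ?thesis unfolding set_lebesgue_integral_def .
  qed
  also have "(\<Sum>j\<le>m. c j * (LINT \<rho>:{r..1}|lborel. of_real \<rho> ^ j / of_real \<rho> ^ (m + 1))) = (\<Sum>j<m. c j / of_nat (m - j) * (1 / of_real r ^ (m - j) - 1)) - c m * of_real (ln r)"
  proof -
    have "(\<Sum>j\<le>m. c j * (LINT \<rho>:{r..1}|lborel. of_real \<rho> ^ j / of_real \<rho> ^ (m + 1))) = (\<Sum>j<m. c j * (LINT \<rho>:{r..1}|lborel. of_real \<rho> ^ j / of_real \<rho> ^ (m + 1))) + c m * (LINT \<rho>:{r..1}|lborel. of_real \<rho> ^ m / of_real \<rho> ^ (m + 1))"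
      by (simp only: lessThan_Suc_atMost[symmetric] sum.lessThan_Suc)
    also have "(\<Sum>j<m. c j * (LINT \<rho>:{r..1}|lborel. of_real \<rho> ^ j / of_real \<rho> ^ (m + 1))) = (\<Sum>j<m. c j / of_nat (m - j) * (1 / of_real r ^ (m - j) - 1))"
      by (intro sum.cong refl, subst integral_power_ratio[OF r]) auto
    also note integral_power_ratio_log[OF r]
    finally show ?thesis by simp
  qed
  also have "(LINT \<rho>:{r..1}|lborel. ?g \<rho>) = (LINT \<rho>:{0..1}|lborel. ?g \<rho>) - (LINT \<rho>:{0..r}|lborel. ?g \<rho>)"
  proof -
    have "(LINT \<rho>:{0..1}|lborel. ?g \<rho>) = (LINT \<rho>:{0..r} \<union> {r<..1}|lborel. ?g \<rho>)"
      using r by (intro arg_cong[where f="\<lambda>S. LINT \<rho>:S|lborel. ?g \<rho>"]) auto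
    also have "\<dots> = (LINT \<rho>:{0..r}|lborel. ?g \<rho>) + (LINT \<rho>:{r<..1}|lborel. ?g \<rho>)"
      by (rule set_integral_Un[OF _ ig1(1,2)]) auto
    also have "(LINT \<rho>:{r<..1}|lborel. ?g \<rho>) = (LINT \<rho>:{r..1}|lborel. ?g \<rho>)"
    proof (rule set_integral_cong_set)
      show "AE \<rho> in lborel. (\<rho> \<in> {r..1}) = (\<rho> \<in> {r<..1})"
        using AE_lborel_singleton[of r] by eventually_elim auto
      show "set_borel_measurable lborel {r<..1} ?g" "set_borel_measurable lborel {r..1} ?g"
        using ig1 unfolding set_integrable_def set_borel_measurable_def by auto
    qed
    finally show ?thesis by simp
  qed
  finally show ?thesis by simp
qed

text \<open>At \<open>r = norm y * s\<close> the logarithm splits into \<open>ln (norm y)\<close>,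
  which belongs to the constant, and the singular \<open>ln s\<close>. The remaining constants are
  those collected in \<open>Omega_k\<close> and in the \<open>k\<close>-th term of
  \<open>F_hat\<close>.\<close>

lemma constant_term_G_fun_le:
  assumes y: "y \<noteq> 0" and k: "k \<le> N"
  shows "constant_term N (G_fun k y) (G_const k y)"
proof -
  let ?n = "sgn y" and ?m = "N - k"
  define w where "w = of_nat l * complex_of_real (norm y) ^ ?m"
  define c where "c j = H_dir l b P k j ?n / fact j" for j
  define K1 where "K1 = (LINT \<rho>:{1..}|lborel. H k (\<rho> *\<^sub>R ?n) / of_real \<rho> ^ (?m + 1))"
  define K2 where "K2 = (LINT \<rho>:{0..1}|lborel. H_hat l b P k \<rho> ?n / of_real \<rho> ^ (?m + 1))"
  define E where "E s = (LINT \<rho>:{0..norm y * s}|lborel. H_hat l b P k \<rho> ?n / of_real \<rho> ^ (?m + 1))" for s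
  have n: "norm ?n = 1" using y by (simp add: norm_sgn)
  have yp: "norm y > 0" using y by simp
  obtain C where C: "C \<ge> 0" "\<And>\<rho>. norm (H_hat l b P k \<rho> ?n / of_real \<rho> ^ (?m + 1)) \<le> C" using H_hat_bound[OF k] n by blast
  have "(E \<longlongrightarrow> 0) (at_right 0)"
  proof (rule Lim_null_comparison)
    show "eventually (\<lambda>s. norm (E s) \<le> C * (norm y * s)) (at_right 0)"
      using eventually_at_right_less[of 0]
      by eventually_elim (unfold E_def, rule set_integral_bound_const, use C in auto)
    show "((\<lambda>s. C * (norm y * s)) \<longlongrightarrow> 0) (at_right 0)" by (auto intro!: tendsto_eq_intros)
  qed
  then have cE: "constant_term N (\<lambda>s. (- w) * E s) ((- w) * 0)" by (intro constant_term_cmult constant_term_tendsto)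
  have cS: "constant_term N (\<lambda>s. \<Sum>j<?m. w * (c j / of_nat (?m - j)) / of_real (norm y) ^ (?m - j) / of_real s ^ (?m - j)) (\<Sum>j<?m. 0)"
    by (intro constant_term_sum constant_term_power) auto
  have cL: "constant_term N (\<lambda>s. (- w * c ?m) * of_real (ln s)) 0" by (rule constant_term_ln)
  define K where "K = w * (K1 + K2 - (\<Sum>j<?m. c j / of_nat (?m - j)) - c ?m * of_real (ln (norm y)))"
  have cK: "constant_term N (\<lambda>s. K) K" by (intro constant_term_tendsto tendsto_const)
  from constant_term_add[OF constant_term_add[OF cK cE] constant_term_add[OF cS cL]]
  have "constant_term N (G_fun k y) ((K + (- w) * 0) + ((\<Sum>j<?m. 0) + 0))"
  proof (rule constant_term_cong)
    have "eventually (\<lambda>s. s < 1 / norm y) (at_right 0)"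
      unfolding eventually_at_right_field by (intro exI[of _ "1 / norm y"]) (use yp in auto)
    then show "eventually (\<lambda>s. (K + (- w) * E s) + ((\<Sum>j<?m. w * (c j / of_nat (?m - j)) / of_real (norm y) ^ (?m - j) / of_real s ^ (?m - j)) + (- w * c ?m) * of_real (ln s)) = G_fun k y s) (at_right 0)"
      using eventually_at_right_less[of 0]
    proof eventually_elim
      case (elim s)
      have r: "0 < norm y * s" "norm y * s \<le> 1" using yp elim by (auto simp: field_simps)
      have "G_fun k y s = w * (K1 + K2 - E s + (\<Sum>j<?m. c j / of_nat (?m - j) * (1 / of_real (norm y * s) ^ (?m - j) - 1)) - c ?m * of_real (ln (norm y * s)))"
        unfolding G_fun_le[OF y k elim(2)] tail_integral_expansion[OF n k r] w_def K1_def K2_def E_def c_def ..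
      also have "(\<Sum>j<?m. c j / of_nat (?m - j) * (1 / of_real (norm y * s) ^ (?m - j) - 1)) = 
        (\<Sum>j<?m. (c j / of_nat (?m - j)) / of_real (norm y) ^ (?m - j) / of_real s ^ (?m - j)) - (\<Sum>j<?m. c j / of_nat (?m - j))"
        by (simp add: right_diff_distrib sum_subtractf power_mult_distrib mult.assoc)
      also have "ln (norm y * s) = ln (norm y) + ln s" using yp elim by (simp add: ln_mult)
      finally show ?case unfolding K_def by (simp add: algebra_simps sum_distrib_left)
    qed
  qed
  moreover have "(K + (- w) * 0) + ((\<Sum>j<?m. 0) + 0) = G_const k y"
  proof -
    have "l - CARD('d) - k = ?m" "\<And>j. l - j - CARD('d) - k = ?m - j" using N_eq by auto
    then have "Omega_k l b P k y = w * (K1 - (\<Sum>j<?m. c j / of_nat (?m - j)) - c ?m * of_real (ln (norm y)))"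
      unfolding Omega_k_def w_def K1_def c_def by simp
    then show ?thesis unfolding G_const_def w_def[symmetric] K2_def[symmetric] by (simp add: K_def algebra_simps)
  qed
  ultimately show ?thesis by simp
qed

text \<open>For \<open>k > N\<close> the antiderivative is an integral starting at 0, or a positive
  power of \<open>s\<close> if \<open>y = 0\<close>, and vanishes in the limit.\<close>

lemma constant_term_G_fun_gt:
  assumes k: "k > N"
  shows "constant_term N (G_fun k y) 0"
proof (rule constant_term_tendsto, cases "y = 0")
  case True
  obtain i where i: "k - N = Suc i" using k by (cases "k - N") auto
  then have "int k - int N = int (Suc i)" by linarith
  then have "s powi (int k - int N) = s ^ Suc i" for s :: real by (simp only: power_int_of_nat)
  then show "(G_fun k y \<longlongrightarrow> 0) (at_right 0)" unfolding G_fun_def[abs_def] using True k by (auto intro!: tendsto_mult_left_zero tendsto_eq_intros)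
next
  case False
  let ?n = "sgn y"
  obtain C where C: "C \<ge> 0" "\<And>y. norm (H k y) \<le> C" using H_decay by blast
  have yp: "norm y > 0" using False by simp
  show "(G_fun k y \<longlongrightarrow> 0) (at_right 0)"
  proof (rule Lim_null_comparison)
    have "eventually (\<lambda>s. s < 1 / norm y) (at_right 0)"
      unfolding eventually_at_right_field by (intro exI[of _ "1 / norm y"]) (use yp in auto)
    then show "eventually (\<lambda>s. norm (G_fun k y s) \<le> real l / norm y ^ (k - N) * (C * (norm y * s))) (at_right 0)"
      using eventually_at_right_less[of 0]
    proof eventually_elim
      case (elim s)
      have r: "0 \<le> norm y * s" "norm y * s \<le> 1" using yp elim by (auto simp: field_simps)
      have "norm (LINT \<rho>:{0..norm y * s}|lborel. of_real \<rho> ^ (k - N - 1) * H k (\<rho> *\<^sub>R ?n)) \<le> C * (norm y * s)"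
      proof (rule set_integral_bound_const[OF r(1)])
        fix \<rho> assume "0 \<le> \<rho>" "\<rho> \<le> norm y * s"
        then have "\<rho> ^ (k - N - 1) \<le> 1" using r by (intro power_le_one) auto
        then have "\<rho> ^ (k - N - 1) * norm (H k (\<rho> *\<^sub>R ?n)) \<le> 1 * C"
          using C by (intro mult_mono) auto
        then show "norm (of_real \<rho> ^ (k - N - 1) * H k (\<rho> *\<^sub>R ?n)) \<le> C"
          using \<open>0 \<le> \<rho>\<close> by (simp add: norm_mult norm_power)
      qed
      then show ?case
        unfolding G_fun_gt[OF False k elim(2)] norm_mult by (intro mult_mono) (auto simp: norm_divide norm_power)
    qed
    show "((\<lambda>s. real l / norm y ^ (k - N) * (C * (norm y * s))) \<longlongrightarrow> 0) (at_right 0)" using False by (auto intro!: tendsto_eq_intros)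
  qed
qed

lemma constant_term_G_fun_0:
  assumes "k \<le> N"
  shows "constant_term N (G_fun k 0) 0"
proof (cases "k = N")
  case True
  then show ?thesis using constant_term_ln[of N "- of_nat l * H N 0"] by (simp add: G_fun_def[abs_def])
next
  case False
  have "int k - int N = - int (N - k)" using assms by simp
  then have "s powi (int k - int N) = 1 / s ^ (N - k)" for s :: real by (simp only: power_int_minus power_int_of_nat divide_inverse mult_1)
  then show ?thesis
    using constant_term_power[of "N - k" N "of_nat l * H k 0 / of_real (real N - real k)"] assms False by (simp add: G_fun_def[abs_def] mult.commute)
qed

section \<open>The remainder estimate, uniform in the lattice point\<close>

definition total_const :: "real ^ 'd \<Rightarrow> complex" where
  "total_const y = (if y = 0 then S_fun M l lhat a b P Q 0 else Omega M l lhat a b P Q y)"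

text \<open>The chain rule factor \<open>- l / s ^ (l + 1)\<close> turns the error
  \<open>O (s ^ (d + K + 1))\<close> for the first Green function into a derivative bound
  \<open>O (s ^ (K - N))\<close>, uniform in \<open>y\<close>. It is integrated from 0, where the
  limit \<open>total_const y\<close>, known for each \<open>y\<close> without a rate, is the initial
  value.\<close>

lemma green2_expansion:
  assumes K: "K \<ge> N"
  shows "\<exists>R\<ge>0. \<forall>s>0. \<forall>y. norm (green2 y (1 / s ^ l) - (\<Sum>k\<le>K. G_fun k y s) - total_const y) \<le> R * s ^ (K - N + 1)"
proof -
  obtain C where C: "C \<ge> 0" "\<And>s y. s > 0 \<Longrightarrow> norm (green1 y (1 / s ^ l) - (\<Sum>k\<le>K. of_real (s ^ (CARD('d) + k)) * H k (s *\<^sub>R y))) \<le> C * s ^ (CARD('d) + K + 1)"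
    using green1_expansion by blast
  let ?p = "K - N + 1"
  \<comment> \<open>The antiderivative of the derivative bound that vanishes at 0.\<close>
  define \<phi> where "\<phi> s = (real l * C / of_nat ?p) * s ^ ?p" for s :: real
  have main: "norm (green2 y (1 / s ^ l) - (\<Sum>k\<le>K. G_fun k y s) - total_const y) \<le> \<phi> s" if s: "s > 0" for s y
  proof -
    define D where "D s = green2 y (1 / s ^ l) - (\<Sum>k\<le>K. G_fun k y s)" for s
    define D' where "D' s = - of_real (real l / s ^ (l + 1)) * (green1 y (1 / s ^ l) - (\<Sum>k\<le>K. of_real (s ^ (CARD('d) + k)) * H k (s *\<^sub>R y)))" for s
    have der: "(D has_vector_derivative D' s) (at s)" if s: "s > 0" for s
    proof -
      have t: "((\<lambda>s. 1 / s ^ l) has_vector_derivative - (real l / s ^ (l + 1))) (at s)"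
      proof -
        obtain i where i: "l = Suc i" using l_ge_1 by (cases l) auto
        have "((\<lambda>s. inverse s ^ l) has_real_derivative of_nat l * (- (inverse s ^ Suc (Suc 0)) * inverse s ^ (l - Suc 0))) (at s)"
          using s by (intro DERIV_power DERIV_inverse) auto
        also have "of_nat l * (- (inverse s ^ Suc (Suc 0)) * inverse s ^ (l - Suc 0)) = - (real l / s ^ (l + 1))"
          using s unfolding i by (simp add: field_simps del: of_nat_Suc)
        finally show ?thesis by (simp add: has_real_derivative_iff_has_vector_derivative power_inverse divide_inverse)
      qed
      have g: "(green2 y has_vector_derivative green1 y (1 / s ^ l)) (at (1 / s ^ l))"
        using green2_deriv[of "1 / s ^ l" y] s at_within_interior[of "1 / s ^ l" "{0..}"] by simp
      have "(green2 y \<circ> (\<lambda>s. 1 / s ^ l) has_vector_derivative (- (real l / s ^ (l + 1))) *\<^sub>R green1 y (1 / s ^ l)) (at s)"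
        by (rule vector_diff_chain_at[OF t g])
      moreover have "((\<lambda>s. \<Sum>k\<le>K. G_fun k y s) has_vector_derivative (\<Sum>k\<le>K. - of_nat l * of_real (s powi (int k - int N - 1)) * H k (s *\<^sub>R y))) (at s)"
        by (intro has_vector_derivative_sum G_fun_deriv s)
      ultimately have "((\<lambda>s. green2 y (1 / s ^ l) - (\<Sum>k\<le>K. G_fun k y s)) has_vector_derivative
        (- (real l / s ^ (l + 1))) *\<^sub>R green1 y (1 / s ^ l) - (\<Sum>k\<le>K. - of_nat l * of_real (s powi (int k - int N - 1)) * H k (s *\<^sub>R y))) (at s)"
        unfolding o_def by (rule has_vector_derivative_diff)
      moreover have "(- (real l / s ^ (l + 1))) *\<^sub>R green1 y (1 / s ^ l) - (\<Sum>k\<le>K. - of_nat l * of_real (s powi (int k - int N - 1)) * H k (s *\<^sub>R y)) = D' s"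
      proof -
        have "s powi (int k - int N - 1) = s ^ (CARD('d) + k) / s ^ (l + 1)" for k
        proof -
          have "int k - int N - 1 = int (CARD('d) + k) - int (l + 1)" using N_eq dim_le by auto
          then show ?thesis using s by (metis less_numeral_extra(3) power_int_diff power_int_of_nat)
        qed
        then have p: "complex_of_real (s powi (int k - int N - 1)) = of_real (s ^ (CARD('d) + k)) / of_real (s ^ (l + 1))" for k by (metis of_real_divide)
        show ?thesis unfolding D'_def p
          by (simp add: scaleR_conv_of_real right_diff_distrib sum_distrib_left sum_negf sum_divide_distrib mult_ac)
      qed
      ultimately show ?thesis unfolding D_def[abs_def] by simp
    qed
    have bD': "norm (D' s) \<le> real l * C * s ^ (K - N)" if s: "s > 0" for s
    proof -
      have "norm (D' s) = real l / s ^ (l + 1) * norm (green1 y (1 / s ^ l) - (\<Sum>k\<le>K. of_real (s ^ (CARD('d) + k)) * H k (s *\<^sub>R y)))"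
        using s by (simp add: D'_def norm_mult norm_divide norm_power)
      also have "\<dots> \<le> real l / s ^ (l + 1) * (C * s ^ (CARD('d) + K + 1))"
        using s by (intro mult_left_mono C(2)) auto
      also have "CARD('d) + K + 1 = (K - N) + (l + 1)" using K N_eq dim_le by auto
      finally show ?thesis using s by (simp add: power_add)
    qed
    have d\<phi>: "(\<phi> has_vector_derivative real l * C * s ^ (K - N)) (at s)" for s
      using DERIV_cmult[OF DERIV_pow[of ?p s UNIV], of "real l * C / real ?p"]
      unfolding \<phi>_def[abs_def] has_real_derivative_iff_has_vector_derivative[symmetric]
      by (simp del: of_nat_Suc add: mult.assoc)
    have contD: "continuous_on {u..v} D" if "u > 0" for u v
      using that by (intro continuous_at_imp_continuous_on ballI has_vector_derivative_continuous[OF der]) auto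
    have cont\<phi>: "continuous_on S \<phi>" for S unfolding \<phi>_def[abs_def] by (intro continuous_intros)
    have mvt: "norm (D v - D u) \<le> \<phi> v - \<phi> u" if "0 < u" "u < v" for u v
      by (rule differentiable_bound_general[where f'=D' and \<phi>'="\<lambda>s. real l * C * s ^ (K - N)"])
        (use that der d\<phi> bD' contD cont\<phi> in auto)
    have \<phi>0: "\<phi> s \<ge> 0" if "s \<ge> 0" for s using that C by (simp add: \<phi>_def)
    have "constant_term N D (total_const y)"
    proof -
      define c where "c k = (if k > N then 0 else if y = 0 then 0 else G_const k y)" for k
      have cG: "constant_term N (G_fun k y) (c k)" for k
        using constant_term_G_fun_gt[of k y] constant_term_G_fun_0[of k] constant_term_G_fun_le[of y k] by (auto simp: c_def not_less)
      have "constant_term N (\<lambda>s. green2 y (1 / s ^ l) + (-1) * (\<Sum>k\<le>K. G_fun k y s)) (S_fun M l lhat a b P Q y + (-1) * (\<Sum>k\<le>K. c k))"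
        by (intro constant_term_add constant_term_green2 constant_term_cmult constant_term_sum cG)
      then have "constant_term N D (S_fun M l lhat a b P Q y + (-1) * (\<Sum>k\<le>K. c k))"
        by (rule constant_term_cong) (simp add: D_def)
      moreover have "(\<Sum>k\<le>K. c k) = (\<Sum>k\<le>N. c k)"
        using K by (intro sum.mono_neutral_right) (auto simp: c_def)
      moreover have "S_fun M l lhat a b P Q y + (-1) * (\<Sum>k\<le>N. c k) = total_const y"
      proof (cases "y = 0")
        case False
        have "(\<Sum>k\<le>N. c k) = (\<Sum>k\<le>N. G_const k y)" using False by (intro sum.cong) (auto simp: c_def)
        also have "\<dots> = F_hat l b P y + (\<Sum>k\<le>N. Omega_k l b P k y)"
          by (simp add: G_const_def sum.distrib F_hat_def N_eq[symmetric] atMost_atLeast0 sum_distrib_left mult.assoc)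
        finally show ?thesis using False by (simp add: total_const_def Omega_def N_eq[symmetric] atMost_atLeast0)
      qed (simp add: total_const_def c_def)
      ultimately show ?thesis by simp
    qed
    \<comment> \<open>The derivative bound is integrable down to 0, so \<open>D\<close> stays
      bounded. This is what forces the singular terms of its expansion to cancel.\<close>
    moreover have "eventually (\<lambda>s. norm (D s) \<le> norm (D 1) + \<phi> 1) (at_right 0)"
    proof -
      have "eventually (\<lambda>s::real. s < 1) (at_right 0)"
        unfolding eventually_at_right_field by (intro exI[of _ 1]) auto
      then show ?thesis
        using eventually_at_right_less[of 0]
      proof eventually_elim
        case (elim s)
        then have "norm (D 1 - D s) \<le> \<phi> 1" using mvt[of s 1] \<phi>0[of s] by linarith
        then show ?case using norm_triangle_sub[of "D s" "D 1"] by (simp add: norm_minus_commute)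
      qed
    qed
    ultimately have lim: "(D \<longlongrightarrow> total_const y) (at_right 0)" by (rule constant_term_bounded)
    \<comment> \<open>The lower end \<open>u\<close> of the mean value estimate is sent to
      0.\<close>
    have "((\<lambda>u. norm (D s - D u)) \<longlongrightarrow> norm (D s - total_const y)) (at_right 0)"
      by (intro tendsto_intros lim)
    moreover have "eventually (\<lambda>u. norm (D s - D u) \<le> \<phi> s) (at_right 0)"
    proof -
      have "eventually (\<lambda>u. u < s) (at_right 0)"
        unfolding eventually_at_right_field by (intro exI[of _ s]) (use s in auto)
      then show ?thesis
        using eventually_at_right_less[of 0]
      proof eventually_elim
        case (elim u)
        then show ?case using mvt[of u s] \<phi>0[of u] by linarith
      qed
    qed
    ultimately have "norm (D s - total_const y) \<le> \<phi> s"
      by (rule tendsto_upperbound) simp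
    then show ?thesis by (simp add: D_def)
  qed
  show ?thesis
    using main C unfolding \<phi>_def by (intro exI[of _ "real l * C / of_nat ?p"]) auto
qed

end

subsection \<open>Mesh size \<open>\<epsilon>\<close>\<close>

text \<open>\<open>\<epsilon> ^ N\<close> is the factor between the Green functions of mesh size
  \<open>\<epsilon>\<close> and 1, and \<open>\<epsilon> / t powr (1 / real l)\<close> is the value
  of \<open>s\<close>. The powers of \<open>\<epsilon>\<close> combine to
  \<open>\<epsilon> ^ k\<close>.\<close>

lemma scaled_power:
  fixes \<epsilon> t :: real and k N l d :: nat
  assumes "\<epsilon> > 0" "t > 0" "1 \<le> l" "N + d = l"
  shows "\<epsilon> ^ N * (\<epsilon> / t powr (1 / real l)) powi (int k - int N) = \<epsilon> ^ k * t powr (1 - real (k + d) / real l)"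
proof -
  let ?s = "\<epsilon> / t powr (1 / real l)"
  have s: "?s > 0" using assms by simp
  have "?s powi (int k - int N) = ?s powr (of_int (int k - int N))"
    using s by (intro powr_real_of_int'[symmetric]) auto
  also have "\<dots> = \<epsilon> powr (real k - real N) / t powr (1 / real l * (real k - real N))"
    using assms by (simp add: powr_divide powr_powr)
  also have "\<epsilon> powr (real k - real N) = \<epsilon> ^ k / \<epsilon> ^ N"
    using assms by (simp add: powr_diff powr_realpow)
  also have "t powr (1 / real l * (real k - real N)) = 1 / t powr (1 - real (k + d) / real l)"
  proof -
    have "1 / real l * (real k - real N) = - (1 - real (k + d) / real l)"
      using assms(3) by (simp add: assms(4)[symmetric] field_simps)
    then show ?thesis by (simp only: powr_minus_divide)
  qed
  finally show ?thesis using assms by simp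
qed

context green_setting
begin

lemma F_fun_vanish: "1 \<le> k \<Longrightarrow> k < M \<Longrightarrow> F_fun l b P k y = 0"
  by (simp add: F_fun_def H_fun_vanish)

text \<open>The terms with \<open>0 < k < M\<close> vanish together with \<open>H_fun\<close>. If
  \<open>M > N\<close>, the middle range is empty and the last one starts at
  \<open>M\<close>.\<close>

lemma sum_G_fun_nonzero:
  assumes "y \<noteq> 0" "K \<ge> N"
  shows "(\<Sum>k\<le>K. G_fun k y s) = G_fun 0 y s + (\<Sum>k=M..N. G_fun k y s) + (\<Sum>k=max M (N + 1)..K. G_fun k y s)"
proof -
  have "(\<Sum>k\<le>K. G_fun k y s) = (\<Sum>k\<in>{0} \<union> ({M..N} \<union> {max M (N + 1)..K}). G_fun k y s)"
    using assms by (intro sum.mono_neutral_right) (auto simp: G_fun_def not_le F_fun_vanish)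
  also have "\<dots> = G_fun 0 y s + ((\<Sum>k=M..N. G_fun k y s) + (\<Sum>k=max M (N + 1)..K. G_fun k y s))"
    using M_ge_1 by (subst sum.union_disjoint, simp, simp, fastforce, subst sum.union_disjoint) auto
  finally show ?thesis by simp
qed

lemma sum_G_fun_split:
  assumes "K \<ge> N"
  shows "(\<Sum>k\<le>K. G_fun k y s) = (\<Sum>k<N. G_fun k y s) + G_fun N y s + (\<Sum>k=N+1..K. G_fun k y s)"
proof -
  have "(\<Sum>k\<le>K. G_fun k y s) = (\<Sum>k\<in>{..N} \<union> {N+1..K}. G_fun k y s)"
    using assms by (intro sum.cong) auto
  also have "\<dots> = (\<Sum>k\<le>N. G_fun k y s) + (\<Sum>k=N+1..K. G_fun k y s)"
    by (intro sum.union_disjoint) auto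
  finally show ?thesis by (simp only: lessThan_Suc_atMost[symmetric] sum.lessThan_Suc)
qed

lemma second_discrete_green_eq:
  assumes v: "second_discrete_green l lhat a \<epsilon> v" and \<epsilon>: "\<epsilon> > 0" and x: "x \<in> lattice \<epsilon>" and t: "t \<ge> 0"
  shows "v x t = of_real (\<epsilon> ^ N) * green2 (x /\<^sub>R \<epsilon>) (t / \<epsilon> ^ l)"
proof -
  have "x /\<^sub>R \<epsilon> \<in> lattice 1"
    unfolding lattice_def
  proof (intro CollectI allI)
    fix k obtain m :: int where "x $ k = \<epsilon> * of_int m" using x unfolding lattice_def by blast
    then show "\<exists>m::int. (x /\<^sub>R \<epsilon>) $ k = 1 * of_int m" using \<epsilon> by (intro exI[of _ m]) simp
  qed
  from green_unique[OF second_discrete_green_rescale[OF v \<epsilon>] this, of "t / \<epsilon> ^ l"]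
  have "of_real (\<epsilon> ^ CARD('d) / \<epsilon> ^ l) * v x t = green2 (x /\<^sub>R \<epsilon>) (t / \<epsilon> ^ l)"
    using \<epsilon> t by simp
  moreover have "\<epsilon> ^ N * (\<epsilon> ^ CARD('d) / \<epsilon> ^ l) = 1"
    using \<epsilon> N_eq dim_le by (simp add: power_add[symmetric])
  then have "complex_of_real (\<epsilon> ^ N) * of_real (\<epsilon> ^ CARD('d) / \<epsilon> ^ l) = 1"
    by (metis of_real_1 of_real_mult)
  ultimately show ?thesis by (metis mult.assoc mult_1)
qed

text \<open>Written in rescaled variables, so that one function serves nonzero \<open>x\<close> and
  \<open>x = 0\<close>; the distinction sits inside \<open>G_fun\<close> and
  \<open>total_const\<close>.\<close>

definition remainder :: "nat \<Rightarrow> real \<Rightarrow> real ^ 'd \<Rightarrow> real \<Rightarrow> complex" where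
  "remainder K \<epsilon> x t = of_real (\<epsilon> ^ N) * (green2 (x /\<^sub>R \<epsilon>) (t / \<epsilon> ^ l)
     - (\<Sum>k\<le>K. G_fun k (x /\<^sub>R \<epsilon>) (\<epsilon> / t powr (1 / real l))) - total_const (x /\<^sub>R \<epsilon>))"

lemma remainder_bound:
  assumes K: "K \<ge> N"
  shows "\<exists>R\<ge>0. \<forall>\<epsilon>>0. \<forall>t>0. \<forall>x. norm (remainder K \<epsilon> x t) \<le> \<epsilon> ^ (K + 1) * R / t powr (real (K + CARD('d) + 1) / real l - 1)"
proof -
  obtain R where R: "R \<ge> 0" "\<And>s y. s > 0 \<Longrightarrow> norm (green2 y (1 / s ^ l) - (\<Sum>k\<le>K. G_fun k y s) - total_const y) \<le> R * s ^ (K - N + 1)"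
    using green2_expansion[OF K] by blast
  have "norm (remainder K \<epsilon> x t) \<le> \<epsilon> ^ (K + 1) * R / t powr (real (K + CARD('d) + 1) / real l - 1)"
    if \<epsilon>: "\<epsilon> > 0" and t: "t > 0" for \<epsilon> t x
  proof -
    \<comment> \<open>The scaling parameter for which \<open>1 / ?s ^ l\<close> is the rescaled time
      \<open>t / \<epsilon> ^ l\<close>.\<close>
    let ?s = "\<epsilon> / t powr (1 / real l)"
    have s: "?s > 0" using \<epsilon> t by simp
    have "(t powr (1 / real l)) ^ l = t"
      using l_ge_1 t by (simp add: powr_powr flip: powr_realpow)
    then have sl: "1 / ?s ^ l = t / \<epsilon> ^ l" by (simp add: power_divide)
    have "norm (remainder K \<epsilon> x t) \<le> \<epsilon> ^ N * (R * ?s ^ (K - N + 1))"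
      using R(2)[OF s, of "x /\<^sub>R \<epsilon>"] \<epsilon> unfolding remainder_def sl norm_mult by (intro mult_mono) (auto simp: norm_power)
    also have "?s ^ (K - N + 1) = ?s powi (int (K + 1) - int N)"
    proof -
      have "int (K + 1) - int N = int (K - N + 1)" using K by simp
      then show ?thesis by (simp only: power_int_of_nat)
    qed
    also have "\<epsilon> ^ N * (R * ?s powi (int (K + 1) - int N)) = R * (\<epsilon> ^ (K + 1) * t powr (1 - real (K + 1 + CARD('d)) / real l))"
      using scaled_power[OF \<epsilon> t l_ge_1, of N "CARD('d)" "K + 1"] N_eq dim_le by (simp add: mult_ac)
    also have "1 - real (K + 1 + CARD('d)) / real l = - (real (K + CARD('d) + 1) / real l - 1)" by (simp add: add_ac)
    finally show ?thesis unfolding powr_minus by (simp add: divide_inverse mult_ac)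
  qed
  then show ?thesis using R(1) by blast
qed

lemma scaled_G_fun:
  assumes "x \<noteq> 0" "\<epsilon> > 0" "t > 0"
  shows "of_real (\<epsilon> ^ N) * G_fun k (x /\<^sub>R \<epsilon>) (\<epsilon> / t powr (1 / real l)) =
    of_real (\<epsilon> ^ k * t powr (1 - real (k + CARD('d)) / real l)) * F_fun l b P k (x /\<^sub>R t powr (1 / real l))"
proof -
  have e: "N + CARD('d) = l" using N_eq dim_le by simp
  have "(\<epsilon> / t powr (1 / real l)) *\<^sub>R (x /\<^sub>R \<epsilon>) = x /\<^sub>R t powr (1 / real l)"
    using assms by (simp add: divide_inverse)
  moreover have "x /\<^sub>R \<epsilon> \<noteq> 0" using assms by simp
  ultimately show ?thesis
    unfolding G_fun_def scaled_power[OF assms(2,3) l_ge_1 e, of k, symmetric] by (simp add: mult.assoc)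
qed

lemma scaled_G_fun_0:
  assumes "k \<noteq> N" "\<epsilon> > 0" "t > 0"
  shows "of_real (\<epsilon> ^ N) * G_fun k 0 (\<epsilon> / t powr (1 / real l)) =
    of_real (\<epsilon> ^ k * t powr (1 - real (k + CARD('d)) / real l)) * (of_nat l * H k 0 / of_real (real l - real CARD('d) - real k))"
proof -
  have e: "N + CARD('d) = l" using N_eq dim_le by simp
  have "real N - real k = real l - real CARD('d) - real k" using e by linarith
  then show ?thesis using assms(1)
    unfolding G_fun_def scaled_power[OF assms(2,3) l_ge_1 e, of k, symmetric] by (simp add: mult.assoc)
qed

text \<open>\<open>ln s = ln \<epsilon> - ln t / l\<close>, and the factor \<open>l\<close> of the
  antiderivative removes the division.\<close>

lemma scaled_G_fun_0_log:
  assumes "\<epsilon> > 0" "t > 0"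
  shows "G_fun N 0 (\<epsilon> / t powr (1 / real l)) = H N 0 * of_real (ln t) - of_nat l * H N 0 * of_real (ln \<epsilon>)"
proof -
  have "ln (\<epsilon> / t powr (1 / real l)) = ln \<epsilon> - ln t / real l"
    using assms by (simp add: ln_div ln_powr)
  then show ?thesis using l_ge_1 by (simp add: G_fun_def right_diff_distrib)
qed

lemma remainder_nonzero:
  assumes v: "second_discrete_green l lhat a \<epsilon> v" and \<epsilon>: "\<epsilon> > 0" and x: "x \<in> lattice \<epsilon>" "x \<noteq> 0" and t: "t > 0" and K: "K \<ge> N"
  shows "v x t = of_real (t powr (1 - real CARD('d) / real l)) * F_fun l b P 0 (x /\<^sub>R t powr (1 / real l))
     + (\<Sum>k=M..N. of_real (\<epsilon> ^ k * t powr (1 - real (k + CARD('d)) / real l)) * F_fun l b P k (x /\<^sub>R t powr (1 / real l)))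
     + of_real (\<epsilon> ^ N) * Omega M l lhat a b P Q (x /\<^sub>R \<epsilon>)
     + (\<Sum>k=max M (N + 1)..K. of_real (\<epsilon> ^ k / t powr (real (k + CARD('d)) / real l - 1)) * F_fun l b P k (x /\<^sub>R t powr (1 / real l)))
     + remainder K \<epsilon> x t"
proof -
  have y: "x /\<^sub>R \<epsilon> \<noteq> 0" using x \<epsilon> by simp
  have neg: "\<epsilon> ^ k / t powr (real (k + CARD('d)) / real l - 1) = \<epsilon> ^ k * t powr (1 - real (k + CARD('d)) / real l)" for k
    by (simp add: powr_diff)
  have "v x t = of_real (\<epsilon> ^ N) * (\<Sum>k\<le>K. G_fun k (x /\<^sub>R \<epsilon>) (\<epsilon> / t powr (1 / real l)))
      + of_real (\<epsilon> ^ N) * total_const (x /\<^sub>R \<epsilon>) + remainder K \<epsilon> x t"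
    using second_discrete_green_eq[OF v \<epsilon> x(1)] t by (simp add: remainder_def right_diff_distrib)
  then show ?thesis
    unfolding sum_G_fun_nonzero[OF y K] distrib_left sum_distrib_left scaled_G_fun[OF x(2) \<epsilon> t] neg
    using y by (simp add: total_const_def)
qed

lemma remainder_0:
  assumes v: "second_discrete_green l lhat a \<epsilon> v" and \<epsilon>: "\<epsilon> > 0" and t: "t > 0" and K: "K \<ge> N"
  shows "v 0 t = (\<Sum>k<N. of_real (\<epsilon> ^ k * t powr (1 - real (CARD('d) + k) / real l)) * (of_nat l * H k 0 / of_real (real l - real CARD('d) - real k)))
     + of_real (\<epsilon> ^ N) * (H N 0 * of_real (ln t) - of_nat l * H N 0 * of_real (ln \<epsilon>) + S_fun M l lhat a b P Q 0)
     + (\<Sum>k=N+1..K. of_real (\<epsilon> ^ k / t powr (real (CARD('d) + k) / real l - 1)) * (of_nat l * H k 0 / of_real (real l - real CARD('d) - real k)))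
     + remainder K \<epsilon> 0 t"
proof -
  have neg: "\<epsilon> ^ k / t powr (real (CARD('d) + k) / real l - 1) = \<epsilon> ^ k * t powr (1 - real (k + CARD('d)) / real l)" for k
    by (simp add: powr_diff add.commute)
  have "(0::real ^ 'd) \<in> lattice \<epsilon>" unfolding lattice_def by (intro CollectI allI exI[of _ 0]) simp
  then have "v 0 t = of_real (\<epsilon> ^ N) * (\<Sum>k\<le>K. G_fun k 0 (\<epsilon> / t powr (1 / real l)))
      + of_real (\<epsilon> ^ N) * S_fun M l lhat a b P Q 0 + remainder K \<epsilon> 0 t"
    using second_discrete_green_eq[OF v \<epsilon>, of 0 t] t by (simp add: remainder_def total_const_def right_diff_distrib)
  moreover have "of_real (\<epsilon> ^ N) * (\<Sum>k<N. G_fun k 0 (\<epsilon> / t powr (1 / real l))) =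
     (\<Sum>k<N. of_real (\<epsilon> ^ k * t powr (1 - real (CARD('d) + k) / real l)) * (of_nat l * H k 0 / of_real (real l - real CARD('d) - real k)))"
    unfolding sum_distrib_left by (intro sum.cong refl, subst scaled_G_fun_0) (use \<epsilon> t in \<open>auto simp: add.commute\<close>)
  moreover have "of_real (\<epsilon> ^ N) * (\<Sum>k=N+1..K. G_fun k 0 (\<epsilon> / t powr (1 / real l))) =
     (\<Sum>k=N+1..K. of_real (\<epsilon> ^ k / t powr (real (CARD('d) + k) / real l - 1)) * (of_nat l * H k 0 / of_real (real l - real CARD('d) - real k)))"
    unfolding sum_distrib_left neg by (intro sum.cong refl, subst scaled_G_fun_0) (use \<epsilon> t in auto)
  ultimately show ?thesis
    unfolding sum_G_fun_split[OF K] by (simp only: distrib_left scaled_G_fun_0_log[OF \<epsilon> t] add_ac)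
qed

end

theorem theorem5p2:
  fixes l lhat M K :: nat
    and b :: "('d::finite \<Rightarrow> nat) \<Rightarrow> complex"
    and a :: "('d + 'd \<Rightarrow> nat) \<Rightarrow> complex"
    and P :: "nat \<Rightarrow> 'd polyn"
    and Q :: "nat \<Rightarrow> real ^ 'd \<Rightarrow> real ^ 'd \<Rightarrow> complex"
    and v :: "real \<Rightarrow> real ^ 'd \<Rightarrow> real \<Rightarrow> complex"
    and t0 :: real
  assumes "even l" and "l \<le> lhat" and "1 \<le> M"
    and "strongly_elliptic l b"
    and "approximates_of_order M l lhat a b"
    and "\<And>\<theta>. \<theta> \<in> cube pi - {0} \<Longrightarrow> Re (difference_symbol l lhat a \<theta>) > 0"
    and "\<And>\<epsilon>. \<epsilon> > 0 \<Longrightarrow> second_discrete_green l lhat a \<epsilon> (v \<epsilon>)"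
    and "exp_expansion l lhat a b P"
    and "Q_expansion l lhat a Q"
    and "CARD('d) \<le> l"
    and "t0 > 0" and "K \<ge> max M (l - CARD('d))"
  shows "\<exists>R\<ge>0. \<exists>r :: real \<Rightarrow> real ^ 'd \<Rightarrow> real \<Rightarrow> complex.
    \<forall>\<epsilon>>0. \<forall>t\<ge>t0 * \<epsilon> ^ l.
      (\<forall>x\<in>lattice \<epsilon> - {0}. v \<epsilon> x t =
          complex_of_real (t powr (1 - real CARD('d) / real l))
            * F_fun l b P 0 (x /\<^sub>R t powr (1 / real l))
        + (\<Sum>k=M..l - CARD('d). complex_of_real (\<epsilon> ^ k * t powr (1 - real (k + CARD('d)) / real l))
            * F_fun l b P k (x /\<^sub>R t powr (1 / real l)))
        + complex_of_real (\<epsilon> ^ (l - CARD('d))) * Omega M l lhat a b P Q (x /\<^sub>R \<epsilon>)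
        + (\<Sum>k=max M (l - CARD('d) + 1)..K.
            complex_of_real (\<epsilon> ^ k / t powr (real (k + CARD('d)) / real l - 1))
              * F_fun l b P k (x /\<^sub>R t powr (1 / real l)))
        + r \<epsilon> x t) \<and>
      v \<epsilon> 0 t =
          (\<Sum>k<l - CARD('d). complex_of_real (\<epsilon> ^ k * t powr (1 - real (CARD('d) + k) / real l))
            * (of_nat l * H_fun l b P k 0 / complex_of_real (real l - real CARD('d) - real k)))
        + complex_of_real (\<epsilon> ^ (l - CARD('d))) *
            (H_fun l b P (l - CARD('d)) 0 * complex_of_real (ln t)
             - of_nat l * H_fun l b P (l - CARD('d)) 0 * complex_of_real (ln \<epsilon>)
             + S_fun M l lhat a b P Q 0)
        + (\<Sum>k=l - CARD('d) + 1..K.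
            complex_of_real (\<epsilon> ^ k / t powr (real (CARD('d) + k) / real l - 1))
              * (of_nat l * H_fun l b P k 0 / complex_of_real (real l - real CARD('d) - real k)))
        + r \<epsilon> 0 t \<and>
      (\<forall>x\<in>lattice \<epsilon>.
        norm (r \<epsilon> x t) \<le> \<epsilon> ^ (K + 1) * R / t powr (real (K + CARD('d) + 1) / real l - 1))"
proof -
  have "1 \<le> CARD('d)" by (simp add: Suc_le_eq)
  then have "1 \<le> l" using assms(10) by linarith
  then interpret green_setting l lhat a M b P Q "l - CARD('d)"
    by unfold_locales (use assms in auto)
  have K: "K \<ge> l - CARD('d)" using assms(12) by simp
  obtain R where R: "R \<ge> 0" "\<And>\<epsilon> t x. \<epsilon> > 0 \<Longrightarrow> t > 0 \<Longrightarrow>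
      norm (remainder K \<epsilon> x t) \<le> \<epsilon> ^ (K + 1) * R / t powr (real (K + CARD('d) + 1) / real l - 1)"
    using remainder_bound[OF K] by blast
  \<comment> \<open>Real powers and the logarithm of \<open>t\<close> require \<open>t\<close> to be
    positive.\<close>
  have pos: "t > 0" if "\<epsilon> > 0" "t \<ge> t0 * \<epsilon> ^ l" for \<epsilon> t
    using that assms(11) by (meson less_le_trans mult_pos_pos zero_less_power)
  show ?thesis
    by (intro exI[of _ R] exI[of _ "remainder K"] conjI allI impI ballI R remainder_0[OF assms(7) _ pos K] remainder_nonzero[OF assms(7) _ _ _ pos K])
      (auto intro: pos)
qed

end
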